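(* Let $d\in\{2,3\}$ and $Q=\mathbb{R}^d\setminus B$, where $B$ is a convex compact set. Let $(\varrho_n,\mathbf{m}_n)_{n=1}^\infty$, $\mathbf{m}_n=\varrho_n\mathbf{u}_n$, be a sequence of finite energy weak solutions (in the sense of the context) to the Navier--Stokes system in $(0,T)\times Q$ with viscosity coefficients $\mu_n=\varepsilon_n\mu$, $\lambda_n=\varepsilon_n\lambda$, $\mu>0$, $\lambda\ge 0$, $\varepsilon_n\searrow 0$, satisfying the energy bound: there is a constant $\overline{\mathcal E}$ such that for all $N\ge 1$ $$\frac1N\sum_{n=1}^N\left[\sup_{0\le\tau\le T}\int_Q E\left(\varrho_n,\mathbf{m}_n\,\big|\,\varrho_\infty,\mathbf{u}_\infty\right)(\tau,\cdot)\,dx+\varepsilon_n\int_0^T\int_Q\mathbb{S}(\nabla_x\mathbf{u}_n):\nabla_x\mathbf{u}_n\,dx\,dt\right]\le\overline{\mathcal E}.$$ Let $\mathcal V\in\mathfrak P[\mathcal T]$ be the limit, along a sequence $N_k\to\infty$, of the Ces\`aro averages $\mathcal V_{N_k}=\frac1{N_k}\sum_{n=1}^{N_k}\delta_{(\varrho_n,\mathbf{m}_n)}$, where $(N_k)$ is the (sub)sequence along which moreover, for every compact $K\subset Q$ and $b\in C_c(\mathbb{R}^{d+1})$, $\frac1{N_k}\sum_{n=1}^{N_k}b(\varrho_n,\mathbf{m}_n)\to\mathbb{E}_{\mathcal V}[b(r,\mathbf{w})]$ strongly in $L^1((0,T)\times K)$. Let $(\varrho,\mathbf{m})$ be a Skorokhod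 representation of $\mathcal V$, i.e. a $\mathcal T$-valued random variable on a probability space $(\Omega,\mathfrak B,\mathcal P)$ with law $\mathcal V$. Suppose that $(\varrho,\mathbf{m})$ is statistically equivalent to a solution $(\tilde\varrho,\tilde{\mathbf{m}})$ of the stochastic Euler system $$d\tilde\varrho+\mathrm{div}_x\tilde{\mathbf{m}}\,dt=0,\qquad d\tilde{\mathbf{m}}+\mathrm{div}_x\left(\frac{\tilde{\mathbf{m}}\otimes\tilde{\mathbf{m}}}{\tilde\varrho}\right)dt+\nabla_x p(\tilde\varrho)\,dt=\mathbf{F}\,dW$$ (in the sense of the context), driven by a stochastic forcing $\mathbf{F}\,dW=\sum_{k\ge1}\mathbf{F}_k\,dW_k$ of It\^o type satisfying $$\mathbb{E}\left[\int_0^T\sum_{k\ge1}\|\mathbf{F}_k\|^2_{W^{-\ell,2}(Q;\mathbb{R}^d)}\,dt\right]<\infty\quad\text{for some }\ell.$$ Suppose in addition that the barycenter $$(\overline\varrho,\overline{\mathbf{m}})=\mathbb{E}_{\mathcal V}[(r,\mathbf{w})]$$ is a weak solution to the (deterministic compressible) Euler system. Then $$\mathcal V=\delta_{(\overline\varrho,\overline{\mathbf{m}})}$$ and, for any compact $K\subset Q$, $$\frac1{N_k}\sum_{n=1}^{N_k}\left(\|\varrho_n-\overline\varrho\|_{L^1((0,T)\times K)}+\|\mathbf{m}_n-\overline{\mathbf{m}}\|_{L^1((0,T)\times K;\mathbb{R}^d)}\right)\to0\quad\text{as }k\to\infty.$$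
   Context: **Data.** $T>0$, $a>0$, $\gamma>1$, $\mu>0$, $\lambda\ge0$; $p(\varrho)=a\varrho^\gamma$, $P(\varrho)=\frac{a}{\gamma-1}\varrho^\gamma$; $\mathbb{S}(\nabla_x\mathbf{u})=\mu\left(\nabla_x\mathbf{u}+\nabla_x^t\mathbf{u}-\frac2d\mathrm{div}_x\mathbf{u}\,\mathbb{I}\right)+\lambda\,\mathrm{div}_x\mathbf{u}\,\mathbb{I}$. $Q=\mathbb{R}^d\setminus B$ is assumed to have regular (smooth) boundary. The far field values $\varrho_\infty>0$ and $\mathbf{u}_\infty\in\mathbb{R}^d$ are constants; $\mathbf{u}_\infty$ is extended to a function $\mathbf{u}_\infty\in C^\infty(Q;\mathbb{R}^d)$ with $\mathbf{u}_\infty(x)=0$ for $|x|<L$ and $\mathbf{u}_\infty(x)=\mathbf{u}_\infty$ for $|x|>2L$, for some $L>0$ with $B\subset\{|x|<L\}$. **Relative energy.** $E(\varrho,\mathbf{m}|\varrho_\infty,\mathbf{u}_\infty)=\frac12\frac{|\mathbf{m}|^2}{\varrho}-\mathbf{m}\cdot\mathbf{u}_\infty+\frac12\varrho|\mathbf{u}_\infty|^2+P(\varrho)-P'(\varrho_\infty)(\varrho-\varrho_\infty)-P(\varrho_\infty)$, where $\frac{|\mathbf{m}|^2}{\varrho}$ is $0$ if $\varrho=0,\mathbf{m}=0$, and the energy is $+\infty$ if $\varrho<0$ or if $\varrho=0$, $\mathbf{m}\ne0$. **Finite energy weak solution** of the Navier--Stokes system with viscosities $\varepsilon\mu,\varepsilon\lambda$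 in $(0,T)\times Q$: a pair $(\varrho,\mathbf{u})$, $\varrho\ge 0$, $\mathbf{m}=\varrho\mathbf{u}$, such that (i) $\int_QE(\varrho,\mathbf{m}|\varrho_\infty,\mathbf{u}_\infty)(\tau,\cdot)\,dx+\int_0^\tau\int_Q\varepsilon\mathbb{S}(\nabla_x\mathbf{u}):\nabla_x\mathbf{u}\,dx\,dt<\infty$ for any $0<\tau\le T$; (ii) $\left[\int_Q\varrho\varphi\,dx\right]_{t=\tau_1}^{t=\tau_2}=\int_{\tau_1}^{\tau_2}\int_Q[\varrho\partial_t\varphi+\varrho\mathbf{u}\cdot\nabla_x\varphi]\,dx\,dt$ for any $0<\tau_1<\tau_2<T$, $\varphi\in C^1_c((0,T)\times Q)$; (iii) $\left[\int_Q\varrho\mathbf{u}\cdot\boldsymbol{\varphi}\,dx\right]_{t=\tau_1}^{t=\tau_2}=\int_{\tau_1}^{\tau_2}\int_Q[\varrho\mathbf{u}\cdot\partial_t\boldsymbol{\varphi}+(\varrho\mathbf{u}\otimes\mathbf{u}):\nabla_x\boldsymbol{\varphi}+p(\varrho)\mathrm{div}_x\boldsymbol{\varphi}-\varepsilon\mathbb{S}(\nabla_x\mathbf{u}):\nabla_x\boldsymbol{\varphi}]\,dx\,dt$ for any $0<\tau_1<\tau_2<T$, $\boldsymbol{\varphi}\in C^1_c((0,T)\times Q;\mathbb{R}^d)$. No boundary condition on $\partial Q$ and no initial condition is imposed. **Trajectory space.** $\mathcal T=C_{\rm weak}([0,T];L^\gamma_{\rm loc}(Q)\times L^{\frac{2\gamma}{\gamma+1}}_{\rm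 loc}(Q;\mathbb{R}^d))$, the functions continuous in time for the weak topology (tested against compactly supported elements of the dual spaces), with uniform-in-time convergence of these pairings. Finite energy weak solutions $(\varrho,\mathbf m)$ belong to $\mathcal T$. $\mathfrak P[\mathcal T]$ is the set of Borel probability measures on $\mathcal T$, $\delta_h$ the Dirac mass at $h$, $(r,\mathbf{w})$ the canonical process on $\mathcal T$, and $\mathbb{E}_{\mathcal Q}$ the expectation under $\mathcal Q\in\mathfrak P[\mathcal T]$. $\mathbb{E}$ without subscript is the expectation on the probability space where the process in question is defined. **Limit measure.** Under the energy bound there exist $N_k\to\infty$ and $\mathcal V\in\mathfrak P[\mathcal T]$ with $\mathcal V_{N_k}\to\mathcal V$ narrowly. Under the stated hypotheses (before the barycenter assumption), after passing to a subsequence, the strong $L^1$ convergence of the averages of $b(\varrho_n,\mathbf{m}_n)$ stated in the claim also holds; $(N_k)$ denotes this subsequence. The function $\mathbb{E}_{\mathcal V}[b(r,\mathbf{w})]\in L^\infty((0,T)\times Q)$ is defined by $\int_0^T\int_Q\mathbb{E}_{\mathcal V}[b(r,\mathbf{w})]\varphi\,dx\,dt=\mathbb{E}_{\mathcal V}\left[\int_0^T\int_Qb(r,\mathbf{w})\varphi\,dx\,dt\right]$ for all $\varphi\in C_c((0,T)\times Q)$. **Barycenter.** $(\overline\varrho,\overline{\mathbf{m}})=\mathbb{E}_{\mathcal V}[(r,\mathbf{w})]\in\mathcal T$ is determined by $\int_0^T\int_Q\overline\varrho\varphi\,dx\,dt=\mathbb{E}_{\mathcal V}\left[\int_0^T\int_Qr\varphi\,dx\,dt\right]$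 and $\int_0^T\int_Q\overline{\mathbf{m}}\cdot\boldsymbol{\varphi}\,dx\,dt=\mathbb{E}_{\mathcal V}\left[\int_0^T\int_Q\mathbf{w}\cdot\boldsymbol{\varphi}\,dx\,dt\right]$ for all $\varphi\in C^1_c((0,T)\times Q)$, $\boldsymbol{\varphi}\in C^1_c((0,T)\times Q;\mathbb{R}^d)$. **Statistical equivalence.** Borel probability measures $\mathcal P_1,\mathcal P_2$ on $\mathcal T$ are statistically equivalent if for $\Phi$ equal to each of the following functionals the expectations $\mathbb{E}_{\mathcal P_1}[\Phi]$, $\mathbb{E}_{\mathcal P_2}[\Phi]$ are finite and equal: $\int_0^T\int_Qr\varphi\,dx\,dt$; $\int_0^T\int_Q\mathbf{w}\cdot\boldsymbol{\varphi}\,dx\,dt$; $\int_0^T\int_Q1_{r>0}\frac{|\mathbf{w}|^2}{r}\varphi\,dx\,dt$; $\int_0^T\int_QP(r)\varphi\,dx\,dt$; $\int_0^T\int_Q1_{r>0}\frac1r(\mathbb{J}_{x_0}\cdot\mathbf{w})\cdot\mathbf{w}\,\varphi\,dx\,dt$; for all $x_0\in\mathbb{R}^d$, $\varphi\in C_c^\infty((0,T)\times Q)$, $\boldsymbol{\varphi}\in C_c^\infty((0,T)\times Q;\mathbb{R}^d)$, where $\mathbb{J}_{x_0}(x)=|x-x_0|^2\mathbb{I}-(x-x_0)\otimes(x-x_0)$. Two $\mathcal T$-valued processes (possibly on different probability spaces) are statistically equivalent if their laws are. **Solution of the stochastic Euler system.** A weak martingale solution: a $\mathcal T$-valued process $(\tilde\varrho,\tilde{\mathbf{m}})$,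 $\tilde\varrho\ge0$, on some filtered probability space carrying a cylindrical Wiener process $W=(W_k)_{k\ge1}$ and a progressively measurable $\mathbf{F}=(\mathbf{F}_k)_{k\ge1}$ (which may depend on the solution), satisfying the equations in the sense of distributions: almost surely, $\partial_t\tilde\varrho+\mathrm{div}_x\tilde{\mathbf{m}}=0$ in $\mathcal D'((0,T)\times Q)$, and $\int_0^T\int_Q\left[\tilde{\mathbf{m}}\cdot\boldsymbol{\varphi}\,\partial_t\psi+\psi1_{\tilde\varrho>0}\frac{\tilde{\mathbf{m}}\otimes\tilde{\mathbf{m}}}{\tilde\varrho}:\nabla_x\boldsymbol{\varphi}+\psi p(\tilde\varrho)\mathrm{div}_x\boldsymbol{\varphi}\right]dx\,dt=-\int_0^T\psi\sum_{k\ge1}\left(\int_Q\mathbf{F}_k\cdot\boldsymbol{\varphi}\,dx\right)dW_k$ for all deterministic test functions $\psi\in C_c^\infty(0,T)$, $\boldsymbol{\varphi}\in C_c^\infty(Q;\mathbb{R}^d)$. **Weak solution of the Euler system.** $(\varrho,\mathbf{m})\in\mathcal T$ with $\int_0^T\int_Q[\varrho\partial_t\varphi+\mathbf{m}\cdot\nabla_x\varphi]\,dx\,dt=0$ for all $\varphi\in C^1_c((0,T)\times Q)$ and $\int_0^T\int_Q\left[\mathbf{m}\cdot\partial_t\boldsymbol{\varphi}+1_{\varrho>0}\frac{\mathbf{m}\otimes\mathbf{m}}{\varrho}:\nabla_x\boldsymbol{\varphi}+p(\varrho)\mathrm{div}_x\boldsymbol{\varphi}\right]dx\,dt=0$ for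 all $\boldsymbol{\varphi}\in C^1_c((0,T)\times Q;\mathbb{R}^d)$. *)

theory Defs
  imports "HOL-Probability.Probability"
begin

section \<open>Functions of class \<open>C\<^sup>k\<close>, test functions, differential operators\<close>

text \<open>Intended for open \<open>S\<close>; on such sets this is the usual class \<open>C\<^sup>k\<close>.\<close>

primrec Ck_on :: "nat \<Rightarrow> 'a::real_normed_vector set \<Rightarrow> ('a \<Rightarrow> 'b::real_normed_vector) \<Rightarrow> bool" where
  "Ck_on 0 S f \<longleftrightarrow> continuous_on S f"
| "Ck_on (Suc k) S f \<longleftrightarrow>
     (\<forall>x\<in>S. f differentiable (at x)) \<and> (\<forall>v. Ck_on k S (\<lambda>x. frechet_derivative f (at x) v))"

definition smooth_on :: "'a::real_normed_vector set \<Rightarrow> ('a \<Rightarrow> 'b::real_normed_vector) \<Rightarrow> bool" where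
  "smooth_on S f \<longleftrightarrow> (\<forall>k. Ck_on k S f)"

text \<open>\<open>C\<^sup>k\<^sub>c(U)\<close> for \<open>k \<in> {0, 1, \<dots>, \<infinity>}\<close>: elements are extended by zero to the whole space.\<close>

definition test_fun :: "enat \<Rightarrow> 'a::real_normed_vector set \<Rightarrow> ('a \<Rightarrow> 'b::real_normed_vector) \<Rightarrow> bool" where
  "test_fun k U \<phi> \<longleftrightarrow> (\<forall>j. enat j \<le> k \<longrightarrow> Ck_on j UNIV \<phi>) \<and>
     (\<exists>K. compact K \<and> K \<subseteq> U \<and> (\<forall>x. x \<notin> K \<longrightarrow> \<phi> x = 0))"

definition grad :: "(real^'n \<Rightarrow> real) \<Rightarrow> real^'n \<Rightarrow> real^'n" where
  "grad f x = (\<chi> i. frechet_derivative f (at x) (axis i 1))"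

definition jacobian :: "(real^'n \<Rightarrow> real^'n) \<Rightarrow> real^'n \<Rightarrow> real^'n^'n" where
  "jacobian f x = matrix (frechet_derivative f (at x))"

definition divergence :: "(real^'n \<Rightarrow> real^'n) \<Rightarrow> real^'n \<Rightarrow> real" where
  "divergence f x = trace (jacobian f x)"

text \<open>Space-time test functions live on \<open>real \<times> (real^'n)\<close>; the following are
  \<open>\<partial>\<^sub>t\<close>, \<open>\<nabla>\<^sub>x\<close> (scalar and vector case) and \<open>div\<^sub>x\<close>.\<close>

definition dt :: "(real \<times> (real^'n) \<Rightarrow> 'b::real_normed_vector) \<Rightarrow> real \<Rightarrow> real^'n \<Rightarrow> 'b" where
  "dt \<phi> t x = vector_derivative (\<lambda>s. \<phi> (s, x)) (at t)"

definition gradx :: "(real \<times> (real^'n) \<Rightarrow> real) \<Rightarrow> real \<Rightarrow> real^'n \<Rightarrow> real^'n" where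
  "gradx \<phi> t x = grad (\<lambda>y. \<phi> (t, y)) x"

definition jacx :: "(real \<times> (real^'n) \<Rightarrow> real^'n) \<Rightarrow> real \<Rightarrow> real^'n \<Rightarrow> real^'n^'n" where
  "jacx \<phi> t x = jacobian (\<lambda>y. \<phi> (t, y)) x"

definition divx :: "(real \<times> (real^'n) \<Rightarrow> real^'n) \<Rightarrow> real \<Rightarrow> real^'n \<Rightarrow> real" where
  "divx \<phi> t x = divergence (\<lambda>y. \<phi> (t, y)) x"

text \<open>The contraction \<open>A : B\<close> of matrices is the inner product \<open>A \<bullet> B\<close> of \<open>real^'n^'n\<close>.\<close>

definition outer :: "real^'n \<Rightarrow> real^'n \<Rightarrow> real^'n^'n" where
  "outer v w = (\<chi> i j. v $ i * w $ j)"

text \<open>An open set whose boundary is locally the regular zero level set of a smooth function,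
  with the set lying on one side.\<close>

definition smooth_boundary :: "(real^'n) set \<Rightarrow> bool" where
  "smooth_boundary Q \<longleftrightarrow> (\<forall>p\<in>frontier Q. \<exists>U g. open U \<and> p \<in> U \<and> smooth_on U g \<and>
     g p = 0 \<and> (\<forall>x\<in>U. grad g x \<noteq> 0) \<and> Q \<inter> U = {x\<in>U. g x > 0})"

section \<open>Space-time integrals and function spaces\<close>

definition st_integrable :: "real set \<Rightarrow> (real^'n) set \<Rightarrow> (real \<Rightarrow> real^'n \<Rightarrow> 'b::{banach,second_countable_topology}) \<Rightarrow> bool" where
  "st_integrable I A f \<longleftrightarrow> set_integrable lborel (I \<times> A) (\<lambda>z. f (fst z) (snd z))"

definition st_integral :: "real set \<Rightarrow> (real^'n) set \<Rightarrow> (real \<Rightarrow> real^'n \<Rightarrow> 'b::{banach,second_countable_topology}) \<Rightarrow> 'b" where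
  "st_integral I A f = set_lebesgue_integral lborel (I \<times> A) (\<lambda>z. f (fst z) (snd z))"

definition st_nn_integral :: "real set \<Rightarrow> (real^'n) set \<Rightarrow> (real \<Rightarrow> real^'n \<Rightarrow> ennreal) \<Rightarrow> ennreal" where
  "st_nn_integral I A f = (\<integral>\<^sup>+z\<in>I \<times> A. f (fst z) (snd z) \<partial>lborel)"

definition L1_norm :: "real set \<Rightarrow> (real^'n) set \<Rightarrow> (real \<Rightarrow> real^'n \<Rightarrow> 'b::real_normed_vector) \<Rightarrow> ennreal" where
  "L1_norm I A f = st_nn_integral I A (\<lambda>t x. ennreal (norm (f t x)))"

definition st_loc_integrable :: "real set \<Rightarrow> (real^'n) set \<Rightarrow> (real \<Rightarrow> real^'n \<Rightarrow> 'b::{banach,second_countable_topology}) \<Rightarrow> bool" where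
  "st_loc_integrable I A f \<longleftrightarrow>
     (\<forall>K. compact K \<and> K \<subseteq> I \<times> A \<longrightarrow> set_integrable lborel K (\<lambda>z. f (fst z) (snd z)))"

definition Lp_loc :: "real \<Rightarrow> (real^'n) set \<Rightarrow> (real^'n \<Rightarrow> 'b::{real_normed_vector,second_countable_topology}) \<Rightarrow> bool" where
  "Lp_loc p Q f \<longleftrightarrow> set_borel_measurable lborel Q f \<and>
     (\<forall>K. compact K \<and> K \<subseteq> Q \<longrightarrow> (\<integral>\<^sup>+x\<in>K. ennreal (norm (f x) powr p) \<partial>lborel) < \<infinity>)"

text \<open>\<open>L\<^sup>p\<close> functions with compact support in \<open>Q\<close>.\<close>

definition Lp_comp :: "real \<Rightarrow> (real^'n) set \<Rightarrow> (real^'n \<Rightarrow> 'b::{real_normed_vector,second_countable_topology}) \<Rightarrow> bool" where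
  "Lp_comp p Q f \<longleftrightarrow> f \<in> borel_measurable lborel \<and>
     (\<exists>K. compact K \<and> K \<subseteq> Q \<and> (\<forall>x. x \<notin> K \<longrightarrow> f x = 0)) \<and>
     (\<integral>\<^sup>+x. ennreal (norm (f x) powr p) \<partial>lborel) < \<infinity>"

definition conj_exponent :: "real \<Rightarrow> real" where
  "conj_exponent p = p / (p - 1)"

section \<open>The trajectory space\<close>

type_synonym 'n trajectory = "(real \<Rightarrow> real^'n \<Rightarrow> real) \<times> (real \<Rightarrow> real^'n \<Rightarrow> real^'n)"

definition pairing :: "(real^'n) set \<Rightarrow> 'n trajectory \<Rightarrow> (real^'n \<Rightarrow> real) \<Rightarrow> (real^'n \<Rightarrow> real^'n) \<Rightarrow> real \<Rightarrow> real" where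
  "pairing Q h \<phi> \<Phi> t =
     (LINT x:Q|lborel. fst h t x * \<phi> x) + (LINT x:Q|lborel. snd h t x \<bullet> \<Phi> x)"

text \<open>Compactly supported elements of the dual of
  \<open>L\<^sup>\<gamma>(Q) \<times> L\<^sup>q(Q; real^'n)\<close>, \<open>q = 2\<gamma>/(\<gamma>+1)\<close>.\<close>

definition dual_pair :: "real \<Rightarrow> (real^'n) set \<Rightarrow> (real^'n \<Rightarrow> real) \<Rightarrow> (real^'n \<Rightarrow> real^'n) \<Rightarrow> bool" where
  "dual_pair \<gamma> Q \<phi> \<Phi> \<longleftrightarrow> Lp_comp (conj_exponent \<gamma>) Q \<phi> \<and>
     Lp_comp (conj_exponent (2 * \<gamma> / (\<gamma> + 1))) Q \<Phi>"

text \<open>Trajectories are represented by functions of \<open>(t, x)\<close>, measurable in both variables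
  (a weakly continuous map into the separable space \<open>L\<^sup>p\<^sub>l\<^sub>o\<^sub>c\<close> always has such a representative).
  Representatives of the same trajectory agree, for every \<open>t \<in> [0,T]\<close>, at almost every \<open>x \<in> Q\<close>.
  The topology below and its Borel sets do not distinguish them, so Borel measures on the space
  of representatives are the same thing as Borel measures on the space of equivalence classes.\<close>

definition trajectories :: "real \<Rightarrow> real \<Rightarrow> (real^'n) set \<Rightarrow> 'n trajectory set" where
  "trajectories T \<gamma> Q = {h.
     set_borel_measurable lborel ({0..T} \<times> Q) (\<lambda>z. fst h (fst z) (snd z)) \<and>
     set_borel_measurable lborel ({0..T} \<times> Q) (\<lambda>z. snd h (fst z) (snd z)) \<and>
     (\<forall>t\<in>{0..T}. Lp_loc \<gamma> Q (fst h t) \<and> Lp_loc (2 * \<gamma> / (\<gamma> + 1)) Q (snd h t)) \<and>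
     (\<forall>\<phi> \<Phi>. dual_pair \<gamma> Q \<phi> \<Phi> \<longrightarrow> continuous_on {0..T} (pairing Q h \<phi> \<Phi>))}"

text \<open>The topology of the seminorms
  \<open>h \<mapsto> sup {\<bar>pairing Q h \<phi> \<Phi> t\<bar> |t. t \<in> {0..T}}\<close>.\<close>

definition traj_topology :: "real \<Rightarrow> real \<Rightarrow> (real^'n) set \<Rightarrow> 'n trajectory topology" where
  "traj_topology T \<gamma> Q = topology_generated_by
     {{h\<in>trajectories T \<gamma> Q. \<forall>t\<in>{0..T}. \<bar>pairing Q h \<phi> \<Phi> t - pairing Q g \<phi> \<Phi> t\<bar> < e}
        | g \<phi> \<Phi> e. g \<in> trajectories T \<gamma> Q \<and> dual_pair \<gamma> Q \<phi> \<Phi> \<and> e > 0}"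

lemma topspace_traj_topology: "topspace (traj_topology T \<gamma> Q) = trajectories T \<gamma> Q"
proof -
  have "dual_pair \<gamma> Q (\<lambda>_. 0) (\<lambda>_. 0)"
    by (auto simp: dual_pair_def Lp_comp_def intro!: exI[of _ "{}"])
  then have "g \<in> topspace (traj_topology T \<gamma> Q)" if "g \<in> trajectories T \<gamma> Q" for g
    unfolding traj_topology_def topology_generated_by_topspace using that
    by (intro UnionI[of "{h \<in> trajectories T \<gamma> Q. \<forall>t\<in>{0..T}.
          \<bar>pairing Q h (\<lambda>_. 0) (\<lambda>_. 0) t - pairing Q g (\<lambda>_. 0) (\<lambda>_. 0) t\<bar> < 1}"])
      (blast intro: zero_less_one, simp)
  then show ?thesis
    unfolding traj_topology_def topology_generated_by_topspace by blast
qed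

definition traj_borel :: "real \<Rightarrow> real \<Rightarrow> (real^'n) set \<Rightarrow> 'n trajectory measure" where
  "traj_borel T \<gamma> Q = sigma (topspace (traj_topology T \<gamma> Q)) {U. openin (traj_topology T \<gamma> Q) U}"

definition prob_on :: "'a measure \<Rightarrow> 'a measure \<Rightarrow> bool" where
  "prob_on B M \<longleftrightarrow> prob_space M \<and> sets M = sets B"

definition narrow_limit :: "'a topology \<Rightarrow> (nat \<Rightarrow> 'a measure) \<Rightarrow> 'a measure \<Rightarrow> bool" where
  "narrow_limit X M L \<longleftrightarrow>
     (\<forall>f. continuous_map X euclideanreal f \<and> bounded (f ` topspace X) \<longrightarrow>
        (\<lambda>k. integral\<^sup>L (M k) f) \<longlonglongrightarrow> integral\<^sup>L L f)"

definition cesaro_measure :: "'a measure \<Rightarrow> (nat \<Rightarrow> 'a) \<Rightarrow> nat \<Rightarrow> 'a measure" where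
  "cesaro_measure B h N = measure_of (space B) (sets B)
     (\<lambda>A. (\<Sum>n=1..N. emeasure (return B (h n)) A) / of_nat N)"

section \<open>Constitutive relations and the Navier--Stokes system\<close>

definition pressure :: "real \<Rightarrow> real \<Rightarrow> real \<Rightarrow> real" where
  "pressure a \<gamma> r = a * r powr \<gamma>"

definition pressure_potential :: "real \<Rightarrow> real \<Rightarrow> real \<Rightarrow> real" where
  "pressure_potential a \<gamma> r = a / (\<gamma> - 1) * r powr \<gamma>"

definition stress :: "real \<Rightarrow> real \<Rightarrow> real^'n^'n \<Rightarrow> real^'n^'n" where
  "stress \<mu> lam G =
     \<mu> *\<^sub>R (G + transpose G - (2 / real CARD('n) * trace G) *\<^sub>R mat 1) + (lam * trace G) *\<^sub>R mat 1"

text \<open>For \<open>r > 0\<close> the real expression equals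
  \<open>r \<bar>w / r - U\<bar>\<^sup>2 / 2 + P(r) - P'(r\<^sub>\<infinity>)(r - r\<^sub>\<infinity>) - P(r\<^sub>\<infinity>) \<ge> 0\<close>, so \<open>ennreal\<close> does not
  truncate it; for \<open>r = 0\<close>, \<open>w = 0\<close> the first term is \<open>0 / 0 = 0\<close>.\<close>

definition rel_energy :: "real \<Rightarrow> real \<Rightarrow> real \<Rightarrow> real^'n \<Rightarrow> real \<Rightarrow> real^'n \<Rightarrow> ennreal" where
  "rel_energy a \<gamma> rinf U r w =
     (if r < 0 \<or> (r = 0 \<and> w \<noteq> 0) then \<infinity>
      else ennreal (1/2 * ((norm w)\<^sup>2 / r) - w \<bullet> U + 1/2 * r * (norm U)\<^sup>2
        + pressure_potential a \<gamma> r - deriv (pressure_potential a \<gamma>) rinf * (r - rinf)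
        - pressure_potential a \<gamma> rinf))"

definition total_energy :: "real \<Rightarrow> real \<Rightarrow> (real^'n) set \<Rightarrow> real \<Rightarrow> (real^'n \<Rightarrow> real^'n) \<Rightarrow>
    (real^'n \<Rightarrow> real) \<Rightarrow> (real^'n \<Rightarrow> real^'n) \<Rightarrow> ennreal" where
  "total_energy a \<gamma> Q rinf U r w = (\<integral>\<^sup>+x\<in>Q. rel_energy a \<gamma> rinf (U x) (r x) (w x) \<partial>lborel)"

text \<open>The integrand \<open>S(G) : G\<close> is nonnegative for \<open>\<mu>, lam \<ge> 0\<close>.\<close>

definition dissipation :: "real \<Rightarrow> real \<Rightarrow> real \<Rightarrow> (real^'n) set \<Rightarrow> real \<Rightarrow> (real \<Rightarrow> real^'n \<Rightarrow> real^'n^'n) \<Rightarrow> ennreal" where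
  "dissipation \<epsilon> \<mu> lam Q \<tau> G =
     st_nn_integral {0<..<\<tau>} Q (\<lambda>t x. ennreal (\<epsilon> * (stress \<mu> lam (G t x) \<bullet> G t x)))"

text \<open>\<open>G $ i $ j\<close> is the distributional derivative \<open>\<partial>\<^sub>j u\<^sub>i\<close> on \<open>(0,T) \<times> Q\<close>.\<close>

definition weak_gradient :: "real \<Rightarrow> (real^'n) set \<Rightarrow> (real \<Rightarrow> real^'n \<Rightarrow> real^'n) \<Rightarrow> (real \<Rightarrow> real^'n \<Rightarrow> real^'n^'n) \<Rightarrow> bool" where
  "weak_gradient T Q u G \<longleftrightarrow> st_loc_integrable {0<..<T} Q u \<and> st_loc_integrable {0<..<T} Q G \<and>
     (\<forall>\<phi> i j. test_fun \<infinity> ({0<..<T} \<times> Q) \<phi> \<longrightarrow>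
        st_integral {0<..<T} Q (\<lambda>t x. u t x $ i * gradx \<phi> t x $ j) =
        - st_integral {0<..<T} Q (\<lambda>t x. G t x $ i $ j * \<phi> (t, x)))"

text \<open>\<open>G\<close> is the spatial gradient of \<open>u\<close>; the viscosities are \<open>\<epsilon> \<mu>\<close> and \<open>\<epsilon> lam\<close>.\<close>

definition finite_energy_weak_solution :: "real \<Rightarrow> real \<Rightarrow> real \<Rightarrow> real \<Rightarrow> real \<Rightarrow> real \<Rightarrow> (real^'n) set \<Rightarrow>
    real \<Rightarrow> (real^'n \<Rightarrow> real^'n) \<Rightarrow> (real \<Rightarrow> real^'n \<Rightarrow> real) \<Rightarrow> (real \<Rightarrow> real^'n \<Rightarrow> real^'n) \<Rightarrow>
    (real \<Rightarrow> real^'n \<Rightarrow> real^'n) \<Rightarrow> (real \<Rightarrow> real^'n \<Rightarrow> real^'n^'n) \<Rightarrow> bool" where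
  "finite_energy_weak_solution T a \<gamma> \<epsilon> \<mu> lam Q rinf U \<rho> m u G \<longleftrightarrow>
     (\<rho>, m) \<in> trajectories T \<gamma> Q \<and>
     (\<forall>t\<in>{0..T}. AE x in lborel. x \<in> Q \<longrightarrow> \<rho> t x \<ge> 0) \<and>
     (AE z in lborel. z \<in> {0<..<T} \<times> Q \<longrightarrow>
        m (fst z) (snd z) = \<rho> (fst z) (snd z) *\<^sub>R u (fst z) (snd z)) \<and>
     weak_gradient T Q u G \<and>
     (\<forall>\<tau>. 0 < \<tau> \<and> \<tau> \<le> T \<longrightarrow>
        total_energy a \<gamma> Q rinf U (\<rho> \<tau>) (m \<tau>) + dissipation \<epsilon> \<mu> lam Q \<tau> G < \<infinity>) \<and>
     (\<forall>\<tau>1 \<tau>2 \<phi>. 0 < \<tau>1 \<and> \<tau>1 < \<tau>2 \<and> \<tau>2 < T \<and> test_fun 1 ({0<..<T} \<times> Q) \<phi> \<longrightarrow>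
        (let f = (\<lambda>t x. \<rho> t x * dt \<phi> t x + (\<rho> t x *\<^sub>R u t x) \<bullet> gradx \<phi> t x) in
         st_integrable {\<tau>1<..<\<tau>2} Q f \<and>
         (LINT x:Q|lborel. \<rho> \<tau>2 x * \<phi> (\<tau>2, x)) - (LINT x:Q|lborel. \<rho> \<tau>1 x * \<phi> (\<tau>1, x))
           = st_integral {\<tau>1<..<\<tau>2} Q f)) \<and>
     (\<forall>\<tau>1 \<tau>2 \<phi>. 0 < \<tau>1 \<and> \<tau>1 < \<tau>2 \<and> \<tau>2 < T \<and> test_fun 1 ({0<..<T} \<times> Q) \<phi> \<longrightarrow>
        (let f = (\<lambda>t x. (\<rho> t x *\<^sub>R u t x) \<bullet> dt \<phi> t x
                   + outer (\<rho> t x *\<^sub>R u t x) (u t x) \<bullet> jacx \<phi> t x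
                   + pressure a \<gamma> (\<rho> t x) * divx \<phi> t x
                   - \<epsilon> * (stress \<mu> lam (G t x) \<bullet> jacx \<phi> t x)) in
         st_integrable {\<tau>1<..<\<tau>2} Q f \<and>
         (LINT x:Q|lborel. m \<tau>2 x \<bullet> \<phi> (\<tau>2, x)) - (LINT x:Q|lborel. m \<tau>1 x \<bullet> \<phi> (\<tau>1, x))
           = st_integral {\<tau>1<..<\<tau>2} Q f))"

section \<open>The Euler system\<close>

definition convective :: "real \<Rightarrow> real^'n \<Rightarrow> real^'n^'n" where
  "convective r w = (if r > 0 then (1 / r) *\<^sub>R outer w w else 0)"

definition continuity_eq :: "enat \<Rightarrow> real \<Rightarrow> (real^'n) set \<Rightarrow> 'n trajectory \<Rightarrow> bool" where
  "continuity_eq k T Q h \<longleftrightarrow> (\<forall>\<phi>. test_fun k ({0<..<T} \<times> Q) \<phi> \<longrightarrow>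
     (let f = (\<lambda>t x. fst h t x * dt \<phi> t x + snd h t x \<bullet> gradx \<phi> t x) in
      st_integrable {0<..<T} Q f \<and> st_integral {0<..<T} Q f = 0))"

definition euler_weak_solution :: "real \<Rightarrow> real \<Rightarrow> real \<Rightarrow> (real^'n) set \<Rightarrow> 'n trajectory \<Rightarrow> bool" where
  "euler_weak_solution T a \<gamma> Q h \<longleftrightarrow>
     h \<in> trajectories T \<gamma> Q \<and> continuity_eq 1 T Q h \<and>
     (\<forall>\<phi>. test_fun 1 ({0<..<T} \<times> Q) \<phi> \<longrightarrow>
       (let f = (\<lambda>t x. snd h t x \<bullet> dt \<phi> t x
                  + convective (fst h t x) (snd h t x) \<bullet> jacx \<phi> t x
                  + pressure a \<gamma> (fst h t x) * divx \<phi> t x) in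
        st_integrable {0<..<T} Q f \<and> st_integral {0<..<T} Q f = 0))"

section \<open>Expectations over the trajectory space\<close>

text \<open>\<open>g\<close> is the function \<open>E\<^sub>V[b(r,w)] \<in> L\<^sup>\<infinity>((0,T) \<times> Q)\<close>.\<close>

definition mean_of :: "real \<Rightarrow> (real^'n) set \<Rightarrow> 'n trajectory measure \<Rightarrow> (real \<times> (real^'n) \<Rightarrow> real) \<Rightarrow> (real \<Rightarrow> real^'n \<Rightarrow> real) \<Rightarrow> bool" where
  "mean_of T Q V b g \<longleftrightarrow>
     set_borel_measurable lborel ({0<..<T} \<times> Q) (\<lambda>z. g (fst z) (snd z)) \<and>
     (\<exists>C. AE z in lborel. z \<in> {0<..<T} \<times> Q \<longrightarrow> \<bar>g (fst z) (snd z)\<bar> \<le> C) \<and>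
     (\<forall>\<phi>. test_fun 0 ({0<..<T} \<times> Q) \<phi> \<longrightarrow>
        st_integral {0<..<T} Q (\<lambda>t x. g t x * \<phi> (t, x)) =
        (LINT h|V. st_integral {0<..<T} Q (\<lambda>t x. b (fst h t x, snd h t x) * \<phi> (t, x))))"

definition barycenter :: "real \<Rightarrow> real \<Rightarrow> (real^'n) set \<Rightarrow> 'n trajectory measure \<Rightarrow> 'n trajectory \<Rightarrow> bool" where
  "barycenter T \<gamma> Q V g \<longleftrightarrow> g \<in> trajectories T \<gamma> Q \<and>
     (\<forall>\<phi>. test_fun 1 ({0<..<T} \<times> Q) \<phi> \<longrightarrow>
        (let \<Phi> = (\<lambda>h. st_integral {0<..<T} Q (\<lambda>t x. fst h t x * \<phi> (t, x)))
         in integrable V \<Phi> \<and> \<Phi> g = integral\<^sup>L V \<Phi>)) \<and>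
     (\<forall>\<phi>. test_fun 1 ({0<..<T} \<times> Q) \<phi> \<longrightarrow>
        (let \<Phi> = (\<lambda>h. st_integral {0<..<T} Q (\<lambda>t x. snd h t x \<bullet> \<phi> (t, x)))
         in integrable V \<Phi> \<and> \<Phi> g = integral\<^sup>L V \<Phi>))"

definition angular_matrix :: "real^'n \<Rightarrow> real^'n \<Rightarrow> real^'n^'n" where
  "angular_matrix x0 x = (norm (x - x0))\<^sup>2 *\<^sub>R mat 1 - outer (x - x0) (x - x0)"

text \<open>The integrands, as functions of \<open>t\<close>, \<open>x\<close>, \<open>r(t,x)\<close>, \<open>w(t,x)\<close>, of the functionals
  compared by statistical equivalence.\<close>

inductive_set observables :: "real \<Rightarrow> real \<Rightarrow> real \<Rightarrow> (real^'n) set \<Rightarrow> (real \<Rightarrow> real^'n \<Rightarrow> real \<Rightarrow> real^'n \<Rightarrow> real) set"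
  for T :: real and a :: real and \<gamma> :: real and Q :: "(real^'n) set" where
  density: "test_fun \<infinity> ({0<..<T} \<times> Q) \<phi> \<Longrightarrow>
     (\<lambda>t x r w. r * \<phi> (t, x)) \<in> observables T a \<gamma> Q"
| momentum: "test_fun \<infinity> ({0<..<T} \<times> Q) \<Phi> \<Longrightarrow>
     (\<lambda>t x r w. w \<bullet> \<Phi> (t, x)) \<in> observables T a \<gamma> Q"
| kinetic: "test_fun \<infinity> ({0<..<T} \<times> Q) \<phi> \<Longrightarrow>
     (\<lambda>t x r w. (if r > 0 then (norm w)\<^sup>2 / r else 0) * \<phi> (t, x)) \<in> observables T a \<gamma> Q"
| internal: "test_fun \<infinity> ({0<..<T} \<times> Q) \<phi> \<Longrightarrow>
     (\<lambda>t x r w. pressure_potential a \<gamma> r * \<phi> (t, x)) \<in> observables T a \<gamma> Q"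
| angular: "test_fun \<infinity> ({0<..<T} \<times> Q) \<phi> \<Longrightarrow>
     (\<lambda>t x r w. (if r > 0 then 1 / r * ((angular_matrix x0 x *v w) \<bullet> w) else 0) * \<phi> (t, x))
       \<in> observables T a \<gamma> Q"

definition observe :: "real \<Rightarrow> (real^'n) set \<Rightarrow> (real \<Rightarrow> real^'n \<Rightarrow> real \<Rightarrow> real^'n \<Rightarrow> real) \<Rightarrow> 'n trajectory \<Rightarrow> real" where
  "observe T Q g h = st_integral {0<..<T} Q (\<lambda>t x. g t x (fst h t x) (snd h t x))"

text \<open>Finiteness of an expectation includes that almost every trajectory has an absolutely
  convergent space-time integral (otherwise \<open>observe\<close> would return the default value 0).\<close>

definition finite_expectation :: "real \<Rightarrow> (real^'n) set \<Rightarrow> 'n trajectory measure \<Rightarrow> (real \<Rightarrow> real^'n \<Rightarrow> real \<Rightarrow> real^'n \<Rightarrow> real) \<Rightarrow> bool" where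
  "finite_expectation T Q P g \<longleftrightarrow>
     (AE h in P. st_integrable {0<..<T} Q (\<lambda>t x. g t x (fst h t x) (snd h t x))) \<and>
     integrable P (observe T Q g)"

definition statistically_equivalent :: "real \<Rightarrow> real \<Rightarrow> real \<Rightarrow> (real^'n) set \<Rightarrow> 'n trajectory measure \<Rightarrow> 'n trajectory measure \<Rightarrow> bool" where
  "statistically_equivalent T a \<gamma> Q P1 P2 \<longleftrightarrow> (\<forall>g\<in>observables T a \<gamma> Q.
     finite_expectation T Q P1 g \<and> finite_expectation T Q P2 g \<and>
     integral\<^sup>L P1 (observe T Q g) = integral\<^sup>L P2 (observe T Q g))"

section \<open>Stochastic integration\<close>

text \<open>A standard Brownian motion on \<open>[0,T]\<close> relative to the filtration \<open>F\<close>.\<close>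

definition brownian_motion :: "'w measure \<Rightarrow> (real \<Rightarrow> 'w measure) \<Rightarrow> real \<Rightarrow> (real \<Rightarrow> 'w \<Rightarrow> real) \<Rightarrow> bool" where
  "brownian_motion M F T w \<longleftrightarrow>
     (\<forall>t\<in>{0..T}. w t \<in> borel_measurable (F t)) \<and>
     (AE \<omega> in M. w 0 \<omega> = 0 \<and> continuous_on {0..T} (\<lambda>t. w t \<omega>)) \<and>
     (\<forall>s t. 0 \<le> s \<and> s < t \<and> t \<le> T \<longrightarrow>
        distributed M lborel (\<lambda>\<omega>. w t \<omega> - w s \<omega>) (\<lambda>y. ennreal (normal_density 0 (sqrt (t - s)) y)) \<and>
        prob_space.indep_set M (sets (F s))
          {(\<lambda>\<omega>. w t \<omega> - w s \<omega>) -` A \<inter> space M | A. A \<in> sets borel})"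

text \<open>A cylindrical Wiener process is given by its coordinates, mutually independent Brownian
  motions; they are numbered from 0 here.\<close>

definition cylindrical_wiener :: "'w measure \<Rightarrow> (real \<Rightarrow> 'w measure) \<Rightarrow> real \<Rightarrow> (nat \<Rightarrow> real \<Rightarrow> 'w \<Rightarrow> real) \<Rightarrow> bool" where
  "cylindrical_wiener M F T W \<longleftrightarrow> (\<forall>k. brownian_motion M F T (W k)) \<and>
     prob_space.indep_vars M (\<lambda>k. PiM {0..T} (\<lambda>_. borel)) (\<lambda>k \<omega>. \<lambda>t\<in>{0..T}. W k t \<omega>) UNIV"

definition simple_process :: "'w measure \<Rightarrow> (real \<Rightarrow> 'w measure) \<Rightarrow> real \<Rightarrow> nat \<Rightarrow> (nat \<Rightarrow> real) \<Rightarrow> (nat \<Rightarrow> 'w \<Rightarrow> real) \<Rightarrow> bool" where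
  "simple_process M F T p \<tau> \<xi> \<longleftrightarrow> (\<forall>i<p. \<tau> i \<le> \<tau> (Suc i)) \<and> (\<forall>i\<le>p. \<tau> i \<in> {0..T}) \<and>
     (\<forall>i<p. \<xi> i \<in> borel_measurable (F (\<tau> i)) \<and> bounded (\<xi> i ` space M))"

definition simple_value :: "nat \<Rightarrow> (nat \<Rightarrow> real) \<Rightarrow> (nat \<Rightarrow> 'w \<Rightarrow> real) \<Rightarrow> real \<Rightarrow> 'w \<Rightarrow> real" where
  "simple_value p \<tau> \<xi> s \<omega> = (\<Sum>i<p. \<xi> i \<omega> * indicator {\<tau> i<..\<tau> (Suc i)} s)"

definition simple_ito :: "nat \<Rightarrow> (nat \<Rightarrow> real) \<Rightarrow> (nat \<Rightarrow> 'w \<Rightarrow> real) \<Rightarrow> (real \<Rightarrow> 'w \<Rightarrow> real) \<Rightarrow> 'w \<Rightarrow> real" where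
  "simple_ito p \<tau> \<xi> w \<omega> = (\<Sum>i<p. \<xi> i \<omega> * (w (\<tau> (Suc i)) \<omega> - w (\<tau> i) \<omega>))"

text \<open>\<open>I\<close> is (a version of) the Ito integral of \<open>X\<close> over \<open>[0,T]\<close> with respect to \<open>w\<close>,
  the isometric extension from simple processes to their closure in \<open>L\<^sup>2(\<Omega> \<times> [0,T])\<close>.\<close>

definition ito_integral :: "'w measure \<Rightarrow> (real \<Rightarrow> 'w measure) \<Rightarrow> real \<Rightarrow> (real \<Rightarrow> 'w \<Rightarrow> real) \<Rightarrow> (real \<Rightarrow> 'w \<Rightarrow> real) \<Rightarrow> ('w \<Rightarrow> real) \<Rightarrow> bool" where
  "ito_integral M F T w X I \<longleftrightarrow> I \<in> borel_measurable M \<and>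
     (\<exists>p \<tau> \<xi>. (\<forall>n. simple_process M F T (p n) (\<tau> n) (\<xi> n)) \<and>
        (\<lambda>n. \<integral>\<^sup>+\<omega>. (\<integral>\<^sup>+s\<in>{0..T}.
            ennreal ((X s \<omega> - simple_value (p n) (\<tau> n) (\<xi> n) s \<omega>)\<^sup>2) \<partial>lborel) \<partial>M) \<longlonglongrightarrow> 0 \<and>
        (\<lambda>n. \<integral>\<^sup>+\<omega>. ennreal ((I \<omega> - simple_ito (p n) (\<tau> n) (\<xi> n) w \<omega>)\<^sup>2) \<partial>M) \<longlonglongrightarrow> 0)"

text \<open>\<open>I\<close> is the sum over \<open>k\<close>, convergent in \<open>L\<^sup>2(\<Omega>)\<close>, of the integrals of \<open>X k\<close> with respect to \<open>W k\<close>.\<close>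

definition ito_integral_cyl :: "'w measure \<Rightarrow> (real \<Rightarrow> 'w measure) \<Rightarrow> real \<Rightarrow> (nat \<Rightarrow> real \<Rightarrow> 'w \<Rightarrow> real) \<Rightarrow> (nat \<Rightarrow> real \<Rightarrow> 'w \<Rightarrow> real) \<Rightarrow> ('w \<Rightarrow> real) \<Rightarrow> bool" where
  "ito_integral_cyl M F T W X I \<longleftrightarrow> I \<in> borel_measurable M \<and>
     (\<exists>J. (\<forall>k. ito_integral M F T (W k) (X k) (J k)) \<and>
        (\<lambda>n. \<integral>\<^sup>+\<omega>. ennreal ((I \<omega> - (\<Sum>k<n. J k \<omega>))\<^sup>2) \<partial>M) \<longlonglongrightarrow> 0)"

section \<open>Negative Sobolev norms\<close>

primrec iter_partial :: "'n list \<Rightarrow> (real^'n \<Rightarrow> real^'n) \<Rightarrow> real^'n \<Rightarrow> real^'n" where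
  "iter_partial [] f = f"
| "iter_partial (i # js) f = (\<lambda>x. frechet_derivative (iter_partial js f) (at x) (axis i 1))"

text \<open>The norm of \<open>W\<^sup>l\<^sup>,\<^sup>2(Q; real^'n)\<close>, with the full derivative tensors
  \<open>D\<^sup>j \<phi>\<close>, \<open>j \<le> l\<close>.\<close>

definition sobolev_norm :: "nat \<Rightarrow> (real^'n) set \<Rightarrow> (real^'n \<Rightarrow> real^'n) \<Rightarrow> real" where
  "sobolev_norm l Q \<phi> = sqrt (\<Sum>js | length js \<le> l. LINT x:Q|lborel. (norm (iter_partial js \<phi> x))\<^sup>2)"

text \<open>\<open>W\<^sup>-\<^sup>l\<^sup>,\<^sup>2(Q; real^'n)\<close> is the dual of the closure of \<open>C\<^sup>\<infinity>\<^sub>c(Q; real^'n)\<close> in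
  \<open>W\<^sup>l\<^sup>,\<^sup>2\<close>; its elements are given by their values \<open>f \<phi>\<close>, written as an integral of
  \<open>f \<cdot> \<phi>\<close> over \<open>Q\<close> in the equations, on the test functions \<open>\<phi> \<in> C\<^sup>\<infinity>\<^sub>c(Q; real^'n)\<close>.\<close>

definition neg_sobolev_norm :: "nat \<Rightarrow> (real^'n) set \<Rightarrow> ((real^'n \<Rightarrow> real^'n) \<Rightarrow> real) \<Rightarrow> ennreal" where
  "neg_sobolev_norm l Q f =
     (SUP \<phi>\<in>{\<phi>. test_fun \<infinity> Q \<phi> \<and> sobolev_norm l Q \<phi> \<le> 1}. ennreal \<bar>f \<phi>\<bar>)"

definition neg_sobolev :: "nat \<Rightarrow> (real^'n) set \<Rightarrow> ((real^'n \<Rightarrow> real^'n) \<Rightarrow> real) \<Rightarrow> bool" where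
  "neg_sobolev l Q f \<longleftrightarrow>
     (\<forall>\<phi> \<psi> c d. test_fun \<infinity> Q \<phi> \<and> test_fun \<infinity> Q \<psi> \<longrightarrow>
        f (\<lambda>x. c *\<^sub>R \<phi> x + d *\<^sub>R \<psi> x) = c * f \<phi> + d * f \<psi>) \<and>
     neg_sobolev_norm l Q f < \<infinity>"

section \<open>The stochastic Euler system\<close>

text \<open>The forcing \<open>F k s \<omega>\<close> takes values in \<open>W\<^sup>-\<^sup>l\<^sup>,\<^sup>2(Q; real^'n)\<close>, a separable Hilbert space,
  so (progressive) measurability can be tested on a dense set of the predual.\<close>

definition progressive :: "(real \<Rightarrow> 'w measure) \<Rightarrow> real \<Rightarrow> (real \<Rightarrow> 'w \<Rightarrow> real) \<Rightarrow> bool" where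
  "progressive Filt T X \<longleftrightarrow> (\<forall>t\<in>{0..T}.
     (\<lambda>(s, \<omega>). X s \<omega>) \<in> borel_measurable (restrict_space borel {0..t} \<Otimes>\<^sub>M Filt t))"

definition square_integrable_forcing :: "'w measure \<Rightarrow> real \<Rightarrow> (real^'n) set \<Rightarrow> nat \<Rightarrow>
    (nat \<Rightarrow> real \<Rightarrow> 'w \<Rightarrow> (real^'n \<Rightarrow> real^'n) \<Rightarrow> real) \<Rightarrow> bool" where
  "square_integrable_forcing M T Q l F \<longleftrightarrow>
     (\<forall>k. \<forall>s\<in>{0..T}. \<forall>\<omega>\<in>space M. neg_sobolev l Q (F k s \<omega>)) \<and>
     (\<integral>\<^sup>+\<omega>. (\<integral>\<^sup>+s\<in>{0..T}. (\<Sum>k. (neg_sobolev_norm l Q (F k s \<omega>))\<^sup>2) \<partial>lborel) \<partial>M) < \<infinity>"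

definition stochastic_euler_solution :: "'w measure \<Rightarrow> (real \<Rightarrow> 'w measure) \<Rightarrow> real \<Rightarrow> real \<Rightarrow> real \<Rightarrow> (real^'n) set \<Rightarrow>
    (nat \<Rightarrow> real \<Rightarrow> 'w \<Rightarrow> real) \<Rightarrow> (nat \<Rightarrow> real \<Rightarrow> 'w \<Rightarrow> (real^'n \<Rightarrow> real^'n) \<Rightarrow> real) \<Rightarrow>
    ('w \<Rightarrow> 'n trajectory) \<Rightarrow> bool" where
  "stochastic_euler_solution M Filt T a \<gamma> Q W F Y \<longleftrightarrow>
     prob_space M \<and> filtration (space M) Filt \<and> (\<forall>t. sets (Filt t) \<subseteq> sets M) \<and>
     cylindrical_wiener M Filt T W \<and>
     (\<forall>k \<phi>. test_fun \<infinity> Q \<phi> \<longrightarrow> progressive Filt T (\<lambda>s \<omega>. F k s \<omega> \<phi>)) \<and>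
     Y \<in> measurable M (traj_borel T \<gamma> Q) \<and>
     (AE \<omega> in M. \<forall>t\<in>{0..T}. AE x in lborel. x \<in> Q \<longrightarrow> fst (Y \<omega>) t x \<ge> 0) \<and>
     (AE \<omega> in M. continuity_eq \<infinity> T Q (Y \<omega>)) \<and>
     (\<forall>\<psi> \<phi>. test_fun \<infinity> {0<..<T} \<psi> \<and> test_fun \<infinity> Q \<phi> \<longrightarrow>
       (let f = (\<lambda>h t x. (snd h t x \<bullet> \<phi> x) * deriv \<psi> t
                  + \<psi> t * (convective (fst h t x) (snd h t x) \<bullet> jacobian \<phi> x)
                  + \<psi> t * (pressure a \<gamma> (fst h t x) * divergence \<phi> x)) in
        \<exists>I. ito_integral_cyl M Filt T W (\<lambda>k s \<omega>. \<psi> s * F k s \<omega> \<phi>) I \<and>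
            (AE \<omega> in M. st_integrable {0<..<T} Q (f (Y \<omega>)) \<and>
                         st_integral {0<..<T} Q (f (Y \<omega>)) = - I \<omega>)))"

end

theory Submission
  imports Defs
begin

text \<open>Both the expectation of the Euler equations under \<open>V\<close> (statistical equivalence transfers it from the stochastic
  system, whose Ito integral has mean zero) and the equations for the barycenter hold without forcing. Their difference says
  that the Jensen defect \<open>E[w \<otimes> w / r + p(r) I] - (m \<otimes> m / \<rho> + p(\<rho>) I)\<close> of the barycenter \<open>(\<rho>, m)\<close> is divergence free;
  by convexity it is positive semidefinite, and it is integrable by the energy bound. Testing with the gradient of a convex
  function of \<open>x \<bullet> e\<close> supported in a half space that misses \<open>B\<close> shows that the defect vanishes there, and since \<open>B\<close> is
  convex such half spaces cover \<open>Q\<close>. By strict convexity the process equals its mean, so \<open>V\<close> is a Dirac mass; the averages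
  of \<open>b\<close> and \<open>b\<^sup>2\<close> then give strong convergence, the tails being controlled by the superlinear energy.\<close>

section \<open>Smooth functions and test functions\<close>

text \<open>Two difficulties shape the development. \<open>Q\<close> is unbounded, and cutting a
  test function off at radius \<open>R\<close> costs 1/R times the mass of the defect on the whole
  cylinder, so the defect must be integrable globally. This comes from a variance argument:
  fluctuations about the mean state are in the mean no larger than those about the constant far
  field state, and the latter are bounded by a multiple of the relative energy without additive
  constant. The energy bound, stated for the extended field \<open>U\<close>, is therefore first
  transferred to the constant \<open>uinf\<close>. Second, trajectories are representatives of
  classes, so evaluation at a point need not be jointly measurable in trajectory and point; Jensen's
  inequality at almost every (t, x) is applied to a jointly measurable version \<open>Z\<close>
  built from averages over cells. The equivalence compares only kinetic energy and angular momentum,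
  but second differences in the base point and polarization recover from them every entry of the
  convective tensor.\<close>

lemma Ck_on_SucI:
  assumes "\<And>x. (f has_derivative f' x) (at x)" "\<And>v. Ck_on k UNIV (\<lambda>x. f' x v)"
  shows "Ck_on (Suc k) UNIV f"
proof -
  have "frechet_derivative f (at x) = f' x" for x
    using frechet_derivative_at[OF assms(1)] by simp
  then show ?thesis
    using assms by (auto simp: differentiable_def)
qed

lemma Ck_on_SucD:
  assumes "Ck_on (Suc k) UNIV f"
  shows "(f has_derivative frechet_derivative f (at x)) (at x)"
    and "Ck_on k UNIV (\<lambda>x. frechet_derivative f (at x) v)"
  using assms by (auto simp: frechet_derivative_works)

lemma Ck_on_mono: "Ck_on (Suc k) UNIV f \<Longrightarrow> Ck_on k UNIV f"
proof (induction k arbitrary: f)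
  case 0
  then show ?case
    by (auto intro!: continuous_at_imp_continuous_on differentiable_imp_continuous_within)
next
  case (Suc k)
  then show ?case by (metis Ck_on.simps(2))
qed

lemma Ck_on_add: "Ck_on k UNIV f \<Longrightarrow> Ck_on k UNIV g \<Longrightarrow> Ck_on k UNIV (\<lambda>x. f x + g x)"
proof (induction k arbitrary: f g)
  case (Suc k)
  note Df = Ck_on_SucD[OF Suc.prems(1)] and Dg = Ck_on_SucD[OF Suc.prems(2)]
  show ?case
    by (rule Ck_on_SucI[OF has_derivative_add[OF Df(1) Dg(1)] Suc.IH[OF Df(2) Dg(2)]])
qed (auto intro: continuous_intros)

text \<open>The product rule turns the derivative into a sum of values of the same \<open>b\<close>
  at functions of class one lower, so one induction serves products, scalar multiples and inner
  products; \<open>Ck_on_mono\<close> lowers the undifferentiated factor.\<close>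

lemma Ck_on_bilinear:
  assumes bil: "bounded_bilinear b"
  shows "Ck_on k UNIV f \<Longrightarrow> Ck_on k UNIV g \<Longrightarrow> Ck_on k UNIV (\<lambda>x. b (f x) (g x))"
proof (induction k arbitrary: f g)
  case 0
  then show ?case by (auto intro: bounded_bilinear.continuous_on[OF bil])
next
  case (Suc k)
  note Df = Ck_on_SucD[OF Suc.prems(1)] and Dg = Ck_on_SucD[OF Suc.prems(2)]
  show ?case
    by (rule Ck_on_SucI[OF bounded_bilinear.FDERIV[OF bil Df(1) Dg(1)]])
      (intro Ck_on_add Suc.IH Df(2) Dg(2) Ck_on_mono[OF Suc.prems(1)] Ck_on_mono[OF Suc.prems(2)])
qed

lemmas Ck_on_mult = Ck_on_bilinear[OF bounded_bilinear_mult]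
  and Ck_on_scaleR = Ck_on_bilinear[OF bounded_bilinear_scaleR]
  and Ck_on_inner = Ck_on_bilinear[OF bounded_bilinear_inner]

lemma Ck_on_const: "Ck_on k UNIV (\<lambda>x. c)"
proof (induction k arbitrary: c)
  case (Suc k)
  show ?case by (rule Ck_on_SucI[OF has_derivative_const Suc])
qed auto

lemma Ck_on_linear: "bounded_linear f \<Longrightarrow> Ck_on k UNIV f"
proof (cases k)
  case (Suc j)
  assume "bounded_linear f"
  then show ?thesis
    unfolding Suc by (intro Ck_on_SucI[OF bounded_linear_imp_has_derivative] Ck_on_const)
qed (simp add: linear_continuous_on)

lemma Ck_on_diff: "Ck_on k UNIV f \<Longrightarrow> Ck_on k UNIV g \<Longrightarrow> Ck_on k UNIV (\<lambda>x. f x - g x :: 'b::real_normed_vector)"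
  using Ck_on_add[of k f "\<lambda>x. (-1) *\<^sub>R g x"] Ck_on_scaleR[OF Ck_on_const[of k "-1::real"], of g]
  by simp

lemma Ck_on_prod:
  fixes f :: "'i \<Rightarrow> 'a::real_normed_vector \<Rightarrow> real"
  shows "finite I \<Longrightarrow> (\<And>i. i \<in> I \<Longrightarrow> Ck_on k UNIV (f i)) \<Longrightarrow> Ck_on k UNIV (\<lambda>x. \<Prod>i\<in>I. f i x)"
  by (induction I rule: finite_induct) (auto intro: Ck_on_const Ck_on_mult)

lemmas Ck_on_intros = Ck_on_add Ck_on_diff Ck_on_mult Ck_on_scaleR Ck_on_inner Ck_on_const
  Ck_on_linear[OF bounded_linear_fst] Ck_on_linear[OF bounded_linear_snd] Ck_on_linear[OF bounded_linear_ident]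

text \<open>The classical flat function exp(-1/s) and its quotients by powers of s. Derivatives stay
  in the span of the family (\<open>flat_deriv\<close>), so smoothness is an induction with the
  exponent \<open>n\<close> left free, and the smooth cutoffs below and their first derivatives are
  expressed by \<open>flat 0\<close> and \<open>flat 2\<close>.\<close>

definition flat :: "nat \<Rightarrow> real \<Rightarrow> real" where
  "flat n s = (if s > 0 then exp (- 1 / s) / s ^ n else 0)"

lemma flat_pos_iff [simp]: "flat n s > 0 \<longleftrightarrow> s > 0"
  by (auto simp: flat_def)

lemma flat_nonneg [simp]: "flat n s \<ge> 0"
  by (auto simp: flat_def)

lemma flat_eq_0 [simp]: "s \<le> 0 \<Longrightarrow> flat n s = 0"
  by (auto simp: flat_def)

lemma flat_0_le_1 [simp]: "flat 0 s \<le> 1"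
  by (auto simp: flat_def)

text \<open>The substitution y = 1/s turns the right-hand limit into that of y^n / exp y at
  infinity.\<close>

lemma tendsto_flat_0: "(flat n \<longlongrightarrow> 0) (at 0)"
proof (rule filterlim_split_at)
  have "((\<lambda>s. (inverse s) ^ n / exp (inverse s)) \<longlongrightarrow> (0::real)) (at_right 0)"
    by (rule filterlim_compose[OF tendsto_power_div_exp_0 filterlim_inverse_at_top_right])
  then show "(flat n \<longlongrightarrow> 0) (at_right 0)"
    by (rule Lim_transform_eventually)
      (auto simp: eventually_at_filter flat_def exp_minus field_simps intro!: always_eventually)
  show "(flat n \<longlongrightarrow> 0) (at_left 0)"
    by (rule tendsto_eventually) (auto simp: eventually_at_filter flat_def intro!: always_eventually)
qed

lemma flat_deriv: "(flat n has_real_derivative (flat (n + 2) s - real n * flat (n + 1) s)) (at s)"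
proof (cases s "0::real" rule: linorder_cases)
  case less
  have "(flat n has_real_derivative 0) (at s)"
    by (rule has_field_derivative_transform_within_open[OF DERIV_const[of 0], of "{..<0}"])
      (use less in auto)
  then show ?thesis using less by simp
next
  case equal
  \<comment> \<open>The difference quotient of \<open>flat n\<close> at 0 is
    \<open>flat (Suc n)\<close>, which tends to 0.\<close>
  have "((\<lambda>h. (flat n h - flat n 0) / (h - 0)) \<longlongrightarrow> 0) (at 0)"
    by (rule Lim_transform_eventually[OF tendsto_flat_0[of "Suc n"]])
      (auto simp: eventually_at_filter flat_def field_simps intro!: always_eventually)
  then show ?thesis using equal by (simp add: has_field_derivative_iff)
next
  case greater
  have "((\<lambda>s. exp (- 1 / s) / s ^ n) has_real_derivative (flat (n + 2) s - real n * flat (n + 1) s)) (at s)"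
    using greater
    by (auto intro!: derivative_eq_intros simp: flat_def field_simps power2_eq_square power_diff)
      (cases n; simp add: field_simps)
  then show ?thesis
    by (rule has_field_derivative_transform_within_open[where S = "{0<..}"])
      (use greater in \<open>auto simp: flat_def\<close>)
qed

text \<open>The index \<open>n\<close> stays free in the induction because differentiation raises
  it; \<open>P\<close> is smooth of every order since its derivatives appear as factors.\<close>

lemma Ck_on_flat:
  fixes P :: "'a::real_normed_vector \<Rightarrow> real"
  assumes "\<And>k. Ck_on k UNIV P"
  shows "Ck_on k UNIV (\<lambda>x. flat n (P x))"
proof (induction k arbitrary: n)
  case 0
  have "continuous_on UNIV (flat n)"
    by (intro continuous_at_imp_continuous_on) (metis DERIV_isCont flat_deriv)
  then show ?case using assms[of 0] by (auto intro: continuous_on_compose2)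
next
  case (Suc k)
  note DP = Ck_on_SucD[OF assms[of "Suc k"]]
  have "((\<lambda>x. flat n (P x)) has_derivative (\<lambda>v. (flat (n + 2) (P x) - real n * flat (n + 1) (P x)) *
      frechet_derivative P (at x) v)) (at x)" for x
    using has_derivative_compose[OF DP(1) flat_deriv[unfolded has_field_derivative_def]]
    by simp
  then show ?case
    by (rule Ck_on_SucI) (intro Ck_on_intros Suc DP)
qed

lemma Ck_on_comp_linear:
  "bounded_linear l \<Longrightarrow> Ck_on k UNIV f \<Longrightarrow> Ck_on k UNIV (\<lambda>x. f (l x))"
proof (induction k arbitrary: f)
  case 0
  then show ?case by (auto intro: continuous_on_compose2 linear_continuous_on)
next
  case (Suc k)
  note Df = Ck_on_SucD[OF Suc.prems(2)]
  show ?case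
    by (rule Ck_on_SucI[OF has_derivative_compose[OF bounded_linear_imp_has_derivative[OF Suc.prems(1)] Df(1)]])
      (rule Suc.IH[OF Suc.prems(1) Df(2)])
qed

section \<open>Test functions, smooth bumps and the fundamental lemma\<close>

lemma test_fun_infinity_iff:
  "test_fun \<infinity> U \<phi> \<longleftrightarrow> (\<forall>j. Ck_on j UNIV \<phi>) \<and>
     (\<exists>K. compact K \<and> K \<subseteq> U \<and> (\<forall>x. x \<notin> K \<longrightarrow> \<phi> x = 0))"
  by (simp add: test_fun_def)

lemma test_fun_mono: "test_fun \<infinity> U \<phi> \<Longrightarrow> test_fun k U \<phi>"
  by (simp add: test_fun_def)

text \<open>The complement of the compact support is open, so the derivative vanishes there as well
  and the same compact set serves.\<close>

lemma test_fun_frechet_derivative: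
  assumes "test_fun \<infinity> U \<phi>"
  shows "test_fun \<infinity> U (\<lambda>x. frechet_derivative \<phi> (at x) v)"
proof -
  obtain K where K: "compact K" "K \<subseteq> U" "\<And>x. x \<notin> K \<Longrightarrow> \<phi> x = 0" and C: "\<And>j. Ck_on j UNIV \<phi>"
    using assms by (auto simp: test_fun_infinity_iff)
  have "frechet_derivative \<phi> (at x) = (\<lambda>_. 0)" if "x \<notin> K" for x
  proof -
    have "(\<phi> has_derivative (\<lambda>_. 0)) (at x)"
      by (rule has_derivative_transform_within_open[OF has_derivative_const[of 0], of "- K"])
        (use K that compact_imp_closed in auto)
    then show ?thesis by (metis frechet_derivative_at)
  qed
  then have "\<forall>x. x \<notin> K \<longrightarrow> frechet_derivative \<phi> (at x) v = 0"
    by simp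
  then show ?thesis
    unfolding test_fun_infinity_iff using K(1,2) Ck_on_SucD(2)[OF C] by blast
qed

lemma test_fun_mult_right:
  assumes "test_fun k U \<phi>" "\<And>j. Ck_on j UNIV \<psi>"
  shows "test_fun k U (\<lambda>x. \<phi> x * \<psi> x :: real)"
  using assms unfolding test_fun_def by (auto intro!: Ck_on_mult)

lemma test_fun_scaleR:
  assumes "test_fun k U \<phi>"
  shows "test_fun k U (\<lambda>x. \<phi> x *\<^sub>R v)"
  using assms unfolding test_fun_def by (auto intro!: Ck_on_scaleR Ck_on_const)

lemma test_fun_tensor:
  fixes \<psi> :: "'a::real_normed_vector \<Rightarrow> real" and \<zeta> :: "'b::real_normed_vector \<Rightarrow> real"
  assumes "test_fun \<infinity> A \<psi>" "test_fun \<infinity> U \<zeta>"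
  shows "test_fun \<infinity> (A \<times> U) (\<lambda>z. \<psi> (fst z) * \<zeta> (snd z))"
proof -
  obtain K K' where K: "compact K" "K \<subseteq> A" "\<And>x. x \<notin> K \<Longrightarrow> \<psi> x = 0"
      "compact K'" "K' \<subseteq> U" "\<And>x. x \<notin> K' \<Longrightarrow> \<zeta> x = 0"
    using assms by (auto simp: test_fun_infinity_iff)
  have "\<exists>K. compact K \<and> K \<subseteq> A \<times> U \<and> (\<forall>z. z \<notin> K \<longrightarrow> \<psi> (fst z) * \<zeta> (snd z) = 0)"
    using K compact_Times[of K K'] by (intro exI[of _ "K \<times> K'"]) auto
  then show ?thesis
    using assms by (auto simp: test_fun_infinity_iff
        intro!: Ck_on_mult Ck_on_comp_linear[OF bounded_linear_fst] Ck_on_comp_linear[OF bounded_linear_snd])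
qed

text \<open>The support condition of a smooth bump and the approximation of an indicator in one: for
  n > 0 the function is positive exactly on the open box, and growing \<open>n\<close> drives every
  factor to 1 there.\<close>

definition box_bump :: "'a::euclidean_space \<Rightarrow> 'a \<Rightarrow> nat \<Rightarrow> 'a \<Rightarrow> real" where
  "box_bump a b n z = (\<Prod>i\<in>Basis. flat 0 (real n * (z \<bullet> i - a \<bullet> i)) * flat 0 (real n * (b \<bullet> i - z \<bullet> i)))"

lemma Ck_on_box_bump: "Ck_on k UNIV (box_bump a b n)"
  unfolding box_bump_def by (intro Ck_on_prod Ck_on_intros Ck_on_flat) simp

lemma box_bump_bounds: "box_bump a b n z \<in> {0..1}"
  unfolding box_bump_def by (auto intro!: prod_nonneg prod_le_1 mult_le_one)

lemma box_bump_eq_0: "z \<notin> box a b \<Longrightarrow> box_bump a b n z = 0"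
proof -
  assume "z \<notin> box a b"
  then obtain i where i: "i \<in> Basis" "z \<bullet> i \<le> a \<bullet> i \<or> b \<bullet> i \<le> z \<bullet> i"
    unfolding mem_box by force
  then have "flat 0 (real n * (z \<bullet> i - a \<bullet> i)) * flat 0 (real n * (b \<bullet> i - z \<bullet> i)) = 0"
    by (auto simp: mult_nonneg_nonpos)
  then show ?thesis
    unfolding box_bump_def using i(1) by (intro prod_zero) auto
qed

lemma box_bump_pos: "z \<in> box a b \<Longrightarrow> n > 0 \<Longrightarrow> box_bump a b n z > 0"
  unfolding box_bump_def mem_box by (intro prod_pos) auto

lemma flat_tendsto_1: "s > 0 \<Longrightarrow> (\<lambda>n. flat 0 (real n * s)) \<longlonglongrightarrow> 1"
proof -
  assume s: "s > 0"
  have "(\<lambda>n. exp (- (1 / s) * (1 / real n))) \<longlonglongrightarrow> exp (- (1 / s) * 0)"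
    by (intro tendsto_intros lim_const_over_n)
  then show ?thesis
    by (elim filterlim_cong[THEN iffD1, rotated -1] )
      (use s in \<open>auto simp: flat_def field_simps intro!: eventually_mono[OF eventually_gt_at_top[of 0]]\<close>)
qed

lemma box_bump_tendsto: "(\<lambda>n. box_bump a b n z) \<longlonglongrightarrow> indicator (box a b) z"
proof (cases "z \<in> box a b")
  case True
  then have "(\<lambda>n. box_bump a b n z) \<longlonglongrightarrow> (\<Prod>i\<in>(Basis :: 'a set). 1 * 1)"
    unfolding box_bump_def mem_box by (intro tendsto_intros flat_tendsto_1) auto
  then show ?thesis using True by simp
qed (simp add: box_bump_eq_0)

lemma test_fun_box_bump: "cbox a b \<subseteq> U \<Longrightarrow> test_fun \<infinity> U (box_bump a b n)"
  using box_bump_eq_0[of _ a b n] box_subset_cbox[of a b]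
  by (auto simp: test_fun_infinity_iff Ck_on_box_bump intro!: exI[of _ "cbox a b"])

text \<open>Dynkin's argument: open boxes are stable under intersection and generate the Borel sets;
  the vanishing total integral handles complements.\<close>

lemma integral_indicator_eq_0_borel:
  fixes g :: "'a::euclidean_space \<Rightarrow> real"
  assumes g: "integrable lborel g" "(LINT z|lborel. g z) = 0"
    and box: "\<And>a b. (LINT z:box a b|lborel. g z) = 0"
    and A: "A \<in> sets borel"
  shows "(LINT z:A|lborel. g z) = 0"
proof -
  let ?G = "range (\<lambda>(a, b). box a b :: 'a set)"
  have si: "set_integrable lborel B g" if "B \<in> sets borel" for B
    using integrable_mult_indicator[OF _ g(1), of B] that by (simp add: set_integrable_def)
  have eq: "sigma_sets UNIV ?G = sets borel"
    by (simp add: borel_eq_box)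
  have "Int_stable ?G"
    by (auto simp: Int_stable_def box_Int_box)
  moreover have "?G \<subseteq> Pow UNIV" by simp
  moreover have "A \<in> sigma_sets UNIV ?G" using A eq by simp
  ultimately show ?thesis
  proof (induction rule: sigma_sets_induct_disjoint)
    case (compl B)
    then have "(LINT z:UNIV|lborel. g z) = (LINT z:B|lborel. g z) + (LINT z:UNIV - B|lborel. g z)"
      using si eq by (subst set_integral_Un[symmetric]) auto
    then show ?case using compl g by (simp add: set_lebesgue_integral_def)
  next
    case (union B)
    then show ?case
      using si eq by (subst lebesgue_integral_countable_add) (auto simp: disjoint_family_on_def)
  qed (use box in \<open>auto simp: set_lebesgue_integral_def\<close>)
qed

text \<open>\<open>f\<close> itself is integrable only after multiplication with test functions. The
  bump of a closed box in \<open>D\<close> makes \<open>g\<close> integrable on the whole space;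
  multiplying by further bumps stays within the test functions of \<open>D\<close> and yields
  vanishing integrals over all open boxes. Hence \<open>g\<close> vanishes, and dividing by the
  positive bump gives the claim inside the box.\<close>

lemma fundamental_lemma_variations:
  fixes f :: "'a::euclidean_space \<Rightarrow> real"
  assumes "open D"
    and int: "\<And>\<phi>. test_fun \<infinity> D \<phi> \<Longrightarrow> integrable lborel (\<lambda>z. f z * \<phi> z)"
    and null: "\<And>\<phi>. test_fun \<infinity> D \<phi> \<Longrightarrow> (LINT z|lborel. f z * \<phi> z) = 0"
  shows "AE z in lborel. z \<in> D \<longrightarrow> f z = 0"
proof -
  have *: "AE z in lborel. z \<in> box a b \<longrightarrow> f z = 0" if ab: "cbox a b \<subseteq> D" for a b
  proof -
    define g where "g z = f z * box_bump a b 1 z" for z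
    have tf: "test_fun \<infinity> D (box_bump a b 1)" by (rule test_fun_box_bump[OF ab])
    have g: "integrable lborel g" "(LINT z|lborel. g z) = 0"
      unfolding g_def by (rule int[OF tf] null[OF tf])+
    have "(LINT z:box c d|lborel. g z) = 0" for c d
    proof -
      have "(\<lambda>n. LINT z|lborel. g z * box_bump c d n z) \<longlonglongrightarrow> (LINT z|lborel. g z * indicator (box c d) z)"
      proof (rule integral_dominated_convergence[where w = "\<lambda>z. \<bar>g z\<bar>"])
        show "(\<lambda>z. g z * box_bump c d n z) \<in> borel_measurable lborel" for n
          using g(1) borel_measurable_continuous_onI[of "box_bump c d n"] Ck_on_box_bump[of 0 c d n]
          by (intro borel_measurable_times) auto
        show "AE z in lborel. norm (g z * box_bump c d n z) \<le> \<bar>g z\<bar>" for n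
          using box_bump_bounds[of c d n] by (auto simp: abs_mult intro!: mult_left_le)
      qed (use g in \<open>auto intro!: tendsto_intros box_bump_tendsto\<close>)
      moreover have "(LINT z|lborel. g z * box_bump c d n z) = 0" for n
        using null[OF test_fun_mult_right[OF tf Ck_on_box_bump[of _ c d n]]]
        by (simp add: g_def mult.assoc)
      ultimately show ?thesis
        by (simp add: set_lebesgue_integral_def mult.commute LIMSEQ_const_iff)
    qed
    note integral_indicator_eq_0_borel[OF g this]
    then have "AE z in lborel. g z = 0"
      by (intro density_unique_real[OF g(1)]) (auto simp: set_lebesgue_integral_def)
    then show ?thesis
      by eventually_elim (use box_bump_pos[of _ a b 1] in \<open>force simp: g_def\<close>)
  qed
  obtain \<D> where D: "countable \<D>" "\<D> \<subseteq> Pow D" "\<And>X. X \<in> \<D> \<Longrightarrow> \<exists>a b. X = cbox a b" "\<Union>\<D> = D"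
    using open_countable_Union_open_cbox[OF \<open>open D\<close>] by metis
  have "AE z in lborel. z \<in> X \<longrightarrow> f z = 0" if X_in: "X \<in> \<D>" for X
  proof -
    obtain a b where X: "X = cbox a b" "cbox a b \<subseteq> D"
      using D(2) D(3)[OF X_in] X_in by auto
    \<comment> \<open>The cover of \<open>D\<close> consists of closed boxes while the bump is
      positive on the open box only; the boundary is a null set.\<close>
    have "cbox a b - box a b \<in> null_sets lborel"
      by (intro null_setsI) (simp_all add: emeasure_lborel_cbox_eq emeasure_lborel_box_eq emeasure_Diff box_subset_cbox)
    from AE_not_in[OF this] *[OF X(2)] show ?thesis
      by eventually_elim (use X in auto)
  qed
  then have "AE z in lborel. \<forall>X\<in>\<D>. z \<in> X \<longrightarrow> f z = 0"
    using D(1) by (intro AE_ball_countable')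
  then show ?thesis
    by eventually_elim (use D(4) in auto)
qed

section \<open>The mean of the Ito integral\<close>

text \<open>On a probability space mean square convergence gives L^1 convergence, so integrability
  and the mean pass to the limit. It is applied twice: from simple integrals to one Ito integral,
  and from partial sums over \<open>k\<close> to the cylindrical integral.\<close>

lemma integral_eq_0_L2_limit:
  fixes I :: "'w \<Rightarrow> real"
  assumes "prob_space M" and I: "I \<in> borel_measurable M"
    and S: "\<And>n. integrable M (S n)" "\<And>n. (LINT \<omega>|M. S n \<omega>) = 0"
    and lim: "(\<lambda>n. \<integral>\<^sup>+\<omega>. ennreal ((I \<omega> - S n \<omega>)\<^sup>2) \<partial>M) \<longlonglongrightarrow> 0"
  shows "integrable M I \<and> (LINT \<omega>|M. I \<omega>) = 0"
proof -
  interpret prob_space M by fact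
  have meas: "(\<lambda>\<omega>. I \<omega> - S n \<omega>) \<in> borel_measurable M" for n
    using I S(1) by auto
  have ev: "\<forall>\<^sub>F n in sequentially. (\<integral>\<^sup>+\<omega>. ennreal ((I \<omega> - S n \<omega>)\<^sup>2) \<partial>M) < ennreal e" if "e > 0" for e
    using order_tendstoD(2)[OF lim, of "ennreal e"] that by simp
  have *: "\<forall>\<^sub>F n in sequentially. integrable M (\<lambda>\<omega>. I \<omega> - S n \<omega>) \<and> \<bar>LINT \<omega>|M. I \<omega> - S n \<omega>\<bar> \<le> 2 * e" if e: "e > 0" for e
    using ev[of "e\<^sup>2"]
  proof (rule eventually_mono)
    fix n assume n: "(\<integral>\<^sup>+\<omega>. ennreal ((I \<omega> - S n \<omega>)\<^sup>2) \<partial>M) < ennreal (e\<^sup>2)"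
    have sq: "integrable M (\<lambda>\<omega>. (I \<omega> - S n \<omega>)\<^sup>2)"
      using meas n by (intro integrableI_nonneg) (auto intro: less_trans)
    have sq_le: "(LINT \<omega>|M. (I \<omega> - S n \<omega>)\<^sup>2) \<le> e\<^sup>2"
      using n sq e by (subst (asm) nn_integral_eq_integral) (auto simp: ennreal_less_iff)
    \<comment> \<open>An elementary substitute for Cauchy-Schwarz: when the mean square is at most
      e^2, the right-hand side has mean at most 2 e.\<close>
    have dom: "\<bar>I \<omega> - S n \<omega>\<bar> \<le> e + (I \<omega> - S n \<omega>)\<^sup>2 / e" for \<omega>
    proof -
      have "0 \<le> (\<bar>I \<omega> - S n \<omega>\<bar> - e)\<^sup>2 + e * \<bar>I \<omega> - S n \<omega>\<bar>" using e by simp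
      also have "\<dots> = e\<^sup>2 + (I \<omega> - S n \<omega>)\<^sup>2 - e * \<bar>I \<omega> - S n \<omega>\<bar>"
        by (simp add: power2_eq_square algebra_simps abs_mult_self_eq)
      finally show ?thesis using e by (simp add: field_simps power2_eq_square)
    qed
    have int: "integrable M (\<lambda>\<omega>. I \<omega> - S n \<omega>)"
      by (rule Bochner_Integration.integrable_bound[of M "\<lambda>\<omega>. e + (I \<omega> - S n \<omega>)\<^sup>2 / e"])
        (use sq meas dom in \<open>auto intro!: AE_I2 order_trans[OF dom]\<close>)
    have "\<bar>LINT \<omega>|M. I \<omega> - S n \<omega>\<bar> \<le> (LINT \<omega>|M. \<bar>I \<omega> - S n \<omega>\<bar>)"
      using integral_abs_bound by blast
    also have "\<dots> \<le> (LINT \<omega>|M. e + (I \<omega> - S n \<omega>)\<^sup>2 / e)"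
      using int sq dom by (intro integral_mono) auto
    also have "\<dots> = e + (LINT \<omega>|M. (I \<omega> - S n \<omega>)\<^sup>2) / e"
      using sq by (simp add: prob_space)
    also have "\<dots> \<le> 2 * e"
      using sq_le e by (simp add: field_simps power2_eq_square)
    finally show "integrable M (\<lambda>\<omega>. I \<omega> - S n \<omega>) \<and> \<bar>LINT \<omega>|M. I \<omega> - S n \<omega>\<bar> \<le> 2 * e"
      using int by simp
  qed (use e in simp)
  obtain n where "integrable M (\<lambda>\<omega>. I \<omega> - S n \<omega>)"
    using eventually_happens[OF *[of 1]] by auto
  from Bochner_Integration.integrable_add[OF this S(1)[of n]] have int: "integrable M I" by simp
  have "\<bar>LINT \<omega>|M. I \<omega>\<bar> \<le> 0 + e" if "e > 0" for e
  proof -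
    obtain n where "\<bar>LINT \<omega>|M. I \<omega> - S n \<omega>\<bar> \<le> 2 * (e / 2)"
      using eventually_happens[OF *[of "e / 2"]] \<open>e > 0\<close> by auto
    then show ?thesis using int S by simp
  qed
  then have "\<bar>LINT \<omega>|M. I \<omega>\<bar> \<le> 0"
    by (rule field_le_epsilon)
  with int show ?thesis by simp
qed

text \<open>Each coefficient is measurable at the left end point of its interval, hence independent
  of the increment, which has mean zero.\<close>

lemma simple_ito_mean_0:
  assumes "prob_space M" and bm: "brownian_motion M F T w" and sp: "simple_process M F T p \<tau> \<xi>"
    and F: "\<And>t. sets (F t) \<subseteq> sets M" "\<And>t. t \<in> {0..T} \<Longrightarrow> space (F t) = space M"
  shows "integrable M (simple_ito p \<tau> \<xi> w)" "(LINT \<omega>|M. simple_ito p \<tau> \<xi> w \<omega>) = 0"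
proof -
  interpret prob_space M by fact
  have *: "integrable M (\<lambda>\<omega>. \<xi> i \<omega> * (w (\<tau> (Suc i)) \<omega> - w (\<tau> i) \<omega>)) \<and>
      (LINT \<omega>|M. \<xi> i \<omega> * (w (\<tau> (Suc i)) \<omega> - w (\<tau> i) \<omega>)) = 0" if i: "i < p" for i
  \<comment> \<open>Simple processes may contain empty intervals, where the law of the increment is
    not prescribed; the summand is then identically zero.\<close>
  proof (cases "\<tau> i = \<tau> (Suc i)")
    case False
    then have \<tau>: "0 \<le> \<tau> i" "\<tau> i < \<tau> (Suc i)" "\<tau> (Suc i) \<le> T" "\<tau> i \<in> {0..T}"
      using sp i by (auto simp: simple_process_def less_le Suc_le_eq)
    define X where "X \<omega> = w (\<tau> (Suc i)) \<omega> - w (\<tau> i) \<omega>" for \<omega>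
    have dist: "distributed M lborel X (\<lambda>y. ennreal (normal_density 0 (sqrt (\<tau> (Suc i) - \<tau> i)) y))"
      and ind: "indep_set (sets (F (\<tau> i))) {X -` A \<inter> space M | A. A \<in> sets borel}"
      using bm \<tau> unfolding brownian_motion_def X_def by auto
    have X: "X \<in> borel_measurable M" using distributed_measurable[OF dist] by simp
    have \<xi>F: "\<xi> i \<in> borel_measurable (F (\<tau> i))" and bdd: "bounded (\<xi> i ` space M)"
      using sp i by (auto simp: simple_process_def)
    have \<xi>: "\<xi> i \<in> borel_measurable M"
      using measurable_sets[OF \<xi>F] F[of "\<tau> i"] \<tau>(4) by (intro measurableI) auto
    obtain c where c: "\<And>\<omega>. \<omega> \<in> space M \<Longrightarrow> \<bar>\<xi> i \<omega>\<bar> \<le> c"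
      using bdd by (auto simp: bounded_iff)
    have \<xi>_int: "integrable M (\<xi> i)"
      by (rule integrable_const_bound[of _ c]) (use c \<xi> in auto)
    have s: "sqrt (\<tau> (Suc i) - \<tau> i) > 0" using \<tau> by simp
    have X_mean: "integrable M X \<and> expectation X = 0"
    proof -
      have "integrable lborel (\<lambda>y. normal_density 0 (sqrt (\<tau> (Suc i) - \<tau> i)) y * y)"
        using integrable_normal_moment[OF s, of 0 1] by simp
      then have "integrable M X"
        using distributed_integrable[OF dist, of "\<lambda>y. y"] by simp
      then show ?thesis
        using normal_distributed_expectation[OF s dist] by simp
    qed
    have "indep_var borel (\<xi> i) borel X"
      unfolding indep_var_eq
    proof (intro conjI \<xi> X)
      have sub: "sigma_sets (space M) {\<xi> i -` A \<inter> space M | A. A \<in> sets borel} \<subseteq> sets (F (\<tau> i))"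
      proof -
        have "sigma_sets (space (F (\<tau> i))) {\<xi> i -` A \<inter> space M | A. A \<in> sets borel} \<subseteq> sets (F (\<tau> i))"
          using measurable_sets[OF \<xi>F] F(2)[OF \<tau>(4)] by (intro sets.sigma_sets_subset) auto
        then show ?thesis using F(2)[OF \<tau>(4)] by simp
      qed
      \<comment> \<open>Preimages of Borel sets already form a sigma-algebra; this reconciles the
        independence in \<open>brownian_motion\<close> with the form that
        \<open>indep_var_eq\<close> asks for.\<close>
      have eq: "sigma_sets (space M) {X -` A \<inter> space M | A. A \<in> sets borel} = {X -` A \<inter> space M | A. A \<in> sets borel}"
        using sets_vimage_algebra[of "space M" X borel] sets_vimage_algebra2[of X "space M" borel] by auto
      show "indep_set (sigma_sets (space M) {\<xi> i -` A \<inter> space M | A. A \<in> sets borel})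
         (sigma_sets (space M) {X -` A \<inter> space M | A. A \<in> sets borel})"
        unfolding eq using ind sub unfolding indep_set_def
        by (elim indep_sets_mono_sets) (auto split: bool.splits)
    qed
    from indep_var_integrable[OF this \<xi>_int] indep_var_lebesgue_integral[OF this \<xi>_int] X_mean
    show ?thesis by (simp flip: X_def)
  qed simp
  show "integrable M (simple_ito p \<tau> \<xi> w)" "(LINT \<omega>|M. simple_ito p \<tau> \<xi> w \<omega>) = 0"
    unfolding simple_ito_def using * by (auto simp: Bochner_Integration.integral_sum)
qed

lemma ito_integral_cyl_mean_0:
  assumes "prob_space M" "filtration (space M) Filt" "\<forall>t. sets (Filt t) \<subseteq> sets M"
    and "cylindrical_wiener M Filt T W" "ito_integral_cyl M Filt T W X I"
  shows "integrable M I \<and> (LINT \<omega>|M. I \<omega>) = 0"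
proof -
  obtain J where J: "\<And>k. ito_integral M Filt T (W k) (X k) (J k)" and I: "I \<in> borel_measurable M"
      "(\<lambda>n. \<integral>\<^sup>+\<omega>. ennreal ((I \<omega> - (\<Sum>k<n. J k \<omega>))\<^sup>2) \<partial>M) \<longlonglongrightarrow> 0"
    using assms(5) by (auto simp: ito_integral_cyl_def)
  have Filt: "sets (Filt t) \<subseteq> sets M" "space (Filt t) = space M" for t
    using assms(2,3) by (auto simp: filtration_def)
  have "integrable M (J k) \<and> (LINT \<omega>|M. J k \<omega>) = 0" for k
  proof -
    obtain p \<tau> \<xi> where sp: "\<And>n. simple_process M Filt T (p n) (\<tau> n) (\<xi> n)"
      and lim: "(\<lambda>n. \<integral>\<^sup>+\<omega>. ennreal ((J k \<omega> - simple_ito (p n) (\<tau> n) (\<xi> n) (W k) \<omega>)\<^sup>2) \<partial>M) \<longlonglongrightarrow> 0"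
      and "J k \<in> borel_measurable M"
      using J[of k] unfolding ito_integral_def by auto
    moreover have "brownian_motion M Filt T (W k)"
      using assms(4) by (simp add: cylindrical_wiener_def)
    ultimately show ?thesis
      using simple_ito_mean_0[OF assms(1) _ sp Filt(1) Filt(2)]
      by (intro integral_eq_0_L2_limit[OF assms(1) _ _ _ lim]) auto
  qed
  then show ?thesis
    by (intro integral_eq_0_L2_limit[OF assms(1) I(1) _ _ I(2)]) (auto simp: Bochner_Integration.integral_sum)
qed

section \<open>Averages over refining partitions\<close>

text \<open>The setting for the L^1 form of Levy's upward theorem: \<open>avg n\<close> is the
  conditional expectation given the partition into level sets of \<open>label n\<close>. Averages
  over cells matter because on the trajectory space they are pairings with compactly supported
  functions, the only quantities whose measurability is immediate.\<close>

locale refining_partition = finite_measure M for M :: "'x measure" +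
  fixes label :: "nat \<Rightarrow> 'x \<Rightarrow> 'l::countable"
  assumes label_measurable [measurable]: "\<And>n. label n \<in> measurable M (count_space UNIV)"
    and finite_labels: "\<And>n. finite (label n ` space M)"
    and label_refine: "\<And>n m x y. n \<le> m \<Longrightarrow> label m x = label m y \<Longrightarrow> label n x = label n y"
    and sets_label: "sets M = sigma_sets (space M) {label n -` S \<inter> space M |n S. True}"
begin

definition cell :: "nat \<Rightarrow> 'l \<Rightarrow> 'x set" where
  "cell n l = {x\<in>space M. label n x = l}"

text \<open>On a null cell division by zero yields the value 0; there are finitely many cells, so
  the null ones are negligible together (\<open>AE_cell_pos\<close>).\<close>

definition avg :: "nat \<Rightarrow> ('x \<Rightarrow> 'b::{banach,second_countable_topology}) \<Rightarrow> 'x \<Rightarrow> 'b" where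
  "avg n f x = (1 / measure M (cell n (label n x))) *\<^sub>R (LINT y:cell n (label n x)|M. f y)"

lemma cell_sets [measurable]: "cell n l \<in> sets M"
  unfolding cell_def by measurable

lemma avg_sum_cells:
  assumes "x \<in> space M"
  shows "avg n f x = (\<Sum>l\<in>label n ` space M. indicator (cell n l) x *\<^sub>R
    ((1 / measure M (cell n l)) *\<^sub>R (LINT y:cell n l|M. f y)))"
proof -
  have "(\<Sum>l\<in>label n ` space M. indicator (cell n l) x *\<^sub>R
      ((1 / measure M (cell n l)) *\<^sub>R (LINT y:cell n l|M. f y))) =
    (\<Sum>l\<in>label n ` space M. if l = label n x then avg n f x else 0)"
    using assms by (intro sum.cong) (auto simp: avg_def cell_def split: split_indicator)
  then show ?thesis
    using assms finite_labels by simp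
qed

lemma sum_cells:
  fixes f :: "'x \<Rightarrow> 'b::{banach,second_countable_topology}"
  assumes "integrable M f"
  shows "(\<Sum>l\<in>label n ` space M. LINT y:cell n l|M. f y) = (LINT y|M. f y)"
proof -
  have "(LINT y|M. f y) = (LINT y|M. (\<Sum>l\<in>label n ` space M. indicator (cell n l) y *\<^sub>R f y))"
  proof (rule Bochner_Integration.integral_cong[OF refl])
    fix y assume y: "y \<in> space M"
    have "(\<Sum>l\<in>label n ` space M. indicator (cell n l) y *\<^sub>R f y) =
        (\<Sum>l\<in>label n ` space M. if l = label n y then f y else 0)"
      using y by (intro sum.cong) (auto simp: cell_def split: split_indicator)
    then show "f y = (\<Sum>l\<in>label n ` space M. indicator (cell n l) y *\<^sub>R f y)"
      using y finite_labels by simp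
  qed
  also have "\<dots> = (\<Sum>l\<in>label n ` space M. LINT y:cell n l|M. f y)"
    unfolding set_lebesgue_integral_def
    using assms by (intro Bochner_Integration.integral_sum integrable_mult_indicator) auto
  finally show ?thesis by simp
qed

lemma avg_integrable: "integrable M (avg n f)"
  by (subst Bochner_Integration.integrable_cong[OF refl avg_sum_cells], assumption)
    (intro Bochner_Integration.integrable_sum integrable_mult_indicator cell_sets integrable_const)

lemma avg_on_cell:
  "x \<in> cell n l \<Longrightarrow> avg n f x = (1 / measure M (cell n l)) *\<^sub>R (LINT y:cell n l|M. f y)"
  by (auto simp: avg_def cell_def)

lemma avg_contraction:
  assumes f: "integrable M f"
  shows "(LINT x|M. norm (avg n f x)) \<le> (LINT x|M. norm (f x))"
proof -
  have "(LINT x|M. norm (avg n f x)) = (\<Sum>l\<in>label n ` space M. LINT x:cell n l|M. norm (avg n f x))"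
    by (rule sum_cells[symmetric]) (intro integrable_norm avg_integrable)
  also have "\<dots> \<le> (\<Sum>l\<in>label n ` space M. LINT x:cell n l|M. norm (f x))"
  proof (rule sum_mono)
    fix l
    have "(LINT x:cell n l|M. norm (avg n f x)) =
        (LINT x:cell n l|M. norm (LINT y:cell n l|M. f y) / measure M (cell n l))"
      by (intro set_lebesgue_integral_cong cell_sets) (simp add: avg_on_cell)
    also have "\<dots> = measure M (cell n l) * (norm (LINT y:cell n l|M. f y) / measure M (cell n l))"
      by (simp add: set_lebesgue_integral_def)
    \<comment> \<open>Only an inequality, because the left-hand side is 0 on a null cell by the
      convention for division.\<close>
    also have "\<dots> \<le> norm (LINT y:cell n l|M. f y)"
      by simp
    also have "\<dots> \<le> (LINT x:cell n l|M. norm (f x))"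
      using set_integral_norm_bound[of M "cell n l" f] f
      by (simp add: set_integrable_def integrable_mult_indicator)
    finally show "(LINT x:cell n l|M. norm (avg n f x)) \<le> (LINT x:cell n l|M. norm (f x))" .
  qed
  also have "\<dots> = (LINT x|M. norm (f x))"
    by (rule sum_cells) (use f in simp)
  finally show ?thesis .
qed

lemma avg_add:
  assumes "integrable M f" "integrable M g"
  shows "avg n (\<lambda>x. f x + g x) x = avg n f x + avg n g x"
  using assms by (simp add: avg_def set_integral_add set_integrable_def integrable_mult_indicator scaleR_add_right)

lemma avg_diff:
  assumes "integrable M f" "integrable M g"
  shows "avg n (\<lambda>x. f x - g x) x = avg n f x - avg n g x"
  using assms by (simp add: avg_def set_integral_diff set_integrable_def integrable_mult_indicator scaleR_diff_right)

definition avg_conv :: "('x \<Rightarrow> 'b::{banach,second_countable_topology}) \<Rightarrow> bool" where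
  "avg_conv f \<longleftrightarrow> integrable M f \<and> (\<lambda>n. LINT x|M. norm (avg n f x - f x)) \<longlonglongrightarrow> 0"

lemma avg_conv_add:
  assumes "avg_conv f" "avg_conv g"
  shows "avg_conv (\<lambda>x. f x + g x)"
proof -
  have i: "integrable M f" "integrable M g" using assms by (auto simp: avg_conv_def)
  have le: "(LINT x|M. norm (avg n (\<lambda>x. f x + g x) x - (f x + g x))) \<le>
    (LINT x|M. norm (avg n f x - f x)) + (LINT x|M. norm (avg n g x - g x))" for n
    using i avg_integrable
    by (subst Bochner_Integration.integral_add[symmetric])
      (auto intro!: integral_mono norm_diff_triangle_ineq integrable_norm Bochner_Integration.integrable_diff
        Bochner_Integration.integrable_add simp: avg_add)
  have "(\<lambda>n. LINT x|M. norm (avg n (\<lambda>x. f x + g x) x - (f x + g x))) \<longlonglongrightarrow> 0"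
  proof (rule tendsto_sandwich[OF _ _ tendsto_const])
    show "(\<lambda>n. (LINT x|M. norm (avg n f x - f x)) + (LINT x|M. norm (avg n g x - g x))) \<longlonglongrightarrow> 0"
      using tendsto_add[of _ 0 _ _ 0] assms by (auto simp: avg_conv_def)
  qed (use le in \<open>auto intro!: always_eventually\<close>)
  then show ?thesis using i by (auto simp: avg_conv_def)
qed

lemma avg_conv_linear:
  fixes f :: "'x \<Rightarrow> real"
  assumes "avg_conv f"
  shows "avg_conv (\<lambda>x. f x *\<^sub>R c)"
proof -
  have i: "integrable M f" using assms by (auto simp: avg_conv_def)
  have "avg n (\<lambda>x. f x *\<^sub>R c) x = avg n f x *\<^sub>R c" for n x
  proof -
    have "(LINT y:cell n l|M. f y *\<^sub>R c) = (LINT y:cell n l|M. f y) *\<^sub>R c" for l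
      unfolding set_lebesgue_integral_def
      using integral_scaleR_left[of c M "\<lambda>y. indicator (cell n l) y *\<^sub>R f y"] integrable_mult_indicator[OF cell_sets i]
      by simp
    then show ?thesis by (simp add: avg_def)
  qed
  then have "(LINT x|M. norm (avg n (\<lambda>x. f x *\<^sub>R c) x - f x *\<^sub>R c)) = (LINT x|M. norm (avg n f x - f x)) * norm c" for n
    by (simp flip: scaleR_diff_left)
  then show ?thesis
    using assms tendsto_mult_left_zero[of _ sequentially "norm c"] by (auto simp: avg_conv_def)
qed

text \<open>A three-epsilon argument: the contraction property bounds the average of
  \<open>f - g\<close> by the L^1 distance of \<open>f\<close> and \<open>g\<close>.\<close>

lemma avg_conv_limit:
  assumes f: "integrable M f"
    and ex: "\<And>e. e > 0 \<Longrightarrow> \<exists>g. avg_conv g \<and> (LINT x|M. norm (f x - g x)) < e"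
  shows "avg_conv f"
  unfolding avg_conv_def
proof (intro conjI f LIMSEQ_I)
  fix e :: real assume "e > 0"
  then obtain g where g: "avg_conv g" "(LINT x|M. norm (f x - g x)) < e / 3"
    using ex[of "e / 3"] by auto
  have gi: "integrable M g" using g by (auto simp: avg_conv_def)
  obtain N where N: "\<And>n. n \<ge> N \<Longrightarrow> (LINT x|M. norm (avg n g x - g x)) < e / 3"
    using g(1) LIMSEQ_D[of _ 0 "e / 3"] \<open>e > 0\<close> by (force simp: avg_conv_def)
  have "(LINT x|M. norm (avg n f x - f x)) < e" if "n \<ge> N" for n
  proof -
    have "(LINT x|M. norm (avg n f x - f x)) \<le>
      (LINT x|M. norm (avg n (\<lambda>x. f x - g x) x) + norm (avg n g x - g x) + norm (f x - g x))"
    proof (intro integral_mono)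
      fix x
      have "avg n f x - f x = avg n (\<lambda>x. f x - g x) x + (avg n g x - g x) - (f x - g x)"
        using f gi by (simp add: avg_diff)
      note eq = this
      show "norm (avg n f x - f x) \<le> norm (avg n (\<lambda>x. f x - g x) x) + norm (avg n g x - g x) + norm (f x - g x)"
        using norm_triangle_ineq4[of "avg n (\<lambda>x. f x - g x) x + (avg n g x - g x)" "f x - g x"]
          norm_triangle_ineq[of "avg n (\<lambda>x. f x - g x) x" "avg n g x - g x"]
        unfolding eq by linarith
    qed (use f gi avg_integrable in \<open>auto intro!: integrable_norm Bochner_Integration.integrable_diff
        Bochner_Integration.integrable_add\<close>)
    also have "\<dots> = (LINT x|M. norm (avg n (\<lambda>x. f x - g x) x)) + (LINT x|M. norm (avg n g x - g x)) + (LINT x|M. norm (f x - g x))"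
      using f gi avg_integrable[of n g] avg_integrable[of n "\<lambda>x. f x - g x"] by simp
    also have "\<dots> < e"
      using avg_contraction[of "\<lambda>x. f x - g x" n] f gi g(2) N[OF that] by simp
    finally show ?thesis .
  qed
  then show "\<exists>N. \<forall>n\<ge>N. norm ((LINT x|M. norm (avg n f x - f x)) - 0) < e"
    by auto
qed

text \<open>The closure property that both later inductions ask for: countable disjoint unions in
  the Dynkin argument, and approximation by simple functions in
  \<open>integrable_induct\<close>.\<close>

lemma avg_conv_limit_dominated:
  assumes s: "\<And>i. avg_conv (s i)" and lim: "\<And>x. x \<in> space M \<Longrightarrow> (\<lambda>i. s i x) \<longlonglongrightarrow> f x"
    and dom: "\<And>i x. x \<in> space M \<Longrightarrow> norm (s i x) \<le> w x" "integrable M w"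
  shows "avg_conv f"
proof (rule avg_conv_limit)
  have si: "integrable M (s i)" for i using s by (auto simp: avg_conv_def)
  show f: "integrable M f"
    using integrable_dominated_convergence[of f M s w] si lim dom
      borel_measurable_LIMSEQ_metric[of s M f] by auto
  have fw: "x \<in> space M \<Longrightarrow> norm (f x) \<le> w x" for x
    using lim dom by (intro LIMSEQ_le_const2[OF tendsto_norm[OF lim]]) auto
  have "(\<lambda>i. LINT x|M. norm (f x - s i x)) \<longlonglongrightarrow> (LINT x|M. 0)"
  proof (rule integral_dominated_convergence[where w = "\<lambda>x. 2 * w x"])
    show "AE x in M. (\<lambda>i. norm (f x - s i x)) \<longlonglongrightarrow> 0"
    proof (rule AE_I2)
      fix x assume "x \<in> space M"
      from tendsto_norm[OF tendsto_diff[OF tendsto_const lim[OF this]], of "f x"]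
      show "(\<lambda>i. norm (f x - s i x)) \<longlonglongrightarrow> 0" by simp
    qed
    show "AE x in M. norm (norm (f x - s i x)) \<le> 2 * w x" for i
    proof (rule AE_I2)
      fix x assume "x \<in> space M"
      from fw[OF this] dom(1)[OF this, of i] show "norm (norm (f x - s i x)) \<le> 2 * w x"
        using norm_triangle_ineq4[of "f x" "s i x"] by simp
    qed
  qed (use f si dom in auto)
  then have *: "(\<lambda>i. LINT x|M. norm (f x - s i x)) \<longlonglongrightarrow> 0" by simp
  show "\<exists>g. avg_conv g \<and> (LINT x|M. norm (f x - g x)) < e" if "e > 0" for e
  proof -
    have "\<forall>\<^sub>F i in sequentially. (LINT x|M. norm (f x - s i x)) < e"
      using order_tendstoD(2)[OF * that] .
    from eventually_happens[OF this] s show ?thesis by auto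
  qed
qed

lemma AE_cell_pos: "AE x in M. measure M (cell n (label n x)) > 0"
proof -
  have "AE x in M. \<forall>l\<in>label n ` space M. measure M (cell n l) = 0 \<longrightarrow> x \<notin> cell n l"
    using finite_labels
  proof (rule AE_finite_allI)
    fix l
    show "AE x in M. measure M (cell n l) = 0 \<longrightarrow> x \<notin> cell n l"
    proof (rule AE_impI)
      assume "measure M (cell n l) = 0"
      then show "AE x in M. x \<notin> cell n l"
        by (intro AE_not_in null_setsI) (simp_all add: emeasure_eq_measure)
    qed
  qed
  then show ?thesis
    using AE_space by eventually_elim (auto simp: cell_def zero_less_measure_iff)
qed

lemma avg_conv_0: "avg_conv (\<lambda>_. 0 :: real)"
  by (simp add: avg_conv_def avg_def set_lebesgue_integral_def)

lemma avg_conv_indicator_UN: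
  assumes "disjoint_family A" "\<And>j. avg_conv (indicator (A j) :: 'x \<Rightarrow> real)"
  shows "avg_conv (indicator (\<Union>j<(i::nat). A j) :: 'x \<Rightarrow> real)"
proof (induction i)
  case 0
  show ?case using avg_conv_0 by simp
next
  case (Suc i)
  have "A j \<inter> A i = {}" if "j < i" for j
    using disjoint_family_onD[OF assms(1), of j i] that by simp
  then have "(\<Union>j<i. A j) \<inter> A i = {}" by blast
  then have "indicator (\<Union>j<Suc i. A j) = (\<lambda>x. indicator (\<Union>j<i. A j) x + (indicator (A i) x :: real))"
    by (fastforce simp: lessThan_Suc split: split_indicator)
  then show ?case
    by (simp only: avg_conv_add[OF Suc assms(2)[of i]])
qed

text \<open>For a generating set of level \<open>n0\<close> the averages equal the indicator almost
  everywhere as soon as n \<ge> n0, because every later cell lies inside the set or outside it. The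
  finer of two labels resolves an intersection, so the generator is intersection stable and Dynkin's
  argument extends the convergence to all measurable sets.\<close>

lemma avg_conv_indicator:
  assumes "A \<in> sets M"
  shows "avg_conv (indicator A :: 'x \<Rightarrow> real)"
proof -
  let ?G = "{label n -` S \<inter> space M |n S. True}"
  have "Int_stable ?G"
  proof (rule Int_stableI)
    fix a b assume "a \<in> ?G" "b \<in> ?G"
    then obtain n S m S' where a: "a = label n -` S \<inter> space M" "b = label m -` S' \<inter> space M" by auto
    define k where "k = max n m"
    have r: "label k x = label k y \<Longrightarrow> label n x = label n y \<and> label m x = label m y" for x y
      unfolding k_def using label_refine by (meson max.cobounded1 max.cobounded2)
    have "a \<inter> b = label k -` (label k ` (a \<inter> b)) \<inter> space M"
    proof (intro equalityI subsetI IntI vimageI2)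
      fix x assume "x \<in> label k -` (label k ` (a \<inter> b)) \<inter> space M"
      then obtain y where "label k x = label k y" "y \<in> a \<inter> b" "x \<in> space M" by auto
      then show "x \<in> a" "x \<in> b" using r[of x y] a by auto
    qed (use a in auto)
    then show "a \<inter> b \<in> ?G" by blast
  qed
  moreover have "?G \<subseteq> Pow (space M)" by auto
  moreover have "A \<in> sigma_sets (space M) ?G" using assms unfolding sets_label .
  ultimately show ?thesis
  proof (induction rule: sigma_sets_induct_disjoint)
    case (basic A)
    then obtain n0 S where A: "A = label n0 -` S \<inter> space M" by auto
    then have As: "A \<in> sets M" by simp
    have "(LINT x|M. norm (avg n (indicator A) x - indicator A x :: real)) = 0" if n: "n \<ge> n0" for n
    proof -
      have "AE x in M. norm (avg n (indicator A) x - indicator A x :: real) = 0"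
        using AE_cell_pos[of n] AE_space
      proof eventually_elim
        case (elim x)
        have eq: "indicator (cell n (label n x)) y * indicator A y =
            indicator (cell n (label n x)) y * (indicator A x :: real)" for y
          using label_refine[OF n, of y x] elim by (auto simp: A cell_def split: split_indicator)
        then have "(LINT y:cell n (label n x)|M. indicator A y) = measure M (cell n (label n x)) * (indicator A x :: real)"
          unfolding set_lebesgue_integral_def real_scaleR_def eq by simp
        then show ?case using elim by (simp add: avg_def)
      qed
      then show ?thesis by (rule integral_eq_zero_AE)
    qed
    then show ?case
      unfolding avg_conv_def using As
      by (intro conjI tendsto_eventually eventually_sequentiallyI[of n0]) (simp_all add: emeasure_eq_measure)
  next
    case empty
    show ?case using avg_conv_0 by simp
  next
    case (compl A)
    have one: "avg_conv (\<lambda>_. 1 :: real)"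
    proof -
      have "(LINT x|M. norm (avg n (\<lambda>_. 1) x - 1 :: real)) = 0" for n
      proof -
        have "AE x in M. norm (avg n (\<lambda>_. 1) x - 1 :: real) = 0"
          using AE_cell_pos[of n] by eventually_elim (simp add: avg_def set_lebesgue_integral_def)
        then show ?thesis by (rule integral_eq_zero_AE)
      qed
      then show ?thesis by (simp add: avg_conv_def)
    qed
    have "avg_conv (\<lambda>x. 1 + indicator A x *\<^sub>R (-1 :: real))"
      by (intro avg_conv_add one avg_conv_linear compl)
    moreover have cong: "avg_conv f \<longleftrightarrow> avg_conv g" if "\<And>x. x \<in> space M \<Longrightarrow> f x = g x" for f g :: "'x \<Rightarrow> real"
    proof -
      have "avg n f x = avg n g x" for n x
        unfolding avg_def set_lebesgue_integral_def
        by (intro arg_cong[where f="\<lambda>u. _ *\<^sub>R u"] Bochner_Integration.integral_cong) (auto simp: that)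
      then show ?thesis
        unfolding avg_conv_def using that
        by (simp cong: Bochner_Integration.integrable_cong Bochner_Integration.integral_cong)
    qed
    note cong[of "\<lambda>x. 1 + indicator A x *\<^sub>R (-1 :: real)" "indicator (space M - A)"]
    moreover have "1 + indicator A x *\<^sub>R (-1) = (indicator (space M - A) x :: real)" if "x \<in> space M" for x
      using that by (simp split: split_indicator)
    ultimately show ?case by blast
  next
    case (union A)
    have As: "A i \<in> sets M" for i
      using union(2) unfolding sets_label by blast
    show ?case
    proof (rule avg_conv_limit_dominated[of "\<lambda>i. indicator (\<Union>j<i. A j)" _ "\<lambda>_. 1"])
      show "avg_conv (indicator (\<Union>j<i. A j) :: 'x \<Rightarrow> real)" for i
        by (rule avg_conv_indicator_UN[OF union(1,3)])
      show "(\<lambda>i. indicator (\<Union>j<i. A j) x) \<longlonglongrightarrow> (indicator (\<Union>i. A i) x :: real)" for x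
        by (rule LIMSEQ_indicator_UN)
    qed (auto split: split_indicator)
  qed
qed

theorem avg_tendsto_L1:
  assumes "integrable M f"
  shows "(\<lambda>n. LINT x|M. norm (avg n f x - f x)) \<longlonglongrightarrow> 0"
proof -
  have "avg_conv f"
    using assms
  proof (induction rule: integrable_induct)
    case (base A c)
    then show ?case by (intro avg_conv_linear avg_conv_indicator)
  next
    case (add f g)
    then show ?case by (intro avg_conv_add)
  next
    case (lim f s)
    show ?case
      by (rule avg_conv_limit_dominated[of s _ "\<lambda>x. 2 * norm (f x)"]) (use lim in auto)
  qed
  then show ?thesis by (simp add: avg_conv_def)
qed

end

section \<open>A jointly measurable version of the canonical process\<close>

lemma ex_borel_generator:
  "\<exists>B :: nat \<Rightarrow> 'a::second_countable_topology set. (\<forall>n. open (B n)) \<and> (borel :: 'a measure) = sigma UNIV (range B)"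
proof -
  obtain B :: "'a set set" where B: "countable B" "topological_basis B"
    using ex_countable_basis by auto
  have ne: "B \<noteq> {}"
    using B(2) topological_basisE[of B UNIV undefined] by auto
  have "range (from_nat_into B) = B"
    by (rule range_from_nat_into[OF ne B(1)])
  moreover have "open b" if "b \<in> B" for b
    using topological_basis_open[OF B(2) that] .
  ultimately show ?thesis
    using borel_eq_countable_basis[OF B] from_nat_into[OF ne] by metis
qed

definition borel_generator :: "nat \<Rightarrow> 'a::second_countable_topology set" where
  "borel_generator = (SOME B. (\<forall>n. open (B n)) \<and> (borel :: 'a measure) = sigma UNIV (range B))"

lemma borel_generator:
  "open (borel_generator n)" "(borel :: 'a::second_countable_topology measure) = sigma UNIV (range borel_generator)"
  using someI_ex[OF ex_borel_generator] unfolding borel_generator_def by auto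

text \<open>The level sets of \<open>bits n\<close> are finite partitions which together generate the Borel sets.\<close>

definition bits :: "nat \<Rightarrow> 'a::second_countable_topology \<Rightarrow> bool list" where
  "bits n x = map (\<lambda>j. x \<in> borel_generator j) [0..<n]"

lemma bits_measurable: "bits n \<in> measurable borel (count_space UNIV)"
proof (induction n)
  case (Suc n)
  have [measurable]: "borel_generator n \<in> sets borel"
    using borel_generator(1) by (rule borel_open)
  note Suc[measurable]
  have "(\<lambda>x. l @ [x \<in> borel_generator n]) \<in> measurable borel (count_space UNIV)" for l :: "bool list"
    by measurable
  from measurable_compose_countable[OF this Suc] show ?case by (simp add: bits_def)
qed (simp add: bits_def)

text \<open>Truncating the bit list shows the refinement, and the last bit of
  \<open>bits (Suc j)\<close> recovers the generator with index \<open>j\<close>.\<close>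

lemma refining_partition_bits:
  fixes K :: "'a::euclidean_space set"
  assumes K: "K \<in> sets borel" "emeasure lborel K < \<infinity>"
  shows "refining_partition (restrict_space lborel K) bits"
proof (intro refining_partition.intro refining_partition_axioms.intro finite_measureI)
  show "emeasure (restrict_space lborel K) (space (restrict_space lborel K)) \<noteq> \<infinity>"
    using K by (simp add: emeasure_restrict_space space_restrict_space)
  show m: "bits n \<in> restrict_space lborel K \<rightarrow>\<^sub>M count_space UNIV" for n
    by (rule measurable_restrict_space1) (simp add: bits_measurable)
  show "finite (bits n ` space (restrict_space lborel K))" for n
    by (rule finite_subset[OF _ finite_lists_length_eq[OF finite, of UNIV n]]) (auto simp: bits_def)
  show "bits n x = bits n y" if "n \<le> m" "bits m x = bits m y" for n m and x y :: 'a
  proof -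
    have "bits n z = take n (bits m z)" for z :: 'a
      using that(1) by (simp add: bits_def take_map min_absorb1)
    then show ?thesis using that(2) by simp
  qed
  let ?G = "{bits n -` S \<inter> space (restrict_space lborel K) |n S. True}"
  show "sets (restrict_space lborel K) = sigma_sets (space (restrict_space lborel K)) ?G"
  proof
    show "sigma_sets (space (restrict_space lborel K)) ?G \<subseteq> sets (restrict_space lborel K)"
      using measurable_sets[OF m] by (intro sets.sigma_sets_subset) auto
    have "sets (restrict_space lborel K) = ((\<inter>) K) ` sigma_sets UNIV (range borel_generator)"
      by (subst sets_restrict_space) (simp add: borel_generator(2))
    also have "\<dots> = sigma_sets K ((\<inter>) K ` range borel_generator)"
    proof (rule sigma_sets_Int)
      have "sets (borel :: 'a measure) = sigma_sets UNIV (range borel_generator)"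
        by (subst borel_generator(2)) simp
      then show "K \<in> sigma_sets UNIV (range borel_generator)" using K by simp
    qed simp
    also have "\<dots> \<subseteq> sigma_sets (space (restrict_space lborel K)) ?G"
    proof -
      have sp: "space (restrict_space lborel K) = K" by (simp add: space_restrict_space)
      have "K \<inter> borel_generator j = bits (Suc j) -` {l. l ! j} \<inter> K" for j
        by (auto simp: bits_def nth_append)
      then have "(\<inter>) K ` range borel_generator \<subseteq> ?G" unfolding sp by blast
      then show ?thesis unfolding sp by (rule sigma_sets_mono')
    qed
    finally show "sets (restrict_space lborel K) \<subseteq> sigma_sets (space (restrict_space lborel K)) ?G" .
  qed
qed

text \<open>Time is rounded down to the grid of step 1/(n+1), where only countably many functions of
  \<open>h\<close> occur; continuity in time gives the convergence as the grid is refined.\<close>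

lemma borel_measurable_caratheodory:
  fixes f :: "'h \<Rightarrow> real \<Rightarrow> 'b::{second_countable_topology, metric_space}"
  assumes meas: "\<And>t. (\<lambda>h. f h t) \<in> borel_measurable P"
    and cont: "\<And>h. h \<in> space P \<Longrightarrow> continuous_on UNIV (f h)"
  shows "(\<lambda>(h, t). f h t) \<in> borel_measurable (P \<Otimes>\<^sub>M borel)"
proof (rule borel_measurable_LIMSEQ_metric[where f = "\<lambda>n w. f (fst w) (real_of_int \<lfloor>snd w * real (Suc n)\<rfloor> / real (Suc n))"])
  fix n
  show "(\<lambda>w. f (fst w) (real_of_int \<lfloor>snd w * real (Suc n)\<rfloor> / real (Suc n))) \<in> borel_measurable (P \<Otimes>\<^sub>M borel)"
  proof (rule measurable_compose_countable[where f = "\<lambda>i w. f (fst w) (real_of_int i / real (Suc n))"])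
    show "(\<lambda>w. f (fst w) (real_of_int i / real (Suc n))) \<in> borel_measurable (P \<Otimes>\<^sub>M borel)" for i
      by (rule measurable_compose[OF measurable_fst meas])
  qed measurable
next
  fix w :: "'h \<times> real" assume w: "w \<in> space (P \<Otimes>\<^sub>M borel)"
  define t where "t = snd w"
  have "(\<lambda>n. real_of_int \<lfloor>t * real (Suc n)\<rfloor> / real (Suc n)) \<longlonglongrightarrow> t"
  proof (rule tendsto_sandwich)
    show "(\<lambda>n. t - 1 / real (Suc n)) \<longlonglongrightarrow> t"
      using tendsto_diff[OF tendsto_const[of t] LIMSEQ_Suc[OF lim_1_over_n]] by simp
    show "\<forall>\<^sub>F n in sequentially. t - 1 / real (Suc n) \<le> real_of_int \<lfloor>t * real (Suc n)\<rfloor> / real (Suc n)"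
    proof (intro always_eventually allI)
      fix n
      have "t * real (Suc n) - 1 \<le> real_of_int \<lfloor>t * real (Suc n)\<rfloor>" by linarith
      then have "(t * real (Suc n) - 1) / real (Suc n) \<le> real_of_int \<lfloor>t * real (Suc n)\<rfloor> / real (Suc n)"
        by (rule divide_right_mono) simp
      then show "t - 1 / real (Suc n) \<le> real_of_int \<lfloor>t * real (Suc n)\<rfloor> / real (Suc n)"
        by (simp add: diff_divide_distrib del: of_nat_Suc)
    qed
    show "\<forall>\<^sub>F n in sequentially. real_of_int \<lfloor>t * real (Suc n)\<rfloor> / real (Suc n) \<le> t"
      by (intro always_eventually allI) (simp add: field_simps del: of_nat_Suc)
  qed simp
  moreover have "isCont (f (fst w)) t"
    using cont[of "fst w"] w by (auto simp: space_pair_measure continuous_on_eq_continuous_at)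
  ultimately have "(\<lambda>n. f (fst w) (real_of_int \<lfloor>t * real (Suc n)\<rfloor> / real (Suc n))) \<longlonglongrightarrow> f (fst w) t"
    by (rule isCont_tendsto_compose[rotated])
  then show "(\<lambda>n. f (fst w) (real_of_int \<lfloor>snd w * real (Suc n)\<rfloor> / real (Suc n))) \<longlonglongrightarrow> (case w of (h, t) \<Rightarrow> f h t)"
    by (simp add: t_def case_prod_beta)
qed

text \<open>The topology controls suprema over time, so the pairing at one fixed time is continuous:
  every point of the preimage of an open set has a generating neighbourhood inside it.\<close>

lemma pairing_measurable:
  assumes d: "dual_pair \<gamma> Q \<phi> \<Phi>" and t: "t \<in> {0..T}"
  shows "(\<lambda>h. pairing Q h \<phi> \<Phi> t) \<in> borel_measurable (traj_borel T \<gamma> Q)"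
proof -
  have sp: "space (traj_borel T \<gamma> Q) = trajectories T \<gamma> Q"
    unfolding traj_borel_def by (simp add: space_measure_of_conv topspace_traj_topology)
  have "(\<lambda>h. pairing Q h \<phi> \<Phi> t) -` S \<inter> trajectories T \<gamma> Q \<in> sets (traj_borel T \<gamma> Q)" if "open S" for S
  proof -
    let ?P = "(\<lambda>h. pairing Q h \<phi> \<Phi> t) -` S \<inter> trajectories T \<gamma> Q"
    have "openin (traj_topology T \<gamma> Q) ?P"
    proof (subst openin_subopen, intro ballI)
      fix g assume g: "g \<in> ?P"
      obtain e where e: "e > 0" "\<And>y. \<bar>y - pairing Q g \<phi> \<Phi> t\<bar> < e \<Longrightarrow> y \<in> S"
        using \<open>open S\<close> g by (auto simp: open_dist dist_real_def)
      let ?U = "{h\<in>trajectories T \<gamma> Q. \<forall>t\<in>{0..T}. \<bar>pairing Q h \<phi> \<Phi> t - pairing Q g \<phi> \<Phi> t\<bar> < e}"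
      have "openin (traj_topology T \<gamma> Q) ?U"
        unfolding traj_topology_def
        by (rule topology_generated_by_Basis) (use g d e(1) in blast)
      moreover have "g \<in> ?U" using g e(1) by auto
      moreover have "?U \<subseteq> ?P" using e(2) t by auto
      ultimately show "\<exists>U. openin (traj_topology T \<gamma> Q) U \<and> g \<in> U \<and> U \<subseteq> ?P" by blast
    qed
    then show ?thesis
      unfolding traj_borel_def using openin_subset
      by (subst sets_measure_of) (auto intro: sigma_sets.Basic)
  qed
  then show ?thesis
    by (intro borel_measurableI) (simp add: sp)
qed

lemma space_traj_borel: "space (traj_borel T \<gamma> Q) = trajectories T \<gamma> Q"
  unfolding traj_borel_def by (simp add: space_measure_of_conv topspace_traj_topology)

definition traj_val :: "'n::finite trajectory \<Rightarrow> real \<Rightarrow> real^'n \<Rightarrow> real \<times> (real^'n)" where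
  "traj_val h t x = (fst h t x, snd h t x)"

text \<open>On a set of finite measure it suffices that s \<le> 1 + s^p for s \<ge> 0.\<close>

lemma set_integrable_Lp_loc:
  fixes f :: "real^'n \<Rightarrow> 'b::{banach,second_countable_topology}"
  assumes f: "Lp_loc p Q f" and p: "p > 1" and K: "compact K" "K \<subseteq> Q"
  shows "set_integrable lborel K f"
proof -
  have K': "K \<in> sets borel" "emeasure lborel K < \<infinity>"
    using K(1) emeasure_bounded_finite[OF compact_imp_bounded[OF K(1)]] by (auto simp: compact_imp_closed)
  have "set_borel_measurable lborel K f"
    using f K K' unfolding Lp_loc_def by (auto intro: set_borel_measurable_subset)
  then have m: "(\<lambda>x. indicator K x *\<^sub>R f x) \<in> borel_measurable lborel"
    by (simp add: set_borel_measurable_def)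
  have "(\<integral>\<^sup>+x. ennreal (norm (indicator K x *\<^sub>R f x)) \<partial>lborel) \<le>
     (\<integral>\<^sup>+x. indicator K x + ennreal (norm (indicator K x *\<^sub>R f x) powr p) \<partial>lborel)"
  proof (rule nn_integral_mono)
    fix x
    have "norm (f x) \<le> 1 + norm (f x) powr p"
    proof (cases "norm (f x) \<le> 1")
      case False
      then show ?thesis using p powr_mono[of 1 p "norm (f x)"] by simp
    qed (simp add: add_increasing2)
    then have "ennreal (norm (f x)) \<le> 1 + ennreal (norm (f x) powr p)"
      by (metis ennreal_1 ennreal_leI ennreal_plus powr_ge_zero zero_le_one)
    then show "ennreal (norm (indicator K x *\<^sub>R f x)) \<le> indicator K x + ennreal (norm (indicator K x *\<^sub>R f x) powr p)"
      by (simp split: split_indicator)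
  qed
  also have "\<dots> = emeasure lborel K + (\<integral>\<^sup>+x. ennreal (norm (indicator K x *\<^sub>R f x) powr p) \<partial>lborel)"
  proof (subst nn_integral_add)
    show "(\<lambda>x. ennreal (norm (indicator K x *\<^sub>R f x) powr p)) \<in> borel_measurable lborel"
      by (intro measurable_compose[OF m, of "\<lambda>v. ennreal (norm v powr p)"]) measurable
  qed (use K' in auto)
  also have "(\<integral>\<^sup>+x. ennreal (norm (indicator K x *\<^sub>R f x) powr p) \<partial>lborel) = (\<integral>\<^sup>+x\<in>K. ennreal (norm (f x) powr p) \<partial>lborel)"
    using p by (intro nn_integral_cong) (auto split: split_indicator)
  also have "emeasure lborel K + \<dots> < \<infinity>"
    using f K K' unfolding Lp_loc_def by (auto simp: ennreal_add_less_top)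
  finally show ?thesis
    unfolding set_integrable_def using m by (intro integrableI_bounded) auto
qed

lemma integrable_Pair:
  fixes f :: "'x \<Rightarrow> 'a::{banach,second_countable_topology}" and g :: "'x \<Rightarrow> 'b::{banach,second_countable_topology}"
  assumes "integrable M f" "integrable M g"
  shows "integrable M (\<lambda>x. (f x, g x))"
  using Bochner_Integration.integrable_add[OF
      integrable_bounded_linear[OF bounded_linear_Pair[OF bounded_linear_ident bounded_linear_zero] assms(1)]
      integrable_bounded_linear[OF bounded_linear_Pair[OF bounded_linear_zero bounded_linear_ident] assms(2)]]
  by simp

lemma traj_val_integrable:
  assumes h: "h \<in> trajectories T \<gamma> Q" and \<gamma>: "\<gamma> > 1" and t: "t \<in> {0..T}"
    and K: "compact K" "K \<subseteq> Q"
  shows "set_integrable lborel K (traj_val h t)"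
proof -
  have q: "2 * \<gamma> / (\<gamma> + 1) > 1" using \<gamma> by (simp add: field_simps)
  have "Lp_loc \<gamma> Q (fst h t)" "Lp_loc (2 * \<gamma> / (\<gamma> + 1)) Q (snd h t)"
    using h t unfolding trajectories_def by blast+
  from set_integrable_Lp_loc[OF this(1) \<gamma> K] set_integrable_Lp_loc[OF this(2) q K]
  have "set_integrable lborel K (fst h t)" "set_integrable lborel K (snd h t)" .
  then have "integrable lborel (\<lambda>x. (indicator K x *\<^sub>R fst h t x, indicator K x *\<^sub>R snd h t x))"
    unfolding set_integrable_def by (rule integrable_Pair)
  then show ?thesis
    unfolding set_integrable_def by (simp add: traj_val_def[abs_def])
qed

lemma Lp_comp_indicator:
  fixes c :: "'b::{real_normed_vector,second_countable_topology}"
  assumes "p > 0" "A \<in> sets borel" "A \<subseteq> K" "compact K" "K \<subseteq> Q"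
  shows "Lp_comp p Q (\<lambda>x. indicator A x *\<^sub>R c)"
proof -
  have "(\<integral>\<^sup>+x. ennreal (norm (indicator A x *\<^sub>R c) powr p) \<partial>lborel) = (\<integral>\<^sup>+x. ennreal (norm c powr p) * indicator A x \<partial>lborel)"
    using assms(1) by (intro nn_integral_cong) (auto split: split_indicator)
  also have "\<dots> = ennreal (norm c powr p) * emeasure lborel A"
    using assms by (simp add: nn_integral_cmult)
  also have "\<dots> \<le> ennreal (norm c powr p) * emeasure lborel K"
    using assms by (intro mult_left_mono emeasure_mono) (auto simp: compact_imp_closed)
  also have "\<dots> < \<infinity>"
    using emeasure_bounded_finite[OF compact_imp_bounded[OF assms(4)]] by (simp add: ennreal_mult_less_top)
  finally show ?thesis
    using assms unfolding Lp_comp_def by (auto intro!: exI[of _ K] simp: indicator_def subset_eq)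
qed

text \<open>Bounded functions with compact support lie in both dual spaces; this is what makes cell
  integrals accessible to the topology of trajectories.\<close>

lemma dual_pair_indicator:
  assumes "\<gamma> > 1" "A \<in> sets borel" "A \<subseteq> K" "compact K" "K \<subseteq> Q"
  shows "dual_pair \<gamma> Q (\<lambda>x. indicator A x *\<^sub>R c) (\<lambda>x. indicator A x *\<^sub>R v)"
proof -
  have q: "2 * \<gamma> / (\<gamma> + 1) > 1" using assms(1) by (simp add: field_simps)
  have "conj_exponent p > 0" if "p > 1" for p
    using that by (simp add: conj_exponent_def)
  then show ?thesis
    unfolding dual_pair_def using q assms by (intro conjI Lp_comp_indicator[where K = K]) auto
qed

text \<open>Every component of a vector-valued cell integral is a single pairing, from which it
  inherits continuity in time and measurability in \<open>h\<close>.\<close>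

lemma inner_integral_traj_val:
  assumes h: "h \<in> trajectories T \<gamma> Q" and \<gamma>: "\<gamma> > 1" and t: "t \<in> {0..T}"
    and A: "A \<in> sets borel" "A \<subseteq> K" "compact K" "K \<subseteq> Q"
  shows "(LINT x:A|lborel. traj_val h t x) \<bullet> (c, v) =
    pairing Q h (\<lambda>x. indicator A x *\<^sub>R c) (\<lambda>x. indicator A x *\<^sub>R v) t"
proof -
  have "set_integrable lborel A (traj_val h t)"
    by (rule set_integrable_subset[OF traj_val_integrable[OF h \<gamma> t A(3,4)]]) (use A in auto)
  then have i: "integrable lborel (\<lambda>x. indicator A x *\<^sub>R traj_val h t x)"
    by (simp add: set_integrable_def)
  have i1: "integrable lborel (\<lambda>x. indicator A x * fst h t x * c)"
    and i2: "integrable lborel (\<lambda>x. indicator A x *\<^sub>R snd h t x \<bullet> v)"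
    using integrable_fst[OF i] integrable_inner_left[of v, OF integrable_snd[OF i]] by (auto simp: traj_val_def)
  have sub: "indicator Q x * indicator A x = (indicator A x :: real)" for x
    using A by (auto split: split_indicator)
  have "(LINT x:A|lborel. traj_val h t x) \<bullet> (c, v) = (LINT x|lborel. indicator A x * fst h t x * c + indicator A x *\<^sub>R snd h t x \<bullet> v)"
    unfolding set_lebesgue_integral_def
    by (subst integral_inner_left[symmetric]) (use i in \<open>auto simp: traj_val_def inner_Pair algebra_simps\<close>)
  also have "\<dots> = (LINT x|lborel. indicator A x * fst h t x * c) + (LINT x|lborel. indicator A x *\<^sub>R snd h t x \<bullet> v)"
    by (rule Bochner_Integration.integral_add[OF i1 i2])
  also have "\<dots> = pairing Q h (\<lambda>x. indicator A x *\<^sub>R c) (\<lambda>x. indicator A x *\<^sub>R v) t"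
    unfolding pairing_def set_lebesgue_integral_def
    by (intro arg_cong2[where f = "(+)"] Bochner_Integration.integral_cong refl)
      (use A in \<open>auto split: split_indicator\<close>)
  finally show ?thesis .
qed

lemma integral_traj_val_continuous:
  fixes Q :: "(real^'n) set"
  assumes h: "h \<in> trajectories T \<gamma> Q" and \<gamma>: "\<gamma> > 1"
    and A: "A \<in> sets borel" "A \<subseteq> K" "compact K" "K \<subseteq> Q"
  shows "continuous_on {0..T} (\<lambda>t. LINT x:A|lborel. traj_val h t x)"
proof (subst continuous_on_componentwise, intro ballI)
  fix i :: "real \<times> (real^'n)"
  obtain c v where i: "i = (c, v)" by (cases i)
  have "continuous_on {0..T} (pairing Q h (\<lambda>x. indicator A x *\<^sub>R c) (\<lambda>x. indicator A x *\<^sub>R v))"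
    using h dual_pair_indicator[OF \<gamma> A] unfolding trajectories_def by auto
  then show "continuous_on {0..T} (\<lambda>t. (LINT x:A|lborel. traj_val h t x) \<bullet> i)"
    unfolding i by (subst continuous_on_cong[OF refl inner_integral_traj_val[OF h \<gamma> _ A]])
qed

lemma integral_traj_val_measurable:
  fixes Q :: "(real^'n) set"
  assumes \<gamma>: "\<gamma> > 1" and t: "t \<in> {0..T}"
    and A: "A \<in> sets borel" "A \<subseteq> K" "compact K" "K \<subseteq> Q"
  shows "(\<lambda>h. LINT x:A|lborel. traj_val h t x) \<in> borel_measurable (traj_borel T \<gamma> Q)"
proof (subst borel_measurable_euclidean_space, intro ballI)
  fix i :: "real \<times> (real^'n)"
  obtain c v where i: "i = (c, v)" by (cases i)
  show "(\<lambda>h. (LINT x:A|lborel. traj_val h t x) \<bullet> i) \<in> borel_measurable (traj_borel T \<gamma> Q)"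
    unfolding i
    by (subst measurable_cong[OF inner_integral_traj_val[OF _ \<gamma> t A]], simp add: space_traj_borel)
      (intro pairing_measurable[OF _ t] dual_pair_indicator[OF \<gamma> A])
qed

text \<open>Time is clamped to [0, T] because pairings are known to be continuous only there, while
  \<open>borel_measurable_caratheodory\<close> asks for continuity on the whole line.\<close>

definition traj_avg :: "real \<Rightarrow> (real^'n) set \<Rightarrow> nat \<Rightarrow> 'n trajectory \<times> (real \<times> (real^'n)) \<Rightarrow> real \<times> (real^'n)" where
  "traj_avg T K n w = (\<Sum>l\<in>bits n ` K. indicator (K \<inter> bits n -` {l}) (snd (snd w)) *\<^sub>R
     ((1 / measure lborel (K \<inter> bits n -` {l})) *\<^sub>R
      (LINT x:K \<inter> bits n -` {l}|lborel. traj_val (fst w) (max 0 (min T (fst (snd w)))) x)))"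

lemma bits_cell_sets: "K \<in> sets borel \<Longrightarrow> K \<inter> bits n -` {l} \<in> sets borel"
  using measurable_sets[OF bits_measurable, of "{l}" n] by auto

lemma traj_avg_measurable:
  fixes Q :: "(real^'n) set"
  assumes sets: "sets P = sets (traj_borel T \<gamma> Q)" and T: "T > 0" and \<gamma>: "\<gamma> > 1" and K: "compact K" "K \<subseteq> Q"
  shows "traj_avg T K n \<in> borel_measurable (P \<Otimes>\<^sub>M lborel)"
proof -
  have K': "K \<in> sets borel" using K by (simp add: compact_imp_closed)
  have "(\<lambda>w. LINT x:K \<inter> bits n -` {l}|lborel. traj_val (fst w) (max 0 (min T (fst (snd w)))) x)
      \<in> borel_measurable (P \<Otimes>\<^sub>M (lborel :: (real \<times> (real^'n)) measure))" for l
  proof -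
    note A = bits_cell_sets[OF K', of n l] Int_lower1[of K "bits n -` {l}"] K
    have "(\<lambda>(h, t). LINT x:K \<inter> bits n -` {l}|lborel. traj_val h (max 0 (min T t)) x)
      \<in> borel_measurable (P \<Otimes>\<^sub>M borel)"
    proof (rule borel_measurable_caratheodory)
      fix t
      have "max 0 (min T t) \<in> {0..T}" using T by auto
      from integral_traj_val_measurable[OF \<gamma> this A]
      show "(\<lambda>h. LINT x:K \<inter> bits n -` {l}|lborel. traj_val h (max 0 (min T t)) x) \<in> borel_measurable P"
        using sets by (simp cong: measurable_cong_sets)
    next
      fix h assume "h \<in> space P"
      then have "h \<in> trajectories T \<gamma> Q"
        using sets_eq_imp_space_eq[OF sets] by (simp add: space_traj_borel)
      from integral_traj_val_continuous[OF this \<gamma> A]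
      show "continuous_on UNIV (\<lambda>t. LINT x:K \<inter> bits n -` {l}|lborel. traj_val h (max 0 (min T t)) x)"
        by (rule continuous_on_compose2) (use T in \<open>auto intro!: continuous_intros\<close>)
    qed
    note m = this
    have "(\<lambda>w. fst (snd w)) \<in> P \<Otimes>\<^sub>M (lborel :: (real \<times> (real^'n)) measure) \<rightarrow>\<^sub>M borel"
      by (rule measurable_compose[OF measurable_snd])
        (use borel_measurable_continuous_onI[OF continuous_on_fst[OF continuous_on_id]] in simp)
    from measurable_compose[OF measurable_Pair[OF measurable_fst this] m] show ?thesis
      by simp
  qed
  moreover have "(\<lambda>w. indicator (K \<inter> bits n -` {l}) (snd (snd w))) \<in> borel_measurable (P \<Otimes>\<^sub>M (lborel :: (real \<times> (real^'n)) measure))" for l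
  proof -
    have "(\<lambda>w. snd (snd w)) \<in> P \<Otimes>\<^sub>M (lborel :: (real \<times> (real^'n)) measure) \<rightarrow>\<^sub>M borel"
      by (rule measurable_compose[OF measurable_snd])
        (use borel_measurable_continuous_onI[OF continuous_on_snd[OF continuous_on_id]] in simp)
    from measurable_compose[OF this borel_measurable_indicator[OF bits_cell_sets[OF K', of n l]]] show ?thesis .
  qed
  ultimately show ?thesis
    unfolding traj_avg_def[abs_def] by (intro borel_measurable_sum borel_measurable_scaleR borel_measurable_const)
qed

text \<open>Connects the explicit sum, whose joint measurability is visible, with the abstract
  average, whose convergence is known.\<close>

lemma traj_avg_eq_avg:
  assumes K: "K \<in> sets borel" "emeasure lborel K < \<infinity>" and t: "t \<in> {0..T}" and x: "x \<in> K"
  shows "traj_avg T K n (h, (t, x)) = refining_partition.avg (restrict_space lborel K) bits n (traj_val h t) x"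
proof -
  interpret R: refining_partition "restrict_space lborel K" bits
    by (rule refining_partition_bits[OF K])
  have sp: "space (restrict_space lborel K) = K" by (simp add: space_restrict_space)
  have cell: "R.cell n l = K \<inter> bits n -` {l}" for l
    unfolding R.cell_def sp by auto
  have m: "measure (restrict_space lborel K) (K \<inter> bits n -` {l}) = measure lborel (K \<inter> bits n -` {l})" for l
    using K by (intro measure_restrict_space) auto
  have i: "set_lebesgue_integral (restrict_space lborel K) (K \<inter> bits n -` {l}) f = set_lebesgue_integral lborel (K \<inter> bits n -` {l}) f"
    for l and f :: "_ \<Rightarrow> real \<times> (real^'a)"
    unfolding set_lebesgue_integral_def using K
    by (subst integral_restrict_space)
      (auto simp: set_lebesgue_integral_def intro!: Bochner_Integration.integral_cong split: split_indicator)
  have "max 0 (min T t) = t" using t by auto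
  then show ?thesis
    using R.avg_sum_cells[of x n "traj_val h t"] x unfolding sp cell m i traj_avg_def by simp
qed

lemma borel_Times: "A \<in> sets borel \<Longrightarrow> B \<in> sets borel \<Longrightarrow> A \<times> B \<in> sets (borel :: ('a::second_countable_topology \<times> 'b::second_countable_topology) measure)"
  using pair_measureI[of A borel B borel] unfolding borel_prod .

lemma traj_val_measurable:
  assumes h: "h \<in> trajectories T \<gamma> Q" and Q: "open Q" and K: "K \<in> sets borel" "K \<subseteq> Q"
  shows "(\<lambda>z. traj_val h (fst z) (snd z)) \<in> borel_measurable (restrict_space lborel ({0<..<T} \<times> K))"
proof -
  have S: "{0<..<T} \<times> K \<in> sets borel" using K by (intro borel_Times) auto
  have sub: "{0<..<T} \<times> K \<subseteq> {0..T} \<times> Q" using K by auto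
  have "set_borel_measurable lborel ({0<..<T} \<times> K) (\<lambda>z. fst h (fst z) (snd z))"
     "set_borel_measurable lborel ({0<..<T} \<times> K) (\<lambda>z. snd h (fst z) (snd z))"
    using h S sub unfolding trajectories_def by (auto intro: set_borel_measurable_subset)
  then have "(\<lambda>z. fst h (fst z) (snd z)) \<in> borel_measurable (restrict_space lborel ({0<..<T} \<times> K))"
    "(\<lambda>z. snd h (fst z) (snd z)) \<in> borel_measurable (restrict_space lborel ({0<..<T} \<times> K))"
    using S by (auto simp: set_borel_measurable_def borel_measurable_restrict_space_iff)
  then show ?thesis
    unfolding traj_val_def by (intro borel_measurable_Pair)
qed

text \<open>The cap at 1 makes the error integrable for every trajectory and gives an immediate
  majorant for dominated convergence, both in time and in \<open>h\<close>.\<close>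

definition avg_error :: "real \<Rightarrow> (real^'n) set \<Rightarrow> nat \<Rightarrow> 'n trajectory \<Rightarrow> real \<times> (real^'n) \<Rightarrow> real" where
  "avg_error T K n h z = min 1 (norm (traj_avg T K n (h, z) - traj_val h (fst z) (snd z)))"

lemma avg_error_bounds: "0 \<le> avg_error T K n h z" "avg_error T K n h z \<le> 1"
  by (auto simp: avg_error_def)

lemma emeasure_Times_finite:
  fixes T :: real and K :: "(real^'n) set"
  assumes "compact K"
  shows "emeasure lborel ({0<..<T} \<times> K) < \<infinity>"
proof -
  have "bounded ({0<..<T} \<times> K)"
    by (intro bounded_Times compact_imp_bounded[OF assms] bounded_subset[OF bounded_closed_interval[of 0 T]]) auto
  then show ?thesis by (rule emeasure_bounded_finite)
qed

lemma section_measurable: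
  fixes Q :: "(real^'n) set"
  assumes h: "h \<in> trajectories T \<gamma> Q" and T: "T > 0" and \<gamma>: "\<gamma> > 1" and K: "compact K" "K \<subseteq> Q"
  shows "(\<lambda>z. traj_avg T K n (h, z)) \<in> borel_measurable lborel"
proof -
  have "(\<lambda>z. (h, z)) \<in> lborel \<rightarrow>\<^sub>M (traj_borel T \<gamma> Q \<Otimes>\<^sub>M lborel)"
    using h by (intro measurable_Pair) (auto simp: space_traj_borel)
  from measurable_compose[OF this traj_avg_measurable[OF refl T \<gamma> K]] show ?thesis .
qed

lemma avg_error_measurable:
  fixes Q :: "(real^'n) set"
  assumes h: "h \<in> trajectories T \<gamma> Q" and Q: "open Q" and T: "T > 0" and \<gamma>: "\<gamma> > 1" and K: "compact K" "K \<subseteq> Q"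
  shows "avg_error T K n h \<in> borel_measurable (restrict_space lborel ({0<..<T} \<times> K))"
  unfolding avg_error_def[abs_def]
proof (intro borel_measurable_min borel_measurable_const measurable_compose[OF borel_measurable_diff borel_measurable_norm])
  show "(\<lambda>z. traj_avg T K n (h, z)) \<in> borel_measurable (restrict_space lborel ({0<..<T} \<times> K))"
    by (rule measurable_restrict_space1[OF section_measurable[OF h T \<gamma> K]])
  show "(\<lambda>z. traj_val h (fst z) (snd z)) \<in> borel_measurable (restrict_space lborel ({0<..<T} \<times> K))"
    by (rule traj_val_measurable[OF h Q _ K(2)]) (use K(1) in \<open>simp add: compact_imp_closed\<close>)
qed

text \<open>By Fubini the integral is taken over time slices; on each slice the averages converge in
  L^1(K) by \<open>avg_tendsto_L1\<close>, and the cap supplies the majorant in time.\<close>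

lemma avg_error_tendsto:
  fixes Q :: "(real^'n) set"
  assumes h: "h \<in> trajectories T \<gamma> Q" and Q: "open Q" and T: "T > 0" and \<gamma>: "\<gamma> > 1" and K: "compact K" "K \<subseteq> Q"
  shows "(\<lambda>n. LINT z|restrict_space lborel ({0<..<T} \<times> K). avg_error T K n h z) \<longlonglongrightarrow> 0"
proof -
  have K': "K \<in> sets borel" "emeasure lborel K < \<infinity>"
    using K(1) emeasure_bounded_finite[OF compact_imp_bounded[OF K(1)]] by (auto simp: compact_imp_closed)
  interpret R: refining_partition "restrict_space lborel K" bits
    by (rule refining_partition_bits[OF K'])
  let ?S = "{0<..<T} \<times> K"
  have S: "?S \<in> sets borel" by (intro borel_Times K') auto
  have m: "(\<lambda>z. indicator ?S z * avg_error T K n h z) \<in> borel_measurable lborel" for n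
    using avg_error_measurable[OF h Q T \<gamma> K, of n] S
    by (simp add: borel_measurable_restrict_space_iff)
  have i: "integrable lborel (\<lambda>z. indicator ?S z * avg_error T K n h z)" for n
    by (rule Bochner_Integration.integrable_bound[of _ "indicator ?S :: _ \<Rightarrow> real"])
      (use S m avg_error_bounds[of T K n h] emeasure_Times_finite[OF K(1), of T] in
        \<open>auto intro!: integrable_real_indicator AE_I2 split: split_indicator\<close>)
  define g where "g n t = (LINT x|lborel. indicator K x * avg_error T K n h (t, x))" for n t
  have eq: "(LINT z|restrict_space lborel ?S. avg_error T K n h z) = (LINT t|lborel. indicator {0<..<T} t * g n t)" for n
  proof -
    have "(LINT z|restrict_space lborel ?S. avg_error T K n h z) = (LINT z|lborel. indicator ?S z * avg_error T K n h z)"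
      using S by (simp add: integral_restrict_space set_lebesgue_integral_def)
    also have "\<dots> = (LINT t|lborel. LINT x|lborel. indicator ?S (t, x) * avg_error T K n h (t, x))"
      using lborel_pair.integral_fst'[of "\<lambda>z. indicator ?S z * avg_error T K n h z"] i[of n] by (simp add: lborel_prod)
    also have "\<dots> = (LINT t|lborel. indicator {0<..<T} t * g n t)"
      unfolding g_def
      by (intro Bochner_Integration.integral_cong refl) (auto simp: indicator_times split: split_indicator)
    finally show ?thesis .
  qed
  have g_meas: "(\<lambda>t. indicator {0<..<T} t * g n t) \<in> borel_measurable lborel" for n
  proof -
    have "(\<lambda>t. LINT x|lborel. indicator ?S (t, x) * avg_error T K n h (t, x)) \<in> borel_measurable lborel"
      using m[of n] lborel.borel_measurable_lebesgue_integral[of "\<lambda>t x. indicator ?S (t, x) * avg_error T K n h (t, x)" lborel]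
      by (simp add: lborel_prod)
    moreover have "(\<lambda>t. LINT x|lborel. indicator ?S (t, x) * avg_error T K n h (t, x)) = (\<lambda>t. indicator {0<..<T} t * g n t)"
      unfolding g_def by (rule ext) (auto simp: indicator_times split: split_indicator)
    ultimately show ?thesis by simp
  qed
  have g_le: "0 \<le> g n t \<and> g n t \<le> (LINT x|restrict_space lborel K. norm (R.avg n (traj_val h t) x - traj_val h t x))"
    if t: "t \<in> {0<..<T}" for n t
  proof -
    have t': "t \<in> {0..T}" using t by auto
    have int: "integrable (restrict_space lborel K) (traj_val h t)"
      using traj_val_integrable[OF h \<gamma> t' K] K' by (simp add: integrable_restrict_space set_integrable_def)
    have "g n t = (LINT x|restrict_space lborel K. avg_error T K n h (t, x))"
      unfolding g_def using K' by (simp add: integral_restrict_space set_lebesgue_integral_def)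
    also have "\<dots> \<le> (LINT x|restrict_space lborel K. norm (R.avg n (traj_val h t) x - traj_val h t x))"
    proof (rule integral_mono_AE)
      have "avg_error T K n h (t, x) = min 1 (norm (R.avg n (traj_val h t) x - traj_val h t x))" if "x \<in> K" for x
        using that by (simp add: avg_error_def traj_avg_eq_avg[OF K' t' that])
      then have e: "avg_error T K n h (t, x) = min 1 (norm (R.avg n (traj_val h t) x - traj_val h t x))" if "x \<in> space (restrict_space lborel K)" for x
        using that by (simp add: space_restrict_space)
      show int2: "integrable (restrict_space lborel K) (\<lambda>x. norm (R.avg n (traj_val h t) x - traj_val h t x))"
        using int R.avg_integrable by (intro integrable_norm Bochner_Integration.integrable_diff)
      show "integrable (restrict_space lborel K) (\<lambda>x. avg_error T K n h (t, x))"
        by (subst Bochner_Integration.integrable_cong[OF refl e], assumption)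
          (rule Bochner_Integration.integrable_bound[OF int2], use int2 in auto)
      show "AE x in restrict_space lborel K. avg_error T K n h (t, x) \<le> norm (R.avg n (traj_val h t) x - traj_val h t x)"
        using e by (intro AE_I2) simp
    qed
    finally have "g n t \<le> (LINT x|restrict_space lborel K. norm (R.avg n (traj_val h t) x - traj_val h t x))" .
    moreover have "0 \<le> g n t"
      unfolding g_def by (intro Bochner_Integration.integral_nonneg) (simp add: avg_error_bounds)
    ultimately show ?thesis by simp
  qed
  have "(\<lambda>n. LINT t|lborel. indicator {0<..<T} t * g n t) \<longlonglongrightarrow> (LINT t::real|lborel. 0 :: real)"
  proof (rule integral_dominated_convergence[where w = "\<lambda>t. indicator {0<..<T} t * measure lborel K"])
    show "AE t in lborel. (\<lambda>n. indicator {0<..<T} t * g n t) \<longlonglongrightarrow> 0"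
    proof (rule AE_I2)
      fix t :: real
      show "(\<lambda>n. indicator {0<..<T} t * g n t) \<longlonglongrightarrow> 0"
      proof (cases "t \<in> {0<..<T}")
        case True
        then have t': "t \<in> {0..T}" by auto
        have int: "integrable (restrict_space lborel K) (traj_val h t)"
          using traj_val_integrable[OF h \<gamma> t' K] K' by (simp add: integrable_restrict_space set_integrable_def)
        have "(\<lambda>n. g n t) \<longlonglongrightarrow> 0"
          by (rule tendsto_sandwich[OF _ _ tendsto_const R.avg_tendsto_L1[OF int]])
            (use g_le[OF True] in \<open>auto intro!: always_eventually\<close>)
        then show ?thesis using True by simp
      qed simp
    qed
    show "AE t in lborel. norm (indicator {0<..<T} t * g n t) \<le> indicator {0<..<T} t * measure lborel K" for n
    proof (rule AE_I2)
      fix t :: real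
      have "0 \<le> g n t" unfolding g_def by (intro Bochner_Integration.integral_nonneg) (simp add: avg_error_bounds)
      moreover have "g n t \<le> measure lborel K"
      proof -
        have "g n t \<le> (LINT x|lborel. indicator K x)"
          unfolding g_def using avg_error_bounds(1,2)[of T K n h] K'
          by (intro integral_mono_AE') (auto split: split_indicator)
        then show ?thesis using K' by simp
      qed
      ultimately show "norm (indicator {0<..<T} t * g n t) \<le> indicator {0<..<T} t * measure lborel K"
        by (auto split: split_indicator)
    qed
    show "integrable lborel (\<lambda>t. indicator {0<..<T} t * measure lborel K :: real)"
      using T by (intro integrable_mult_left integrable_real_indicator) auto
  qed (use g_meas in auto)
  then show ?thesis by (simp add: eq)
qed

lemma space_eq_trajectories: "sets P = sets (traj_borel T \<gamma> Q) \<Longrightarrow> space P = trajectories T \<gamma> Q"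
  using sets_eq_imp_space_eq[of P "traj_borel T \<gamma> Q"] by (simp add: space_traj_borel)

lemma measurable_pair_restrict:
  assumes "f \<in> borel_measurable (P \<Otimes>\<^sub>M M)"
  shows "f \<in> borel_measurable (P \<Otimes>\<^sub>M restrict_space M S)"
proof -
  have "(\<lambda>w. (fst w, snd w)) \<in> P \<Otimes>\<^sub>M restrict_space M S \<rightarrow>\<^sub>M P \<Otimes>\<^sub>M M"
    by (intro measurable_Pair measurable_fst measurable_compose[OF measurable_snd measurable_restrict_space1[OF measurable_ident_sets[OF refl]]])
  from measurable_compose[OF this assms] show ?thesis by simp
qed

text \<open>The capped distance is again a metric; this is its reverse triangle inequality.\<close>

lemma min_norm_diff_bound:
  fixes a b c :: "'a::real_normed_vector"
  shows "\<bar>min 1 (norm (a - b)) - min 1 (norm (a - c))\<bar> \<le> min 1 (norm (b - c))"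
  using norm_triangle_ineq[of "a - c" "c - b"] norm_triangle_ineq[of "a - b" "b - c"] norm_minus_commute[of b c]
    norm_ge_zero[of "a - b"] norm_ge_zero[of "a - c"]
  unfolding min_def abs_if by (simp del: norm_ge_zero)

lemma test_fun_0D:
  assumes "test_fun 0 U \<phi>"
  obtains S where "compact S" "S \<subseteq> U" "\<And>z. z \<notin> S \<Longrightarrow> \<phi> z = 0" "continuous_on UNIV \<phi>"
proof -
  have "Ck_on 0 UNIV \<phi>" using assms unfolding test_fun_def by (simp add: zero_enat_def)
  then show ?thesis using assms that unfolding test_fun_def by auto
qed

lemma compact_support_bounded:
  fixes f :: "'a::topological_space \<Rightarrow> real"
  assumes "continuous_on UNIV f" "compact S" "\<And>x. x \<notin> S \<Longrightarrow> f x = 0"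
  obtains C where "C \<ge> 0" "\<And>x. \<bar>f x\<bar> \<le> C"
proof -
  have "bounded (f ` S)"
    using assms by (intro compact_imp_bounded compact_continuous_image) (auto intro: continuous_on_subset)
  then obtain C where C: "\<And>x. x \<in> S \<Longrightarrow> \<bar>f x\<bar> \<le> C" by (auto simp: bounded_iff)
  have "\<bar>f x\<bar> \<le> max C 0" for x using C[of x] assms(3)[of x] by (cases "x \<in> S") auto
  then show ?thesis using that[of "max C 0"] by simp
qed

lemma compact_support_uniformly_continuous:
  fixes f :: "'a::euclidean_space \<Rightarrow> real"
  assumes f: "continuous_on UNIV f" and S: "compact S" "\<And>x. x \<notin> S \<Longrightarrow> f x = 0"
  shows "uniformly_continuous_on UNIV f"
  unfolding uniformly_continuous_on_def
proof (intro allI impI)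
  fix e :: real assume "e > 0"
  obtain R where R: "S \<subseteq> cball 0 R"
    using compact_imp_bounded[OF S(1)] bounded_subset_ballD[of S 0] ball_subset_cball by (metis subset_trans)
  have "uniformly_continuous_on (cball 0 (R + 1)) f"
    using f by (intro compact_uniformly_continuous) (auto intro: continuous_on_subset)
  then obtain d where d: "d > 0" "\<And>x y. x \<in> cball 0 (R + 1) \<Longrightarrow> y \<in> cball 0 (R + 1) \<Longrightarrow> dist y x < d \<Longrightarrow> dist (f y) (f x) < e"
    using \<open>e > 0\<close> unfolding uniformly_continuous_on_def by blast
  have "dist (f y) (f x) < e" if xy: "dist y x < min d 1" for x y
  proof (cases "x \<in> cball 0 (R + 1) \<and> y \<in> cball 0 (R + 1)")
    case True
    then show ?thesis using d(2) xy by simp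
  next
    case False
    then have "x \<notin> cball 0 R \<and> y \<notin> cball 0 R"
      using xy dist_triangle[of 0 x y] dist_triangle[of 0 y x] by (auto simp: dist_commute)
    then have "f x = 0" "f y = 0" using R S(2) by blast+
    then show ?thesis using \<open>e > 0\<close> by simp
  qed
  then show "\<exists>d>0. \<forall>x\<in>UNIV. \<forall>y\<in>UNIV. dist y x < d \<longrightarrow> dist (f y) (f x) < e"
    using d(1) by (intro exI[of _ "min d 1"]) auto
qed

section \<open>Random trajectories: measurability in trajectory and point jointly\<close>

locale trajectory_law = prob_space P for P :: "'n::finite trajectory measure" +
  fixes T \<gamma> :: real and Q :: "(real^'n) set"
  assumes sets_P: "sets P = sets (traj_borel T \<gamma> Q)"
    and T_pos: "T > 0" and \<gamma>_gt_1: "\<gamma> > 1" and open_Q: "open Q"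
begin

abbreviation cyl :: "(real^'n) set \<Rightarrow> (real \<times> (real^'n)) measure" where
  "cyl K \<equiv> restrict_space lborel ({0<..<T} \<times> K)"

lemma space_P: "space P = trajectories T \<gamma> Q"
  by (rule space_eq_trajectories[OF sets_P])

lemma cyl_set: "(K :: (real^'n) set) \<in> sets borel \<Longrightarrow> {0<..<T} \<times> K \<in> sets borel"
  by (intro borel_Times) auto

lemma finite_cyl:
  assumes "compact K"
  shows "finite_measure (cyl K)"
  using emeasure_Times_finite[OF assms, of T] cyl_set[of K] assms
  by (intro finite_measureI) (simp add: emeasure_restrict_space space_restrict_space compact_imp_closed)

lemma traj_avg_measurable_cyl:
  "compact K \<Longrightarrow> K \<subseteq> Q \<Longrightarrow> traj_avg T K n \<in> borel_measurable (P \<Otimes>\<^sub>M cyl K)"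
  by (rule measurable_pair_restrict[OF traj_avg_measurable[OF sets_P T_pos \<gamma>_gt_1]])

lemma avg_error_integrable:
  assumes h: "h \<in> space P" and K: "compact K" "K \<subseteq> Q"
  shows "integrable (cyl K) (avg_error T K n h)"
proof -
  interpret N: finite_measure "cyl K" by (rule finite_cyl[OF K(1)])
  show ?thesis
    using avg_error_measurable[OF h[unfolded space_P] open_Q T_pos \<gamma>_gt_1 K] avg_error_bounds[of T K n h]
    by (intro N.integrable_const_bound[of _ 1]) auto
qed

text \<open>The integrand contains the sample itself, which need not be jointly measurable.
  Replacing the sample by its average of level \<open>m\<close> gives a jointly measurable
  integrand, and the change is at most the integrated error of level \<open>m\<close>, which tends
  to 0.\<close>

lemma avg_error_integral_measurable:
  assumes K: "compact K" "K \<subseteq> Q"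
  shows "(\<lambda>h. LINT z|cyl K. avg_error T K n h z) \<in> borel_measurable P"
proof -
  interpret N: finite_measure "cyl K" by (rule finite_cyl[OF K(1)])
  define d where "d m h z = min 1 (norm (traj_avg T K n (h, z) - traj_avg T K m (h, z)))" for m h z
  have dm: "(\<lambda>(h, z). d m h z) \<in> borel_measurable (P \<Otimes>\<^sub>M cyl K)" for m
    unfolding d_def case_prod_beta using traj_avg_measurable_cyl[OF K] by simp
  show ?thesis
  proof (rule borel_measurable_LIMSEQ_real[where u = "\<lambda>m h. LINT z|cyl K. d m h z"])
    show "(\<lambda>h. LINT z|cyl K. d m h z) \<in> borel_measurable P" for m
      by (rule N.borel_measurable_lebesgue_integral[OF dm])
    fix h assume h: "h \<in> space P"
    have "d m h \<in> borel_measurable (cyl K)" for m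
      using measurable_Pair2[OF dm h] by simp
    then have di: "integrable (cyl K) (d m h)" for m
      by (intro N.integrable_const_bound[of _ 1]) (auto simp: d_def)
    have "\<bar>(LINT z|cyl K. d m h z) - (LINT z|cyl K. avg_error T K n h z)\<bar> \<le> (LINT z|cyl K. avg_error T K m h z)" for m
    proof -
      have "\<bar>(LINT z|cyl K. d m h z) - (LINT z|cyl K. avg_error T K n h z)\<bar> = \<bar>LINT z|cyl K. d m h z - avg_error T K n h z\<bar>"
        using di avg_error_integrable[OF h K] by simp
      also have "\<dots> \<le> (LINT z|cyl K. \<bar>d m h z - avg_error T K n h z\<bar>)"
        by (rule integral_abs_bound)
      also have "\<dots> \<le> (LINT z|cyl K. avg_error T K m h z)"
      proof (rule integral_mono)
        show "\<bar>d m h z - avg_error T K n h z\<bar> \<le> avg_error T K m h z" for z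
          unfolding d_def avg_error_def by (rule min_norm_diff_bound)
      qed (use di avg_error_integrable[OF h K] in auto)
      finally show ?thesis .
    qed
    then have "(\<lambda>m. (LINT z|cyl K. d m h z) - (LINT z|cyl K. avg_error T K n h z)) \<longlonglongrightarrow> 0"
      by (intro Lim_null_comparison[OF always_eventually avg_error_tendsto[OF h[unfolded space_P] open_Q T_pos \<gamma>_gt_1 K]]) simp
    then show "(\<lambda>m. LINT z|cyl K. d m h z) \<longlonglongrightarrow> (LINT z|cyl K. avg_error T K n h z)"
      by (rule LIM_zero_cancel)
  qed
qed

lemma avg_error_expectation_tendsto:
  assumes K: "compact K" "K \<subseteq> Q"
  shows "(\<lambda>n. LINT h|P. LINT z|cyl K. avg_error T K n h z) \<longlonglongrightarrow> 0"
proof -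
  interpret N: finite_measure "cyl K" by (rule finite_cyl[OF K(1)])
  have bd: "\<bar>LINT z|cyl K. avg_error T K n h z\<bar> \<le> measure (cyl K) (space (cyl K))" if "h \<in> space P" for n h
  proof -
    have "(LINT z|cyl K. avg_error T K n h z) \<le> (LINT z|cyl K. 1)"
      using avg_error_integrable[OF that K] by (intro integral_mono) (auto simp: avg_error_bounds)
    moreover have "0 \<le> (LINT z|cyl K. avg_error T K n h z)"
      by (intro Bochner_Integration.integral_nonneg) (simp add: avg_error_bounds)
    ultimately show ?thesis by simp
  qed
  have "(\<lambda>n. LINT h|P. LINT z|cyl K. avg_error T K n h z) \<longlonglongrightarrow> (LINT h|P. 0)"
    by (rule integral_dominated_convergence[where w = "\<lambda>_. measure (cyl K) (space (cyl K))"])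
      (use bd avg_error_integral_measurable[OF K] avg_error_tendsto[OF _ open_Q T_pos \<gamma>_gt_1 K] in
        \<open>auto simp: space_P intro!: AE_I2\<close>)
  then show ?thesis by simp
qed

text \<open>Convergence of the averages in mean yields one subsequence, common to all trajectories,
  along which the errors are summable; its limit is jointly measurable and equals the sample almost
  everywhere.\<close>

lemma version_on_compact:
  assumes K: "compact K" "K \<subseteq> Q"
  shows "\<exists>Z \<in> borel_measurable (P \<Otimes>\<^sub>M lborel). AE h in P. AE z in cyl K. Z (h, z) = traj_val h (fst z) (snd z)"
proof -
  interpret N: finite_measure "cyl K" by (rule finite_cyl[OF K(1)])
  define \<delta> where "\<delta> n h = (LINT z|cyl K. avg_error T K n h z)" for n h
  have \<delta>m [measurable]: "\<delta> n \<in> borel_measurable P" for n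
    unfolding \<delta>_def[abs_def] by (rule avg_error_integral_measurable[OF K])
  have \<delta>_nonneg: "0 \<le> \<delta> n h" for n h
    unfolding \<delta>_def by (intro Bochner_Integration.integral_nonneg) (simp add: avg_error_bounds)
  have \<delta>i: "integrable P (\<delta> n)" for n
  proof (rule integrable_const_bound[of _ "measure (cyl K) (space (cyl K))"])
    show "AE h in P. norm (\<delta> n h) \<le> measure (cyl K) (space (cyl K))"
    proof (rule AE_I2)
      fix h assume "h \<in> space P"
      then have "\<delta> n h \<le> (LINT z|cyl K. 1)"
        unfolding \<delta>_def using avg_error_integrable[OF _ K] by (intro integral_mono) (auto simp: avg_error_bounds)
      then show "norm (\<delta> n h) \<le> measure (cyl K) (space (cyl K))" using \<delta>_nonneg[of n h] by simp
    qed
  qed simp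
  \<comment> \<open>The geometric rate makes the sum of the chosen errors finite in expectation,
    hence finite for almost every \<open>h\<close>, and then for almost every
    \<open>z\<close>.\<close>
  have "\<forall>k. \<exists>n. (LINT h|P. \<delta> n h) < (1 / 2) ^ k"
  proof
    fix k
    have "\<forall>\<^sub>F n in sequentially. (LINT h|P. \<delta> n h) < (1 / 2) ^ k"
      by (rule order_tendstoD(2)[OF avg_error_expectation_tendsto[OF K, folded \<delta>_def]]) simp
    then show "\<exists>n. (LINT h|P. \<delta> n h) < (1 / 2) ^ k" using eventually_happens by fastforce
  qed
  then obtain r where r: "\<And>k. (LINT h|P. \<delta> (r k) h) < (1 / 2) ^ k" by metis
  have "(\<integral>\<^sup>+h. (\<Sum>k. ennreal (\<delta> (r k) h)) \<partial>P) = (\<Sum>k. \<integral>\<^sup>+h. ennreal (\<delta> (r k) h) \<partial>P)"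
    by (rule nn_integral_suminf) simp
  also have "\<dots> = (\<Sum>k. ennreal (LINT h|P. \<delta> (r k) h))"
    using \<delta>i \<delta>_nonneg by (intro suminf_cong nn_integral_eq_integral) auto
  also have "\<dots> \<le> (\<Sum>k. ennreal ((1 / 2) ^ k))"
    using r by (intro suminf_le summableI ennreal_leI less_imp_le)
  also have "\<dots> = ennreal (\<Sum>k. (1 / 2) ^ k)"
    by (intro suminf_ennreal2 summable_geometric) auto
  finally have "(\<integral>\<^sup>+h. (\<Sum>k. ennreal (\<delta> (r k) h)) \<partial>P) \<noteq> \<infinity>"
    by (auto simp: top_unique)
  then have "AE h in P. (\<Sum>k. ennreal (\<delta> (r k) h)) \<noteq> \<infinity>"
    by (intro nn_integral_noteq_infinite) simp_all
  then have "AE h in P. AE z in cyl K. (\<lambda>k. traj_avg T K (r k) (h, z)) \<longlonglongrightarrow> traj_val h (fst z) (snd z)"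
    using AE_space
  proof eventually_elim
    case (elim h)
    note am = avg_error_measurable[OF elim(2)[unfolded space_P] open_Q T_pos \<gamma>_gt_1 K]
    have "(\<integral>\<^sup>+z. (\<Sum>k. ennreal (avg_error T K (r k) h z)) \<partial>cyl K) = (\<Sum>k. \<integral>\<^sup>+z. ennreal (avg_error T K (r k) h z) \<partial>cyl K)"
      using am by (intro nn_integral_suminf) simp
    also have "\<dots> = (\<Sum>k. ennreal (\<delta> (r k) h))"
      unfolding \<delta>_def
      by (intro suminf_cong nn_integral_eq_integral avg_error_integrable[OF elim(2) K] AE_I2 avg_error_bounds)
    finally have "AE z in cyl K. (\<Sum>k. ennreal (avg_error T K (r k) h z)) \<noteq> \<infinity>"
      using elim(1) am by (intro nn_integral_noteq_infinite) simp_all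
    then show ?case
    proof eventually_elim
      case (elim z)
      then have "summable (\<lambda>k. avg_error T K (r k) h z)"
        by (intro summable_suminf_not_top) (simp_all add: avg_error_bounds)
      then have lim: "(\<lambda>k. avg_error T K (r k) h z) \<longlonglongrightarrow> 0" by (rule summable_LIMSEQ_zero)
      show ?case
      proof (rule metric_LIMSEQ_I)
        fix e :: real assume "e > 0"
        \<comment> \<open>Below 1 the cap is inactive, so a small error is a small distance.\<close>
        then have "\<forall>\<^sub>F k in sequentially. avg_error T K (r k) h z < min e 1"
          by (intro order_tendstoD(2)[OF lim]) auto
        then have "\<forall>\<^sub>F k in sequentially. dist (traj_avg T K (r k) (h, z)) (traj_val h (fst z) (snd z)) < e"
          by eventually_elim (auto simp: avg_error_def dist_norm min_def split: if_splits)
        then show "\<exists>N. \<forall>k\<ge>N. dist (traj_avg T K (r k) (h, z)) (traj_val h (fst z) (snd z)) < e"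
          by (simp add: eventually_sequentially)
      qed
    qed
  qed
  then have "AE h in P. AE z in cyl K. lim (\<lambda>k. traj_avg T K (r k) (h, z)) = traj_val h (fst z) (snd z)"
    by (rule eventually_mono) (erule eventually_mono, rule limI)
  moreover have "(\<lambda>w. lim (\<lambda>k. traj_avg T K (r k) w)) \<in> borel_measurable (P \<Otimes>\<^sub>M lborel)"
    by (intro borel_measurable_lim_metric traj_avg_measurable[OF sets_P T_pos \<gamma>_gt_1 K])
  ultimately show ?thesis by (intro bexI[of _ "\<lambda>w. lim (\<lambda>k. traj_avg T K (r k) w)"])
qed

text \<open>A sample \<open>(h, z) \<mapsto> traj_val h z\<close> depends on the representative of \<open>h\<close> and need not be jointly measurable.
  Averages over cells in \<open>x\<close> are pairings, hence measurable in \<open>h\<close> and continuous in \<open>t\<close>, and they converge in \<open>L\<^sup>1\<^sub>l\<^sub>o\<^sub>c\<close>.\<close>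

theorem measurable_version:
  "\<exists>Z \<in> borel_measurable (P \<Otimes>\<^sub>M lborel). AE h in P. AE z in cyl Q. Z (h, z) = traj_val h (fst z) (snd z)"
proof -
  obtain C :: "nat \<Rightarrow> (real^'n) set" where C: "\<And>j. compact (C j)" "\<And>j. C j \<subseteq> Q" "\<Union>(range C) = Q"
    using open_Union_compact_subsets[OF open_Q] by metis
  have "\<forall>j. \<exists>Z. Z \<in> borel_measurable (P \<Otimes>\<^sub>M lborel) \<and> (AE h in P. AE z in cyl (C j). Z (h, z) = traj_val h (fst z) (snd z))"
    using version_on_compact[OF C(1,2)] by blast
  from choice[OF this] obtain Z where Z: "\<And>j. Z j \<in> borel_measurable (P \<Otimes>\<^sub>M lborel)"
      "\<And>j. AE h in P. AE z in cyl (C j). Z j (h, z) = traj_val h (fst z) (snd z)"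
    by blast
  \<comment> \<open>The versions on the compact sets \<open>C j\<close> are glued by the least index
    whose set contains \<open>x\<close>, a Borel function of \<open>x\<close>.\<close>
  define i where "i x = (LEAST j. x \<in> C j)" for x
  have Cs: "C j \<in> sets borel" for j using C(1) by (simp add: compact_imp_closed)
  have Qs: "Q \<in> sets borel" using open_Q by simp
  have im: "i \<in> measurable borel (count_space UNIV)"
    unfolding i_def using Cs by (intro measurable_Least) simp
  have "(\<lambda>w. Z (i (snd (snd w))) w) \<in> borel_measurable (P \<Otimes>\<^sub>M lborel)"
  proof (rule measurable_compose_countable[OF Z(1)])
    have "(\<lambda>w. snd (snd w)) \<in> P \<Otimes>\<^sub>M (lborel :: (real \<times> (real^'n)) measure) \<rightarrow>\<^sub>M borel"
      by (rule measurable_compose[OF measurable_snd])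
        (use borel_measurable_continuous_onI[OF continuous_on_snd[OF continuous_on_id]] in simp)
    from measurable_compose[OF this im] show "(\<lambda>w. i (snd (snd w))) \<in> P \<Otimes>\<^sub>M (lborel :: (real \<times> (real^'n)) measure) \<rightarrow>\<^sub>M count_space UNIV" .
  qed
  moreover have "AE h in P. \<forall>j. AE z in cyl (C j). Z j (h, z) = traj_val h (fst z) (snd z)"
    using Z(2) by (simp add: AE_all_countable)
  then have "AE h in P. AE z in cyl Q. Z (i (snd z)) (h, z) = traj_val h (fst z) (snd z)"
  proof eventually_elim
    case (elim h)
    have "AE z in lborel. \<forall>j. z \<in> {0<..<T} \<times> C j \<longrightarrow> Z j (h, z) = traj_val h (fst z) (snd z)"
      using elim cyl_set[OF Cs] by (simp add: AE_all_countable AE_restrict_space_iff)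
    then have "AE z in lborel. z \<in> {0<..<T} \<times> Q \<longrightarrow> Z (i (snd z)) (h, z) = traj_val h (fst z) (snd z)"
    proof eventually_elim
      case (elim z)
      show ?case
      proof
        assume z: "z \<in> {0<..<T} \<times> Q"
        then obtain j where "snd z \<in> C j" using C(3) by auto
        then have "snd z \<in> C (i (snd z))" unfolding i_def by (rule LeastI)
        then show "Z (i (snd z)) (h, z) = traj_val h (fst z) (snd z)"
          using elim z by (auto simp: mem_Times_iff)
      qed
    qed
    then show ?case using cyl_set[OF Qs] by (simp add: AE_restrict_space_iff)
  qed
  ultimately show ?thesis by (intro bexI[of _ "\<lambda>w. Z (i (snd (snd w))) w"]) auto
qed

text \<open>Concerns functionals of the sample itself, not of its measurable version. Uniform
  continuity of \<open>b\<close> controls the replacement of the sample by its averages, for which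
  Fubini gives measurability in \<open>h\<close>.\<close>

lemma observable_measurable:
  fixes b :: "real \<times> (real^'n) \<Rightarrow> real" and \<phi> :: "real \<times> (real^'n) \<Rightarrow> real"
  assumes b: "test_fun 0 UNIV b" and \<phi>: "test_fun 0 ({0<..<T} \<times> Q) \<phi>"
  shows "(\<lambda>h. LINT z|cyl Q. b (traj_val h (fst z) (snd z)) * \<phi> z) \<in> borel_measurable P"
proof -
  obtain S where S: "compact S" "S \<subseteq> {0<..<T} \<times> Q" "\<And>z. z \<notin> S \<Longrightarrow> \<phi> z = 0" and \<phi>c: "continuous_on UNIV \<phi>"
    using test_fun_0D[OF \<phi>] by blast
  obtain Kb where Kb: "compact Kb" "\<And>y. y \<notin> Kb \<Longrightarrow> b y = 0" and bc: "continuous_on UNIV b"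
    using test_fun_0D[OF b] by metis
  define K where "K = snd ` S"
  have K: "compact K" "K \<subseteq> Q"
    using S(1,2) by (auto simp: K_def intro!: compact_continuous_image continuous_intros)
  have Ks: "K \<in> sets borel" "Q \<in> sets borel" using K(1) open_Q by (auto simp: compact_imp_closed)
  interpret N: finite_measure "cyl K" by (rule finite_cyl[OF K(1)])
  obtain Cb where Cb: "Cb \<ge> 0" "\<And>y. \<bar>b y\<bar> \<le> Cb" using compact_support_bounded[OF bc Kb] by blast
  obtain C\<phi> where C\<phi>: "C\<phi> \<ge> 0" "\<And>z. \<bar>\<phi> z\<bar> \<le> C\<phi>" using compact_support_bounded[OF \<phi>c S(1,3)] by blast
  have bm: "b \<in> borel_measurable borel" and \<phi>m: "\<phi> \<in> borel_measurable (cyl K)"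
    using bc \<phi>c by (auto intro!: borel_measurable_continuous_onI measurable_restrict_space1)
  have "uniformly_continuous_on UNIV b"
    by (rule compact_support_uniformly_continuous[OF bc Kb])
  \<comment> \<open>Either the arguments are closer than the modulus \<open>d\<close>, or their
    capped distance is at least \<open>min d 1\<close> and the constant \<open>C\<close> absorbs the
    oscillation of \<open>b\<close>.\<close>
  then have uc: "\<exists>C\<ge>0. \<forall>y y'. \<bar>b y - b y'\<bar> \<le> e + C * min 1 (norm (y - y'))" if "e > 0" for e
  proof -
    obtain d where d: "d > 0" "\<And>y y'. dist y' y < d \<Longrightarrow> dist (b y') (b y) < e"
      using \<open>uniformly_continuous_on UNIV b\<close> \<open>e > 0\<close> unfolding uniformly_continuous_on_def by blast
    define C where "C = 2 * Cb / min d 1"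
    have C0: "C \<ge> 0" using d Cb(1) by (simp add: C_def)
    have "\<bar>b y - b y'\<bar> \<le> e + C * min 1 (norm (y - y'))" for y y'
    proof (cases "norm (y - y') < d")
      case True
      then have "\<bar>b y - b y'\<bar> < e" using d(2)[of y y'] by (simp add: dist_norm)
      then show ?thesis using C0 by (simp add: add_increasing2)
    next
      case False
      then have "min d 1 \<le> min 1 (norm (y - y'))" by auto
      then have "C * min d 1 \<le> C * min 1 (norm (y - y'))" using C0 by (rule mult_left_mono)
      moreover have "C * min d 1 = 2 * Cb" using d Cb(1) by (simp add: C_def)
      moreover have "\<bar>b y - b y'\<bar> \<le> 2 * Cb" using Cb(2)[of y] Cb(2)[of y'] by linarith
      ultimately show ?thesis using \<open>e > 0\<close> by linarith
    qed
    then show ?thesis using C0 by blast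
  qed
  have "(\<lambda>h. LINT z|cyl K. b (traj_val h (fst z) (snd z)) * \<phi> z) \<in> borel_measurable P"
  proof (rule borel_measurable_LIMSEQ_real[where u = "\<lambda>n h. LINT z|cyl K. b (traj_avg T K n (h, z)) * \<phi> z"])
    have "(\<lambda>w. b (traj_avg T K n w) * \<phi> (snd w)) \<in> borel_measurable (P \<Otimes>\<^sub>M cyl K)" for n
      by (intro borel_measurable_times measurable_compose[OF traj_avg_measurable_cyl[OF K] bm]
          measurable_compose[OF measurable_snd \<phi>m])
    then show "(\<lambda>h. LINT z|cyl K. b (traj_avg T K n (h, z)) * \<phi> z) \<in> borel_measurable P" for n
      by (intro N.borel_measurable_lebesgue_integral) (simp add: case_prod_beta')
    fix h assume h: "h \<in> space P"
    have hT: "h \<in> trajectories T \<gamma> Q" using h by (simp add: space_P)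
    have int: "integrable (cyl K) (\<lambda>z. b (f z) * \<phi> z)" if "f \<in> borel_measurable (cyl K)" for f
    proof (rule N.integrable_const_bound[of _ "Cb * C\<phi>"])
      show "AE z in cyl K. norm (b (f z) * \<phi> z) \<le> Cb * C\<phi>"
        unfolding real_norm_def abs_mult by (intro AE_I2 mult_mono Cb C\<phi> abs_ge_zero)
    qed (intro borel_measurable_times measurable_compose[OF that bm] \<phi>m)
    have m1: "(\<lambda>z. traj_avg T K n (h, z)) \<in> borel_measurable (cyl K)" for n
      by (rule measurable_restrict_space1[OF section_measurable[OF hT T_pos \<gamma>_gt_1 K]])
    have m2: "(\<lambda>z. traj_val h (fst z) (snd z)) \<in> borel_measurable (cyl K)"
      by (rule traj_val_measurable[OF hT open_Q Ks(1) K(2)])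
    show "(\<lambda>n. LINT z|cyl K. b (traj_avg T K n (h, z)) * \<phi> z) \<longlonglongrightarrow> (LINT z|cyl K. b (traj_val h (fst z) (snd z)) * \<phi> z)"
    proof (rule LIMSEQ_I)
      fix r :: real assume "r > 0"
      define M where "M = C\<phi> * measure (cyl K) (space (cyl K)) + 1"
      have M: "M > 0" using C\<phi>(1) by (simp add: M_def add_nonneg_pos)
      define e where "e = r / (2 * M)"
      have e: "e > 0" using \<open>r > 0\<close> M by (simp add: e_def)
      obtain C where C: "C \<ge> 0" "\<And>y y'. \<bar>b y - b y'\<bar> \<le> e + C * min 1 (norm (y - y'))"
        using uc[OF e] by blast
      have bound: "\<bar>(LINT z|cyl K. b (traj_avg T K n (h, z)) * \<phi> z) - (LINT z|cyl K. b (traj_val h (fst z) (snd z)) * \<phi> z)\<bar>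
          \<le> C\<phi> * e * measure (cyl K) (space (cyl K)) + C\<phi> * C * (LINT z|cyl K. avg_error T K n h z)" for n
      proof -
        have "\<bar>(LINT z|cyl K. b (traj_avg T K n (h, z)) * \<phi> z) - (LINT z|cyl K. b (traj_val h (fst z) (snd z)) * \<phi> z)\<bar>
           = \<bar>LINT z|cyl K. b (traj_avg T K n (h, z)) * \<phi> z - b (traj_val h (fst z) (snd z)) * \<phi> z\<bar>"
          using int[OF m1] int[OF m2] by simp
        also have "\<dots> \<le> (LINT z|cyl K. \<bar>b (traj_avg T K n (h, z)) * \<phi> z - b (traj_val h (fst z) (snd z)) * \<phi> z\<bar>)"
          by (rule integral_abs_bound)
        also have "\<dots> \<le> (LINT z|cyl K. C\<phi> * e + C\<phi> * C * avg_error T K n h z)"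
        proof (rule integral_mono)
          fix z
          have "\<bar>b (traj_avg T K n (h, z)) * \<phi> z - b (traj_val h (fst z) (snd z)) * \<phi> z\<bar> =
              \<bar>\<phi> z\<bar> * \<bar>b (traj_avg T K n (h, z)) - b (traj_val h (fst z) (snd z))\<bar>"
            by (subst abs_mult[symmetric]) (simp add: algebra_simps)
          also have "\<dots> \<le> C\<phi> * (e + C * avg_error T K n h z)"
            unfolding avg_error_def using C(2) C\<phi> by (intro mult_mono) simp_all
          finally show "\<bar>b (traj_avg T K n (h, z)) * \<phi> z - b (traj_val h (fst z) (snd z)) * \<phi> z\<bar>
              \<le> C\<phi> * e + C\<phi> * C * avg_error T K n h z"
            by (simp add: algebra_simps)
        qed (use int[OF m1] int[OF m2] avg_error_integrable[OF h K] in auto)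
        also have "\<dots> = C\<phi> * e * measure (cyl K) (space (cyl K)) + C\<phi> * C * (LINT z|cyl K. avg_error T K n h z)"
          using avg_error_integrable[OF h K] by simp
        finally show ?thesis .
      qed
      have small: "C\<phi> * e * measure (cyl K) (space (cyl K)) \<le> r / 2"
      proof -
        have "C\<phi> * e * measure (cyl K) (space (cyl K)) \<le> e * M"
          using e by (simp add: M_def algebra_simps)
        also have "\<dots> = r / 2" using M by (simp add: e_def)
        finally show ?thesis .
      qed
      have "(\<lambda>n. C\<phi> * C * (LINT z|cyl K. avg_error T K n h z)) \<longlonglongrightarrow> 0"
        using tendsto_mult_left[OF avg_error_tendsto[OF hT open_Q T_pos \<gamma>_gt_1 K], of "C\<phi> * C"] by simp
      from order_tendstoD(2)[OF this, of "r / 2"] \<open>r > 0\<close>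
      obtain n0 where n0: "\<And>n. n \<ge> n0 \<Longrightarrow> C\<phi> * C * (LINT z|cyl K. avg_error T K n h z) < r / 2"
        by (auto simp: eventually_sequentially)
      show "\<exists>n0. \<forall>n\<ge>n0. norm ((LINT z|cyl K. b (traj_avg T K n (h, z)) * \<phi> z) - (LINT z|cyl K. b (traj_val h (fst z) (snd z)) * \<phi> z)) < r"
      proof (intro exI allI impI)
        fix n assume "n \<ge> n0"
        from bound[of n] n0[OF this] small
        show "norm ((LINT z|cyl K. b (traj_avg T K n (h, z)) * \<phi> z) - (LINT z|cyl K. b (traj_val h (fst z) (snd z)) * \<phi> z)) < r"
          by simp
      qed
    qed
  qed
  moreover have "(LINT z|cyl K. b (traj_val h (fst z) (snd z)) * \<phi> z) = (LINT z|cyl Q. b (traj_val h (fst z) (snd z)) * \<phi> z)" for h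
  proof -
    have eq: "indicator ({0<..<T} \<times> K) z * \<phi> z = indicator ({0<..<T} \<times> Q) z * \<phi> z" for z
    proof (cases "z \<in> S")
      case True
      then have "snd z \<in> K" "z \<in> {0<..<T} \<times> Q" using S(2) by (auto simp only: K_def image_eqI)
      then show ?thesis by (simp add: indicator_def mem_Times_iff)
    qed (simp add: S(3))
    have "indicator ({0<..<T} \<times> K) z *\<^sub>R (b (traj_val h (fst z) (snd z)) * \<phi> z) =
        indicator ({0<..<T} \<times> Q) z *\<^sub>R (b (traj_val h (fst z) (snd z)) * \<phi> z)" for z
      using eq[of z] by auto
    note e = this
    have "(LINT z|cyl K. b (traj_val h (fst z) (snd z)) * \<phi> z) =
        (LINT z|lborel. indicator ({0<..<T} \<times> K) z *\<^sub>R (b (traj_val h (fst z) (snd z)) * \<phi> z))"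
      using cyl_set[OF Ks(1)] by (subst integral_restrict_space) (simp_all add: set_lebesgue_integral_def)
    also have "\<dots> = (LINT z|cyl Q. b (traj_val h (fst z) (snd z)) * \<phi> z)"
      unfolding e using cyl_set[OF Ks(2)] by (subst integral_restrict_space) (simp_all add: set_lebesgue_integral_def)
    finally show ?thesis .
  qed
  ultimately show ?thesis by simp
qed

end

section \<open>The relative energy\<close>

text \<open>Vacuum is included on both sides: the mean value theorem asks for derivatives in the
  open interval only, and monotonicity of the derivative holds down to 0.\<close>

lemma powr_tangent_strict:
  fixes r s :: real
  assumes \<gamma>: "\<gamma> > 1" and rs: "r \<ge> 0" "s \<ge> 0" "r \<noteq> s"
  shows "s powr \<gamma> + \<gamma> * s powr (\<gamma> - 1) * (r - s) < r powr \<gamma>"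
proof -
  have mvt': "\<exists>\<xi>. a < \<xi> \<and> \<xi> < b \<and> b powr \<gamma> - a powr \<gamma> = \<gamma> * \<xi> powr (\<gamma> - 1) * (b - a)" if "0 \<le> a" "a < b" for a b
  proof (rule mvt[OF \<open>a < b\<close>, of "\<lambda>x. x powr \<gamma>" "\<lambda>x y. \<gamma> * x powr (\<gamma> - 1) * y"])
    show "continuous_on {a..b} (\<lambda>x. x powr \<gamma>)"
      using that \<gamma> by (intro continuous_on_powr') (auto intro!: continuous_intros)
    show "((\<lambda>x. x powr \<gamma>) has_derivative (\<lambda>y. \<gamma> * x powr (\<gamma> - 1) * y)) (at x)" if "a < x" for x
      using has_real_derivative_powr[of x \<gamma>] that \<open>0 \<le> a\<close> by (simp add: has_field_derivative_def)
  qed (auto simp: that)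
  show ?thesis
  proof (cases "s < r")
    case True
    obtain \<xi> where \<xi>: "s < \<xi>" "r powr \<gamma> - s powr \<gamma> = \<gamma> * \<xi> powr (\<gamma> - 1) * (r - s)"
      using mvt'[OF rs(2) True] by auto
    have "s powr (\<gamma> - 1) < \<xi> powr (\<gamma> - 1)"
      using \<xi>(1) \<gamma> rs by (intro powr_less_mono2) auto
    then have "\<gamma> * s powr (\<gamma> - 1) * (r - s) < \<gamma> * \<xi> powr (\<gamma> - 1) * (r - s)"
      using True \<gamma> by simp
    then show ?thesis using \<xi>(2) by linarith
  next
    case False
    then have "r < s" using rs by simp
    obtain \<xi> where \<xi>: "r < \<xi>" "\<xi> < s" "s powr \<gamma> - r powr \<gamma> = \<gamma> * \<xi> powr (\<gamma> - 1) * (s - r)"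
      using mvt'[OF rs(1) \<open>r < s\<close>] by auto
    have "\<xi> powr (\<gamma> - 1) < s powr (\<gamma> - 1)"
      using \<xi> \<gamma> rs by (intro powr_less_mono2) auto
    then have "\<gamma> * \<xi> powr (\<gamma> - 1) * (s - r) < \<gamma> * s powr (\<gamma> - 1) * (s - r)"
      using \<open>r < s\<close> \<gamma> by simp
    then show ?thesis using \<xi>(3) by (simp add: algebra_simps)
  qed
qed

lemma powr_tangent:
  fixes r s :: real
  assumes "\<gamma> > 1" "r \<ge> 0" "s \<ge> 0"
  shows "s powr \<gamma> + \<gamma> * s powr (\<gamma> - 1) * (r - s) \<le> r powr \<gamma>"
  using powr_tangent_strict[OF assms] by (cases "r = s") auto

locale isentropic =
  fixes a \<gamma> rinf :: real
  assumes a_pos: "a > 0" and \<gamma>_gt_1: "\<gamma> > 1" and rinf_pos: "rinf > 0"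
begin

text \<open>The Bregman distance P(r) - P'(rinf)(r - rinf) - P(rinf).\<close>

definition rel_potential :: "real \<Rightarrow> real" where
  "rel_potential r = a / (\<gamma> - 1) * (r powr \<gamma> - rinf powr \<gamma> - \<gamma> * rinf powr (\<gamma> - 1) * (r - rinf))"

text \<open>The states of finite relative energy, see \<open>rel_energy_eq\<close>.\<close>

definition admissible :: "real \<times> (real^'n) \<Rightarrow> bool" where
  "admissible y \<longleftrightarrow> fst y \<ge> 0 \<and> (fst y = 0 \<longrightarrow> snd y = 0)"

text \<open>The relative energy after completing the square in the momentum; the convention 0/0 = 0
  gives the right value in vacuum.\<close>

definition energy :: "real^'n \<Rightarrow> real \<times> (real^'n) \<Rightarrow> real" where
  "energy u y = 1 / 2 * ((norm (snd y - fst y *\<^sub>R u))\<^sup>2 / fst y) + rel_potential (fst y)"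

lemma rel_potential_nonneg: "r \<ge> 0 \<Longrightarrow> rel_potential r \<ge> 0"
  using powr_tangent[OF \<gamma>_gt_1, of r rinf] a_pos \<gamma>_gt_1 rinf_pos by (simp add: rel_potential_def)

lemma energy_ge:
  assumes "fst y \<ge> 0"
  shows "energy u y \<ge> rel_potential (fst y)" "energy u y \<ge> 1 / 2 * ((norm (snd y - fst y *\<^sub>R u))\<^sup>2 / fst y)" "energy u y \<ge> 0"
proof -
  have "1 / 2 * ((norm (snd y - fst y *\<^sub>R u))\<^sup>2 / fst y) \<ge> 0" using assms by simp
  with rel_potential_nonneg[OF assms]
  show "energy u y \<ge> rel_potential (fst y)" "energy u y \<ge> 1 / 2 * ((norm (snd y - fst y *\<^sub>R u))\<^sup>2 / fst y)" "energy u y \<ge> 0"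
    unfolding energy_def by linarith+
qed

lemma deriv_pressure_potential: "deriv (pressure_potential a \<gamma>) rinf = a / (\<gamma> - 1) * (\<gamma> * rinf powr (\<gamma> - 1))"
  unfolding pressure_potential_def using rinf_pos
  by (intro DERIV_imp_deriv DERIV_cmult has_real_derivative_powr)

lemma rel_energy_eq:
  fixes u w :: "real^'n"
  shows "rel_energy a \<gamma> rinf u r w = (if admissible (r, w) then ennreal (energy u (r, w)) else \<infinity>)"
proof (cases "admissible (r, w)")
  case True
  have "1 / 2 * ((norm (w - r *\<^sub>R u))\<^sup>2 / r) = 1/2 * ((norm w)\<^sup>2 / r) - w \<bullet> u + 1/2 * r * (norm u)\<^sup>2"
  proof (cases "r = 0")
    case True
    then show ?thesis using \<open>admissible (r, w)\<close> by (simp add: admissible_def)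
  next
    case False
    have "(norm (w - r *\<^sub>R u))\<^sup>2 = (norm w)\<^sup>2 - 2 * r * (w \<bullet> u) + r\<^sup>2 * (norm u)\<^sup>2"
      unfolding power2_norm_eq_inner
      by (simp add: inner_diff_left inner_diff_right inner_commute power2_eq_square algebra_simps)
    then show ?thesis using False by (simp add: field_simps power2_eq_square)
  qed
  then have "energy u (r, w) = 1/2 * ((norm w)\<^sup>2 / r) - w \<bullet> u + 1/2 * r * (norm u)\<^sup>2
        + pressure_potential a \<gamma> r - deriv (pressure_potential a \<gamma>) rinf * (r - rinf)
        - pressure_potential a \<gamma> rinf"
  proof -
    have "rel_potential r = a / (\<gamma> - 1) * r powr \<gamma> - a / (\<gamma> - 1) * (\<gamma> * rinf powr (\<gamma> - 1)) * (r - rinf) - a / (\<gamma> - 1) * rinf powr \<gamma>"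
      unfolding rel_potential_def right_diff_distrib[of "a / (\<gamma> - 1)"] mult.assoc by linarith
    then show ?thesis
      using \<open>1 / 2 * ((norm (w - r *\<^sub>R u))\<^sup>2 / r) = 1/2 * ((norm w)\<^sup>2 / r) - w \<bullet> u + 1/2 * r * (norm u)\<^sup>2\<close>
      unfolding energy_def deriv_pressure_potential pressure_potential_def fst_conv snd_conv by linarith
  qed
  then show ?thesis using True by (auto simp: rel_energy_def admissible_def)
qed (auto simp: rel_energy_def admissible_def)

text \<open>Superlinear growth of the potential, from \<gamma> > 1; the arbitrarily small
  coefficient is what later controls tails.\<close>

lemma density_le_potential:
  assumes "e > 0"
  shows "\<exists>C\<ge>0. \<forall>r\<ge>0. r \<le> e * rel_potential r + C"
proof -
  define k where "k = a / (\<gamma> - 1)"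
  define A where "A = \<gamma> * rinf powr (\<gamma> - 1)"
  \<comment> \<open>The first bound makes the coefficient d/k of the potential at most e/2; the
    second lets half of \<open>r\<close> absorb the linear term d A r.\<close>
  define d where "d = min (e * k) (1 / A) / 2"
  have pos: "k > 0" "A > 0" using a_pos \<gamma>_gt_1 rinf_pos by (auto simp: k_def A_def)
  then have d: "d > 0" using assms by (simp add: d_def)
  \<comment> \<open>Beyond this density d r^(\<gamma>-1) is at least 1, so the power
    dominates.\<close>
  define M where "M = (1 / d) powr (1 / (\<gamma> - 1))"
  have M: "r \<le> d * r powr \<gamma> + M" if "r \<ge> 0" for r
  proof (cases "r \<le> M")
    case True
    then show ?thesis using d by (simp add: add_increasing)
  next
    case False
    have M0: "M > 0" using d by (simp add: M_def)
    have "1 / d = M powr (\<gamma> - 1)"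
      using d \<gamma>_gt_1 by (simp add: M_def powr_powr)
    also have "\<dots> \<le> r powr (\<gamma> - 1)"
      using False M0 \<gamma>_gt_1 by (intro powr_mono2) auto
    finally have "1 \<le> d * r powr (\<gamma> - 1)" using d by (simp add: field_simps)
    then have "r * 1 \<le> r * (d * r powr (\<gamma> - 1))" using that by (rule mult_left_mono)
    also have "\<dots> = d * r powr \<gamma>"
      using False M0 by (simp add: powr_diff field_simps)
    finally show ?thesis using M0 by simp
  qed
  have pw: "r powr \<gamma> = rel_potential r / k + rinf powr \<gamma> + A * (r - rinf)" for r
  proof -
    have "rel_potential r = k * (r powr \<gamma> - rinf powr \<gamma> - A * (r - rinf))"
      by (simp add: rel_potential_def k_def A_def)
    then show ?thesis using pos(1) by simp
  qed
  have "r \<le> e * rel_potential r + 2 * (d * rinf powr \<gamma> + M)" if r: "r \<ge> 0" for r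
  proof -
    have "r \<le> d * (rel_potential r / k + rinf powr \<gamma> + A * (r - rinf)) + M"
      using M[OF r] unfolding pw[symmetric] .
    also have "\<dots> = d / k * rel_potential r + d * rinf powr \<gamma> + (d * A) * (r - rinf) + M"
      by (simp add: algebra_simps)
    finally have 1: "r \<le> d / k * rel_potential r + d * rinf powr \<gamma> + (d * A) * (r - rinf) + M" .
    have "d * A \<le> 1 / 2" using pos by (simp add: d_def field_simps min_def)
    then have "(d * A) * r \<le> 1 / 2 * r" using r by (rule mult_right_mono)
    moreover have "(d * A) * rinf \<ge> 0" using d pos rinf_pos by simp
    ultimately have 2: "(d * A) * (r - rinf) \<le> r / 2" by (simp add: algebra_simps)
    have "d \<le> (e / 2) * k" by (simp add: d_def)
    then have "d / k \<le> e / 2" using pos by (simp add: divide_le_eq)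
    then have 3: "d / k * rel_potential r \<le> e / 2 * rel_potential r"
      using rel_potential_nonneg[OF r] by (rule mult_right_mono)
    define x y z where "x = d / k * rel_potential r" and "y = (d * A) * (r - rinf)" and "z = e * rel_potential r"
    have "r \<le> x + d * rinf powr \<gamma> + y + M" "y \<le> r / 2" "x \<le> z / 2"
      using 1 2 3 by (simp_all add: x_def y_def z_def)
    then have "r \<le> z + 2 * (d * rinf powr \<gamma> + M)" by (simp add: field_simps)
    then show ?thesis by (simp add: z_def)
  qed
  moreover have "M > 0" using d by (simp add: M_def)
  then have "0 \<le> 2 * (d * rinf powr \<gamma> + M)" using d by (simp add: add_nonneg_nonneg less_imp_le)
  ultimately show ?thesis by blast
qed

lemma momentum_young:
  fixes v :: "real^'n"
  assumes "r > 0" "e > 0"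
  shows "norm v \<le> e * (1 / 2 * ((norm v)\<^sup>2 / r)) + r / (2 * e)"
proof -
  have "0 \<le> (e * norm v - r)\<^sup>2" by simp
  then have "2 * (e * norm v * r) \<le> (e * norm v)\<^sup>2 + r\<^sup>2"
    by (simp add: power2_diff)
  then show ?thesis using assms by (simp add: field_simps power2_eq_square)
qed

text \<open>With coefficient 1 this gives integrability of the state; with a small one it gives
  equi-integrability of the sequence, used for the tails in the strong convergence.\<close>

lemma state_le_energy:
  fixes u :: "real^'n"
  assumes "e > 0"
  shows "\<exists>C\<ge>0. \<forall>y. admissible y \<longrightarrow> norm y \<le> e * energy u y + C"
proof -
  \<comment> \<open>Collects the multiples of the density: 1/(2e) from Young's inequality, the norm
    of \<open>u\<close> from the shift of velocity, and 1 from the density component of the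
    state.\<close>
  define k where "k = 1 / (2 * e) + norm u + 1"
  have k: "k > 0" using assms by (simp add: k_def add_pos_nonneg add_nonneg_pos)
  obtain C where C: "C \<ge> 0" "\<And>r. r \<ge> 0 \<Longrightarrow> r \<le> e / k * rel_potential r + C"
    using density_le_potential[of "e / k"] assms k by auto
  have "norm y \<le> e * energy u y + k * C" if adm: "admissible y" for y
  proof -
    obtain r w where y: "y = (r, w)" by (cases y)
    have r: "r \<ge> 0" "r = 0 \<Longrightarrow> w = 0" using adm by (auto simp: y admissible_def)
    have "norm y \<le> r + norm w"
      unfolding y using norm_triangle_ineq[of "(r, 0)" "(0, w)"] r(1) by (simp add: norm_Pair)
    also have "norm w \<le> norm (w - r *\<^sub>R u) + r * norm u"
      using norm_triangle_ineq[of "w - r *\<^sub>R u" "r *\<^sub>R u"] r(1) by simp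
    also have "norm (w - r *\<^sub>R u) \<le> e * (1 / 2 * ((norm (w - r *\<^sub>R u))\<^sup>2 / r)) + r / (2 * e)"
      using momentum_young[of r e "w - r *\<^sub>R u"] r assms by (cases "r = 0") auto
    finally have "norm y \<le> e * (1 / 2 * ((norm (w - r *\<^sub>R u))\<^sup>2 / r)) + k * r"
      by (simp add: k_def algebra_simps)
    also have "k * r \<le> k * (e / k * rel_potential r + C)"
      using C(2)[OF r(1)] k by (intro mult_left_mono) auto
    also have "\<dots> = e * rel_potential r + k * C" using k by (simp add: algebra_simps)
    finally show ?thesis by (simp add: y energy_def algebra_simps)
  qed
  then show ?thesis using C(1) k by (intro exI[of _ "k * C"]) auto
qed

lemma norm_sq_split:
  fixes v w :: "real^'n"
  shows "(norm (v + w))\<^sup>2 \<le> 2 * (norm v)\<^sup>2 + 2 * (norm w)\<^sup>2"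
proof -
  have "(norm (v + w))\<^sup>2 \<le> (norm v + norm w)\<^sup>2" by (intro power_mono norm_triangle_ineq) simp
  also have "\<dots> \<le> 2 * (norm v)\<^sup>2 + 2 * (norm w)\<^sup>2"
    using sum_squares_bound[of "norm v" "norm w"] by (simp add: power2_sum)
  finally show ?thesis .
qed

lemma kinetic_shift:
  fixes u v w :: "real^'n"
  assumes "r \<ge> 0"
  shows "(norm (w - r *\<^sub>R u))\<^sup>2 / r \<le> 2 * ((norm (w - r *\<^sub>R v))\<^sup>2 / r) + 2 * r * (norm (u - v))\<^sup>2"
proof (cases "r = 0")
  case False
  then have r: "r > 0" using assms by simp
  have "(norm (w - r *\<^sub>R u))\<^sup>2 \<le> 2 * (norm (w - r *\<^sub>R v))\<^sup>2 + 2 * (norm (r *\<^sub>R (v - u)))\<^sup>2"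
    using norm_sq_split[of "w - r *\<^sub>R v" "r *\<^sub>R (v - u)"] by (simp add: algebra_simps)
  also have "(norm (r *\<^sub>R (v - u)))\<^sup>2 = r\<^sup>2 * (norm (u - v))\<^sup>2"
    by (simp add: power_mult_distrib norm_minus_commute)
  finally have "(norm (w - r *\<^sub>R u))\<^sup>2 / r \<le> (2 * (norm (w - r *\<^sub>R v))\<^sup>2 + 2 * (r\<^sup>2 * (norm (u - v))\<^sup>2)) / r"
    using r by (intro divide_right_mono) auto
  also have "\<dots> = 2 * ((norm (w - r *\<^sub>R v))\<^sup>2 / r) + 2 * r * (norm (u - v))\<^sup>2"
    using r by (simp add: field_simps power2_eq_square)
  finally show ?thesis .
qed simp

text \<open>The constant is uniform for \<open>v\<close> in a ball, as needed to pass from the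
  variable field \<open>U\<close> to the constant far field on a bounded region. The additive 1 is
  the price of bounding the density by its potential.\<close>

lemma energy_compare:
  fixes u :: "real^'n"
  shows "\<exists>C\<ge>1. \<forall>v y. norm v \<le> R \<and> admissible y \<longrightarrow> energy u y \<le> C * (energy v y + 1)"
proof -
  obtain C where C: "C \<ge> 0" "\<And>r. r \<ge> 0 \<Longrightarrow> r \<le> 1 * rel_potential r + C"
    using density_le_potential[of 1] by auto
  define k where "k = (norm u + \<bar>R\<bar>)\<^sup>2"
  have k: "k \<ge> 0" by (simp add: k_def)
  have "energy u y \<le> (2 + k * (1 + C)) * (energy v y + 1)" if "norm v \<le> R" and adm: "admissible y" for v y
  proof -
    obtain r w where y: "y = (r, w)" by (cases y)
    have r: "r \<ge> 0" using adm by (auto simp: y admissible_def)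
    define K where "K = 1 / 2 * ((norm (w - r *\<^sub>R v))\<^sup>2 / r)"
    have K: "K \<ge> 0" using r by (simp add: K_def)
    have "norm (u - v) \<le> norm u + \<bar>R\<bar>"
      using norm_triangle_ineq4[of u v] that(1) by linarith
    then have "(norm (u - v))\<^sup>2 \<le> k" unfolding k_def by (intro power_mono) auto
    then have "r * (norm (u - v))\<^sup>2 \<le> r * k" using r by (rule mult_left_mono)
    also have "\<dots> \<le> (rel_potential r + C) * k" using C(2)[OF r] k by (intro mult_right_mono) auto
    finally have 1: "r * (norm (u - v))\<^sup>2 \<le> (rel_potential r + C) * k" .
    have P: "rel_potential r \<ge> 0" by (rule rel_potential_nonneg[OF r])
    have "energy u y \<le> 2 * K + r * (norm (u - v))\<^sup>2 + rel_potential r"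
      using kinetic_shift[OF r, of w u v] by (simp add: energy_def y K_def)
    also have "\<dots> \<le> 2 * K + (rel_potential r + C) * k + rel_potential r"
      using 1 by simp
    also have "\<dots> \<le> (2 + k * (1 + C)) * (K + rel_potential r + 1)"
    proof -
      have "0 \<le> k * K" "0 \<le> k * C * K" "0 \<le> k * C * rel_potential r" "0 \<le> k * C"
        using k K P C(1) by simp_all
      then show ?thesis using K P k by (simp add: algebra_simps)
    qed
    finally show ?thesis by (simp add: energy_def y K_def)
  qed
  moreover have "2 + k * (1 + C) \<ge> 1" using k C(1) by (simp add: add_increasing2)
  ultimately show ?thesis by blast
qed

text \<open>Comparison with the energy relative to velocity 0 isolates the kinetic energy; the power
  of the density is a multiple of its potential up to affine terms.\<close>

lemma kinetic_le_energy:
  fixes u :: "real^'n"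
  shows "\<exists>C\<ge>0. \<forall>y. admissible y \<longrightarrow> (norm (snd y))\<^sup>2 / fst y \<le> C * (energy u y + 1) \<and> (fst y) powr \<gamma> \<le> C * (energy u y + 1)"
proof -
  obtain C where C: "C \<ge> 1" "\<And>y. admissible y \<Longrightarrow> energy 0 y \<le> C * (energy u y + 1)"
    using energy_compare[where u = 0 and R = "norm u"] by auto
  obtain D where D: "D \<ge> 0" "\<And>r. r \<ge> 0 \<Longrightarrow> r \<le> 1 * rel_potential r + D"
    using density_le_potential[of 1] by auto
  define k where "k = a / (\<gamma> - 1)"
  define A where "A = \<gamma> * rinf powr (\<gamma> - 1)"
  have pos: "k > 0" "A > 0" using a_pos \<gamma>_gt_1 rinf_pos by (auto simp: k_def A_def)
  define E where "E = 2 * C + 1 / k + rinf powr \<gamma> + A + A * D"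
  have E: "E \<ge> 2 * C" "E \<ge> 1 / k + A" "E \<ge> rinf powr \<gamma> + A * D" "E \<ge> 0"
    using C(1) D(1) pos by (auto simp: E_def)
  have "(norm (snd y))\<^sup>2 / fst y \<le> E * (energy u y + 1) \<and> (fst y) powr \<gamma> \<le> E * (energy u y + 1)" if adm: "admissible y" for y
  proof
    have r: "fst y \<ge> 0" using adm by (simp add: admissible_def)
    note en = energy_ge[OF r, of u]
    have "(norm (snd y))\<^sup>2 / fst y \<le> 2 * energy 0 y"
      using energy_ge(2)[OF r, of 0] by simp
    also have "\<dots> \<le> 2 * C * (energy u y + 1)" using C(2)[OF adm] by simp
    also have "\<dots> \<le> E * (energy u y + 1)" using E(1) en(3) by (intro mult_right_mono) auto
    finally show "(norm (snd y))\<^sup>2 / fst y \<le> E * (energy u y + 1)" .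
    have P: "rel_potential (fst y) \<ge> 0" by (rule rel_potential_nonneg[OF r])
    have "rel_potential (fst y) = k * ((fst y) powr \<gamma> - rinf powr \<gamma> - A * (fst y - rinf))"
      by (simp add: rel_potential_def k_def A_def)
    then have "(fst y) powr \<gamma> = rel_potential (fst y) / k + rinf powr \<gamma> + A * (fst y - rinf)"
      using pos(1) by simp
    also have "\<dots> \<le> rel_potential (fst y) / k + rinf powr \<gamma> + A * (rel_potential (fst y) + D)"
      using D(2)[OF r] rinf_pos pos by (intro add_left_mono mult_left_mono) auto
    also have "\<dots> = (1 / k + A) * rel_potential (fst y) + (rinf powr \<gamma> + A * D)"
      by (simp add: algebra_simps)
    also have "\<dots> \<le> E * rel_potential (fst y) + E"
      using E P by (intro add_mono mult_right_mono) auto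
    also have "\<dots> \<le> E * (energy u y + 1)"
      using en(1) E(4) by (simp add: algebra_simps mult_left_mono)
    finally show "(fst y) powr \<gamma> \<le> E * (energy u y + 1)" .
  qed
  then show ?thesis using E(4) by blast
qed

text \<open>Compactly supported continuous functions below the relative energy and converging to it; the last term produces the
  value infinity for negative densities, \<open>1 / Suc m\<close> the one for vacuum with nonzero momentum.\<close>

definition trunc_energy :: "real^'n \<Rightarrow> nat \<Rightarrow> real \<times> (real^'n) \<Rightarrow> real" where
  "trunc_energy u m y = max 0 (min 1 (real m - norm y)) *
     (1 / 2 * ((norm (snd y - fst y *\<^sub>R u))\<^sup>2 / (max 0 (fst y) + 1 / real (Suc m)))
       + rel_potential (max 0 (fst y)) + real m * max 0 (- fst y))"

lemma trunc_energy_nonneg: "trunc_energy u m y \<ge> 0"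
  unfolding trunc_energy_def
  by (intro mult_nonneg_nonneg add_nonneg_nonneg rel_potential_nonneg divide_nonneg_nonneg) auto

lemma test_fun_trunc_energy: "test_fun 0 UNIV (trunc_energy (u :: real^'n) m)"
proof -
  have "continuous_on UNIV (\<lambda>r. max 0 r powr \<gamma> :: real)"
    using \<gamma>_gt_1 by (intro continuous_on_powr') (auto intro!: continuous_intros)
  then have "continuous_on UNIV (\<lambda>r. rel_potential (max 0 r))"
    unfolding rel_potential_def
    by (intro continuous_on_mult continuous_on_diff continuous_on_const continuous_on_max continuous_on_id)
  from continuous_on_compose2[OF this continuous_on_fst[OF continuous_on_id]]
  have "continuous_on UNIV (\<lambda>y :: real \<times> (real^'n). rel_potential (max 0 (fst y)))" by simp
  moreover have "max 0 (fst y) + 1 / real (Suc m) \<noteq> 0" for y :: "real \<times> (real^'n)"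
    by (simp add: add_nonneg_eq_0_iff)
  ultimately have "continuous_on UNIV (trunc_energy u m)"
    unfolding trunc_energy_def by (intro continuous_intros) auto
  moreover have "trunc_energy u m y = 0" if "y \<notin> cball 0 (real m)" for y
    using that by (simp add: trunc_energy_def)
  ultimately show ?thesis
    unfolding test_fun_def by (auto intro!: exI[of _ "cball 0 (real m)"] simp: zero_enat_def)
qed

text \<open>On admissible states the summand 1/(m+1) in the denominator only lowers the kinetic
  term; on all others the energy is infinite.\<close>

lemma trunc_energy_le: "ennreal (trunc_energy u m y) \<le> rel_energy a \<gamma> rinf u (fst y) (snd y)"
proof (cases "admissible y")
  case True
  obtain r w where y: "y = (r, w)" by (cases y)
  have r: "r \<ge> 0" "r = 0 \<Longrightarrow> w = 0" using True by (auto simp: y admissible_def)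
  have "(norm (w - r *\<^sub>R u))\<^sup>2 / (r + 1 / real (Suc m)) \<le> (norm (w - r *\<^sub>R u))\<^sup>2 / r"
  proof (cases "r = 0")
    case False
    then show ?thesis using r(1) by (intro divide_left_mono) (auto intro!: mult_pos_pos add_pos_pos)
  qed (simp add: r)
  then have "1 / 2 * ((norm (w - r *\<^sub>R u))\<^sup>2 / (r + 1 / real (Suc m))) + rel_potential r \<le> energy u y"
    unfolding energy_def y fst_conv snd_conv by (intro add_mono mult_left_mono) auto
  then have "trunc_energy u m y \<le> 1 * energy u y"
    unfolding trunc_energy_def y using r(1) rel_potential_nonneg[OF r(1)]
    by (intro mult_mono) (auto intro!: add_nonneg_nonneg divide_nonneg_nonneg)
  then show ?thesis
    using True rel_energy_eq[of u r w] by (simp add: y ennreal_leI)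
next
  case False
  then show ?thesis using rel_energy_eq[of u "fst y" "snd y"] by simp
qed

lemma trunc_energy_tendsto:
  "(\<lambda>m. ennreal (trunc_energy u m y)) \<longlonglongrightarrow> rel_energy a \<gamma> rinf u (fst y) (snd y)"
proof -
  obtain r w where y: "y = (r, w)" by (cases y)
  define g where "g m = 1 / 2 * ((norm (w - r *\<^sub>R u))\<^sup>2 / (max 0 r + 1 / real (Suc m)))
       + rel_potential (max 0 r) + real m * max 0 (- r)" for m
  have ev: "\<forall>\<^sub>F m in sequentially. ennreal (trunc_energy u m y) = ennreal (g m)"
  proof -
    have "\<forall>\<^sub>F m in sequentially. norm y + 1 \<le> real m"
      using filterlim_real_sequentially by (simp add: filterlim_at_top)
    then show ?thesis
      by eventually_elim (simp add: trunc_energy_def g_def y)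
  qed
  have P: "rel_potential (max 0 r) \<ge> 0" by (intro rel_potential_nonneg) simp
  have lim: "(\<lambda>m. 1 / real (Suc m)) \<longlonglongrightarrow> 0" by (rule LIMSEQ_Suc[OF lim_1_over_n])
  have "(\<lambda>m. ennreal (g m)) \<longlonglongrightarrow> rel_energy a \<gamma> rinf u r w"
  proof (cases "admissible (r, w)")
    case True
    then have r: "r \<ge> 0" "r = 0 \<Longrightarrow> w = 0" by (auto simp: admissible_def)
    have "(\<lambda>m. g m) \<longlonglongrightarrow> energy u (r, w)"
    proof (cases "r = 0")
      case True
      then show ?thesis using r by (simp add: g_def energy_def)
    next
      case False
      have "(\<lambda>m. 1 / 2 * ((norm (w - r *\<^sub>R u))\<^sup>2 / (r + 1 / real (Suc m))) + rel_potential r)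
          \<longlonglongrightarrow> 1 / 2 * ((norm (w - r *\<^sub>R u))\<^sup>2 / (r + 0)) + rel_potential r"
        using False r by (intro tendsto_intros lim) auto
      then show ?thesis using r by (simp add: g_def energy_def)
    qed
    then show ?thesis using True by (simp add: rel_energy_eq)
  next
    case False
    then have "r < 0 \<or> (r = 0 \<and> w \<noteq> 0)" by (auto simp: admissible_def)
    then have "filterlim g at_top sequentially"
    proof
      assume r: "r < 0"
      show ?thesis
      proof (rule filterlim_at_top_mono)
        show "filterlim (\<lambda>m. (- r) * real m) at_top sequentially"
          using r by (intro filterlim_tendsto_pos_mult_at_top[OF tendsto_const _ filterlim_real_sequentially]) simp
        show "\<forall>\<^sub>F m in sequentially. (- r) * real m \<le> g m"
          using r P by (intro always_eventually allI) (simp add: g_def add_increasing mult.commute)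
      qed
    next
      assume r: "r = 0 \<and> w \<noteq> 0"
      show ?thesis
      proof (rule filterlim_at_top_mono)
        show "filterlim (\<lambda>m. (1 / 2 * (norm w)\<^sup>2) * real m) at_top sequentially"
          using r by (intro filterlim_tendsto_pos_mult_at_top[OF tendsto_const _ filterlim_real_sequentially]) simp
        show "\<forall>\<^sub>F m in sequentially. (1 / 2 * (norm w)\<^sup>2) * real m \<le> g m"
          using r P by (intro always_eventually allI) (simp add: g_def algebra_simps add_increasing2)
      qed
    qed
    then show ?thesis
      using False by (simp add: rel_energy_eq ennreal_tendsto_top_eq_at_top)
  qed
  with ev show ?thesis unfolding y by (auto intro: Lim_transform_eventually simp: eventually_mono)
qed

end

lemma fst_borel: "fst \<in> borel_measurable borel"
  by (intro borel_measurable_continuous_onI continuous_on_fst continuous_on_id)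

lemma snd_borel: "snd \<in> borel_measurable borel"
  by (intro borel_measurable_continuous_onI continuous_on_snd continuous_on_id)

section \<open>Fluctuations about a reference state and Jensen's inequality\<close>

context isentropic
begin

text \<open>An entry of r (w/r - c) \<otimes> (w/r - c), the convective tensor relative to the
  velocity \<open>c\<close>.\<close>

definition stress_fluct :: "real^'n \<Rightarrow> real \<times> (real^'n) \<Rightarrow> real^'n \<Rightarrow> real^'n \<Rightarrow> real" where
  "stress_fluct c y v v' = ((snd y - fst y *\<^sub>R c) \<bullet> v) * ((snd y - fst y *\<^sub>R c) \<bullet> v') / fst y"

text \<open>The Bregman distance of the pressure law; its mean about the mean density is the Jensen
  defect of the pressure.\<close>

definition pressure_fluct :: "real \<Rightarrow> real \<Rightarrow> real" where
  "pressure_fluct s r = a * (r powr \<gamma> - s powr \<gamma> - \<gamma> * s powr (\<gamma> - 1) * (r - s))"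

lemma pressure_fluct_nonneg: "r \<ge> 0 \<Longrightarrow> s \<ge> 0 \<Longrightarrow> pressure_fluct s r \<ge> 0"
  using powr_tangent[OF \<gamma>_gt_1, of r s] a_pos by (simp add: pressure_fluct_def)

lemma pressure_fluct_eq_0: "r \<ge> 0 \<Longrightarrow> s \<ge> 0 \<Longrightarrow> pressure_fluct s r = 0 \<Longrightarrow> r = s"
  using powr_tangent_strict[OF \<gamma>_gt_1, of r s] a_pos by (auto simp: pressure_fluct_def)

text \<open>The trace of the convective fluctuation plus the pressure fluctuation; for admissible
  states it dominates the entries of both.\<close>

definition fluct :: "real^'n \<Rightarrow> real \<Rightarrow> real \<times> (real^'n) \<Rightarrow> real" where
  "fluct c s y = (norm (snd y - fst y *\<^sub>R c))\<^sup>2 / fst y + pressure_fluct s (fst y)"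

lemma fluct_nonneg: "admissible y \<Longrightarrow> s \<ge> 0 \<Longrightarrow> fluct c s y \<ge> 0"
  using pressure_fluct_nonneg[of "fst y" s] by (simp add: fluct_def admissible_def)

lemma stress_fluct_bound:
  assumes "admissible y"
  shows "\<bar>stress_fluct c y v v'\<bar> \<le> norm v * norm v' * ((norm (snd y - fst y *\<^sub>R c))\<^sup>2 / fst y)"
proof -
  define x where "x = snd y - fst y *\<^sub>R c"
  have r: "fst y \<ge> 0" using assms by (simp add: admissible_def)
  have "\<bar>(x \<bullet> v) * (x \<bullet> v')\<bar> \<le> (norm x * norm v) * (norm x * norm v')"
    unfolding abs_mult by (intro mult_mono Cauchy_Schwarz_ineq2) auto
  also have "\<dots> = norm v * norm v' * (norm x)\<^sup>2" by (simp add: power2_eq_square)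
  finally have "\<bar>(x \<bullet> v) * (x \<bullet> v')\<bar> / fst y \<le> norm v * norm v' * (norm x)\<^sup>2 / fst y"
    using r by (rule divide_right_mono)
  then show ?thesis using r by (simp add: stress_fluct_def x_def abs_mult)
qed

lemma stress_fluct_expand:
  assumes "admissible y"
  shows "stress_fluct c y v v' = (snd y \<bullet> v) * (snd y \<bullet> v') / fst y
    - (c \<bullet> v') * (snd y \<bullet> v) - (c \<bullet> v) * (snd y \<bullet> v') + fst y * (c \<bullet> v) * (c \<bullet> v')"
  using assms unfolding stress_fluct_def admissible_def
  by (cases "fst y = 0") (auto simp: inner_diff_left field_simps)

lemma norm_sq_stress_fluct:
  fixes y :: "real \<times> (real^'n)"
  shows "(norm (snd y - fst y *\<^sub>R c))\<^sup>2 / fst y = (\<Sum>i\<in>Basis. stress_fluct c y i i)"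
proof -
  define x where "x = snd y - fst y *\<^sub>R c"
  have "(norm x)\<^sup>2 = (\<Sum>i\<in>Basis. (x \<bullet> i) * (x \<bullet> i))"
    unfolding power2_norm_eq_inner by (rule euclidean_inner)
  then show ?thesis by (simp add: stress_fluct_def x_def sum_divide_distrib)
qed

text \<open>The reference velocity \<open>c\<close> is the mean weighted by mass. About the means
  the linear terms cancel, so the expected fluctuations are exactly the Jensen defects. The last
  estimate is the variance argument: the expected fluctuation about the mean state does not exceed
  that about the far field state \<open>u\<close>, \<open>rinf\<close>, which is at most \<gamma> +
  1 times the energy.\<close>

lemma jensen_defect:
  fixes Y :: "'s \<Rightarrow> real \<times> (real^'n)" and u :: "real^'n"
  assumes "prob_space M" and Y: "Y \<in> borel_measurable M"
    and adm: "AE s in M. admissible (Y s)"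
    and int: "integrable M (\<lambda>s. energy u (Y s))"
  defines "\<rho> \<equiv> (LINT s|M. fst (Y s))" and "m \<equiv> (LINT s|M. snd (Y s))"
  defines "c \<equiv> (1 / \<rho>) *\<^sub>R m"
  shows jensen_integrable: "integrable M Y" "integrable M (\<lambda>s. (snd (Y s) \<bullet> v) * (snd (Y s) \<bullet> v') / fst (Y s))"
      "integrable M (\<lambda>s. fst (Y s) powr \<gamma>)"
    and jensen_nonneg: "\<rho> \<ge> 0" and jensen_vacuum: "\<rho> = 0 \<Longrightarrow> m = 0"
    and jensen_stress_integrable: "integrable M (\<lambda>s. stress_fluct c (Y s) v v')"
    and jensen_stress: "(LINT s|M. stress_fluct c (Y s) v v') =
      (LINT s|M. (snd (Y s) \<bullet> v) * (snd (Y s) \<bullet> v') / fst (Y s)) - (m \<bullet> v) * (m \<bullet> v') / \<rho>"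
    and jensen_pressure_integrable: "integrable M (\<lambda>s. pressure_fluct \<rho> (fst (Y s)))"
    and jensen_pressure: "(LINT s|M. pressure_fluct \<rho> (fst (Y s))) = (LINT s|M. a * fst (Y s) powr \<gamma>) - a * \<rho> powr \<gamma>"
    and jensen_fluct_integrable: "integrable M (\<lambda>s. fluct c \<rho> (Y s))"
    and jensen_fluct: "(LINT s|M. fluct c \<rho> (Y s)) \<le> (\<gamma> + 1) * (LINT s|M. energy u (Y s))"
proof -
  interpret prob_space M by fact
  have fm [measurable]: "(\<lambda>s. fst (Y s)) \<in> borel_measurable M" and sm [measurable]: "(\<lambda>s. snd (Y s)) \<in> borel_measurable M"
    using measurable_compose[OF Y fst_borel] measurable_compose[OF Y snd_borel] by auto
  obtain C where C: "C \<ge> 0" "\<And>y. admissible y \<Longrightarrow> norm y \<le> 1 * energy u y + C"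
    using state_le_energy[of 1 u] by auto
  obtain D where D: "D \<ge> 0" "\<And>y. admissible y \<Longrightarrow> (norm (snd y))\<^sup>2 / fst y \<le> D * (energy u y + 1)"
    "\<And>y. admissible y \<Longrightarrow> (fst y) powr \<gamma> \<le> D * (energy u y + 1)"
    using kinetic_le_energy[of u] by blast
  show iY: "integrable M Y"
  proof (rule Bochner_Integration.integrable_bound[of M "\<lambda>s. energy u (Y s) + C"])
    show "AE s in M. norm (Y s) \<le> norm (energy u (Y s) + C)"
      using adm by eventually_elim (use C(2) in fastforce)
  qed (use int Y in auto)
  show ik: "integrable M (\<lambda>s. (snd (Y s) \<bullet> v) * (snd (Y s) \<bullet> v') / fst (Y s))" for v v'
  proof (rule Bochner_Integration.integrable_bound[of M "\<lambda>s. norm v * norm v' * (D * (energy u (Y s) + 1))"])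
    show "AE s in M. norm ((snd (Y s) \<bullet> v) * (snd (Y s) \<bullet> v') / fst (Y s)) \<le> norm (norm v * norm v' * (D * (energy u (Y s) + 1)))"
      using adm
    proof eventually_elim
      case (elim s)
      have "\<bar>stress_fluct 0 (Y s) v v'\<bar> \<le> norm v * norm v' * ((norm (snd (Y s)))\<^sup>2 / fst (Y s))"
        using stress_fluct_bound[OF elim, of 0 v v'] by simp
      also have "\<dots> \<le> norm v * norm v' * (D * (energy u (Y s) + 1))"
        using D(2)[OF elim] by (intro mult_left_mono) auto
      finally show ?case by (simp add: stress_fluct_def)
    qed
  qed (use int in auto)
  show ip: "integrable M (\<lambda>s. fst (Y s) powr \<gamma>)"
  proof (rule Bochner_Integration.integrable_bound[of M "\<lambda>s. D * (energy u (Y s) + 1)"])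
    show "AE s in M. norm (fst (Y s) powr \<gamma>) \<le> norm (D * (energy u (Y s) + 1))"
      using adm by eventually_elim (use D(3) in fastforce)
  qed (use int in auto)
  have ir: "integrable M (\<lambda>s. fst (Y s))" and iw: "integrable M (\<lambda>s. snd (Y s))"
    using iY by (rule integrable_fst, rule integrable_snd)
  show \<rho>0: "\<rho> \<ge> 0"
    unfolding \<rho>_def using adm by (intro integral_nonneg_AE) (auto simp: admissible_def elim: eventually_mono)
  show vac: "m = 0" if "\<rho> = 0"
  proof -
    have "AE s in M. fst (Y s) = 0"
      using that adm ir by (subst (asm) \<rho>_def, subst (asm) integral_nonneg_eq_0_iff_AE) (auto simp: admissible_def elim: eventually_mono)
    then have "AE s in M. snd (Y s) = 0"
      using adm by eventually_elim (simp add: admissible_def)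
    then show ?thesis unfolding m_def by (rule integral_eq_zero_AE)
  qed
  \<comment> \<open>In vacuum division by zero gives \<open>c = 0\<close>; this is consistent
    because the mean momentum vanishes too.\<close>
  have mc: "m = \<rho> *\<^sub>R c" unfolding c_def using vac by auto
  have exp: "AE s in M. stress_fluct c' (Y s) v v' = (snd (Y s) \<bullet> v) * (snd (Y s) \<bullet> v') / fst (Y s)
    - (c' \<bullet> v') * (snd (Y s) \<bullet> v) - (c' \<bullet> v) * (snd (Y s) \<bullet> v') + fst (Y s) * (c' \<bullet> v) * (c' \<bullet> v')" for v v' c'
    using adm by eventually_elim (rule stress_fluct_expand)
  have iexp: "integrable M (\<lambda>s. (snd (Y s) \<bullet> v) * (snd (Y s) \<bullet> v') / fst (Y s)
    - (c' \<bullet> v') * (snd (Y s) \<bullet> v) - (c' \<bullet> v) * (snd (Y s) \<bullet> v') + fst (Y s) * (c' \<bullet> v) * (c' \<bullet> v'))" for v v' c'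
    using ik[of v v'] ir iw
    by (intro Bochner_Integration.integrable_add Bochner_Integration.integrable_diff integrable_mult_right integrable_mult_left
      integrable_inner_left)
  have sfm: "(\<lambda>s. stress_fluct c' (Y s) v v') \<in> borel_measurable M" for v v' c'
    unfolding stress_fluct_def by measurable
  have sfi: "integrable M (\<lambda>s. stress_fluct c' (Y s) v v')" for v v' c'
    by (subst integrable_cong_AE[OF sfm _ exp]) (use iexp in auto)
  then show "integrable M (\<lambda>s. stress_fluct c (Y s) v v')" .
  have sf: "(LINT s|M. stress_fluct c' (Y s) v v') =
      (LINT s|M. (snd (Y s) \<bullet> v) * (snd (Y s) \<bullet> v') / fst (Y s))
      - (c' \<bullet> v') * (m \<bullet> v) - (c' \<bullet> v) * (m \<bullet> v') + \<rho> * (c' \<bullet> v) * (c' \<bullet> v')" for v v' c'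
  proof -
    have "(LINT s|M. stress_fluct c' (Y s) v v') = (LINT s|M. (snd (Y s) \<bullet> v) * (snd (Y s) \<bullet> v') / fst (Y s)
    - (c' \<bullet> v') * (snd (Y s) \<bullet> v) - (c' \<bullet> v) * (snd (Y s) \<bullet> v') + fst (Y s) * (c' \<bullet> v) * (c' \<bullet> v'))"
      by (intro integral_cong_AE sfm exp borel_measurable_integrable[OF iexp])
    also have "\<dots> = (LINT s|M. (snd (Y s) \<bullet> v) * (snd (Y s) \<bullet> v') / fst (Y s))
      - (c' \<bullet> v') * (m \<bullet> v) - (c' \<bullet> v) * (m \<bullet> v') + \<rho> * (c' \<bullet> v) * (c' \<bullet> v')"
      using ik[of v v'] ir iw by (simp add: m_def \<rho>_def)
    finally show ?thesis .
  qed
  show sfc: "(LINT s|M. stress_fluct c (Y s) v v') =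
      (LINT s|M. (snd (Y s) \<bullet> v) * (snd (Y s) \<bullet> v') / fst (Y s)) - (m \<bullet> v) * (m \<bullet> v') / \<rho>" for v v'
    unfolding sf by (subst (1 2 3 4) mc) (cases "\<rho> = 0", simp_all)
  show pfi: "integrable M (\<lambda>s. pressure_fluct \<rho> (fst (Y s)))"
    unfolding pressure_fluct_def using ip ir by simp
  have pf: "(LINT s|M. pressure_fluct s' (fst (Y s))) = (LINT s|M. a * fst (Y s) powr \<gamma>) - a * s' powr \<gamma> - a * (\<gamma> * s' powr (\<gamma> - 1) * (\<rho> - s'))" for s'
    unfolding pressure_fluct_def using ip ir by (simp add: \<rho>_def prob_space algebra_simps)
  show "(LINT s|M. pressure_fluct \<rho> (fst (Y s))) = (LINT s|M. a * fst (Y s) powr \<gamma>) - a * \<rho> powr \<gamma>"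
    unfolding pf by simp
  show "integrable M (\<lambda>s. fluct c \<rho> (Y s))"
    unfolding fluct_def norm_sq_stress_fluct using sfi pfi by (intro Bochner_Integration.integrable_add Bochner_Integration.integrable_sum)
  have "(LINT s|M. fluct c \<rho> (Y s)) = (\<Sum>i\<in>Basis. LINT s|M. stress_fluct c (Y s) i i) + (LINT s|M. pressure_fluct \<rho> (fst (Y s)))"
    unfolding fluct_def norm_sq_stress_fluct using sfi pfi by (simp add: Bochner_Integration.integral_sum)
  also have "\<dots> \<le> (\<Sum>i\<in>Basis. LINT s|M. stress_fluct u (Y s) i i) + (LINT s|M. pressure_fluct rinf (fst (Y s)))"
  proof (intro add_mono sum_mono)
    fix i :: "real^'n"
    \<comment> \<open>The parallel axis identity: moving the reference velocity from
      \<open>c\<close> to \<open>u\<close> adds a nonnegative square.\<close>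
    have "(LINT s|M. stress_fluct u (Y s) i i) - (LINT s|M. stress_fluct c (Y s) i i) = \<rho> * ((c - u) \<bullet> i)\<^sup>2"
      unfolding sf by (subst (1 2 3 4) mc) (simp add: inner_diff_left algebra_simps power2_eq_square)
    moreover have "\<rho> * ((c - u) \<bullet> i)\<^sup>2 \<ge> 0" using \<rho>0 by simp
    ultimately show "(LINT s|M. stress_fluct c (Y s) i i) \<le> (LINT s|M. stress_fluct u (Y s) i i)" by linarith
    \<comment> \<open>Its analogue for the pressure, the three-point identity of a Bregman
      distance.\<close>
    have "(LINT s|M. pressure_fluct rinf (fst (Y s))) - (LINT s|M. pressure_fluct \<rho> (fst (Y s))) = pressure_fluct rinf \<rho>"
      unfolding pf by (simp add: pressure_fluct_def algebra_simps)
    then show "(LINT s|M. pressure_fluct \<rho> (fst (Y s))) \<le> (LINT s|M. pressure_fluct rinf (fst (Y s)))"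
      using pressure_fluct_nonneg[OF \<rho>0, of rinf] rinf_pos by linarith
  qed
  also have "\<dots> = (LINT s|M. fluct u rinf (Y s))"
    unfolding fluct_def norm_sq_stress_fluct using sfi ip ir by (simp add: Bochner_Integration.integral_sum pressure_fluct_def)
  also have "\<dots> \<le> (LINT s|M. (\<gamma> + 1) * energy u (Y s))"
  proof (rule integral_mono_AE)
    show "integrable M (\<lambda>s. fluct u rinf (Y s))"
      unfolding fluct_def norm_sq_stress_fluct using sfi ip ir
      by (intro Bochner_Integration.integrable_add Bochner_Integration.integrable_sum) (simp_all add: pressure_fluct_def)
    show "AE s in M. fluct u rinf (Y s) \<le> (\<gamma> + 1) * energy u (Y s)"
      using adm
    proof eventually_elim
      case (elim s)
      then have r: "fst (Y s) \<ge> 0" by (simp add: admissible_def)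
      \<comment> \<open>The kinetic part contributes the factor 2 and the pressure the factor
        \<gamma> - 1, as p = (\<gamma> - 1) P; together \<gamma> + 1.\<close>
      have "pressure_fluct rinf (fst (Y s)) = (\<gamma> - 1) * rel_potential (fst (Y s))"
        using \<gamma>_gt_1 by (simp add: pressure_fluct_def rel_potential_def)
      then have "fluct u rinf (Y s) \<le> 2 * energy u (Y s) + (\<gamma> - 1) * energy u (Y s)"
        unfolding fluct_def using energy_ge[OF r, of u] \<gamma>_gt_1 by (intro add_mono) (auto intro: mult_left_mono)
      then show ?case by (simp add: algebra_simps)
    qed
  qed (use int in simp)
  finally show "(LINT s|M. fluct c \<rho> (Y s)) \<le> (\<gamma> + 1) * (LINT s|M. energy u (Y s))"
    by simp
qed

end

section \<open>The energy of the limit measure\<close>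

lemma st_integral_restrict:
  assumes "I \<in> sets borel" "A \<in> sets borel"
  shows "st_integral I A f = (LINT z|restrict_space lborel (I \<times> A). f (fst z) (snd z))"
  using borel_Times[OF assms] by (simp add: st_integral_def integral_restrict_space set_lebesgue_integral_def)

lemma st_integrable_restrict:
  assumes "I \<in> sets borel" "A \<in> sets borel"
  shows "st_integrable I A f \<longleftrightarrow> integrable (restrict_space lborel (I \<times> A)) (\<lambda>z. f (fst z) (snd z))"
  using borel_Times[OF assms] by (simp add: st_integrable_def set_integrable_def integrable_restrict_space)

lemma L1_norm_restrict:
  assumes "I \<in> sets borel" "A \<in> sets borel"
  shows "L1_norm I A f = (\<integral>\<^sup>+z. ennreal (norm (f (fst z) (snd z))) \<partial>restrict_space lborel (I \<times> A))"
  using borel_Times[OF assms] by (simp add: L1_norm_def st_nn_integral_def nn_integral_restrict_space)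

text \<open>Only continuity is asked of these functions, so they can be built from the distance to
  the complement, which is therefore assumed to be nonempty.\<close>

lemma exhausting_test_functions:
  fixes D :: "'a::euclidean_space set"
  assumes D: "open D" "D \<noteq> UNIV"
  obtains \<phi> :: "nat \<Rightarrow> 'a \<Rightarrow> real" where "\<And>j. test_fun 0 D (\<phi> j)" "\<And>j z. 0 \<le> \<phi> j z \<and> \<phi> j z \<le> 1"
    "\<And>z. z \<in> D \<Longrightarrow> (\<lambda>j. \<phi> j z) \<longlonglongrightarrow> 1"
proof
  define \<phi> where "\<phi> j z = max 0 (min 1 (real j * infdist z (- D) - 1)) * max 0 (min 1 (real j - norm z))" for j and z :: 'a
  show "test_fun 0 D (\<phi> j)" for j
  proof -
    define K where "K = {z. 1 \<le> real j * infdist z (- D)} \<inter> cball 0 (real j)"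
    have "closed {z. 1 \<le> real j * infdist z (- D)}"
      by (intro closed_Collect_le continuous_intros)
    then have "compact K" unfolding K_def by (intro closed_Int_compact compact_cball)
    moreover have "K \<subseteq> D"
    proof
      fix z assume z: "z \<in> K"
      show "z \<in> D"
      proof (rule ccontr)
        assume "z \<notin> D"
        then have "infdist z (- D) = 0" by (intro infdist_zero) simp
        then show False using z by (simp add: K_def)
      qed
    qed
    moreover have "\<phi> j z = 0" if "z \<notin> K" for z
      using that by (auto simp: \<phi>_def K_def)
    moreover have "continuous_on UNIV (\<phi> j)"
      unfolding \<phi>_def by (intro continuous_intros)
    ultimately show ?thesis unfolding test_fun_def by (auto simp: zero_enat_def)
  qed
  show "0 \<le> \<phi> j z \<and> \<phi> j z \<le> 1" for j z
    unfolding \<phi>_def by (auto intro: mult_le_one)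
  show "(\<lambda>j. \<phi> j z) \<longlonglongrightarrow> 1" if "z \<in> D" for z
  proof -
    have "infdist z (- D) > 0"
      using D that by (intro infdist_pos_not_in_closed) auto
    then obtain j0 where j0: "2 / infdist z (- D) \<le> real j0" using real_arch_simple by blast
    have "\<forall>\<^sub>F j in sequentially. real j \<ge> real j0 \<and> real j \<ge> norm z + 1"
      using filterlim_real_sequentially by (simp add: filterlim_at_top eventually_conj)
    then have "\<forall>\<^sub>F j in sequentially. \<phi> j z = 1"
    proof eventually_elim
      case (elim j)
      have "2 \<le> real j0 * infdist z (- D)" using j0 \<open>infdist z (- D) > 0\<close> by (simp add: field_simps)
      also have "\<dots> \<le> real j * infdist z (- D)" using elim \<open>infdist z (- D) > 0\<close> by (intro mult_right_mono) auto
      finally show ?case using elim by (simp add: \<phi>_def)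
    qed
    then show ?thesis by (rule tendsto_eventually)
  qed
qed

lemma rel_energy_measurable:
  fixes u w :: "'s \<Rightarrow> real^'n"
  assumes [measurable]: "u \<in> borel_measurable M" "r \<in> borel_measurable M" "w \<in> borel_measurable M"
  shows "(\<lambda>s. rel_energy a \<gamma> rinf (u s) (r s) (w s)) \<in> borel_measurable M"
  unfolding rel_energy_def pressure_potential_def by measurable

context trajectory_law
begin

lemma Q_borel: "Q \<in> sets borel"
  using open_Q by simp

lemma sigma_finite_cyl: "sigma_finite_measure (cyl Q)"
  by (rule sigma_finite_measure_restrict_space[OF lborel.sigma_finite_measure_axioms]) (use cyl_set[OF Q_borel] in simp)

lemma integrable_bounded_test:
  fixes f :: "real \<times> (real^'n) \<Rightarrow> real"
  assumes f: "f \<in> borel_measurable (cyl Q)" "AE z in cyl Q. \<bar>f z\<bar> \<le> C"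
    and \<phi>: "test_fun 0 ({0<..<T} \<times> Q) \<phi>"
  shows "integrable (cyl Q) (\<lambda>z. f z * \<phi> z)"
proof -
  obtain S where S: "compact S" "S \<subseteq> {0<..<T} \<times> Q" "\<And>z. z \<notin> S \<Longrightarrow> \<phi> z = 0" and \<phi>c: "continuous_on UNIV \<phi>"
    using test_fun_0D[OF \<phi>] by blast
  obtain C' where C': "C' \<ge> 0" "\<And>z. \<bar>\<phi> z\<bar> \<le> C'"
    using compact_support_bounded[OF \<phi>c S(1,3)] by blast
  have Ss: "S \<in> sets (cyl Q)"
    using S(1,2) cyl_set[OF Q_borel] by (subst sets_restrict_space_iff) (auto simp: compact_imp_closed)
  have "emeasure (cyl Q) S < \<infinity>"
    using S(1,2) cyl_set[OF Q_borel] emeasure_bounded_finite[OF compact_imp_bounded[OF S(1)]]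
    by (subst emeasure_restrict_space) (auto simp: Int_absorb2)
  then have ind: "integrable (cyl Q) (\<lambda>z. indicator S z * (C * C'))"
    using Ss by (intro integrable_mult_left integrable_real_indicator) auto
  show ?thesis
  proof (rule Bochner_Integration.integrable_bound[OF ind])
    show "(\<lambda>z. f z * \<phi> z) \<in> borel_measurable (cyl Q)"
      by (rule borel_measurable_times[OF f(1) measurable_restrict_space1])
        (use borel_measurable_continuous_onI[OF \<phi>c] in simp)
    show "AE z in cyl Q. norm (f z * \<phi> z) \<le> norm (indicator S z * (C * C'))"
      using f(2)
    proof eventually_elim
      case (elim z)
      show ?case
      proof (cases "z \<in> S")
        case True
        have "\<bar>f z\<bar> * \<bar>\<phi> z\<bar> \<le> C * C'" using elim C' by (intro mult_mono) auto
        then show ?thesis using True abs_ge_self[of "C * C'"] by (simp add: abs_mult)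
      qed (simp add: S(3))
    qed
  qed
qed

lemma traj_val_meas: "h \<in> trajectories T \<gamma> Q \<Longrightarrow> (\<lambda>z. traj_val h (fst z) (snd z)) \<in> borel_measurable (cyl Q)"
  by (rule traj_val_measurable[OF _ open_Q Q_borel]) auto

lemma test_fun_bounded_measurable:
  fixes b :: "real \<times> (real^'n) \<Rightarrow> real"
  assumes "test_fun 0 UNIV b"
  shows "b \<in> borel_measurable borel" "\<exists>C\<ge>0. \<forall>y. \<bar>b y\<bar> \<le> C"
proof -
  obtain S where S: "compact S" "\<And>z. z \<notin> S \<Longrightarrow> b z = 0" "continuous_on UNIV b"
    using test_fun_0D[OF assms] by metis
  then show "b \<in> borel_measurable borel" by (intro borel_measurable_continuous_onI)
  show "\<exists>C\<ge>0. \<forall>y. \<bar>b y\<bar> \<le> C"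
    using compact_support_bounded[OF S(3,1,2)] by blast
qed

lemma integrable_observable:
  fixes b :: "real \<times> (real^'n) \<Rightarrow> real"
  assumes b: "test_fun 0 UNIV b" and \<phi>: "test_fun 0 ({0<..<T} \<times> Q) \<phi>"
    and f: "f \<in> borel_measurable (cyl Q)"
  shows "integrable (cyl Q) (\<lambda>z. b (f z) * \<phi> z)"
proof -
  obtain C where "\<And>y. \<bar>b y\<bar> \<le> C" using test_fun_bounded_measurable(2)[OF b] by auto
  then show ?thesis
    using measurable_compose[OF f test_fun_bounded_measurable(1)[OF b]]
    by (intro integrable_bounded_test[OF _ _ \<phi>, of _ C]) auto
qed

end

locale cesaro_limit = isentropic a \<gamma> rinf + trajectory_law V T \<gamma> Q
  for a \<gamma> rinf :: real and V :: "'n::finite trajectory measure" and T :: real and Q :: "(real^'n) set" +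
  fixes L Ebar :: real and uinf :: "real^'n" and U :: "real^'n \<Rightarrow> real^'n"
    and seq :: "nat \<Rightarrow> 'n trajectory" and diss :: "nat \<Rightarrow> ennreal" and N :: "nat \<Rightarrow> nat"
  assumes L_pos: "L > 0" and annulus: "- ball 0 L \<subseteq> Q" and U_cont: "continuous_on Q U"
    and U_near: "\<And>x. x \<in> Q \<Longrightarrow> norm x < L \<Longrightarrow> U x = 0"
    and U_far: "\<And>x. x \<in> Q \<Longrightarrow> norm x > 2 * L \<Longrightarrow> U x = uinf"
    and seq_traj: "\<And>n. n \<ge> 1 \<Longrightarrow> seq n \<in> trajectories T \<gamma> Q"
    and seq_energy: "\<And>K. K \<ge> 1 \<Longrightarrow> (\<Sum>n=1..K. (SUP \<tau>\<in>{0..T}. total_energy a \<gamma> Q rinf U (fst (seq n) \<tau>) (snd (seq n) \<tau>))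
       + diss n) / of_nat K \<le> ennreal Ebar"
    and N_lim: "filterlim N at_top sequentially"
    and averages: "\<And>b. test_fun 0 UNIV b \<Longrightarrow> \<exists>g. mean_of T Q V b g \<and>
      (\<forall>K. compact K \<and> K \<subseteq> Q \<longrightarrow>
        (\<lambda>k. L1_norm {0<..<T} K (\<lambda>t x.
           (\<Sum>n=1..N k. b (traj_val (seq n) t x)) / real (N k) - g t x)) \<longlonglongrightarrow> 0)"
begin

text \<open>The reference velocity is the constant \<open>uinf\<close> instead of \<open>U\<close>,
  so that one far field state serves the Jensen estimate at every point.\<close>

abbreviation E0 :: "real \<times> (real^'n) \<Rightarrow> ennreal" where
  "E0 y \<equiv> rel_energy a \<gamma> rinf uinf (fst y) (snd y)"

lemma E0_measurable: "f \<in> borel_measurable M \<Longrightarrow> (\<lambda>s. E0 (f s)) \<in> borel_measurable M"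
  by (intro rel_energy_measurable measurable_compose[OF _ fst_borel] measurable_compose[OF _ snd_borel]) auto

lemma U_bounded: "\<exists>R. \<forall>x\<in>Q. norm x \<le> 2 * L \<longrightarrow> norm (U x) \<le> R"
proof -
  let ?A = "cball 0 (2 * L) - ball 0 L"
  have "compact (U ` ?A)"
    using annulus by (intro compact_continuous_image continuous_on_subset[OF U_cont] compact_diff) auto
  then obtain R where R: "\<And>x. x \<in> ?A \<Longrightarrow> norm (U x) \<le> R"
    using compact_imp_bounded by (force simp: bounded_iff)
  have "norm (U x) \<le> max R 0" if "x \<in> Q" "norm x \<le> 2 * L" for x
    using R[of x] U_near[OF that(1)] that(2) by (cases "norm x < L") auto
  then show ?thesis by blast
qed

text \<open>Beyond radius 2 L the fields \<open>U\<close> and \<open>uinf\<close> agree and no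
  additive term arises; the additive constant of \<open>energy_compare\<close> is confined to a
  ball, so the estimate can be integrated over the unbounded domain.\<close>

lemma E0_compare:
  "\<exists>C>0. \<forall>x\<in>Q. \<forall>y. E0 y \<le> ennreal C * (rel_energy a \<gamma> rinf (U x) (fst y) (snd y) + indicator (cball 0 (2 * L)) x)"
proof -
  obtain R where R: "\<And>x. x \<in> Q \<Longrightarrow> norm x \<le> 2 * L \<Longrightarrow> norm (U x) \<le> R" using U_bounded by blast
  obtain C where C: "C \<ge> 1" "\<And>v y. norm v \<le> R \<Longrightarrow> admissible y \<Longrightarrow> energy uinf y \<le> C * (energy v y + 1)"
    using energy_compare[where u = uinf and R = R] by blast
  have "E0 y \<le> ennreal C * (rel_energy a \<gamma> rinf (U x) (fst y) (snd y) + indicator (cball 0 (2 * L)) x)" if x: "x \<in> Q" for x y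
  proof (cases "admissible y")
    case False
    then show ?thesis using C(1) by (simp add: rel_energy_eq ennreal_mult_top)
  next
    case True
    then have r: "fst y \<ge> 0" by (simp add: admissible_def)
    note nn = energy_ge(3)[OF r]
    show ?thesis
    proof (cases "norm x \<le> 2 * L")
      case True
      have "ennreal (energy uinf y) \<le> ennreal (C * (energy (U x) y + 1))"
        using C(2)[OF R[OF x True] \<open>admissible y\<close>] by (rule ennreal_leI)
      also have "\<dots> = ennreal C * (ennreal (energy (U x) y) + 1)"
        using C(1) nn by (simp add: ennreal_mult')
      finally show ?thesis using True \<open>admissible y\<close> by (simp add: rel_energy_eq)
    next
      case False
      then have "U x = uinf" using U_far[OF x] by simp
      moreover have "energy uinf y \<le> C * energy uinf y" using C(1) nn[of uinf] mult_right_mono[of 1 C] by simp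
      then have "ennreal (energy uinf y) \<le> ennreal C * ennreal (energy uinf y)"
        using C(1) by (simp add: ennreal_leI flip: ennreal_mult')
      ultimately show ?thesis using False \<open>admissible y\<close> by (simp add: rel_energy_eq)
    qed
  qed
  then show ?thesis using C(1) by (intro exI[of _ C]) auto
qed

lemma cyl_nn_integral:
  assumes f: "f \<in> borel_measurable (cyl Q)"
  shows "(\<integral>\<^sup>+z. f z \<partial>cyl Q) = (\<integral>\<^sup>+t. (\<integral>\<^sup>+x. f (t, x) * indicator Q x \<partial>lborel) * indicator {0<..<T} t \<partial>lborel)"
proof -
  have m: "(\<lambda>z. f z * indicator ({0<..<T} \<times> Q) z) \<in> borel_measurable (lborel \<Otimes>\<^sub>M lborel)"
    using f cyl_set[OF Q_borel] unfolding lborel_prod by (subst (asm) borel_measurable_restrict_space_iff_ennreal) auto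
  have "(\<integral>\<^sup>+z. f z \<partial>cyl Q) = (\<integral>\<^sup>+z. f z * indicator ({0<..<T} \<times> Q) z \<partial>lborel)"
    using cyl_set[OF Q_borel] by (simp add: nn_integral_restrict_space)
  also have "\<dots> = (\<integral>\<^sup>+t. \<integral>\<^sup>+x. f (t, x) * indicator ({0<..<T} \<times> Q) (t, x) \<partial>lborel \<partial>lborel)"
    using lborel.nn_integral_fst[OF m] by (simp add: lborel_prod)
  also have "\<dots> = (\<integral>\<^sup>+t. (\<integral>\<^sup>+x. f (t, x) * indicator Q x \<partial>lborel) * indicator {0<..<T} t \<partial>lborel)"
    by (intro nn_integral_cong) (auto simp: indicator_times split: split_indicator)
  finally show ?thesis .
qed

text \<open>The supremum bounds every time slice, so integration in time costs only the factor
  \<open>T\<close>.\<close>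

lemma cyl_energy:
  "\<exists>C\<ge>0. \<forall>h\<in>trajectories T \<gamma> Q. (\<integral>\<^sup>+z. E0 (traj_val h (fst z) (snd z)) \<partial>cyl Q) \<le>
     ennreal C * ((SUP \<tau>\<in>{0..T}. total_energy a \<gamma> Q rinf U (fst h \<tau>) (snd h \<tau>)) + 1)"
proof -
  obtain C where C: "C > 0" "\<And>x y. x \<in> Q \<Longrightarrow> E0 y \<le> ennreal C * (rel_energy a \<gamma> rinf (U x) (fst y) (snd y) + indicator (cball 0 (2 * L)) x)"
    using E0_compare by blast
  \<comment> \<open>At least 1, so that \<open>b\<close> may multiply the energy term as well and be
    factored out.\<close>
  define b where "b = max 1 (measure lborel (cball (0 :: real^'n) (2 * L)))"
  have b: "emeasure lborel (cball (0 :: real^'n) (2 * L)) \<le> ennreal b" "b \<ge> 1"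
    using emeasure_bounded_finite[OF bounded_cball, of "0 :: real^'n" "2 * L"]
    by (auto simp: b_def emeasure_eq_ennreal_measure ennreal_leI)
  have "(\<integral>\<^sup>+z. E0 (traj_val h (fst z) (snd z)) \<partial>cyl Q) \<le>
     ennreal (C * b * T) * ((SUP \<tau>\<in>{0..T}. total_energy a \<gamma> Q rinf U (fst h \<tau>) (snd h \<tau>)) + 1)"
    if h: "h \<in> trajectories T \<gamma> Q" for h
  proof -
    let ?S = "(SUP \<tau>\<in>{0..T}. total_energy a \<gamma> Q rinf U (fst h \<tau>) (snd h \<tau>))"
    have slice: "(\<integral>\<^sup>+x. E0 (traj_val h t x) * indicator Q x \<partial>lborel) \<le> ennreal (C * b) * (?S + 1)" if t: "t \<in> {0..T}" for t
    proof -
      have "Lp_loc \<gamma> Q (fst h t)" "Lp_loc (2 * \<gamma> / (\<gamma> + 1)) Q (snd h t)"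
        using h t unfolding trajectories_def by blast+
      then have [measurable]: "fst h t \<in> borel_measurable (restrict_space lborel Q)" "snd h t \<in> borel_measurable (restrict_space lborel Q)"
        using Q_borel by (auto simp: Lp_loc_def set_borel_measurable_def borel_measurable_restrict_space_iff)
      have [measurable]: "U \<in> borel_measurable (restrict_space lborel Q)"
        using borel_measurable_continuous_on_restrict[OF U_cont] by (simp cong: measurable_cong_sets add: sets_restrict_space)
      have m: "(\<lambda>x. rel_energy a \<gamma> rinf (U x) (fst h t x) (snd h t x)) \<in> borel_measurable (restrict_space lborel Q)"
        by (rule rel_energy_measurable) measurable
      have "(\<integral>\<^sup>+x. E0 (traj_val h t x) * indicator Q x \<partial>lborel) = (\<integral>\<^sup>+x. E0 (traj_val h t x) \<partial>restrict_space lborel Q)"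
        using Q_borel by (simp add: nn_integral_restrict_space)
      also have "\<dots> \<le> (\<integral>\<^sup>+x. ennreal C * (rel_energy a \<gamma> rinf (U x) (fst h t x) (snd h t x) + indicator (cball 0 (2 * L)) x) \<partial>restrict_space lborel Q)"
        using C(2) by (intro nn_integral_mono) (auto simp: space_restrict_space traj_val_def)
      also have "\<dots> = ennreal C * ((\<integral>\<^sup>+x. rel_energy a \<gamma> rinf (U x) (fst h t x) (snd h t x) \<partial>restrict_space lborel Q) + (\<integral>\<^sup>+x. indicator (cball 0 (2 * L)) x \<partial>restrict_space lborel Q))"
      proof -
        have i: "(indicator (cball 0 (2 * L)) :: _ \<Rightarrow> ennreal) \<in> borel_measurable (restrict_space lborel Q)"
          by (intro measurable_restrict_space1 borel_measurable_indicator) simp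
        show ?thesis
          by (simp only: nn_integral_cmult[OF borel_measurable_add[OF m i]] nn_integral_add[OF m i])
      qed
      also have "\<dots> \<le> ennreal C * (?S + ennreal b)"
      proof (intro mult_left_mono add_mono)
        have "(\<integral>\<^sup>+x. rel_energy a \<gamma> rinf (U x) (fst h t x) (snd h t x) \<partial>restrict_space lborel Q) = total_energy a \<gamma> Q rinf U (fst h t) (snd h t)"
          using Q_borel by (simp add: nn_integral_restrict_space total_energy_def)
        then show "(\<integral>\<^sup>+x. rel_energy a \<gamma> rinf (U x) (fst h t x) (snd h t x) \<partial>restrict_space lborel Q) \<le> ?S"
          using SUP_upper[OF t, of "\<lambda>\<tau>. total_energy a \<gamma> Q rinf U (fst h \<tau>) (snd h \<tau>)"] by simp
        have "(\<integral>\<^sup>+x. indicator (cball 0 (2 * L)) x \<partial>restrict_space lborel Q) \<le> (\<integral>\<^sup>+x. indicator (cball 0 (2 * L)) x \<partial>(lborel :: (real^'n) measure))"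
          by (subst nn_integral_restrict_space) (use Q_borel in simp, intro nn_integral_mono, simp split: split_indicator)
        then show "(\<integral>\<^sup>+x. indicator (cball 0 (2 * L)) x \<partial>restrict_space lborel Q) \<le> ennreal b"
          using b(1) by simp
      qed simp
      also have "\<dots> \<le> ennreal C * (ennreal b * ?S + ennreal b)"
        using b(2) mult_right_mono[of 1 "ennreal b" ?S] by (intro mult_left_mono add_mono) (auto simp: ennreal_leI)
      also have "\<dots> = ennreal (C * b) * (?S + 1)"
        using C(1) b(2) by (simp add: ennreal_mult' distrib_left mult.assoc)
      finally show ?thesis .
    qed
    have "(\<integral>\<^sup>+z. E0 (traj_val h (fst z) (snd z)) \<partial>cyl Q) =
      (\<integral>\<^sup>+t. (\<integral>\<^sup>+x. E0 (traj_val h t x) * indicator Q x \<partial>lborel) * indicator {0<..<T} t \<partial>lborel)"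
      using cyl_nn_integral[OF E0_measurable[OF traj_val_meas[OF h]]] by simp
    also have "\<dots> \<le> (\<integral>\<^sup>+t. ennreal (C * b) * (?S + 1) * indicator {0<..<T} t \<partial>lborel)"
      using slice by (intro nn_integral_mono) (auto split: split_indicator)
    also have "\<dots> = ennreal (C * b) * (?S + 1) * ennreal T"
      using T_pos by (simp add: nn_integral_cmult_indicator)
    also have "\<dots> = ennreal (C * b * T) * (?S + 1)"
      using C(1) b(2) T_pos by (simp add: ennreal_mult' ac_simps)
    finally show ?thesis .
  qed
  then show ?thesis using C(1) b(2) T_pos by (intro exI[of _ "C * b * T"]) auto
qed

lemma average_energy:
  "\<exists>C\<ge>0. \<forall>K\<ge>1. (\<Sum>n=1..K. \<integral>\<^sup>+z. E0 (traj_val (seq n) (fst z) (snd z)) \<partial>cyl Q) / of_nat K \<le> ennreal C"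
proof -
  obtain C where C: "C \<ge> 0" "\<And>h. h \<in> trajectories T \<gamma> Q \<Longrightarrow> (\<integral>\<^sup>+z. E0 (traj_val h (fst z) (snd z)) \<partial>cyl Q) \<le>
     ennreal C * ((SUP \<tau>\<in>{0..T}. total_energy a \<gamma> Q rinf U (fst h \<tau>) (snd h \<tau>)) + 1)"
    using cyl_energy by blast
  let ?S = "\<lambda>n. (SUP \<tau>\<in>{0..T}. total_energy a \<gamma> Q rinf U (fst (seq n) \<tau>) (snd (seq n) \<tau>))"
  have "(\<Sum>n=1..K. \<integral>\<^sup>+z. E0 (traj_val (seq n) (fst z) (snd z)) \<partial>cyl Q) / of_nat K \<le> ennreal (C * (\<bar>Ebar\<bar> + 1))" if K: "K \<ge> 1" for K
  proof -
    have "(\<Sum>n=1..K. \<integral>\<^sup>+z. E0 (traj_val (seq n) (fst z) (snd z)) \<partial>cyl Q) \<le> (\<Sum>n=1..K. ennreal C * ((?S n + diss n) + 1))"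
      using C(2) seq_traj by (intro sum_mono order_trans[OF C(2)] mult_left_mono add_right_mono) auto
    also have "\<dots> = ennreal C * ((\<Sum>n=1..K. ?S n + diss n) + of_nat K)"
      by (simp add: sum.distrib flip: sum_distrib_left)
    finally have "(\<Sum>n=1..K. \<integral>\<^sup>+z. E0 (traj_val (seq n) (fst z) (snd z)) \<partial>cyl Q) / of_nat K
        \<le> ennreal C * ((\<Sum>n=1..K. ?S n + diss n) + of_nat K) / of_nat K"
      by (rule divide_right_mono_ennreal)
    also have "\<dots> = ennreal C * ((\<Sum>n=1..K. ?S n + diss n) / of_nat K + of_nat K / of_nat K)"
      by (simp only: ennreal_times_divide[symmetric] add_divide_distrib_ennreal)
    also have "of_nat K / of_nat K = (1 :: ennreal)" using K by (intro ennreal_divide_self) (auto simp: of_nat_less_top)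
    also have "(\<Sum>n=1..K. ?S n + diss n) / of_nat K \<le> ennreal \<bar>Ebar\<bar>"
      using seq_energy[OF K] by (rule order_trans) (simp add: ennreal_leI)
    also have "ennreal C * (ennreal \<bar>Ebar\<bar> + 1) = ennreal (C * (\<bar>Ebar\<bar> + 1))"
      using C(1) by (simp add: ennreal_mult')
    finally show ?thesis by (simp add: mult_left_mono add_right_mono)
  qed
  then show ?thesis using C(1) by (intro exI[of _ "C * (\<bar>Ebar\<bar> + 1)"]) auto
qed

lemma N_pos: "\<forall>\<^sub>F k in sequentially. N k \<ge> 1"
  using N_lim by (simp add: filterlim_at_top)

text \<open>The strong convergence is used on the spatial projection of the support of \<phi>, where
  the bounded \<phi> may be tested against it; the property defining the mean identifies the
  limit.\<close>

lemma averages_limit: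
  fixes b :: "real \<times> (real^'n) \<Rightarrow> real"
  assumes b: "test_fun 0 UNIV b" and \<phi>: "test_fun 0 ({0<..<T} \<times> Q) \<phi>"
  shows "(\<lambda>k. (\<Sum>n=1..N k. LINT z|cyl Q. b (traj_val (seq n) (fst z) (snd z)) * \<phi> z) / real (N k))
    \<longlonglongrightarrow> (LINT h|V. LINT z|cyl Q. b (traj_val h (fst z) (snd z)) * \<phi> z)"
proof -
  obtain g where g: "mean_of T Q V b g"
    and conv: "\<And>K. compact K \<Longrightarrow> K \<subseteq> Q \<Longrightarrow> (\<lambda>k. L1_norm {0<..<T} K (\<lambda>t x.
           (\<Sum>n=1..N k. b (traj_val (seq n) t x)) / real (N k) - g t x)) \<longlonglongrightarrow> 0"
    using averages[OF b] by blast
  obtain S where S: "compact S" "S \<subseteq> {0<..<T} \<times> Q" "\<And>z. z \<notin> S \<Longrightarrow> \<phi> z = 0" and \<phi>c: "continuous_on UNIV \<phi>"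
    using test_fun_0D[OF \<phi>] by blast
  obtain C where C: "C \<ge> 0" "\<And>z. \<bar>\<phi> z\<bar> \<le> C"
    using compact_support_bounded[OF \<phi>c S(1,3)] by blast
  define K where "K = snd ` S"
  have K: "compact K" "K \<subseteq> Q"
    using S(1,2) by (auto simp: K_def intro!: compact_continuous_image continuous_intros)
  have Ks: "K \<in> sets borel" using K(1) by (simp add: compact_imp_closed)
  have gm: "(\<lambda>z. g (fst z) (snd z)) \<in> borel_measurable (cyl Q)"
    using g cyl_set[OF Q_borel] unfolding mean_of_def
    by (auto simp: set_borel_measurable_def borel_measurable_restrict_space_iff)
  obtain Cg where Cg: "AE z in cyl Q. \<bar>g (fst z) (snd z)\<bar> \<le> Cg"
    using g cyl_set[OF Q_borel] unfolding mean_of_def by (auto simp: AE_restrict_space_iff)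
  have gi: "integrable (cyl Q) (\<lambda>z. g (fst z) (snd z) * \<phi> z)"
    by (rule integrable_bounded_test[OF gm Cg \<phi>])
  have lim: "(LINT z|cyl Q. g (fst z) (snd z) * \<phi> z) = (LINT h|V. LINT z|cyl Q. b (traj_val h (fst z) (snd z)) * \<phi> z)"
    using g \<phi> Q_borel unfolding mean_of_def by (simp add: st_integral_restrict traj_val_def)
  define A where "A k t x = (\<Sum>n=1..N k. b (traj_val (seq n) t x)) / real (N k)" for k t x
  have bi: "integrable (cyl Q) (\<lambda>z. b (traj_val (seq n) (fst z) (snd z)) * \<phi> z)" if "n \<in> {1..N k}" for n k
    using that by (intro integrable_observable[OF b \<phi> traj_val_meas] seq_traj) auto
  have Ai: "integrable (cyl Q) (\<lambda>z. A k (fst z) (snd z) * \<phi> z)" for k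
  proof -
    have "(\<lambda>z. A k (fst z) (snd z) * \<phi> z) = (\<lambda>z. (\<Sum>n=1..N k. b (traj_val (seq n) (fst z) (snd z)) * \<phi> z) / real (N k))"
      by (simp add: A_def sum_distrib_right)
    moreover have "integrable (cyl Q) (\<lambda>z. (\<Sum>n=1..N k. b (traj_val (seq n) (fst z) (snd z)) * \<phi> z) / real (N k))"
      by (intro Bochner_Integration.integrable_divide Bochner_Integration.integrable_sum bi)
    ultimately show ?thesis by simp
  qed
  have AI: "(LINT z|cyl Q. A k (fst z) (snd z) * \<phi> z) = (\<Sum>n=1..N k. LINT z|cyl Q. b (traj_val (seq n) (fst z) (snd z)) * \<phi> z) / real (N k)" for k
  proof -
    have "(LINT z|cyl Q. A k (fst z) (snd z) * \<phi> z) = (LINT z|cyl Q. (\<Sum>n=1..N k. b (traj_val (seq n) (fst z) (snd z)) * \<phi> z) / real (N k))"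
      by (simp add: A_def sum_distrib_right)
    also have "\<dots> = (LINT z|cyl Q. (\<Sum>n=1..N k. b (traj_val (seq n) (fst z) (snd z)) * \<phi> z)) / real (N k)"
      by simp
    also have "(LINT z|cyl Q. (\<Sum>n=1..N k. b (traj_val (seq n) (fst z) (snd z)) * \<phi> z)) = (\<Sum>n=1..N k. LINT z|cyl Q. b (traj_val (seq n) (fst z) (snd z)) * \<phi> z)"
      by (rule Bochner_Integration.integral_sum[OF bi])
    finally show ?thesis .
  qed
  have bound: "ennreal \<bar>(LINT z|cyl Q. A k (fst z) (snd z) * \<phi> z) - (LINT z|cyl Q. g (fst z) (snd z) * \<phi> z)\<bar>
     \<le> ennreal C * L1_norm {0<..<T} K (\<lambda>t x. A k t x - g t x)" for k
  proof -
    have i: "integrable (cyl Q) (\<lambda>z. A k (fst z) (snd z) * \<phi> z - g (fst z) (snd z) * \<phi> z)"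
      using Ai gi by simp
    have "ennreal \<bar>(LINT z|cyl Q. A k (fst z) (snd z) * \<phi> z) - (LINT z|cyl Q. g (fst z) (snd z) * \<phi> z)\<bar>
      = ennreal (norm (LINT z|cyl Q. A k (fst z) (snd z) * \<phi> z - g (fst z) (snd z) * \<phi> z))"
      using Ai gi by simp
    also have "\<dots> \<le> (\<integral>\<^sup>+z. ennreal (norm (A k (fst z) (snd z) * \<phi> z - g (fst z) (snd z) * \<phi> z)) \<partial>cyl Q)"
      by (rule integral_norm_bound_ennreal[OF i])
    also have "\<dots> \<le> (\<integral>\<^sup>+z. ennreal C * (ennreal \<bar>A k (fst z) (snd z) - g (fst z) (snd z)\<bar> * indicator ({0<..<T} \<times> K) z) \<partial>cyl Q)"
    proof (rule nn_integral_mono)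
      fix z
      show "ennreal (norm (A k (fst z) (snd z) * \<phi> z - g (fst z) (snd z) * \<phi> z)) \<le> ennreal C * (ennreal \<bar>A k (fst z) (snd z) - g (fst z) (snd z)\<bar> * indicator ({0<..<T} \<times> K) z)"
      proof (cases "z \<in> S")
        case True
        then have zK: "z \<in> {0<..<T} \<times> K" using S(2) by (auto simp: K_def mem_Times_iff)
        have "\<bar>A k (fst z) (snd z) * \<phi> z - g (fst z) (snd z) * \<phi> z\<bar> = \<bar>\<phi> z\<bar> * \<bar>A k (fst z) (snd z) - g (fst z) (snd z)\<bar>"
          by (subst abs_mult[symmetric]) (simp add: algebra_simps)
        also have "\<dots> \<le> C * \<bar>A k (fst z) (snd z) - g (fst z) (snd z)\<bar>" using C(2) by (rule mult_right_mono) simp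
        finally show ?thesis using zK C(1) by (simp add: ennreal_leI flip: ennreal_mult')
      qed (simp add: S(3))
    qed
    also have "\<dots> \<le> ennreal C * L1_norm {0<..<T} K (\<lambda>t x. A k t x - g t x)"
    proof -
      have m: "(\<lambda>z. ennreal \<bar>A k (fst z) (snd z) - g (fst z) (snd z)\<bar>) \<in> borel_measurable (cyl Q)"
      proof -
        have "(\<lambda>z. b (traj_val (seq n) (fst z) (snd z))) \<in> borel_measurable (cyl Q)" if "n \<in> {1..N k}" for n
          using that by (intro measurable_compose[OF traj_val_meas test_fun_bounded_measurable(1)[OF b]] seq_traj) auto
        then show ?thesis unfolding A_def using gm
          by (intro measurable_compose[OF _ measurable_ennreal] borel_measurable_abs borel_measurable_diff borel_measurable_divide
            borel_measurable_sum borel_measurable_const)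
      qed
      have "(\<integral>\<^sup>+z. ennreal C * (ennreal \<bar>A k (fst z) (snd z) - g (fst z) (snd z)\<bar> * indicator ({0<..<T} \<times> K) z) \<partial>cyl Q)
        \<le> ennreal C * (\<integral>\<^sup>+z. ennreal \<bar>A k (fst z) (snd z) - g (fst z) (snd z)\<bar> * indicator ({0<..<T} \<times> K) z \<partial>cyl Q)"
      proof (subst nn_integral_cmult)
        have "indicator ({0<..<T} \<times> K) \<in> borel_measurable (cyl Q)"
          using cyl_set[OF Ks] by (intro measurable_restrict_space1 borel_measurable_indicator) simp
        then show "(\<lambda>z. ennreal \<bar>A k (fst z) (snd z) - g (fst z) (snd z)\<bar> * indicator ({0<..<T} \<times> K) z) \<in> borel_measurable (cyl Q)"
          by (rule borel_measurable_times_ennreal[OF m])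
      qed simp
      also have "(\<integral>\<^sup>+z. ennreal \<bar>A k (fst z) (snd z) - g (fst z) (snd z)\<bar> * indicator ({0<..<T} \<times> K) z \<partial>cyl Q)
        \<le> L1_norm {0<..<T} K (\<lambda>t x. A k t x - g t x)"
        unfolding L1_norm_def st_nn_integral_def using cyl_set[OF Q_borel]
        by (auto simp: nn_integral_restrict_space intro!: nn_integral_mono split: split_indicator)
      finally show ?thesis by (simp add: mult_left_mono)
    qed
    finally show ?thesis .
  qed
  have "(\<lambda>k. ennreal C * L1_norm {0<..<T} K (\<lambda>t x. A k t x - g t x)) \<longlonglongrightarrow> ennreal C * 0"
    using conv[OF K] unfolding A_def by (intro tendsto_mult_ennreal tendsto_const) auto
  then have l0: "(\<lambda>k. ennreal C * L1_norm {0<..<T} K (\<lambda>t x. A k t x - g t x)) \<longlonglongrightarrow> 0"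
    by simp
  have "(\<lambda>k. ennreal \<bar>(LINT z|cyl Q. A k (fst z) (snd z) * \<phi> z) - (LINT z|cyl Q. g (fst z) (snd z) * \<phi> z)\<bar>) \<longlonglongrightarrow> ennreal 0"
    unfolding ennreal_0
  proof (rule tendsto_sandwich[OF _ _ tendsto_const l0])
    show "\<forall>\<^sub>F k in sequentially. 0 \<le> ennreal \<bar>(LINT z|cyl Q. A k (fst z) (snd z) * \<phi> z) - (LINT z|cyl Q. g (fst z) (snd z) * \<phi> z)\<bar>"
      by simp
    show "\<forall>\<^sub>F k in sequentially. ennreal \<bar>(LINT z|cyl Q. A k (fst z) (snd z) * \<phi> z) - (LINT z|cyl Q. g (fst z) (snd z) * \<phi> z)\<bar>
       \<le> ennreal C * L1_norm {0<..<T} K (\<lambda>t x. A k t x - g t x)"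
      by (rule always_eventually) (rule allI, rule bound)
  qed
  then have "(\<lambda>k. \<bar>(LINT z|cyl Q. A k (fst z) (snd z) * \<phi> z) - (LINT z|cyl Q. g (fst z) (snd z) * \<phi> z)\<bar>) \<longlonglongrightarrow> 0"
    by (subst (asm) tendsto_ennreal_iff) auto
  then have "(\<lambda>k. LINT z|cyl Q. A k (fst z) (snd z) * \<phi> z) \<longlonglongrightarrow> (LINT z|cyl Q. g (fst z) (snd z) * \<phi> z)"
    by (rule LIM_zero_cancel[OF tendsto_rabs_zero_cancel])
  then show ?thesis unfolding AI lim .
qed

lemma trunc_energy_limit:
  assumes C0: "C0 \<ge> 0" "\<And>K. K \<ge> 1 \<Longrightarrow> (\<Sum>n=1..K. \<integral>\<^sup>+z. E0 (traj_val (seq n) (fst z) (snd z)) \<partial>cyl Q) / of_nat K \<le> ennreal C0"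
    and \<phi>: "test_fun 0 ({0<..<T} \<times> Q) \<phi>" "\<And>z. 0 \<le> \<phi> z \<and> \<phi> z \<le> 1"
  shows "(LINT h|V. LINT z|cyl Q. trunc_energy uinf j (traj_val h (fst z) (snd z)) * \<phi> z) \<le> C0"
proof (rule LIMSEQ_le_const2[OF averages_limit[OF test_fun_trunc_energy \<phi>(1)]])
  have nonneg: "0 \<le> trunc_energy uinf j y * \<phi> z" for y z
    by (intro mult_nonneg_nonneg trunc_energy_nonneg) (simp add: \<phi>(2))
  have "\<forall>\<^sub>F k in sequentially. (\<Sum>n=1..N k. LINT z|cyl Q. trunc_energy uinf j (traj_val (seq n) (fst z) (snd z)) * \<phi> z) / real (N k) \<le> C0"
    using N_pos
  proof eventually_elim
    case (elim k)
    let ?I = "\<lambda>n. LINT z|cyl Q. trunc_energy uinf j (traj_val (seq n) (fst z) (snd z)) * \<phi> z"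
    have I0: "?I n \<ge> 0" for n
      by (intro Bochner_Integration.integral_nonneg) (simp add: nonneg)
    have I: "ennreal (?I n) \<le> (\<integral>\<^sup>+z. E0 (traj_val (seq n) (fst z) (snd z)) \<partial>cyl Q)" if "n \<in> {1..N k}" for n
    proof -
      have "ennreal (?I n) = (\<integral>\<^sup>+z. ennreal (trunc_energy uinf j (traj_val (seq n) (fst z) (snd z)) * \<phi> z) \<partial>cyl Q)"
        using that
        by (intro nn_integral_eq_integral[symmetric] integrable_observable[OF test_fun_trunc_energy \<phi>(1) traj_val_meas]
          seq_traj AE_I2 nonneg) auto
      also have "\<dots> \<le> (\<integral>\<^sup>+z. E0 (traj_val (seq n) (fst z) (snd z)) \<partial>cyl Q)"
      proof (rule nn_integral_mono)
        fix z
        have "trunc_energy uinf j (traj_val (seq n) (fst z) (snd z)) * \<phi> z \<le> trunc_energy uinf j (traj_val (seq n) (fst z) (snd z))"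
          using trunc_energy_nonneg[of uinf j] \<phi>(2)[of z] by (simp add: mult_left_le)
        then show "ennreal (trunc_energy uinf j (traj_val (seq n) (fst z) (snd z)) * \<phi> z) \<le> E0 (traj_val (seq n) (fst z) (snd z))"
          using trunc_energy_le[of uinf j "traj_val (seq n) (fst z) (snd z)"] by (meson ennreal_leI order_trans)
      qed
      finally show ?thesis .
    qed
    have "ennreal ((\<Sum>n=1..N k. ?I n) / real (N k)) = (\<Sum>n=1..N k. ennreal (?I n)) / of_nat (N k)"
      using I0 elim
      by (subst divide_ennreal[symmetric]) (simp_all add: sum_nonneg sum_ennreal ennreal_of_nat_eq_real_of_nat)
    also have "\<dots> \<le> (\<Sum>n=1..N k. \<integral>\<^sup>+z. E0 (traj_val (seq n) (fst z) (snd z)) \<partial>cyl Q) / of_nat (N k)"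
      by (intro divide_right_mono_ennreal sum_mono I)
    also have "\<dots> \<le> ennreal C0" by (rule C0(2)[OF elim])
    finally show ?case using C0(1) by (simp add: ennreal_le_iff)
  qed
  then show "\<exists>k0. \<forall>k\<ge>k0. (\<Sum>n=1..N k. LINT z|cyl Q. trunc_energy uinf j (traj_val (seq n) (fst z) (snd z)) * \<phi> z) / real (N k) \<le> C0"
    by (simp add: eventually_sequentially)
qed

text \<open>Lower semicontinuity of the energy: each truncated energy is an admissible
  \<open>b\<close>, so its expectation inherits the bound of the averages, and Fatou's lemma removes
  truncation and cutoff together. Joint measurability of \<open>Z\<close> gives a meaning to the
  integral over the product.\<close>

theorem limit_energy:
  assumes Z: "Z \<in> borel_measurable (V \<Otimes>\<^sub>M lborel)"
    and version: "AE h in V. AE z in cyl Q. Z (h, z) = traj_val h (fst z) (snd z)"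
  shows "(\<integral>\<^sup>+w. E0 (Z w) \<partial>(V \<Otimes>\<^sub>M cyl Q)) < \<infinity>"
proof -
  obtain C0 where C0: "C0 \<ge> 0" "\<And>K. K \<ge> 1 \<Longrightarrow> (\<Sum>n=1..K. \<integral>\<^sup>+z. E0 (traj_val (seq n) (fst z) (snd z)) \<partial>cyl Q) / of_nat K \<le> ennreal C0"
    using average_energy by blast
  interpret c: sigma_finite_measure "cyl Q" by (rule sigma_finite_cyl)
  \<comment> \<open>Time 0 is excluded, which provides the nonempty complement that
    \<open>exhausting_test_functions\<close> asks for.\<close>
  have "(0, 0) \<notin> {0<..<T} \<times> Q" by simp
  then have "open ({0<..<T} \<times> Q)" "{0<..<T} \<times> Q \<noteq> UNIV"
    using open_Q by (auto intro!: open_Times simp del: mem_Sigma_iff)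
  then obtain \<phi> where \<phi>: "\<And>j. test_fun 0 ({0<..<T} \<times> Q) (\<phi> j)" "\<And>j z. 0 \<le> \<phi> j z \<and> \<phi> j z \<le> (1 :: real)"
    "\<And>z. z \<in> {0<..<T} \<times> Q \<Longrightarrow> (\<lambda>j. \<phi> j z) \<longlonglongrightarrow> 1"
    using exhausting_test_functions by blast
  have nonneg: "0 \<le> trunc_energy uinf j y * \<phi> j z" for j y z
    by (intro mult_nonneg_nonneg trunc_energy_nonneg) (simp add: \<phi>(2))
  have Zc: "Z \<in> borel_measurable (V \<Otimes>\<^sub>M cyl Q)" by (rule measurable_pair_restrict[OF Z])
  define f where "f j w = ennreal (trunc_energy uinf j (Z w) * \<phi> j (snd w))" for j w
  have \<phi>m: "\<phi> j \<in> borel_measurable borel" for j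
    using test_fun_0D[OF \<phi>(1)[of j]] borel_measurable_continuous_onI by metis
  have fm: "f j \<in> borel_measurable (V \<Otimes>\<^sub>M cyl Q)" for j
  proof -
    have "\<phi> j \<in> borel_measurable (cyl Q)" using \<phi>m by (intro measurable_restrict_space1) simp
    then show ?thesis
      unfolding f_def
      by (intro measurable_compose[OF _ measurable_ennreal] borel_measurable_times measurable_compose[OF measurable_snd]
        measurable_compose[OF Zc test_fun_bounded_measurable(1)[OF test_fun_trunc_energy]])
  qed
  have f_le: "(\<integral>\<^sup>+w. f j w \<partial>(V \<Otimes>\<^sub>M cyl Q)) \<le> ennreal C0" for j
  proof -
    let ?I = "\<lambda>h. LINT z|cyl Q. trunc_energy uinf j (traj_val h (fst z) (snd z)) * \<phi> j z"
    have I0: "?I h \<ge> 0" for h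
      by (intro Bochner_Integration.integral_nonneg) (simp add: nonneg)
    have nn: "(\<integral>\<^sup>+z. ennreal (trunc_energy uinf j (traj_val h (fst z) (snd z)) * \<phi> j z) \<partial>cyl Q) = ennreal (?I h)"
      if "h \<in> space V" for h
      using that
      by (intro nn_integral_eq_integral integrable_observable[OF test_fun_trunc_energy \<phi>(1) traj_val_meas] AE_I2 nonneg)
        (auto simp: space_P)
    obtain Cb where Cb: "Cb \<ge> 0" "\<And>y. \<bar>trunc_energy uinf j y\<bar> \<le> Cb"
      using test_fun_bounded_measurable(2)[OF test_fun_trunc_energy] by blast
    have \<phi>i: "integrable (cyl Q) (\<lambda>z. 1 * \<phi> j z)"
      by (rule integrable_bounded_test[OF _ _ \<phi>(1), of _ 1]) auto
    have Ii: "integrable V ?I"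
    proof (rule integrable_const_bound[of _ "Cb * (LINT z|cyl Q. \<phi> j z)"])
      show "AE h in V. norm (?I h) \<le> Cb * (LINT z|cyl Q. \<phi> j z)"
      proof (rule AE_I2)
        fix h assume "h \<in> space V"
        then have "?I h \<le> (LINT z|cyl Q. Cb * \<phi> j z)"
          using \<phi>i Cb(2) \<phi>(2)
          by (intro integral_mono integrable_observable[OF test_fun_trunc_energy \<phi>(1) traj_val_meas] mult_right_mono)
            (auto simp: space_P abs_le_iff)
        then show "norm (?I h) \<le> Cb * (LINT z|cyl Q. \<phi> j z)" using I0[of h] by simp
      qed
    qed (rule observable_measurable[OF test_fun_trunc_energy \<phi>(1)])
    have "(\<integral>\<^sup>+w. f j w \<partial>(V \<Otimes>\<^sub>M cyl Q)) = (\<integral>\<^sup>+h. \<integral>\<^sup>+z. f j (h, z) \<partial>cyl Q \<partial>V)"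
      by (rule c.nn_integral_fst[OF fm, symmetric])
    also have "\<dots> = (\<integral>\<^sup>+h. ennreal (?I h) \<partial>V)"
    proof (rule nn_integral_cong_AE)
      show "AE h in V. (\<integral>\<^sup>+z. f j (h, z) \<partial>cyl Q) = ennreal (?I h)"
        using version AE_space
      proof eventually_elim
        case (elim h)
        have "(\<integral>\<^sup>+z. f j (h, z) \<partial>cyl Q) = (\<integral>\<^sup>+z. ennreal (trunc_energy uinf j (traj_val h (fst z) (snd z)) * \<phi> j z) \<partial>cyl Q)"
          using elim(1) by (intro nn_integral_cong_AE) (auto simp: f_def elim: eventually_mono)
        then show ?case using nn[OF elim(2)] by simp
      qed
    qed
    also have "\<dots> = ennreal (LINT h|V. ?I h)"
      using Ii I0 by (intro nn_integral_eq_integral) auto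
    also have "\<dots> \<le> ennreal C0"
      by (intro ennreal_leI trunc_energy_limit[OF C0 \<phi>(1,2)])
    finally show ?thesis .
  qed
  have "(\<integral>\<^sup>+w. E0 (Z w) \<partial>(V \<Otimes>\<^sub>M cyl Q)) = (\<integral>\<^sup>+w. liminf (\<lambda>j. f j w) \<partial>(V \<Otimes>\<^sub>M cyl Q))"
  proof (rule nn_integral_cong)
    fix w assume w: "w \<in> space (V \<Otimes>\<^sub>M cyl Q)"
    then have "(\<lambda>j. \<phi> j (snd w)) \<longlonglongrightarrow> 1"
      by (intro \<phi>(3)) (auto simp: space_pair_measure space_restrict_space)
    then have "(\<lambda>j. ennreal (\<phi> j (snd w))) \<longlonglongrightarrow> ennreal 1" by (rule tendsto_ennrealI)
    then have "(\<lambda>j. ennreal (trunc_energy uinf j (Z w)) * ennreal (\<phi> j (snd w))) \<longlonglongrightarrow> E0 (Z w) * 1"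
      by (intro tendsto_mult_ennreal trunc_energy_tendsto) auto
    then have "(\<lambda>j. f j w) \<longlonglongrightarrow> E0 (Z w)"
      by (simp add: f_def ennreal_mult trunc_energy_nonneg \<phi>(2))
    then show "E0 (Z w) = liminf (\<lambda>j. f j w)"
      by (simp add: lim_imp_Liminf)
  qed
  also have "\<dots> \<le> liminf (\<lambda>j. \<integral>\<^sup>+w. f j w \<partial>(V \<Otimes>\<^sub>M cyl Q))"
    by (rule nn_integral_liminf[OF fm])
  also have "\<dots> \<le> ennreal C0"
    using f_le by (intro Liminf_le) (auto intro: always_eventually)
  finally show ?thesis by (auto simp: top_unique less_top[symmetric])
qed

end

section \<open>Statistical equivalence and the expected Euler equations\<close>

definition convective_part :: "real^'n \<Rightarrow> real^'n \<Rightarrow> real \<Rightarrow> real^'n \<Rightarrow> real" where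
  "convective_part v v' r w = (if r > 0 then (w \<bullet> v) * (w \<bullet> v') / r else 0)"

text \<open>The integrand of the momentum equation for the test field
  \<open>\<psi>(t) \<zeta>(x) e\<close> with a fixed direction \<open>e\<close>; both Euler systems
  have their momentum equations tested with such fields only.\<close>

definition euler_obs :: "real \<Rightarrow> real \<Rightarrow> (real \<Rightarrow> real) \<Rightarrow> (real^'n \<Rightarrow> real) \<Rightarrow> real^'n \<Rightarrow> real \<Rightarrow> real^'n \<Rightarrow> real \<Rightarrow> real^'n \<Rightarrow> real" where
  "euler_obs a \<gamma> \<psi> \<zeta> e t x r w = (w \<bullet> e) * (deriv \<psi> t * \<zeta> x)
     + (\<Sum>j\<in>UNIV. convective_part e (axis j 1) r w * (\<psi> t * frechet_derivative \<zeta> (at x) (axis j 1)))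
     + pressure a \<gamma> r * (\<psi> t * frechet_derivative \<zeta> (at x) e)"

lemma inner_axis_1: "(v :: real^'n) \<bullet> axis j 1 = v $ j"
  by (simp add: inner_axis)

lemma jacobian_scaleR:
  fixes \<zeta> :: "real^'n \<Rightarrow> real"
  assumes "\<zeta> differentiable (at x)"
  shows "jacobian (\<lambda>x. \<zeta> x *\<^sub>R e) x = (\<chi> i j. frechet_derivative \<zeta> (at x) (axis j 1) * e $ i)"
proof -
  have "((\<lambda>x. \<zeta> x *\<^sub>R e) has_derivative (\<lambda>v. frechet_derivative \<zeta> (at x) v *\<^sub>R e)) (at x)"
    using assms by (intro has_derivative_scaleR_left) (simp add: frechet_derivative_works)
  then have "frechet_derivative (\<lambda>x. \<zeta> x *\<^sub>R e) (at x) = (\<lambda>v. frechet_derivative \<zeta> (at x) v *\<^sub>R e)"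
    by (rule frechet_derivative_at[symmetric])
  then show ?thesis by (simp add: jacobian_def matrix_def)
qed

lemma convective_inner_jacobian:
  fixes \<zeta> :: "real^'n \<Rightarrow> real"
  assumes "\<zeta> differentiable (at x)"
  shows "convective r w \<bullet> jacobian (\<lambda>x. \<zeta> x *\<^sub>R e) x =
    (\<Sum>j\<in>UNIV. convective_part e (axis j 1) r w * frechet_derivative \<zeta> (at x) (axis j 1))"
proof (cases "r > 0")
  case True
  have "convective r w \<bullet> jacobian (\<lambda>x. \<zeta> x *\<^sub>R e) x =
      (\<Sum>i\<in>UNIV. \<Sum>j\<in>UNIV. 1 / r * (w $ i * w $ j) * (frechet_derivative \<zeta> (at x) (axis j 1) * e $ i))"
    using True by (simp add: convective_def jacobian_scaleR[OF assms] inner_vec_def outer_def sum_distrib_left algebra_simps)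
  also have "\<dots> = (\<Sum>j\<in>UNIV. \<Sum>i\<in>UNIV. 1 / r * (w $ i * w $ j) * (frechet_derivative \<zeta> (at x) (axis j 1) * e $ i))"
    by (rule sum.swap)
  also have "\<dots> = (\<Sum>j\<in>UNIV. convective_part e (axis j 1) r w * frechet_derivative \<zeta> (at x) (axis j 1))"
    using True by (intro sum.cong refl)
      (simp add: convective_part_def inner_axis_1 inner_vec_def[of w e] sum_distrib_left sum_distrib_right sum_divide_distrib algebra_simps)
  finally show ?thesis .
qed (simp add: convective_def convective_part_def)

lemma divergence_scaleR:
  fixes \<zeta> :: "real^'n \<Rightarrow> real"
  assumes "\<zeta> differentiable (at x)"
  shows "divergence (\<lambda>x. \<zeta> x *\<^sub>R e) x = frechet_derivative \<zeta> (at x) e"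
proof -
  have lin: "linear (frechet_derivative \<zeta> (at x))"
    using assms by (simp add: linear_frechet_derivative)
  have "frechet_derivative \<zeta> (at x) e = frechet_derivative \<zeta> (at x) (\<Sum>i\<in>UNIV. e $ i *\<^sub>R axis i 1)"
    using basis_expansion[of e] by (simp add: scalar_mult_eq_scaleR)
  also have "\<dots> = (\<Sum>i\<in>UNIV. e $ i * frechet_derivative \<zeta> (at x) (axis i 1))"
    by (simp add: linear_sum[OF lin] linear_cmul[OF lin])
  finally show ?thesis
    by (simp add: divergence_def trace_def jacobian_scaleR[OF assms] mult.commute)
qed

lemma test_fun_differentiable:
  "test_fun \<infinity> U \<phi> \<Longrightarrow> \<phi> differentiable (at x)"
  unfolding test_fun_infinity_iff by (metis Ck_on.simps(2) UNIV_I)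

lemma euler_obs_stochastic:
  assumes "test_fun \<infinity> Q \<zeta>"
  shows "(w \<bullet> (\<zeta> x *\<^sub>R e)) * deriv \<psi> t + \<psi> t * (convective r w \<bullet> jacobian (\<lambda>x. \<zeta> x *\<^sub>R e) x)
     + \<psi> t * (pressure a \<gamma> r * divergence (\<lambda>x. \<zeta> x *\<^sub>R e) x) = euler_obs a \<gamma> \<psi> \<zeta> e t x r w"
  unfolding euler_obs_def convective_inner_jacobian[OF test_fun_differentiable[OF assms]]
    divergence_scaleR[OF test_fun_differentiable[OF assms]]
  by (simp add: sum_distrib_left algebra_simps)

lemma deriv_eq_frechet:
  fixes \<psi> :: "real \<Rightarrow> real"
  assumes "\<psi> differentiable (at t)"
  shows "deriv \<psi> t = frechet_derivative \<psi> (at t) 1"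
proof -
  have lin: "linear (frechet_derivative \<psi> (at t))" using assms by (rule linear_frechet_derivative)
  have "frechet_derivative \<psi> (at t) v = frechet_derivative \<psi> (at t) 1 * v" for v
    using linear_cmul[OF lin, of v 1] by (simp add: mult.commute)
  then have "frechet_derivative \<psi> (at t) = (*) (frechet_derivative \<psi> (at t) 1)" by (rule ext)
  then have "(\<psi> has_real_derivative frechet_derivative \<psi> (at t) 1) (at t)"
    using assms unfolding frechet_derivative_works has_field_derivative_def by simp
  then show ?thesis by (rule DERIV_imp_deriv)
qed

lemma test_fun_deriv:
  fixes \<psi> :: "real \<Rightarrow> real"
  assumes "test_fun \<infinity> U \<psi>"
  shows "test_fun \<infinity> U (deriv \<psi>)"
proof -
  have "deriv \<psi> = (\<lambda>t. frechet_derivative \<psi> (at t) 1)"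
    by (rule ext) (rule deriv_eq_frechet[OF test_fun_differentiable[OF assms]])
  then show ?thesis using test_fun_frechet_derivative[OF assms, of 1] by simp
qed

text \<open>The product field reduces the deterministic equation to the integrand that
  \<open>euler_obs_stochastic\<close> finds in the stochastic one, so the two can be
  subtracted.\<close>

lemma euler_obs_deterministic:
  fixes \<zeta> :: "real^'n \<Rightarrow> real" and \<psi> :: "real \<Rightarrow> real" and e :: "real^'n"
  assumes \<psi>: "test_fun \<infinity> I \<psi>" and \<zeta>: "test_fun \<infinity> Q \<zeta>"
  defines "\<Phi> \<equiv> (\<lambda>z. (\<psi> (fst z) * \<zeta> (snd z)) *\<^sub>R e)"
  shows "w \<bullet> dt \<Phi> t x + convective r w \<bullet> jacx \<Phi> t x + pressure a \<gamma> r * divx \<Phi> t x = euler_obs a \<gamma> \<psi> \<zeta> e t x r w"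
proof -
  have d\<zeta>: "\<zeta> differentiable (at x)" and d\<psi>: "\<psi> differentiable (at t)"
    using test_fun_differentiable[OF \<zeta>] test_fun_differentiable[OF \<psi>] by auto
  have d: "(\<lambda>x. \<psi> t * \<zeta> x) differentiable (at x)"
    using d\<zeta> by (intro differentiable_mult) auto
  have "((\<lambda>x. \<psi> t * \<zeta> x) has_derivative (\<lambda>v. \<psi> t * frechet_derivative \<zeta> (at x) v)) (at x)"
    using d\<zeta> by (intro has_derivative_mult_right) (simp add: frechet_derivative_works)
  then have f: "frechet_derivative (\<lambda>x. \<psi> t * \<zeta> x) (at x) = (\<lambda>v. \<psi> t * frechet_derivative \<zeta> (at x) v)"
    by (rule frechet_derivative_at[symmetric])
  have "(\<psi> has_real_derivative deriv \<psi> t) (at t)"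
    using d\<psi> by (metis DERIV_deriv_iff_real_differentiable)
  then have "((\<lambda>s. (\<psi> s * \<zeta> x) *\<^sub>R e) has_vector_derivative (deriv \<psi> t * \<zeta> x) *\<^sub>R e) (at t)"
    by (auto intro!: derivative_eq_intros simp: has_real_derivative_iff_has_vector_derivative)
  then have "dt \<Phi> t x = (deriv \<psi> t * \<zeta> x) *\<^sub>R e"
    unfolding dt_def \<Phi>_def by (simp add: vector_derivative_at)
  moreover have "jacx \<Phi> t x = jacobian (\<lambda>x. (\<psi> t * \<zeta> x) *\<^sub>R e) x" "divx \<Phi> t x = divergence (\<lambda>x. (\<psi> t * \<zeta> x) *\<^sub>R e) x"
    by (simp_all add: jacx_def divx_def \<Phi>_def)
  ultimately show ?thesis
    unfolding euler_obs_def using convective_inner_jacobian[OF d] divergence_scaleR[OF d] by (simp add: f algebra_simps)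
qed

text \<open>\<open>observe\<close> is additive only on trajectories whose integrals converge; on the
  exceptional null set it returns default values and may fail to be measurable. Working with
  integrable functions that agree with it almost everywhere makes the notion closed under linear
  combinations.\<close>

definition same_expectation :: "real \<Rightarrow> (real^'n) set \<Rightarrow> 'n trajectory measure \<Rightarrow> 'n trajectory measure \<Rightarrow>
    (real \<Rightarrow> real^'n \<Rightarrow> real \<Rightarrow> real^'n \<Rightarrow> real) \<Rightarrow> bool" where
  "same_expectation T Q P1 P2 g \<longleftrightarrow> (\<exists>I1 I2. integrable P1 I1 \<and> integrable P2 I2 \<and> integral\<^sup>L P1 I1 = (integral\<^sup>L P2 I2 :: real) \<and>
     (AE h in P1. st_integrable {0<..<T} Q (\<lambda>t x. g t x (fst h t x) (snd h t x)) \<and> observe T Q g h = I1 h) \<and>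
     (AE h in P2. st_integrable {0<..<T} Q (\<lambda>t x. g t x (fst h t x) (snd h t x)) \<and> observe T Q g h = I2 h))"

lemma same_expectation_linear:
  assumes "same_expectation T Q P1 P2 f" "same_expectation T Q P1 P2 g"
  shows "same_expectation T Q P1 P2 (\<lambda>t x r w. c * f t x r w + d * g t x r w)"
proof -
  obtain I1 I2 where I: "integrable P1 I1" "integrable P2 I2" "integral\<^sup>L P1 I1 = (integral\<^sup>L P2 I2 :: real)"
     "AE h in P1. st_integrable {0<..<T} Q (\<lambda>t x. f t x (fst h t x) (snd h t x)) \<and> observe T Q f h = I1 h"
     "AE h in P2. st_integrable {0<..<T} Q (\<lambda>t x. f t x (fst h t x) (snd h t x)) \<and> observe T Q f h = I2 h"
    using assms(1) unfolding same_expectation_def by blast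
  obtain J1 J2 where J: "integrable P1 J1" "integrable P2 J2" "integral\<^sup>L P1 J1 = (integral\<^sup>L P2 J2 :: real)"
     "AE h in P1. st_integrable {0<..<T} Q (\<lambda>t x. g t x (fst h t x) (snd h t x)) \<and> observe T Q g h = J1 h"
     "AE h in P2. st_integrable {0<..<T} Q (\<lambda>t x. g t x (fst h t x) (snd h t x)) \<and> observe T Q g h = J2 h"
    using assms(2) unfolding same_expectation_def by blast
  have step: "st_integrable {0<..<T} Q (\<lambda>t x. c * f t x (fst h t x) (snd h t x) + d * g t x (fst h t x) (snd h t x)) \<and>
      observe T Q (\<lambda>t x r w. c * f t x r w + d * g t x r w) h = c * i + d * j"
    if "st_integrable {0<..<T} Q (\<lambda>t x. f t x (fst h t x) (snd h t x)) \<and> observe T Q f h = i"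
       "st_integrable {0<..<T} Q (\<lambda>t x. g t x (fst h t x) (snd h t x)) \<and> observe T Q g h = j" for h i j
    using that unfolding st_integrable_def observe_def st_integral_def by simp
  have "AE h in P1. st_integrable {0<..<T} Q (\<lambda>t x. c * f t x (fst h t x) (snd h t x) + d * g t x (fst h t x) (snd h t x)) \<and>
      observe T Q (\<lambda>t x r w. c * f t x r w + d * g t x r w) h = c * I1 h + d * J1 h"
    using I(4) J(4) by eventually_elim (rule step)
  moreover have "AE h in P2. st_integrable {0<..<T} Q (\<lambda>t x. c * f t x (fst h t x) (snd h t x) + d * g t x (fst h t x) (snd h t x)) \<and>
      observe T Q (\<lambda>t x r w. c * f t x r w + d * g t x r w) h = c * I2 h + d * J2 h"
    using I(5) J(5) by eventually_elim (rule step)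
  moreover have "integral\<^sup>L P1 (\<lambda>h. c * I1 h + d * J1 h) = integral\<^sup>L P2 (\<lambda>h. c * I2 h + d * J2 h)"
    using I J by simp
  moreover have "integrable P1 (\<lambda>h. c * I1 h + d * J1 h)" "integrable P2 (\<lambda>h. c * I2 h + d * J2 h)"
    using I J by simp_all
  ultimately show ?thesis unfolding same_expectation_def by blast
qed

lemma same_expectation_sum:
  assumes "finite J" "J \<noteq> {}" "\<And>j. j \<in> J \<Longrightarrow> same_expectation T Q P1 P2 (g j)"
  shows "same_expectation T Q P1 P2 (\<lambda>t x r w. \<Sum>j\<in>J. g j t x r w)"
  using assms
proof (induction J rule: finite_ne_induct)
  case (insert j J)
  then show ?case using same_expectation_linear[of T Q P1 P2 "g j" "\<lambda>t x r w. \<Sum>j\<in>J. g j t x r w" 1 1] by simp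
qed simp

section \<open>Moments determined by statistical equivalence\<close>

context
  fixes T a \<gamma> :: real and Q :: "(real^'n) set" and P1 P2
  assumes se: "statistically_equivalent T a \<gamma> Q P1 P2"
begin

lemma same_expectation_observable:
  assumes "g \<in> observables T a \<gamma> Q"
  shows "same_expectation T Q P1 P2 g"
  using se assms unfolding statistically_equivalent_def same_expectation_def finite_expectation_def
  by (intro exI[of _ "observe T Q g"]) auto

text \<open>The functional of \<open>(w \<bullet> v)\<^sup>2 / r\<close> is recovered from the angular momenta about the points \<open>v\<close>, \<open>-v\<close>, \<open>0\<close>:
  the second difference of a quadratic polynomial is its leading part.\<close>

lemma same_expectation_convective_diag:
  assumes \<phi>: "test_fun \<infinity> ({0<..<T} \<times> Q) \<phi>"
  shows "same_expectation T Q P1 P2 (\<lambda>t x r w. convective_part v v r w * \<phi> (t, x))"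
proof -
  define k where "k = (\<lambda>(t :: real) x r (w :: real^'n). (if r > 0 then (norm w)\<^sup>2 / r else 0) * \<phi> (t, x :: real^'n) :: real)"
  define q where "q x0 = (\<lambda>(t :: real) x r (w :: real^'n). (if r > 0 then 1 / r * ((angular_matrix x0 x *v w) \<bullet> w) else 0) * \<phi> (t, x :: real^'n) :: real)" for x0
  have k: "same_expectation T Q P1 P2 k" and q: "same_expectation T Q P1 P2 (q x0)" for x0
    unfolding k_def q_def
    by (intro same_expectation_observable observables.kinetic observables.angular \<phi>)+
  have ang: "(angular_matrix x0 x *v w) \<bullet> w = (norm (x - x0))\<^sup>2 * (norm w)\<^sup>2 - ((x - x0) \<bullet> w)\<^sup>2" for x0 x w :: "real^'n"
  proof -
    have "outer y y *v w = (y \<bullet> w) *\<^sub>R y" for y :: "real^'n"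
      by (simp add: vec_eq_iff matrix_vector_mult_def outer_def inner_vec_def sum_distrib_left sum_distrib_right algebra_simps)
    then show ?thesis
      by (simp add: angular_matrix_def matrix_vector_mult_diff_rdistrib scaleR_matrix_vector_assoc[symmetric] inner_diff_left
        flip: power2_norm_eq_inner) (simp add: power2_eq_square)
  qed
  have "(\<lambda>t x r w. convective_part v v r w * \<phi> (t, x)) =
      (\<lambda>t x r w. 1 * ((norm v)\<^sup>2 * k t x r w + (- 1 / 2) * q v t x r w) + 1 * ((- 1 / 2) * q (- v) t x r w + 1 * q 0 t x r w))"
  proof (intro ext)
    fix t x r and w :: "real^'n"
    have sd: "(norm (x - v))\<^sup>2 * (norm w)\<^sup>2 - ((x - v) \<bullet> w)\<^sup>2 + ((norm (x - - v))\<^sup>2 * (norm w)\<^sup>2 - ((x - - v) \<bullet> w)\<^sup>2)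
        - 2 * ((norm (x - 0))\<^sup>2 * (norm w)\<^sup>2 - ((x - 0) \<bullet> w)\<^sup>2) = 2 * (norm v)\<^sup>2 * (norm w)\<^sup>2 - 2 * (w \<bullet> v)\<^sup>2"
      unfolding power2_norm_eq_inner
      by (simp add: inner_diff_left inner_diff_right inner_add_left inner_add_right inner_commute power2_eq_square algebra_simps)
    have "convective_part v v r w = (norm v)\<^sup>2 * (if r > 0 then (norm w)\<^sup>2 / r else 0)
      + (- 1 / 2) * (if r > 0 then 1 / r * ((angular_matrix v x *v w) \<bullet> w) else 0)
      + (- 1 / 2) * (if r > 0 then 1 / r * ((angular_matrix (- v) x *v w) \<bullet> w) else 0)
      + (if r > 0 then 1 / r * ((angular_matrix 0 x *v w) \<bullet> w) else 0)"
    proof (cases "r > 0")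
      case True
      define A where "A x0 = (angular_matrix x0 x *v w) \<bullet> w" for x0
      have "A v + A (- v) - 2 * A 0 = 2 * (norm v)\<^sup>2 * (norm w)\<^sup>2 - 2 * (w \<bullet> v)\<^sup>2"
        using sd unfolding A_def ang .
      then have "(w \<bullet> v) * (w \<bullet> v) = (norm v)\<^sup>2 * (norm w)\<^sup>2 + (- 1 / 2) * A v + (- 1 / 2) * A (- v) + A 0"
        by (simp add: power2_eq_square[of "w \<bullet> v"])
      then show ?thesis
        using True unfolding A_def[symmetric] convective_part_def by (simp add: add_divide_distrib diff_divide_distrib)
    qed (simp add: convective_part_def)
    then show "convective_part v v r w * \<phi> (t, x) =
       1 * ((norm v)\<^sup>2 * k t x r w + (- 1 / 2) * q v t x r w) + 1 * ((- 1 / 2) * q (- v) t x r w + 1 * q 0 t x r w)"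
      unfolding k_def q_def by (simp only: distrib_right mult.assoc mult_1_left add.assoc)
  qed
  moreover have "same_expectation T Q P1 P2 \<dots>"
    by (intro same_expectation_linear k q)
  ultimately show ?thesis by simp
qed

text \<open>Polarization of the quadratic form already recovered from kinetic energy and angular
  momenta.\<close>

lemma same_expectation_convective:
  assumes \<phi>: "test_fun \<infinity> ({0<..<T} \<times> Q) \<phi>"
  shows "same_expectation T Q P1 P2 (\<lambda>t x r w. convective_part v v' r w * \<phi> (t, x))"
proof -
  have "(\<lambda>t x r w. convective_part v v' r w * \<phi> (t, x)) =
    (\<lambda>t x r w. (1 / 2) * (convective_part (v + v') (v + v') r w * \<phi> (t, x)) +
      1 * ((- 1 / 2) * (convective_part v v r w * \<phi> (t, x)) + (- 1 / 2) * (convective_part v' v' r w * \<phi> (t, x))))"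
    by (intro ext) (simp add: convective_part_def inner_add_right field_simps)
  moreover have "same_expectation T Q P1 P2 \<dots>"
    by (intro same_expectation_linear same_expectation_convective_diag \<phi>)
  ultimately show ?thesis by simp
qed

text \<open>The momentum observable gives the term with the time derivative, the polarized moments
  give the convective term, and the internal energy gives the pressure since p = (\<gamma> - 1)
  P.\<close>

lemma same_expectation_euler_obs:
  assumes \<psi>: "test_fun \<infinity> {0<..<T} \<psi>" and \<zeta>: "test_fun \<infinity> Q \<zeta>" and \<gamma>: "\<gamma> > 1"
  shows "same_expectation T Q P1 P2 (euler_obs a \<gamma> \<psi> \<zeta> e)"
proof -
  have "test_fun \<infinity> ({0<..<T} \<times> Q) (\<lambda>z. (deriv \<psi> (fst z) * \<zeta> (snd z)) *\<^sub>R e)"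
    by (intro test_fun_scaleR test_fun_tensor test_fun_deriv \<psi> \<zeta>)
  from same_expectation_observable[OF observables.momentum[OF this]]
  have m: "same_expectation T Q P1 P2 (\<lambda>t x r w. w \<bullet> ((deriv \<psi> t * \<zeta> x) *\<^sub>R e))" by simp
  have D: "test_fun \<infinity> ({0<..<T} \<times> Q) (\<lambda>z. \<psi> (fst z) * frechet_derivative \<zeta> (at (snd z)) v)" for v
    by (rule test_fun_tensor[OF \<psi> test_fun_frechet_derivative[OF \<zeta>]])
  have c: "same_expectation T Q P1 P2 (\<lambda>t x r w. \<Sum>j\<in>UNIV. convective_part e (axis j 1) r w * (\<psi> t * frechet_derivative \<zeta> (at x) (axis j 1)))"
    using same_expectation_convective[OF D] by (intro same_expectation_sum) auto
  from same_expectation_observable[OF observables.internal[OF D[of e]]]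
  have p: "same_expectation T Q P1 P2 (\<lambda>t x r w. pressure_potential a \<gamma> r * (\<psi> t * frechet_derivative \<zeta> (at x) e))" by simp
  have "euler_obs a \<gamma> \<psi> \<zeta> e = (\<lambda>t x r w. 1 * (w \<bullet> ((deriv \<psi> t * \<zeta> x) *\<^sub>R e)) + 1 * (1 *
      (\<Sum>j\<in>UNIV. convective_part e (axis j 1) r w * (\<psi> t * frechet_derivative \<zeta> (at x) (axis j 1)))
      + (\<gamma> - 1) * (pressure_potential a \<gamma> r * (\<psi> t * frechet_derivative \<zeta> (at x) e))))"
  proof -
    have "pressure a \<gamma> r = (\<gamma> - 1) * pressure_potential a \<gamma> r" for r
      using \<gamma> by (simp add: pressure_def pressure_potential_def)
    then show ?thesis by (intro ext) (simp add: euler_obs_def ac_simps)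
  qed
  moreover have "same_expectation T Q P1 P2 \<dots>"
    by (intro same_expectation_linear m c p)
  ultimately show ?thesis by simp
qed

end

text \<open>Along the stochastic solution the functional is almost surely minus an Ito integral and
  so has mean zero. The equivalence carries this mean over to \<open>P\<close>, although the two
  laws may differ.\<close>

theorem expected_euler_obs:
  assumes sol: "stochastic_euler_solution M Filt T a \<gamma> Q W F Y"
    and se: "statistically_equivalent T a \<gamma> Q P (distr M (traj_borel T \<gamma> Q) Y)"
    and \<gamma>: "\<gamma> > 1" and \<psi>: "test_fun \<infinity> {0<..<T} \<psi>" and \<zeta>: "test_fun \<infinity> Q \<zeta>"
  shows "\<exists>I. integrable P I \<and> integral\<^sup>L P I = (0 :: real) \<and>
    (AE h in P. st_integrable {0<..<T} Q (\<lambda>t x. euler_obs a \<gamma> \<psi> \<zeta> e t x (fst h t x) (snd h t x)) \<and> observe T Q (euler_obs a \<gamma> \<psi> \<zeta> e) h = I h)"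
proof -
  let ?B = "traj_borel T \<gamma> Q"
  obtain I1 I2 where I: "integrable P I1" "integrable (distr M ?B Y) I2" "integral\<^sup>L P I1 = (integral\<^sup>L (distr M ?B Y) I2 :: real)"
     "AE h in P. st_integrable {0<..<T} Q (\<lambda>t x. euler_obs a \<gamma> \<psi> \<zeta> e t x (fst h t x) (snd h t x)) \<and> observe T Q (euler_obs a \<gamma> \<psi> \<zeta> e) h = I1 h"
     "AE h in distr M ?B Y. st_integrable {0<..<T} Q (\<lambda>t x. euler_obs a \<gamma> \<psi> \<zeta> e t x (fst h t x) (snd h t x)) \<and> observe T Q (euler_obs a \<gamma> \<psi> \<zeta> e) h = I2 h"
    using same_expectation_euler_obs[OF se \<psi> \<zeta> \<gamma>, of e] unfolding same_expectation_def by blast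
  have Y: "Y \<in> M \<rightarrow>\<^sub>M ?B" and M: "prob_space M" "filtration (space M) Filt" "\<forall>t. sets (Filt t) \<subseteq> sets M" "cylindrical_wiener M Filt T W"
    using sol unfolding stochastic_euler_solution_def by auto
  have tf: "test_fun \<infinity> Q (\<lambda>x. \<zeta> x *\<^sub>R e)" by (rule test_fun_scaleR[OF \<zeta>])
  obtain J where J: "ito_integral_cyl M Filt T W (\<lambda>k s \<omega>. \<psi> s * F k s \<omega> (\<lambda>x. \<zeta> x *\<^sub>R e)) J"
    and J_AE: "AE \<omega> in M. st_integrable {0<..<T} Q (\<lambda>t x. euler_obs a \<gamma> \<psi> \<zeta> e t x (fst (Y \<omega>) t x) (snd (Y \<omega>) t x)) \<and>
      st_integral {0<..<T} Q (\<lambda>t x. euler_obs a \<gamma> \<psi> \<zeta> e t x (fst (Y \<omega>) t x) (snd (Y \<omega>) t x)) = - J \<omega>"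
    \<comment> \<open>The chain of conjuncts selects the momentum equation, instantiated with \<psi>
      and the field \<open>\<zeta> x *\<^sub>R e\<close>.\<close>
    using sol[unfolded stochastic_euler_solution_def Let_def, THEN conjunct2, THEN conjunct2, THEN conjunct2, THEN conjunct2,
      THEN conjunct2, THEN conjunct2, THEN conjunct2, THEN conjunct2, THEN spec[of _ \<psi>], THEN spec[of _ "\<lambda>x. \<zeta> x *\<^sub>R e"],
      THEN mp, OF conjI[OF \<psi> tf], unfolded euler_obs_stochastic[OF \<zeta>]] by blast
  have J0: "integrable M J" "(LINT \<omega>|M. J \<omega>) = 0"
    using ito_integral_cyl_mean_0[OF M J] by auto
  have I2m: "I2 \<in> borel_measurable ?B" using I(2) by (auto dest: borel_measurable_integrable)
  have "integral\<^sup>L (distr M ?B Y) I2 = (LINT \<omega>|M. I2 (Y \<omega>))"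
    by (rule integral_distr[OF Y I2m])
  also have "\<dots> = (LINT \<omega>|M. - J \<omega>)"
  proof (rule integral_cong_AE)
    show "AE \<omega> in M. I2 (Y \<omega>) = - J \<omega>"
      using AE_distrD[OF Y I(5)] J_AE by eventually_elim (simp add: observe_def)
  qed (use measurable_compose[OF Y I2m] J0 in auto)
  also have "\<dots> = 0" using J0 by simp
  finally show ?thesis using I by auto
qed

section \<open>The barycenter and the Jensen defects\<close>

text \<open>The continuity equation pairs the space-time vector (r, w) with the full derivative of
  \<phi>, so the product rule can be applied once in space-time.\<close>

lemma flux_eq_derivative:
  fixes \<phi> :: "real \<times> (real^'n) \<Rightarrow> real"
  assumes "\<phi> differentiable (at (t, x))"
  shows "r * dt \<phi> t x + w \<bullet> gradx \<phi> t x = frechet_derivative \<phi> (at (t, x)) (r, w)"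
proof -
  let ?D = "frechet_derivative \<phi> (at (t, x))"
  have D: "(\<phi> has_derivative ?D) (at (t, x))" using assms by (simp add: frechet_derivative_works)
  have lin: "linear ?D" using assms by (rule linear_frechet_derivative)
  have "((\<lambda>s. (s, x)) has_derivative (\<lambda>s. (s, 0))) (at t)"
    by (intro has_derivative_Pair has_derivative_ident has_derivative_const)
  from has_derivative_compose[OF this, of \<phi> ?D] D
  have dt': "((\<lambda>s. \<phi> (s, x)) has_derivative (\<lambda>s. ?D (s, 0))) (at t)" by simp
  have "(\<lambda>s. ?D (s, 0)) = (\<lambda>s. s *\<^sub>R ?D (1, 0))"
  proof
    fix s
    show "?D (s, 0) = s *\<^sub>R ?D (1, 0)"
      using linear_cmul[OF lin, of s "(1, 0)"] by (simp only: scaleR_Pair real_scaleR_def mult_1_right scaleR_zero_right)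
  qed
  then have "((\<lambda>s. \<phi> (s, x)) has_vector_derivative ?D (1, 0)) (at t)"
    using dt' unfolding has_vector_derivative_def by (simp only:)
  then have dt_eq: "dt \<phi> t x = ?D (1, 0)"
    unfolding dt_def by (rule vector_derivative_at)
  have "((\<lambda>y. (t, y)) has_derivative (\<lambda>y. (0, y))) (at x)"
    by (intro has_derivative_Pair has_derivative_ident has_derivative_const)
  from has_derivative_compose[OF this, of \<phi> ?D] D
  have "((\<lambda>y. \<phi> (t, y)) has_derivative (\<lambda>y. ?D (0, y))) (at x)" by simp
  then have "frechet_derivative (\<lambda>y. \<phi> (t, y)) (at x) = (\<lambda>y. ?D (0, y))"
    by (rule frechet_derivative_at[symmetric])
  then have "w \<bullet> gradx \<phi> t x = (\<Sum>i\<in>UNIV. w $ i *\<^sub>R ?D (0, axis i 1))"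
    by (simp add: gradx_def grad_def inner_vec_def)
  also have "\<dots> = ?D (\<Sum>i\<in>UNIV. w $ i *\<^sub>R (0, axis i 1))"
    by (simp only: linear_sum[OF lin] linear_cmul[OF lin])
  also have "(\<Sum>i\<in>UNIV. w $ i *\<^sub>R ((0 :: real), axis i 1)) = (0, w)"
    using basis_expansion[of w] by (simp add: prod_eq_iff fst_sum snd_sum scalar_mult_eq_scaleR)
  finally have gr: "w \<bullet> gradx \<phi> t x = ?D (0, w)" .
  have "?D (r, w) = ?D (r *\<^sub>R (1, 0) + (0, w))" by simp
  also have "\<dots> = r * ?D (1, 0) + ?D (0, w)"
    by (simp only: linear_add[OF lin] linear_cmul[OF lin] real_scaleR_def)
  finally show ?thesis by (simp only: gr dt_eq)
qed

context isentropic
begin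

lemma energy_measurable: "energy u \<in> borel_measurable borel"
proof -
  note [measurable] = fst_borel snd_borel
  show ?thesis unfolding energy_def[abs_def] rel_potential_def by measurable
qed

end

text \<open>The unbounded linear factor is harmless because the derivative vanishes off a compact
  set.\<close>

lemma test_fun_compact_mult:
  assumes \<phi>: "test_fun \<infinity> U' \<phi>" and f: "integrable M (\<lambda>z. frechet_derivative \<phi> (at z) (g z))"
    and M: "sets M = sets (restrict_space lborel S)"
  shows "integrable M (\<lambda>z. (z \<bullet> d) * frechet_derivative \<phi> (at z) (g z) :: real)"
proof -
  obtain K where K: "compact K" "\<And>x. x \<notin> K \<Longrightarrow> \<phi> x = 0"
    using \<phi> by (auto simp: test_fun_infinity_iff)
  have zero: "frechet_derivative \<phi> (at z) y = 0" if "z \<notin> K" for z y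
  proof -
    have "(\<phi> has_derivative (\<lambda>_. 0)) (at z)"
      by (rule has_derivative_transform_within_open[OF has_derivative_const[of 0], of "- K"])
        (use K that compact_imp_closed in auto)
    then show ?thesis by (metis frechet_derivative_at)
  qed
  obtain R where R: "\<And>z. z \<in> K \<Longrightarrow> norm z \<le> R" using compact_imp_bounded[OF K(1)] by (auto simp: bounded_iff)
  have "(\<lambda>z. z \<bullet> d) \<in> borel_measurable M"
    using M by (subst measurable_cong_sets[OF M refl]) (intro measurable_restrict_space1, simp)
  then show ?thesis
  proof (intro Bochner_Integration.integrable_bound[OF integrable_mult_right[OF f, of "\<bar>R\<bar> * norm d"]] AE_I2)
    fix z
    show "norm ((z \<bullet> d) * frechet_derivative \<phi> (at z) (g z)) \<le> norm (\<bar>R\<bar> * norm d * frechet_derivative \<phi> (at z) (g z))"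
    proof (cases "z \<in> K")
      case True
      have "\<bar>z \<bullet> d\<bar> \<le> norm z * norm d" by (rule Cauchy_Schwarz_ineq2)
      also have "\<dots> \<le> \<bar>R\<bar> * norm d" using R[OF True] by (intro mult_right_mono) auto
      finally show ?thesis by (auto simp: abs_mult intro!: mult_right_mono)
    qed (simp add: zero)
  qed (use f in auto)
qed

text \<open>The stochastic system and the equivalence enter through \<open>expected_obs\<close>
  alone, and \<open>Z\<close> is the jointly measurable version under \<open>V\<close>; from here on
  the argument is deterministic analysis on the product space.\<close>

locale euler_limit = cesaro_limit a \<gamma> rinf V T Q L Ebar uinf U seq diss N
  for a \<gamma> rinf :: real and V :: "'n::finite trajectory measure" and T :: real and Q :: "(real^'n) set"
    and L Ebar uinf U seq diss N +
  fixes \<rho>bar :: "real \<Rightarrow> real^'n \<Rightarrow> real" and mbar :: "real \<Rightarrow> real^'n \<Rightarrow> real^'n"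
    and Z :: "'n trajectory \<times> (real \<times> (real^'n)) \<Rightarrow> real \<times> (real^'n)"
  assumes bary: "barycenter T \<gamma> Q V (\<rho>bar, mbar)"
    and bary_euler: "euler_weak_solution T a \<gamma> Q (\<rho>bar, mbar)"
    and Z_lborel: "Z \<in> borel_measurable (V \<Otimes>\<^sub>M lborel)"
    and Z_version: "AE h in V. AE z in cyl Q. Z (h, z) = traj_val h (fst z) (snd z)"
    and expected_obs: "\<And>\<psi> \<zeta> e. test_fun \<infinity> {0<..<T} \<psi> \<Longrightarrow> test_fun \<infinity> Q \<zeta> \<Longrightarrow>
      \<exists>I. integrable V I \<and> integral\<^sup>L V I = (0 :: real) \<and>
        (AE h in V. st_integrable {0<..<T} Q (\<lambda>t x. euler_obs a \<gamma> \<psi> \<zeta> e t x (fst h t x) (snd h t x)) \<and> observe T Q (euler_obs a \<gamma> \<psi> \<zeta> e) h = I h)"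
begin

sublocale VQ: pair_sigma_finite V "cyl Q"
  by (intro pair_sigma_finite.intro sigma_finite_measure_axioms sigma_finite_cyl)

abbreviation PI where "PI \<equiv> V \<Otimes>\<^sub>M cyl Q"

abbreviation bar :: "real \<times> (real^'n) \<Rightarrow> real \<times> (real^'n)" where
  "bar z \<equiv> traj_val (\<rho>bar, mbar) (fst z) (snd z)"

lemma bar_traj: "(\<rho>bar, mbar) \<in> trajectories T \<gamma> Q"
  using bary by (simp add: barycenter_def)

lemma bar_meas: "bar \<in> borel_measurable (cyl Q)"
  by (rule traj_val_meas[OF bar_traj])

lemma Z_meas: "Z \<in> borel_measurable PI"
  by (rule measurable_pair_restrict[OF Z_lborel])

lemma open_D: "open ({0<..<T} \<times> Q)"
  using open_Q by (intro open_Times) auto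

lemma adm_AE: "AE w in PI. admissible (Z w)"
proof -
  have "AE w in PI. E0 (Z w) \<noteq> \<infinity>"
    using limit_energy[OF Z_lborel Z_version] by (intro nn_integral_PInf_AE E0_measurable Z_meas) auto
  then show ?thesis
    by eventually_elim (metis prod.collapse rel_energy_eq)
qed

lemma energy_integrable: "integrable PI (\<lambda>w. energy uinf (Z w))"
proof (rule integrableI_nonneg)
  show "(\<lambda>w. energy uinf (Z w)) \<in> borel_measurable PI"
    by (rule measurable_compose[OF Z_meas energy_measurable])
  show "AE w in PI. 0 \<le> energy uinf (Z w)"
    using adm_AE by eventually_elim (auto simp: admissible_def intro: energy_ge)
  have "(\<integral>\<^sup>+w. ennreal (energy uinf (Z w)) \<partial>PI) = (\<integral>\<^sup>+w. E0 (Z w) \<partial>PI)"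
    using adm_AE by (intro nn_integral_cong_AE) (auto simp: rel_energy_eq elim: eventually_mono)
  then show "(\<integral>\<^sup>+w. ennreal (energy uinf (Z w)) \<partial>PI) < \<infinity>"
    using limit_energy[OF Z_lborel Z_version] by simp
qed

lemma adm_measurable: "{w \<in> space PI. admissible (Z w)} \<in> sets PI"
proof -
  note [measurable] = measurable_compose[OF Z_meas fst_borel] measurable_compose[OF Z_meas snd_borel]
  show ?thesis unfolding admissible_def by measurable
qed

text \<open>Exchanging the order of the almost-everywhere quantifiers: at almost every space-time
  point the random state is almost surely admissible with finite mean energy, so Jensen's inequality
  applies pointwise.\<close>

lemma slice_AE:
  "AE z in cyl Q. (\<lambda>h. Z (h, z)) \<in> borel_measurable V \<and> (AE h in V. admissible (Z (h, z))) \<and> integrable V (\<lambda>h. energy uinf (Z (h, z)))"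
proof -
  have "AE h in V. AE z in cyl Q. admissible (Z (h, z))"
    using VQ.AE_pair[OF adm_AE] by simp
  then have "AE z in cyl Q. AE h in V. admissible (Z (h, z))"
    using adm_measurable by (subst VQ.AE_commute[symmetric]) (simp_all add: case_prod_beta)
  moreover have "AE z in cyl Q. integrable V (\<lambda>h. energy uinf (Z (h, z)))"
    using VQ.AE_integrable_snd[of "\<lambda>h z. energy uinf (Z (h, z))"] energy_integrable by (simp add: case_prod_beta')
  moreover have "AE z in cyl Q. (\<lambda>h. Z (h, z)) \<in> borel_measurable V"
    using measurable_Pair1[OF Z_meas] by (intro AE_I2) auto
  ultimately show ?thesis by eventually_elim auto
qed

lemma integrable_snd_component:
  fixes f :: "real \<times> (real^'n) \<Rightarrow> real"
  assumes "integrable (cyl Q) f"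
  shows "integrable PI (\<lambda>w. f (snd w))"
proof (rule integrableI_bounded)
  show m: "(\<lambda>w. f (snd w)) \<in> borel_measurable PI"
    using assms by (intro measurable_compose[OF measurable_snd]) auto
  have "(\<integral>\<^sup>+w. ennreal (norm (f (snd w))) \<partial>PI) = (\<integral>\<^sup>+h. \<integral>\<^sup>+z. ennreal (norm (f z)) \<partial>cyl Q \<partial>V)"
    using m by (subst VQ.M2.nn_integral_fst[symmetric]) auto
  also have "\<dots> = (\<integral>\<^sup>+z. ennreal (norm (f z)) \<partial>cyl Q)"
    by (simp add: emeasure_space_1)
  finally show "(\<integral>\<^sup>+w. ennreal (norm (f (snd w))) \<partial>PI) < \<infinity>"
    using assms by (simp add: integrable_iff_bounded)
qed

text \<open>The energy is integrable on the whole cylinder, the additive constant only against a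
  compactly supported weight.\<close>

lemma local_integrable:
  fixes p :: "real \<times> (real^'n) \<Rightarrow> real"
  assumes p: "p \<in> borel_measurable borel" and bd: "\<exists>C\<ge>0. \<forall>y. admissible y \<longrightarrow> \<bar>p y\<bar> \<le> C * (energy uinf y + 1)"
    and \<phi>: "test_fun 0 ({0<..<T} \<times> Q) \<phi>"
  shows "integrable PI (\<lambda>w. p (Z w) * \<phi> (snd w))"
proof -
  obtain C where C: "C \<ge> 0" "\<And>y. admissible y \<Longrightarrow> \<bar>p y\<bar> \<le> C * (energy uinf y + 1)" using bd by blast
  obtain S where S: "compact S" "\<And>z. z \<notin> S \<Longrightarrow> \<phi> z = 0" and \<phi>c: "continuous_on UNIV \<phi>"
    using test_fun_0D[OF \<phi>] by metis
  obtain D where D: "D \<ge> 0" "\<And>z. \<bar>\<phi> z\<bar> \<le> D"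
    using compact_support_bounded[OF \<phi>c S] by blast
  have \<phi>i: "integrable (cyl Q) (\<lambda>z. \<phi> z)"
    using integrable_bounded_test[OF _ _ \<phi>, of "\<lambda>_. 1" 1] by simp
  have \<phi>m: "\<phi> \<in> borel_measurable (cyl Q)" using \<phi>i by simp
  have "integrable PI (\<lambda>w. C * D * energy uinf (Z w) + C * \<bar>\<phi> (snd w)\<bar>)"
    using energy_integrable integrable_snd_component[OF integrable_abs[OF \<phi>i]] by simp
  then show ?thesis
  proof (rule Bochner_Integration.integrable_bound)
    show "(\<lambda>w. p (Z w) * \<phi> (snd w)) \<in> borel_measurable PI"
      by (intro borel_measurable_times measurable_compose[OF Z_meas p] measurable_compose[OF measurable_snd \<phi>m])
    show "AE w in PI. norm (p (Z w) * \<phi> (snd w)) \<le> norm (C * D * energy uinf (Z w) + C * \<bar>\<phi> (snd w)\<bar>)"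
      using adm_AE
    proof eventually_elim
      case (elim w)
      have e: "energy uinf (Z w) \<ge> 0" using elim by (auto simp: admissible_def intro: energy_ge)
      have "\<bar>p (Z w)\<bar> * \<bar>\<phi> (snd w)\<bar> \<le> C * (energy uinf (Z w) + 1) * \<bar>\<phi> (snd w)\<bar>"
        by (intro mult_right_mono C(2) elim) simp
      also have "\<dots> = C * energy uinf (Z w) * \<bar>\<phi> (snd w)\<bar> + C * \<bar>\<phi> (snd w)\<bar>" by (simp add: algebra_simps)
      also have "C * energy uinf (Z w) * \<bar>\<phi> (snd w)\<bar> \<le> C * energy uinf (Z w) * D"
        using C(1) e D by (intro mult_left_mono) auto
      finally show ?case by (simp add: abs_mult ac_simps)
    qed
  qed
qed

text \<open>Local integrability of the barycenter in space-time is not part of the definition of the trajectory space;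
  it follows from the continuity equation tested with \<open>\<phi>\<close> and with \<open>\<phi>\<close> times a linear function.\<close>

lemma bar_integrable:
  assumes \<phi>: "test_fun \<infinity> ({0<..<T} \<times> Q) \<phi>"
  shows "integrable (cyl Q) (\<lambda>z. (bar z \<bullet> d) * \<phi> z)"
proof -
  have D: "integrable (cyl Q) (\<lambda>z. frechet_derivative \<phi> (at z) (bar z))" if \<phi>: "test_fun \<infinity> ({0<..<T} \<times> Q) \<phi>"
    for \<phi> :: "real \<times> (real^'n) \<Rightarrow> real"
  proof -
    have "st_integrable {0<..<T} Q (\<lambda>t x. \<rho>bar t x * dt \<phi> t x + mbar t x \<bullet> gradx \<phi> t x)"
      using bary_euler test_fun_mono[OF \<phi>, of 1] unfolding euler_weak_solution_def continuity_eq_def by (simp add: Let_def)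
    then have "st_integrable {0<..<T} Q (\<lambda>t x. frechet_derivative \<phi> (at (t, x)) (\<rho>bar t x, mbar t x))"
      by (simp add: flux_eq_derivative[OF test_fun_differentiable[OF \<phi>]])
    then show ?thesis using Q_borel by (simp add: st_integrable_restrict traj_val_def)
  qed
  have Cl: "Ck_on j UNIV (\<lambda>z. z \<bullet> d)" for j by (intro Ck_on_intros)
  have prod: "test_fun \<infinity> ({0<..<T} \<times> Q) (\<lambda>z. \<phi> z * (z \<bullet> d))"
    by (rule test_fun_mult_right[OF \<phi> Cl])
  have deriv: "frechet_derivative (\<lambda>z. \<phi> z * (z \<bullet> d)) (at z) y = \<phi> z * (y \<bullet> d) + (z \<bullet> d) * frechet_derivative \<phi> (at z) y" for z y
  proof -
    have "(\<phi> has_derivative frechet_derivative \<phi> (at z)) (at z)"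
      using test_fun_differentiable[OF \<phi>] by (simp add: frechet_derivative_works)
    moreover have "((\<lambda>z. z \<bullet> d) has_derivative (\<lambda>y. y \<bullet> d)) (at z)"
      by (intro derivative_eq_intros) simp_all
    ultimately have "((\<lambda>z. \<phi> z * (z \<bullet> d)) has_derivative (\<lambda>y. \<phi> z * (y \<bullet> d) + frechet_derivative \<phi> (at z) y * (z \<bullet> d))) (at z)"
      by (rule has_derivative_mult)
    note e = frechet_derivative_at[OF this, symmetric]
    show ?thesis unfolding e by (simp only: mult.commute)
  qed
  have "integrable (cyl Q) (\<lambda>z. frechet_derivative (\<lambda>z. \<phi> z * (z \<bullet> d)) (at z) (bar z) - (z \<bullet> d) * frechet_derivative \<phi> (at z) (bar z))"
    by (intro Bochner_Integration.integrable_diff D[OF prod] test_fun_compact_mult[OF \<phi> D[OF \<phi>] refl])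
  moreover have "frechet_derivative (\<lambda>z. \<phi> z * (z \<bullet> d)) (at z) (bar z) - (z \<bullet> d) * frechet_derivative \<phi> (at z) (bar z) = (bar z \<bullet> d) * \<phi> z" for z
    unfolding deriv by simp
  ultimately show ?thesis by (simp only:)
qed

lemma state_bound: "\<exists>C\<ge>0. \<forall>y. admissible y \<longrightarrow> \<bar>y \<bullet> d\<bar> \<le> C * (energy uinf y + 1)"
proof -
  obtain C where C: "C \<ge> 0" "\<And>y. admissible y \<Longrightarrow> norm y \<le> 1 * energy uinf y + C"
    using state_le_energy[of 1 uinf] by auto
  have "\<bar>y \<bullet> d\<bar> \<le> (1 + C) * norm d * (energy uinf y + 1)" if "admissible y" for y
  proof -
    have e: "energy uinf y \<ge> 0" using that by (auto simp: admissible_def intro: energy_ge)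
    have "\<bar>y \<bullet> d\<bar> \<le> norm y * norm d" by (rule Cauchy_Schwarz_ineq2)
    also have "\<dots> \<le> ((1 + C) * (energy uinf y + 1)) * norm d"
    proof (rule mult_right_mono)
      have "0 \<le> C * energy uinf y" using C(1) e by simp
      then show "norm y \<le> (1 + C) * (energy uinf y + 1)" using C(2)[OF that] by (simp add: algebra_simps)
    qed simp
    finally show ?thesis by (simp add: ac_simps)
  qed
  then show ?thesis using C(1) by (intro exI[of _ "(1 + C) * norm d"]) auto
qed

lemma inner_borel: "(\<lambda>y. y \<bullet> d) \<in> borel_measurable borel" for d :: "real \<times> (real^'n)"
  by simp

text \<open>Fubini moves the expectation inside the space-time integral. The two kinds of direction
  \<open>d\<close> reflect that the barycenter is defined separately for density and
  momentum.\<close>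

lemma bar_weak:
  assumes \<phi>: "test_fun \<infinity> ({0<..<T} \<times> Q) \<phi>" and d: "d = (1, 0) \<or> (\<exists>v. d = (0, v))"
  shows "(LINT z|cyl Q. (bar z \<bullet> d) * \<phi> z) = (LINT z|cyl Q. (LINT h|V. Z (h, z) \<bullet> d) * \<phi> z)"
proof -
  note li = local_integrable[OF inner_borel state_bound test_fun_mono[OF \<phi>], of d]
  let ?J = "\<lambda>h. LINT z|cyl Q. (traj_val h (fst z) (snd z) \<bullet> d) * \<phi> z"
  have J: "integrable V ?J \<and> ?J (\<rho>bar, mbar) = integral\<^sup>L V ?J"
    using d
  proof
    assume d: "d = (1, 0)"
    show ?thesis
      using bary test_fun_mono[OF \<phi>, of 1] Q_borel unfolding barycenter_def
      by (simp add: Let_def st_integral_restrict traj_val_def d)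
  next
    assume "\<exists>v. d = (0, v)"
    then obtain v where d: "d = (0, v)" by auto
    have "test_fun 1 ({0<..<T} \<times> Q) (\<lambda>z. \<phi> z *\<^sub>R v)"
      by (rule test_fun_scaleR[OF test_fun_mono[OF \<phi>]])
    from bary[unfolded barycenter_def Let_def, THEN conjunct2, THEN conjunct2, THEN spec[of _ "\<lambda>z. \<phi> z *\<^sub>R v"], THEN mp, OF this]
    show ?thesis
      using Q_borel by (simp add: st_integral_restrict traj_val_def d mult.commute)
  qed
  have "integral\<^sup>L V ?J = (LINT h|V. LINT z|cyl Q. (Z (h, z) \<bullet> d) * \<phi> z)"
  proof (rule integral_cong_AE)
    show "AE h in V. ?J h = (LINT z|cyl Q. (Z (h, z) \<bullet> d) * \<phi> z)"
      using Z_version AE_space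
    proof eventually_elim
      case (elim h)
      show ?case
      proof (rule integral_cong_AE)
        show "AE z in cyl Q. (traj_val h (fst z) (snd z) \<bullet> d) * \<phi> z = (Z (h, z) \<bullet> d) * \<phi> z"
          using elim(1) by eventually_elim simp
        have \<phi>m: "\<phi> \<in> borel_measurable (cyl Q)"
          using integrable_bounded_test[OF _ _ test_fun_mono[OF \<phi>], of "\<lambda>_. 1" 1] by simp
        show "(\<lambda>z. (traj_val h (fst z) (snd z) \<bullet> d) * \<phi> z) \<in> borel_measurable (cyl Q)"
          using elim(2) \<phi>m by (intro borel_measurable_times measurable_compose[OF traj_val_meas inner_borel]) (auto simp: space_P)
        show "(\<lambda>z. (Z (h, z) \<bullet> d) * \<phi> z) \<in> borel_measurable (cyl Q)"
          by (intro borel_measurable_times measurable_compose[OF measurable_Pair2[OF Z_meas elim(2)] inner_borel] \<phi>m)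
      qed
    qed
    show "?J \<in> borel_measurable V" using J by auto
    show "(\<lambda>h. LINT z|cyl Q. (Z (h, z) \<bullet> d) * \<phi> z) \<in> borel_measurable V"
      using VQ.integrable_fst'[OF li] by auto
  qed
  also have "\<dots> = (LINT w|PI. (Z w \<bullet> d) * \<phi> (snd w))"
    using VQ.integral_fst'[OF li] by simp
  also have "\<dots> = (LINT z|cyl Q. LINT h|V. (Z (h, z) \<bullet> d) * \<phi> z)"
    using VQ.integral_snd[of "\<lambda>h z. (Z (h, z) \<bullet> d) * \<phi> z"] li by (simp add: case_prod_beta')
  also have "\<dots> = (LINT z|cyl Q. (LINT h|V. Z (h, z) \<bullet> d) * \<phi> z)"
    by simp
  finally show ?thesis using J by simp
qed

text \<open>The fundamental lemma turns the tested identity into a pointwise one; the indicator in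
  \<open>?f\<close> moves the problem from the cylinder to the whole space.\<close>

lemma mean_component:
  assumes d: "d = (1, 0) \<or> (\<exists>v. d = (0, v))"
  shows "AE z in cyl Q. bar z \<bullet> d = (LINT h|V. Z (h, z) \<bullet> d)"
proof -
  let ?D = "{0<..<T} \<times> Q"
  let ?f = "\<lambda>z. indicator ?D z * (bar z \<bullet> d - (LINT h|V. Z (h, z) \<bullet> d)) :: real"
  have D: "?D \<in> sets borel" by (rule cyl_set[OF Q_borel])
  have "AE z in lborel. z \<in> ?D \<longrightarrow> ?f z = 0"
  proof (rule fundamental_lemma_variations[OF open_D])
    fix \<phi> :: "real \<times> (real^'n) \<Rightarrow> real" assume \<phi>: "test_fun \<infinity> ?D \<phi>"
    note li = local_integrable[OF inner_borel state_bound test_fun_mono[OF \<phi>], of d]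
    have i2: "integrable (cyl Q) (\<lambda>z. (LINT h|V. Z (h, z) \<bullet> d) * \<phi> z)"
      using VQ.integrable_snd[of "\<lambda>h z. (Z (h, z) \<bullet> d) * \<phi> z"] li by (simp add: case_prod_beta')
    have i: "integrable (cyl Q) (\<lambda>z. (bar z \<bullet> d) * \<phi> z - (LINT h|V. Z (h, z) \<bullet> d) * \<phi> z)"
      by (rule Bochner_Integration.integrable_diff[OF bar_integrable[OF \<phi>] i2])
    have eq: "?f z * \<phi> z = indicator ?D z *\<^sub>R ((bar z \<bullet> d) * \<phi> z - (LINT h|V. Z (h, z) \<bullet> d) * \<phi> z)" for z
      by (simp add: algebra_simps)
    show "integrable lborel (\<lambda>z. ?f z * \<phi> z)"
      unfolding eq using i D by (simp add: integrable_restrict_space)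
    have "(LINT z|lborel. ?f z * \<phi> z) = (LINT z|cyl Q. (bar z \<bullet> d) * \<phi> z - (LINT h|V. Z (h, z) \<bullet> d) * \<phi> z)"
      unfolding eq using D by (simp add: integral_restrict_space set_lebesgue_integral_def)
    also have "\<dots> = 0"
      using bar_weak[OF \<phi> d] bar_integrable[OF \<phi>, of d] i2 by simp
    finally show "(LINT z|lborel. ?f z * \<phi> z) = 0" .
  qed
  then show ?thesis using D by (auto simp: AE_restrict_space_iff elim: eventually_mono)
qed

lemma mean_AE: "AE z in cyl Q. bar z = (LINT h|V. fst (Z (h, z)), LINT h|V. snd (Z (h, z)))"
proof -
  have "AE z in cyl Q. \<forall>v\<in>Basis. bar z \<bullet> (0, v) = (LINT h|V. Z (h, z) \<bullet> (0, v))"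
    by (intro AE_finite_allI mean_component) auto
  moreover have "AE z in cyl Q. bar z \<bullet> (1, 0) = (LINT h|V. Z (h, z) \<bullet> (1, 0))"
    by (intro mean_component) auto
  ultimately show ?thesis using slice_AE
  proof eventually_elim
    case (elim z)
    have "integrable V (\<lambda>h. Z (h, z))"
      using elim(3) by (intro jensen_integrable[OF prob_space_axioms]) auto
    then have int: "integrable V (\<lambda>h. snd (Z (h, z)))" by (rule integrable_snd)
    have inner_1: "y \<bullet> (1, 0) = fst y" and inner_0: "y \<bullet> (0, v) = snd y \<bullet> v" for y :: "real \<times> (real^'n)" and v
      by (simp_all add: inner_prod_def)
    have "snd (bar z) = (LINT h|V. snd (Z (h, z)))"
    proof (rule euclidean_eqI)
      fix i :: "real^'n" assume i: "i \<in> Basis"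
      have "snd (bar z) \<bullet> i = (LINT h|V. snd (Z (h, z)) \<bullet> i)"
        using bspec[OF elim(1) i] unfolding inner_0 .
      also have "\<dots> = (LINT h|V. snd (Z (h, z))) \<bullet> i"
        by (rule integral_inner_left) (use int in simp)
      finally show "snd (bar z) \<bullet> i = (LINT h|V. snd (Z (h, z))) \<bullet> i" .
    qed
    moreover have "fst (bar z) = (LINT h|V. fst (Z (h, z)))"
      using elim(2) unfolding inner_1 .
    ultimately show ?case by (metis prod.collapse)
  qed
qed

section \<open>Mean density and velocity, and integrability of the fluctuations\<close>

abbreviation dens :: "real \<times> (real^'n) \<Rightarrow> real" where
  "dens z \<equiv> fst (bar z)"

definition vel :: "real \<times> (real^'n) \<Rightarrow> real^'n" where
  "vel z = (1 / dens z) *\<^sub>R snd (bar z)"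

lemma AE_snd_component:
  assumes "AE z in cyl Q. P z"
  shows "AE w in PI. P (snd w)"
proof -
  obtain N' where N': "{z \<in> space (cyl Q). \<not> P z} \<subseteq> N'" "emeasure (cyl Q) N' = 0" "N' \<in> sets (cyl Q)"
    using assms by (rule AE_E)
  have "AE z in cyl Q. z \<notin> N'" using N' by (intro AE_not_in null_setsI) auto
  then have "AE w in PI. snd w \<notin> N'"
    using N'(3) by (intro VQ.AE_pair_measure) (auto intro!: AE_I2)
  then show ?thesis
    using AE_space
  proof eventually_elim
    case (elim w)
    then have "snd w \<in> space (cyl Q)" by (auto simp: space_pair_measure)
    with elim N'(1) show ?case by blast
  qed
qed

text \<open>The conclusions of \<open>jensen_defect\<close> at almost every point, with the abstract
  means already identified with the barycenter.\<close>

lemma slice_jensen: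
  "AE z in cyl Q. dens z \<ge> 0 \<and> (dens z = 0 \<longrightarrow> snd (bar z) = 0) \<and> (AE h in V. admissible (Z (h, z))) \<and> integrable V (\<lambda>h. Z (h, z)) \<and>
     bar z = (LINT h|V. Z (h, z)) \<and>
     (\<forall>v v'. integrable V (\<lambda>h. (snd (Z (h, z)) \<bullet> v) * (snd (Z (h, z)) \<bullet> v') / fst (Z (h, z))) \<and>
       integrable V (\<lambda>h. stress_fluct (vel z) (Z (h, z)) v v') \<and>
       (LINT h|V. stress_fluct (vel z) (Z (h, z)) v v') =
         (LINT h|V. (snd (Z (h, z)) \<bullet> v) * (snd (Z (h, z)) \<bullet> v') / fst (Z (h, z))) - (snd (bar z) \<bullet> v) * (snd (bar z) \<bullet> v') / dens z) \<and>
     integrable V (\<lambda>h. fst (Z (h, z)) powr \<gamma>) \<and> integrable V (\<lambda>h. pressure_fluct (dens z) (fst (Z (h, z)))) \<and>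
     (LINT h|V. pressure_fluct (dens z) (fst (Z (h, z)))) = (LINT h|V. a * fst (Z (h, z)) powr \<gamma>) - a * dens z powr \<gamma> \<and>
     integrable V (\<lambda>h. fluct (vel z) (dens z) (Z (h, z))) \<and>
     (LINT h|V. fluct (vel z) (dens z) (Z (h, z))) \<le> (\<gamma> + 1) * (LINT h|V. energy uinf (Z (h, z)))"
  using slice_AE mean_AE
proof eventually_elim
  case (elim z)
  have r: "(LINT h|V. fst (Z (h, z))) = dens z" and m: "(LINT h|V. snd (Z (h, z))) = snd (bar z)"
    using elim(2) by (metis fst_conv, metis snd_conv)
  note p = prob_space_axioms conjunct1[OF elim(1)] conjunct1[OF conjunct2[OF elim(1)]] conjunct2[OF conjunct2[OF elim(1)]]
  note iZ = jensen_integrable(1)[OF p]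
  have barZ: "bar z = (LINT h|V. Z (h, z))"
  proof -
    have "fst (LINT h|V. Z (h, z)) = dens z" "snd (LINT h|V. Z (h, z)) = snd (bar z)"
      using integral_fst[OF iZ] integral_snd[OF iZ] r m by simp_all
    then show ?thesis by (metis prod.collapse)
  qed
  show ?case
    using jensen_integrable[OF p] jensen_nonneg[OF p, unfolded r m] jensen_vacuum[OF p, unfolded r m]
      jensen_stress_integrable[OF p, unfolded r m, folded vel_def] jensen_stress[OF p, unfolded r m, folded vel_def]
      jensen_pressure_integrable[OF p, unfolded r m] jensen_pressure[OF p, unfolded r m]
      jensen_fluct_integrable[OF p, unfolded r m, folded vel_def] jensen_fluct[OF p, unfolded r m, folded vel_def] p(3) barZ
    by blast
qed

lemma dens_meas [measurable]: "dens \<in> borel_measurable (cyl Q)"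
  by (rule measurable_compose[OF bar_meas fst_borel])

lemma vel_meas [measurable]: "vel \<in> borel_measurable (cyl Q)"
proof -
  have "(\<lambda>z. snd (bar z)) \<in> borel_measurable (cyl Q)" by (rule measurable_compose[OF bar_meas snd_borel])
  then show ?thesis unfolding vel_def[abs_def] using dens_meas by (intro borel_measurable_scaleR borel_measurable_divide) auto
qed

lemma Z_fst_meas [measurable]: "(\<lambda>w. fst (Z w)) \<in> borel_measurable PI"
  by (rule measurable_compose[OF Z_meas fst_borel])

lemma Z_snd_meas [measurable]: "(\<lambda>w. snd (Z w)) \<in> borel_measurable PI"
  by (rule measurable_compose[OF Z_meas snd_borel])

text \<open>The scalar majorant for all entries of the defect before the expectation is
  taken.\<close>

definition fl :: "'n trajectory \<times> (real \<times> (real^'n)) \<Rightarrow> real" where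
  "fl w = fluct (vel (snd w)) (dens (snd w)) (Z w)"

lemma dens_snd_meas: "(\<lambda>w. dens (snd w)) \<in> borel_measurable PI"
  by (rule measurable_compose[OF measurable_snd dens_meas])

lemma vel_snd_meas: "(\<lambda>w. vel (snd w)) \<in> borel_measurable PI"
  by (rule measurable_compose[OF measurable_snd vel_meas])

lemma stress_fluct_meas:
  assumes "f \<in> borel_measurable PI" "g \<in> borel_measurable PI"
  shows "(\<lambda>w. stress_fluct (vel (snd w)) (Z w) (f w) (g w)) \<in> borel_measurable PI"
proof -
  note [measurable] = assms vel_snd_meas
  show ?thesis unfolding stress_fluct_def by measurable
qed

lemma pressure_fluct_meas: "(\<lambda>w. pressure_fluct (dens (snd w)) (fst (Z w))) \<in> borel_measurable PI"
proof -
  note [measurable] = dens_snd_meas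
  show ?thesis unfolding pressure_fluct_def by measurable
qed

lemma fl_meas: "fl \<in> borel_measurable PI"
proof -
  note [measurable] = vel_snd_meas pressure_fluct_meas
  show ?thesis unfolding fl_def[abs_def] fluct_def by measurable
qed

lemma dens_nonneg: "AE w in PI. dens (snd w) \<ge> 0"
  by (rule AE_snd_component) (use slice_jensen in \<open>auto elim: eventually_mono\<close>)

lemma fl_nonneg: "AE w in PI. fl w \<ge> 0"
  using adm_AE dens_nonneg by eventually_elim (auto simp: fl_def intro: fluct_nonneg)

text \<open>The Jensen estimate has no additive constant, so the bound by the energy holds on the
  whole unbounded cylinder. This global integrability pays for the cutoff at infinity.\<close>

lemma fl_integrable: "integrable PI fl"
proof (rule integrableI_nonneg[OF fl_meas fl_nonneg])
  have ei: "integrable (cyl Q) (\<lambda>z. LINT h|V. energy uinf (Z (h, z)))"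
    using VQ.integrable_snd[of "\<lambda>h z. energy uinf (Z (h, z))"] energy_integrable by (simp add: case_prod_beta')
  have "(\<integral>\<^sup>+w. ennreal (fl w) \<partial>PI) = (\<integral>\<^sup>+z. \<integral>\<^sup>+h. ennreal (fl (h, z)) \<partial>V \<partial>cyl Q)"
    using VQ.nn_integral_snd[of "\<lambda>w. ennreal (fl w)"] fl_meas by simp
  also have "\<dots> \<le> (\<integral>\<^sup>+z. ennreal ((\<gamma> + 1) * (LINT h|V. energy uinf (Z (h, z)))) \<partial>cyl Q)"
  proof (rule nn_integral_mono_AE)
    show "AE z in cyl Q. (\<integral>\<^sup>+h. ennreal (fl (h, z)) \<partial>V) \<le> ennreal ((\<gamma> + 1) * (LINT h|V. energy uinf (Z (h, z))))"
      using slice_jensen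
    proof eventually_elim
      case (elim z)
      have d0: "dens z \<ge> 0" and adm: "AE h in V. admissible (Z (h, z))"
        and fi: "integrable V (\<lambda>h. fluct (vel z) (dens z) (Z (h, z)))"
        and fle: "(LINT h|V. fluct (vel z) (dens z) (Z (h, z))) \<le> (\<gamma> + 1) * (LINT h|V. energy uinf (Z (h, z)))"
        using elim by blast+
      have "AE h in V. 0 \<le> fluct (vel z) (dens z) (Z (h, z))"
        using adm by eventually_elim (rule fluct_nonneg[OF _ d0])
      then have "(\<integral>\<^sup>+h. ennreal (fluct (vel z) (dens z) (Z (h, z))) \<partial>V) = ennreal (LINT h|V. fluct (vel z) (dens z) (Z (h, z)))"
        by (rule nn_integral_eq_integral[OF fi])
      then show ?case using fle unfolding fl_def snd_conv by (simp only: ennreal_leI)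
    qed
  qed
  also have "\<dots> < \<infinity>"
  proof -
    have "integrable (cyl Q) (\<lambda>z. (\<gamma> + 1) * (LINT h|V. energy uinf (Z (h, z))))" using ei by simp
    then have "(\<integral>\<^sup>+z. ennreal (norm ((\<gamma> + 1) * (LINT h|V. energy uinf (Z (h, z))))) \<partial>cyl Q) < \<infinity>"
      unfolding integrable_iff_bounded by blast
    then show ?thesis by (rule order.strict_trans1[rotated]) (intro nn_integral_mono ennreal_leI, simp)
  qed
  finally show "(\<integral>\<^sup>+w. ennreal (fl w) \<partial>PI) < \<infinity>" .
qed

lemma stress_le_fl: "AE w in PI. \<forall>v v'. \<bar>stress_fluct (vel (snd w)) (Z w) v v'\<bar> \<le> norm v * norm v' * fl w"
  using adm_AE dens_nonneg
proof eventually_elim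
  case (elim w)
  have "0 \<le> pressure_fluct (dens (snd w)) (fst (Z w))"
    using elim by (intro pressure_fluct_nonneg) (auto simp: admissible_def)
  then have "norm v * norm v' * ((norm (snd (Z w) - fst (Z w) *\<^sub>R vel (snd w)))\<^sup>2 / fst (Z w)) \<le> norm v * norm v' * fl w" for v v' :: "real^'n"
    by (intro mult_left_mono) (auto simp: fl_def fluct_def)
  then show ?case using stress_fluct_bound[OF elim(1)] order_trans by blast
qed

lemma pressure_le_fl: "AE w in PI. 0 \<le> pressure_fluct (dens (snd w)) (fst (Z w)) \<and> pressure_fluct (dens (snd w)) (fst (Z w)) \<le> fl w"
  using adm_AE dens_nonneg
proof eventually_elim
  case (elim w)
  then have "0 \<le> (norm (snd (Z w) - fst (Z w) *\<^sub>R vel (snd w)))\<^sup>2 / fst (Z w)" by (simp add: admissible_def)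
  then show ?case
    using elim pressure_fluct_nonneg[of "fst (Z w)" "dens (snd w)"] by (auto simp: fl_def fluct_def admissible_def)
qed

lemma convective_part_bound:
  "\<exists>C\<ge>0. \<forall>y. admissible y \<longrightarrow> \<bar>convective_part v v' (fst y) (snd y)\<bar> \<le> C * (energy uinf y + 1)"
proof -
  obtain D where D: "D \<ge> 0" "\<And>y. admissible y \<Longrightarrow> (norm (snd y))\<^sup>2 / fst y \<le> D * (energy uinf y + 1)"
    using kinetic_le_energy[of uinf] by blast
  have "\<bar>convective_part v v' (fst y) (snd y)\<bar> \<le> (norm v * norm v' * D) * (energy uinf y + 1)" if adm: "admissible y" for y
  proof -
    have "convective_part v v' (fst y) (snd y) = stress_fluct 0 y v v'"
      using adm by (auto simp: convective_part_def stress_fluct_def admissible_def)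
    then have "\<bar>convective_part v v' (fst y) (snd y)\<bar> \<le> norm v * norm v' * ((norm (snd y))\<^sup>2 / fst y)"
      using stress_fluct_bound[OF adm, of 0 v v'] by simp
    also have "\<dots> \<le> norm v * norm v' * (D * (energy uinf y + 1))"
      by (intro mult_left_mono D(2) adm) auto
    finally show ?thesis by (simp add: mult.assoc)
  qed
  then show ?thesis using D(1) by (intro exI[of _ "norm v * norm v' * D"]) auto
qed

lemma pressure_bound: "\<exists>C\<ge>0. \<forall>y. admissible y \<longrightarrow> \<bar>pressure a \<gamma> (fst y)\<bar> \<le> C * (energy uinf y + 1)"
proof -
  obtain D where D: "D \<ge> 0" "\<And>y. admissible y \<Longrightarrow> (fst y) powr \<gamma> \<le> D * (energy uinf y + 1)"
    using kinetic_le_energy[of uinf] by blast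
  show ?thesis
    using D a_pos by (intro exI[of _ "a * D"]) (auto simp: pressure_def mult.assoc)
qed

definition tderiv :: "(real \<Rightarrow> real) \<Rightarrow> (real^'n \<Rightarrow> real) \<Rightarrow> real^'n \<Rightarrow> real \<times> (real^'n) \<Rightarrow> real" where
  "tderiv \<psi> \<zeta> v z = \<psi> (fst z) * frechet_derivative \<zeta> (at (snd z)) v"

text \<open>The fluctuation tensor, convective part plus pressure times identity, contracted with
  the gradient of the field \<open>\<psi> \<zeta> e\<close>. It is kept as a function of the
  trajectory as well, so that its vanishing speaks about almost every sample and not only about the
  mean.\<close>

definition defect :: "(real \<Rightarrow> real) \<Rightarrow> (real^'n \<Rightarrow> real) \<Rightarrow> real^'n \<Rightarrow> 'n trajectory \<times> (real \<times> (real^'n)) \<Rightarrow> real" where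
  "defect \<psi> \<zeta> e w = (\<Sum>j\<in>UNIV. stress_fluct (vel (snd w)) (Z w) e (axis j 1) * tderiv \<psi> \<zeta> (axis j 1) (snd w))
     + pressure_fluct (dens (snd w)) (fst (Z w)) * tderiv \<psi> \<zeta> e (snd w)"

section \<open>Defects tested with product fields have mean zero\<close>

context
  fixes \<psi> :: "real \<Rightarrow> real" and \<zeta> :: "real^'n \<Rightarrow> real"
  assumes \<psi>: "test_fun \<infinity> {0<..<T} \<psi>" and \<zeta>: "test_fun \<infinity> Q \<zeta>"
begin

lemma test_fun_tderiv: "test_fun \<infinity> ({0<..<T} \<times> Q) (tderiv \<psi> \<zeta> v)"
  unfolding tderiv_def by (rule test_fun_tensor[OF \<psi> test_fun_frechet_derivative[OF \<zeta>]])

lemma tderiv_bounded: "\<exists>C\<ge>0. \<forall>z. \<bar>tderiv \<psi> \<zeta> v z\<bar> \<le> C"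
proof -
  obtain S where "compact S" "\<And>z. z \<notin> S \<Longrightarrow> tderiv \<psi> \<zeta> v z = 0" "continuous_on UNIV (tderiv \<psi> \<zeta> v)"
    using test_fun_0D[OF test_fun_mono[OF test_fun_tderiv]] by metis
  then show ?thesis using compact_support_bounded by metis
qed

lemma tderiv_meas: "tderiv \<psi> \<zeta> v \<in> borel_measurable (cyl Q)"
  using integrable_bounded_test[OF _ _ test_fun_mono[OF test_fun_tderiv], of "\<lambda>_. 1" 1] by simp

lemma defect_integrable: "integrable PI (defect \<psi> \<zeta> e)"
proof -
  have m: "(\<lambda>w. tderiv \<psi> \<zeta> v (snd w)) \<in> borel_measurable PI" for v
    by (rule measurable_compose[OF measurable_snd tderiv_meas])
  have s: "integrable PI (\<lambda>w. stress_fluct (vel (snd w)) (Z w) e v * tderiv \<psi> \<zeta> v (snd w))" for v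
  proof -
    obtain C where C: "C \<ge> 0" "\<And>z. \<bar>tderiv \<psi> \<zeta> v z\<bar> \<le> C" using tderiv_bounded by blast
    show ?thesis
    proof (rule Bochner_Integration.integrable_bound[OF integrable_mult_right[OF fl_integrable, of "norm e * norm v * C"]])
      show "AE w in PI. norm (stress_fluct (vel (snd w)) (Z w) e v * tderiv \<psi> \<zeta> v (snd w)) \<le> norm (norm e * norm v * C * fl w)"
        using stress_le_fl fl_nonneg
      proof eventually_elim
        case (elim w)
        have "\<bar>stress_fluct (vel (snd w)) (Z w) e v\<bar> * \<bar>tderiv \<psi> \<zeta> v (snd w)\<bar> \<le> (norm e * norm v * fl w) * C"
          using elim C by (intro mult_mono) auto
        then show ?case using C(1) elim(2) by (simp add: abs_mult ac_simps)
      qed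
    qed (intro borel_measurable_times stress_fluct_meas m borel_measurable_const)
  qed
  have p: "integrable PI (\<lambda>w. pressure_fluct (dens (snd w)) (fst (Z w)) * tderiv \<psi> \<zeta> e (snd w))"
  proof -
    obtain C where C: "C \<ge> 0" "\<And>z. \<bar>tderiv \<psi> \<zeta> e z\<bar> \<le> C" using tderiv_bounded by blast
    show ?thesis
    proof (rule Bochner_Integration.integrable_bound[OF integrable_mult_right[OF fl_integrable, of C]])
      show "AE w in PI. norm (pressure_fluct (dens (snd w)) (fst (Z w)) * tderiv \<psi> \<zeta> e (snd w)) \<le> norm (C * fl w)"
        using pressure_le_fl
      proof eventually_elim
        case (elim w)
        have "\<bar>pressure_fluct (dens (snd w)) (fst (Z w))\<bar> * \<bar>tderiv \<psi> \<zeta> e (snd w)\<bar> \<le> fl w * C"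
          using elim C by (intro mult_mono) auto
        then show ?case using C(1) elim by (simp add: abs_mult ac_simps)
      qed
    qed (intro borel_measurable_times pressure_fluct_meas m)
  qed
  show ?thesis
    unfolding defect_def[abs_def] by (intro Bochner_Integration.integrable_add Bochner_Integration.integrable_sum s p)
qed

definition eobs :: "real^'n \<Rightarrow> real \<times> (real^'n) \<Rightarrow> real \<times> (real^'n) \<Rightarrow> real" where
  "eobs e z y = euler_obs a \<gamma> \<psi> \<zeta> e (fst z) (snd z) (fst y) (snd y)"

lemma eobs_eq: "eobs e z y = (y \<bullet> (0, e)) * (deriv \<psi> (fst z) * \<zeta> (snd z))
   + (\<Sum>j\<in>UNIV. convective_part e (axis j 1) (fst y) (snd y) * tderiv \<psi> \<zeta> (axis j 1) z)
   + pressure a \<gamma> (fst y) * tderiv \<psi> \<zeta> e z"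
  by (simp add: eobs_def euler_obs_def tderiv_def inner_prod_def)

lemma eobs_integrable: "integrable PI (\<lambda>w. eobs e (snd w) (Z w))"
proof -
  note [measurable] = fst_borel snd_borel
  have c: "(\<lambda>y. convective_part v v' (fst y) (snd y)) \<in> borel_measurable borel" for v v' :: "real^'n"
    unfolding convective_part_def by measurable
  have p: "(\<lambda>y :: real \<times> (real^'n). pressure a \<gamma> (fst y)) \<in> borel_measurable borel"
    unfolding pressure_def by measurable
  have t: "test_fun \<infinity> ({0<..<T} \<times> Q) (\<lambda>z. deriv \<psi> (fst z) * \<zeta> (snd z))"
    by (intro test_fun_tensor test_fun_deriv \<psi> \<zeta>)
  show ?thesis
    unfolding eobs_eq
    by (intro Bochner_Integration.integrable_add Bochner_Integration.integrable_sum local_integrable[OF c convective_part_bound]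
        local_integrable[OF p pressure_bound] local_integrable[OF inner_borel state_bound]
        test_fun_mono[OF test_fun_tderiv] test_fun_mono[OF t])
qed

text \<open>The hypothesis \<open>expected_obs\<close> speaks of samples, so for almost every
  trajectory \<open>Z\<close> is first replaced by the sample it is a version of.\<close>

lemma eobs_mean_0: "(LINT w|PI. eobs e (snd w) (Z w)) = 0"
proof -
  obtain I where I: "integrable V I" "integral\<^sup>L V I = (0 :: real)"
    "AE h in V. st_integrable {0<..<T} Q (\<lambda>t x. euler_obs a \<gamma> \<psi> \<zeta> e t x (fst h t x) (snd h t x)) \<and> observe T Q (euler_obs a \<gamma> \<psi> \<zeta> e) h = I h"
    using expected_obs[OF \<psi> \<zeta>, of e] by blast
  have "(LINT w|PI. eobs e (snd w) (Z w)) = (LINT h|V. LINT z|cyl Q. eobs e z (Z (h, z)))"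
    using VQ.integral_fst'[OF eobs_integrable] by simp
  also have "\<dots> = integral\<^sup>L V I"
  proof (rule integral_cong_AE)
    show "AE h in V. (LINT z|cyl Q. eobs e z (Z (h, z))) = I h"
      using Z_version I(3) AE_space VQ.AE_integrable_fst'[OF eobs_integrable[of e]]
    proof eventually_elim
      case (elim h)
      have "(LINT z|cyl Q. eobs e z (Z (h, z))) = (LINT z|cyl Q. eobs e z (traj_val h (fst z) (snd z)))"
      proof (rule integral_cong_AE)
        show "AE z in cyl Q. eobs e z (Z (h, z)) = eobs e z (traj_val h (fst z) (snd z))"
          using elim(1) by eventually_elim simp
        show "(\<lambda>z. eobs e z (Z (h, z))) \<in> borel_measurable (cyl Q)" using elim(4) by auto
        have "integrable (cyl Q) (\<lambda>z. eobs e z (traj_val h (fst z) (snd z)))"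
          using elim(2) Q_borel by (simp add: st_integrable_restrict eobs_def traj_val_def)
        then show "(\<lambda>z. eobs e z (traj_val h (fst z) (snd z))) \<in> borel_measurable (cyl Q)" by auto
      qed
      also have "\<dots> = I h"
        using elim(2) Q_borel by (simp add: observe_def st_integral_restrict eobs_def traj_val_def)
      finally show ?case .
    qed
    show "(\<lambda>h. LINT z|cyl Q. eobs e z (Z (h, z))) \<in> borel_measurable V"
      using VQ.integrable_fst'[OF eobs_integrable] by auto
  qed (use I in auto)
  finally show ?thesis using I(2) by simp
qed

lemma eobs_bar: "integrable (cyl Q) (\<lambda>z. eobs e z (bar z))" "(LINT z|cyl Q. eobs e z (bar z)) = 0"
proof -
  have "test_fun \<infinity> ({0<..<T} \<times> Q) (\<lambda>z. (\<psi> (fst z) * \<zeta> (snd z)) *\<^sub>R e)"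
    by (intro test_fun_scaleR test_fun_tensor \<psi> \<zeta>)
  from test_fun_mono[OF this, of 1]
  have "test_fun 1 ({0<..<T} \<times> Q) (\<lambda>z. (\<psi> (fst z) * \<zeta> (snd z)) *\<^sub>R e)" .
  from bary_euler[unfolded euler_weak_solution_def Let_def, THEN conjunct2, THEN conjunct2, THEN spec, THEN mp, OF this]
  have "st_integrable {0<..<T} Q (\<lambda>t x. euler_obs a \<gamma> \<psi> \<zeta> e t x (\<rho>bar t x) (mbar t x)) \<and>
      st_integral {0<..<T} Q (\<lambda>t x. euler_obs a \<gamma> \<psi> \<zeta> e t x (\<rho>bar t x) (mbar t x)) = 0"
    by (simp only: euler_obs_deterministic[OF \<psi> \<zeta>] fst_conv snd_conv)
  then show "integrable (cyl Q) (\<lambda>z. eobs e z (bar z))" "(LINT z|cyl Q. eobs e z (bar z)) = 0"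
    using Q_borel by (simp_all add: st_integrable_restrict st_integral_restrict eobs_def traj_val_def)
qed

text \<open>The term with the time derivative is linear in the state and cancels between expectation
  and barycenter; the nonlinear terms leave exactly the Jensen defects.\<close>

lemma slice_defect: "AE z in cyl Q. (LINT h|V. defect \<psi> \<zeta> e (h, z)) = (LINT h|V. eobs e z (Z (h, z))) - eobs e z (bar z)"
  using slice_jensen
proof eventually_elim
  case (elim z)
  have adm: "AE h in V. admissible (Z (h, z))" and iZ: "integrable V (\<lambda>h. Z (h, z))" and bz: "bar z = (LINT h|V. Z (h, z))"
    and d0: "dens z \<ge> 0" "dens z = 0 \<Longrightarrow> snd (bar z) = 0"
    using elim by auto
  have k: "integrable V (\<lambda>h. (snd (Z (h, z)) \<bullet> v) * (snd (Z (h, z)) \<bullet> v') / fst (Z (h, z)))"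
    and sf: "integrable V (\<lambda>h. stress_fluct (vel z) (Z (h, z)) v v')"
    and sfI: "(LINT h|V. stress_fluct (vel z) (Z (h, z)) v v') =
         (LINT h|V. (snd (Z (h, z)) \<bullet> v) * (snd (Z (h, z)) \<bullet> v') / fst (Z (h, z))) - (snd (bar z) \<bullet> v) * (snd (bar z) \<bullet> v') / dens z" for v v'
    using elim by blast+
  have pr: "integrable V (\<lambda>h. fst (Z (h, z)) powr \<gamma>)" and pf: "integrable V (\<lambda>h. pressure_fluct (dens z) (fst (Z (h, z))))"
    and pfI: "(LINT h|V. pressure_fluct (dens z) (fst (Z (h, z)))) = (LINT h|V. a * fst (Z (h, z)) powr \<gamma>) - a * dens z powr \<gamma>"
    using elim by blast+
  define K where "K v v' = (LINT h|V. (snd (Z (h, z)) \<bullet> v) * (snd (Z (h, z)) \<bullet> v') / fst (Z (h, z)))" for v v'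
  have "(LINT h|V. eobs e z (Z (h, z))) = (LINT h|V. (Z (h, z) \<bullet> (0, e)) * (deriv \<psi> (fst z) * \<zeta> (snd z))
     + (\<Sum>j\<in>UNIV. (snd (Z (h, z)) \<bullet> e) * (snd (Z (h, z)) \<bullet> axis j 1) / fst (Z (h, z)) * tderiv \<psi> \<zeta> (axis j 1) z)
     + a * fst (Z (h, z)) powr \<gamma> * tderiv \<psi> \<zeta> e z)"
  proof (rule integral_cong_AE)
    show "AE h in V. eobs e z (Z (h, z)) = (Z (h, z) \<bullet> (0, e)) * (deriv \<psi> (fst z) * \<zeta> (snd z))
     + (\<Sum>j\<in>UNIV. (snd (Z (h, z)) \<bullet> e) * (snd (Z (h, z)) \<bullet> axis j 1) / fst (Z (h, z)) * tderiv \<psi> \<zeta> (axis j 1) z)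
     + a * fst (Z (h, z)) powr \<gamma> * tderiv \<psi> \<zeta> e z"
      using adm
    proof eventually_elim
      case (elim h)
      then have "convective_part v v' (fst (Z (h, z))) (snd (Z (h, z))) = (snd (Z (h, z)) \<bullet> v) * (snd (Z (h, z)) \<bullet> v') / fst (Z (h, z))" for v v'
        by (auto simp: convective_part_def admissible_def)
      then show ?case by (simp only: eobs_eq pressure_def)
    qed
    note [measurable] = borel_measurable_integrable[OF iZ] fst_borel snd_borel
    have [measurable]: "(\<lambda>h. fst (Z (h, z))) \<in> borel_measurable V" "(\<lambda>h. snd (Z (h, z))) \<in> borel_measurable V"
      using measurable_compose[OF borel_measurable_integrable[OF iZ] fst_borel] measurable_compose[OF borel_measurable_integrable[OF iZ] snd_borel] by auto
    show "(\<lambda>h. eobs e z (Z (h, z))) \<in> borel_measurable V"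
      unfolding eobs_eq pressure_def convective_part_def by measurable
    show "(\<lambda>h. (Z (h, z) \<bullet> (0, e)) * (deriv \<psi> (fst z) * \<zeta> (snd z))
     + (\<Sum>j\<in>UNIV. (snd (Z (h, z)) \<bullet> e) * (snd (Z (h, z)) \<bullet> axis j 1) / fst (Z (h, z)) * tderiv \<psi> \<zeta> (axis j 1) z)
     + a * fst (Z (h, z)) powr \<gamma> * tderiv \<psi> \<zeta> e z) \<in> borel_measurable V"
      by measurable
  qed
  also have "\<dots> = (bar z \<bullet> (0, e)) * (deriv \<psi> (fst z) * \<zeta> (snd z)) + (\<Sum>j\<in>UNIV. K e (axis j 1) * tderiv \<psi> \<zeta> (axis j 1) z)
     + (LINT h|V. a * fst (Z (h, z)) powr \<gamma>) * tderiv \<psi> \<zeta> e z"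
  proof -
    have i1: "integrable V (\<lambda>h. (Z (h, z) \<bullet> (0, e)) * (deriv \<psi> (fst z) * \<zeta> (snd z)))"
      by (intro integrable_mult_left integrable_inner_left iZ)
    have i2: "integrable V (\<lambda>h. \<Sum>j\<in>UNIV. (snd (Z (h, z)) \<bullet> e) * (snd (Z (h, z)) \<bullet> axis j 1) / fst (Z (h, z)) * tderiv \<psi> \<zeta> (axis j 1) z)"
      by (intro Bochner_Integration.integrable_sum integrable_mult_left k)
    have i3: "integrable V (\<lambda>h. a * fst (Z (h, z)) powr \<gamma> * tderiv \<psi> \<zeta> e z)"
      by (intro integrable_mult_left integrable_mult_right pr)
    have I1: "(LINT h|V. (Z (h, z) \<bullet> (0, e)) * (deriv \<psi> (fst z) * \<zeta> (snd z))) = (bar z \<bullet> (0, e)) * (deriv \<psi> (fst z) * \<zeta> (snd z))"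
      unfolding bz using integral_inner_left[OF iZ, of "(0, e)"] by simp
    have I2: "(LINT h|V. (\<Sum>j\<in>UNIV. (snd (Z (h, z)) \<bullet> e) * (snd (Z (h, z)) \<bullet> axis j 1) / fst (Z (h, z)) * tderiv \<psi> \<zeta> (axis j 1) z))
      = (\<Sum>j\<in>UNIV. K e (axis j 1) * tderiv \<psi> \<zeta> (axis j 1) z)"
      unfolding K_def by (subst Bochner_Integration.integral_sum) (intro integrable_mult_left k, simp only: integral_mult_left_zero)
    have I3: "(LINT h|V. a * fst (Z (h, z)) powr \<gamma> * tderiv \<psi> \<zeta> e z) = (LINT h|V. a * fst (Z (h, z)) powr \<gamma>) * tderiv \<psi> \<zeta> e z"
      by (rule integral_mult_left_zero)
    show ?thesis
      by (simp only: Bochner_Integration.integral_add[OF Bochner_Integration.integrable_add[OF i1 i2] i3]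
        Bochner_Integration.integral_add[OF i1 i2] I1 I2 I3)
  qed
  finally have E: "(LINT h|V. eobs e z (Z (h, z))) = (bar z \<bullet> (0, e)) * (deriv \<psi> (fst z) * \<zeta> (snd z)) + (\<Sum>j\<in>UNIV. K e (axis j 1) * tderiv \<psi> \<zeta> (axis j 1) z)
     + (LINT h|V. a * fst (Z (h, z)) powr \<gamma>) * tderiv \<psi> \<zeta> e z" .
  have cb: "convective_part v v' (dens z) (snd (bar z)) = (snd (bar z) \<bullet> v) * (snd (bar z) \<bullet> v') / dens z" for v v'
    using d0 by (auto simp: convective_part_def)
  have B: "eobs e z (bar z) = (bar z \<bullet> (0, e)) * (deriv \<psi> (fst z) * \<zeta> (snd z))
    + (\<Sum>j\<in>UNIV. (snd (bar z) \<bullet> e) * (snd (bar z) \<bullet> axis j 1) / dens z * tderiv \<psi> \<zeta> (axis j 1) z) + a * dens z powr \<gamma> * tderiv \<psi> \<zeta> e z"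
    by (simp only: eobs_eq pressure_def cb)
  have "(LINT h|V. defect \<psi> \<zeta> e (h, z)) = (\<Sum>j\<in>UNIV. (LINT h|V. stress_fluct (vel z) (Z (h, z)) e (axis j 1)) * tderiv \<psi> \<zeta> (axis j 1) z)
     + (LINT h|V. pressure_fluct (dens z) (fst (Z (h, z)))) * tderiv \<psi> \<zeta> e z"
  proof -
    have i1: "integrable V (\<lambda>h. \<Sum>j\<in>UNIV. stress_fluct (vel z) (Z (h, z)) e (axis j 1) * tderiv \<psi> \<zeta> (axis j 1) z)"
      by (intro Bochner_Integration.integrable_sum integrable_mult_left sf)
    have I1: "(LINT h|V. (\<Sum>j\<in>UNIV. stress_fluct (vel z) (Z (h, z)) e (axis j 1) * tderiv \<psi> \<zeta> (axis j 1) z))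
      = (\<Sum>j\<in>UNIV. (LINT h|V. stress_fluct (vel z) (Z (h, z)) e (axis j 1)) * tderiv \<psi> \<zeta> (axis j 1) z)"
      by (subst Bochner_Integration.integral_sum) (intro integrable_mult_left sf, simp only: integral_mult_left_zero)
    show ?thesis
      unfolding defect_def snd_conv
      by (simp only: Bochner_Integration.integral_add[OF i1 integrable_mult_left[OF pf]] I1 integral_mult_left_zero)
  qed
  also have "\<dots> = (\<Sum>j\<in>UNIV. K e (axis j 1) * tderiv \<psi> \<zeta> (axis j 1) z)
      - (\<Sum>j\<in>UNIV. (snd (bar z) \<bullet> e) * (snd (bar z) \<bullet> axis j 1) / dens z * tderiv \<psi> \<zeta> (axis j 1) z)
      + ((LINT h|V. a * fst (Z (h, z)) powr \<gamma>) - a * dens z powr \<gamma>) * tderiv \<psi> \<zeta> e z"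
    unfolding sfI K_def pfI left_diff_distrib sum_subtractf by (rule refl)
  also have "\<dots> = (LINT h|V. eobs e z (Z (h, z))) - eobs e z (bar z)"
    unfolding E B left_diff_distrib by linarith
  finally show ?case .
qed

theorem defect_mean_0: "(LINT w|PI. defect \<psi> \<zeta> e w) = 0"
proof -
  have sn: "(LINT z|cyl Q. LINT h|V. f (h, z)) = (LINT w|PI. f w)" "integrable (cyl Q) (\<lambda>z. LINT h|V. f (h, z))"
    if "integrable PI f" for f :: "_ \<Rightarrow> real"
    using VQ.integral_snd[of "\<lambda>h z. f (h, z)"] VQ.integrable_snd[of "\<lambda>h z. f (h, z)"] that by (simp_all add: case_prod_beta')
  have "(LINT w|PI. defect \<psi> \<zeta> e w) = (LINT z|cyl Q. (LINT h|V. eobs e z (Z (h, z))) - eobs e z (bar z))"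
    unfolding sn(1)[OF defect_integrable, symmetric]
    using slice_defect sn(2)[OF defect_integrable] sn(2)[OF eobs_integrable] eobs_bar(1)
    by (intro integral_cong_AE) auto
  also have "\<dots> = 0"
    using sn[OF eobs_integrable] eobs_bar eobs_mean_0 by simp
  finally show ?thesis .
qed

end

end

section \<open>Vanishing of the defects outside a convex set\<close>

lemma flat_mono: "s \<le> s' \<Longrightarrow> flat 0 s \<le> flat 0 s'"
  by (auto simp: flat_def divide_left_mono)

text \<open>Follows from the quadratic term of the exponential series at 1/s.\<close>

lemma flat_2_le: "flat 2 s \<le> 2"
proof (cases "s > 0")
  case True
  have "1 / s > 0" using True by simp
  then have "(1 / s)\<^sup>2 / 2 \<le> exp (1 / s)"
    using exp_lower_Taylor_quadratic[of "1 / s"] by linarith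
  then have "(1 / s)\<^sup>2 \<le> 2 * exp (1 / s)" by simp
  then have "(1 / s)\<^sup>2 * exp (- (1 / s)) \<le> 2 * exp (1 / s) * exp (- (1 / s))" by (rule mult_right_mono) simp
  also have "\<dots> = 2" by (simp add: exp_minus)
  finally have "(1 / s)\<^sup>2 * exp (- (1 / s)) \<le> 2" .
  moreover have "flat 2 s = (1 / s)\<^sup>2 * exp (- (1 / s))" using True by (simp add: flat_def power_divide)
  ultimately show ?thesis by simp
qed (simp add: flat_def)

definition time_cutoff :: "real \<Rightarrow> real \<Rightarrow> real \<Rightarrow> real" where
  "time_cutoff T \<delta> t = flat 0 (t - \<delta>) * flat 0 (T - \<delta> - t)"

text \<open>On a half space \<open>x \<bullet> e > s\<close> that misses the obstacle this is, for large \<open>R\<close>, an increasing function of \<open>x \<bullet> e\<close>: tested with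
  \<open>space_cutoff e s R *\<^sub>R e\<close>, the defect has a nonnegative density up to an error of order \<open>1 / R\<close>.\<close>

definition space_cutoff :: "real^'n \<Rightarrow> real \<Rightarrow> real \<Rightarrow> real^'n \<Rightarrow> real" where
  "space_cutoff e s R x = flat 0 (x \<bullet> e - s) * flat 0 (1 - (x \<bullet> x) / R\<^sup>2)"

lemma test_fun_time_cutoff:
  assumes "\<delta> > 0"
  shows "test_fun \<infinity> {0<..<T} (time_cutoff T \<delta>)"
proof -
  have "Ck_on k UNIV (time_cutoff T \<delta>)" for k
    unfolding time_cutoff_def by (intro Ck_on_intros Ck_on_flat)
  moreover have "time_cutoff T \<delta> t = 0" if "t \<notin> {\<delta>..T - \<delta>}" for t
    using that by (auto simp: time_cutoff_def)
  ultimately show ?thesis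
    using assms unfolding test_fun_infinity_iff by (intro conjI allI exI[of _ "{\<delta>..T - \<delta>}"]) auto
qed

text \<open>The half space keeps the support away from the obstacle and the radial factor confines
  it to a ball.\<close>

lemma test_fun_space_cutoff:
  fixes e :: "real^'n"
  assumes "{x. x \<bullet> e \<ge> s} \<subseteq> Q" "R > 0"
  shows "test_fun \<infinity> Q (space_cutoff e s R)"
proof -
  have "space_cutoff e s R = (\<lambda>x. flat 0 (x \<bullet> e - s) * flat 0 (1 - (1 / R\<^sup>2) * (x \<bullet> x)))"
    by (rule ext) (simp add: space_cutoff_def)
  moreover have "Ck_on k UNIV (\<lambda>x. flat 0 (x \<bullet> e - s) * flat 0 (1 - (1 / R\<^sup>2) * (x \<bullet> x)))" for k
    by (intro Ck_on_intros Ck_on_flat)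
  ultimately have "Ck_on k UNIV (space_cutoff e s R)" for k by simp
  moreover have "compact ({x. x \<bullet> e \<ge> s} \<inter> cball 0 R)"
    by (intro closed_Int_compact closed_halfspace_component_ge compact_cball)
  moreover have "space_cutoff e s R x = 0" if "x \<notin> {x. x \<bullet> e \<ge> s} \<inter> cball 0 R" for x
  proof (cases "x \<bullet> e \<ge> s")
    case True
    then have "norm x > R" using that by simp
    then have "R\<^sup>2 \<le> x \<bullet> x" using assms(2) unfolding power2_norm_eq_inner[symmetric] by (intro power_mono) auto
    then have "1 - (x \<bullet> x) / R\<^sup>2 \<le> 0" using assms(2) by simp
    then show ?thesis by (simp add: space_cutoff_def)
  qed (simp add: space_cutoff_def)
  ultimately show ?thesis
    using assms(1) unfolding test_fun_infinity_iff
    by (intro conjI allI exI[of _ "{x. x \<bullet> e \<ge> s} \<inter> cball 0 R"]) auto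
qed

text \<open>\<open>flat 2\<close> is the derivative of \<open>flat 0\<close>. The first term stems
  from the increasing profile in x \<bullet> e and has a sign, the second from the radial factor and
  has the size 1/R.\<close>

lemma space_cutoff_derivative:
  fixes e :: "real^'n"
  shows "frechet_derivative (space_cutoff e s R) (at x) v =
    flat 2 (x \<bullet> e - s) * flat 0 (1 - (x \<bullet> x) / R\<^sup>2) * (v \<bullet> e)
    - 2 / R\<^sup>2 * (flat 0 (x \<bullet> e - s) * flat 2 (1 - (x \<bullet> x) / R\<^sup>2)) * (x \<bullet> v)"
proof -
  have f: "(flat 0 has_derivative (*) (flat 2 s)) (at s)" for s
    using flat_deriv[of 0 s] by (simp add: has_field_derivative_def numeral_2_eq_2)
  have 1: "((\<lambda>x. flat 0 (x \<bullet> e - s)) has_derivative (\<lambda>v. flat 2 (x \<bullet> e - s) * (v \<bullet> e))) (at x)"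
    by (rule has_derivative_compose[OF _ f]) (auto intro!: derivative_eq_intros)
  have 2: "((\<lambda>x. flat 0 (1 - (x \<bullet> x) / R\<^sup>2)) has_derivative (\<lambda>v. flat 2 (1 - (x \<bullet> x) / R\<^sup>2) * (- (2 * (x \<bullet> v)) / R\<^sup>2))) (at x)"
  proof (rule has_derivative_compose[OF _ f])
    have "((\<lambda>x. 1 - c * (x \<bullet> x)) has_derivative (\<lambda>v. - (c * (x \<bullet> v + v \<bullet> x)))) (at x)" for c
      by (auto intro!: derivative_eq_intros)
    from this[of "1 / R\<^sup>2"]
    show "((\<lambda>x. 1 - (x \<bullet> x) / R\<^sup>2) has_derivative (\<lambda>v. - (2 * (x \<bullet> v)) / R\<^sup>2)) (at x)"
      by (simp add: inner_commute)
  qed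
  show ?thesis unfolding space_cutoff_def[abs_def]
    using frechet_derivative_at[OF has_derivative_mult[OF 1 2], symmetric] by (simp add: algebra_simps)
qed

context isentropic
begin

lemma stress_diag_nonneg: "admissible y \<Longrightarrow> stress_fluct c y v v \<ge> 0"
  by (simp add: stress_fluct_def admissible_def)

lemma stress_fluct_sum:
  fixes u :: "real^'n"
  shows "(\<Sum>j\<in>UNIV. stress_fluct c y e (axis j 1) * (axis j 1 \<bullet> u)) = stress_fluct c y e u"
proof -
  have "stress_fluct c y e u = (\<Sum>j\<in>UNIV. (snd y - fst y *\<^sub>R c) \<bullet> e * ((snd y - fst y *\<^sub>R c) $ j * u $ j) / fst y)"
    by (simp add: stress_fluct_def inner_vec_def[of _ u] sum_distrib_left sum_divide_distrib)
  then show ?thesis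
    by (simp add: stress_fluct_def inner_axis_1 inner_axis' algebra_simps)
qed

end

section \<open>Half spaces that miss the obstacle\<close>

context euler_limit
begin

text \<open>The contribution of the profile in x \<bullet> e. Its gradient is parallel to
  \<open>e\<close>, so only the diagonal entry in direction \<open>e\<close> occurs, and this is
  nonnegative.\<close>

definition cut_defect :: "real^'n \<Rightarrow> real \<Rightarrow> real \<Rightarrow> real \<Rightarrow> 'n trajectory \<times> (real \<times> (real^'n)) \<Rightarrow> real" where
  "cut_defect e s \<delta> R w = time_cutoff T \<delta> (fst (snd w)) * (flat 2 (snd (snd w) \<bullet> e - s) * flat 0 (1 - (snd (snd w) \<bullet> snd (snd w)) / R\<^sup>2))
     * (stress_fluct (vel (snd w)) (Z w) e e + pressure_fluct (dens (snd w)) (fst (Z w)) * (e \<bullet> e))"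

text \<open>The contribution of the radial factor, whose gradient is parallel to \<open>x\<close>;
  hence the mixed entry, which has no sign.\<close>

definition cut_error :: "real^'n \<Rightarrow> real \<Rightarrow> real \<Rightarrow> real \<Rightarrow> 'n trajectory \<times> (real \<times> (real^'n)) \<Rightarrow> real" where
  "cut_error e s \<delta> R w = time_cutoff T \<delta> (fst (snd w)) * (2 / R\<^sup>2 * (flat 0 (snd (snd w) \<bullet> e - s) * flat 2 (1 - (snd (snd w) \<bullet> snd (snd w)) / R\<^sup>2)))
     * (stress_fluct (vel (snd w)) (Z w) e (snd (snd w)) + pressure_fluct (dens (snd w)) (fst (Z w)) * (snd (snd w) \<bullet> e))"

lemma defect_cutoff: "defect (time_cutoff T \<delta>) (space_cutoff e s R) e w = cut_defect e s \<delta> R w - cut_error e s \<delta> R w"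
proof -
  define x where "x = snd (snd w)"
  define p where "p = time_cutoff T \<delta> (fst (snd w))"
  define A where "A = flat 2 (x \<bullet> e - s) * flat 0 (1 - (x \<bullet> x) / R\<^sup>2)"
  define B where "B = 2 / R\<^sup>2 * (flat 0 (x \<bullet> e - s) * flat 2 (1 - (x \<bullet> x) / R\<^sup>2))"
  let ?s = "stress_fluct (vel (snd w)) (Z w)"
  have d: "tderiv (time_cutoff T \<delta>) (space_cutoff e s R) v (snd w) = p * (A * (v \<bullet> e) - B * (v \<bullet> x))" for v
    unfolding tderiv_def space_cutoff_derivative by (simp add: x_def p_def A_def B_def inner_commute)
  have "(\<Sum>j\<in>UNIV. ?s e (axis j 1) * (p * (A * (axis j 1 \<bullet> e) - B * (axis j 1 \<bullet> x))))
     = p * A * (\<Sum>j\<in>UNIV. ?s e (axis j 1) * (axis j 1 \<bullet> e)) - p * B * (\<Sum>j\<in>UNIV. ?s e (axis j 1) * (axis j 1 \<bullet> x))"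
    by (simp add: sum_distrib_left sum_subtractf[symmetric] algebra_simps)
  also have "\<dots> = p * A * ?s e e - p * B * ?s e x"
    by (simp only: stress_fluct_sum)
  finally show ?thesis
    unfolding defect_def d cut_defect_def cut_error_def x_def[symmetric] p_def[symmetric] A_def[symmetric] B_def[symmetric]
    by (simp add: algebra_simps inner_commute)
qed

lemma fst_snd_w_meas: "(\<lambda>w. fst (snd w)) \<in> borel_measurable PI" "(\<lambda>w. snd (snd w)) \<in> borel_measurable PI"
proof -
  have "(\<lambda>z. fst z) \<in> borel_measurable (cyl Q)" "(\<lambda>z. snd z) \<in> borel_measurable (cyl Q)"
    using fst_borel snd_borel by (auto intro!: measurable_restrict_space1)
  from measurable_compose[OF measurable_snd this(1)] measurable_compose[OF measurable_snd this(2)]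
  show "(\<lambda>w. fst (snd w)) \<in> borel_measurable PI" "(\<lambda>w. snd (snd w)) \<in> borel_measurable PI" .
qed

context
  fixes e :: "real^'n" and s :: real
  assumes half: "{x. x \<bullet> e \<ge> s} \<subseteq> Q"
begin

text \<open>The radial derivative vanishes unless |x| < R. The constant is 2/R^2 from the derivative
  of |x|^2/R^2, times 2 from \<open>flat_2_le\<close>, times 2 |e| R from stress and
  pressure.\<close>

lemma cut_error_bound:
  assumes "R \<ge> 1"
  shows "AE w in PI. \<bar>cut_error e s \<delta> R w\<bar> \<le> 8 * norm e / R * fl w"
  using stress_le_fl pressure_le_fl fl_nonneg
proof eventually_elim
  case (elim w)
  define x where "x = snd (snd w)"
  define p where "p = time_cutoff T \<delta> (fst (snd w))"
  define f2 where "f2 = flat 2 (1 - (x \<bullet> x) / R\<^sup>2)"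
  define f0 where "f0 = flat 0 (x \<bullet> e - s)"
  define q where "q = stress_fluct (vel (snd w)) (Z w) e x + pressure_fluct (dens (snd w)) (fst (Z w)) * (x \<bullet> e)"
  have ce: "cut_error e s \<delta> R w = p * (2 / R\<^sup>2 * (f0 * f2)) * q"
    by (simp add: cut_error_def x_def p_def f0_def f2_def q_def)
  have p: "0 \<le> p" "p \<le> 1" by (auto simp: p_def time_cutoff_def intro: mult_le_one)
  have f0: "0 \<le> f0" "f0 \<le> 1" by (auto simp: f0_def)
  have f2: "0 \<le> f2" "f2 \<le> 2" by (auto simp: f2_def flat_2_le)
  have R: "R > 0" using assms by simp
  show ?case
  proof (cases "norm x < R")
    case False
    then have "R\<^sup>2 \<le> x \<bullet> x" using R unfolding power2_norm_eq_inner[symmetric] by (intro power_mono) auto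
    then have "1 - (x \<bullet> x) / R\<^sup>2 \<le> 0" using R by simp
    then have "f2 = 0" by (simp add: f2_def)
    then show ?thesis using ce elim(3) R by simp
  next
    case True
    have "\<bar>pressure_fluct (dens (snd w)) (fst (Z w)) * (x \<bullet> e)\<bar> \<le> fl w * (norm x * norm e)"
      unfolding abs_mult using elim(2) by (intro mult_mono Cauchy_Schwarz_ineq2) auto
    moreover have "\<bar>stress_fluct (vel (snd w)) (Z w) e x\<bar> \<le> norm e * norm x * fl w" using elim(1) by blast
    ultimately have "\<bar>q\<bar> \<le> 2 * norm e * (norm x * fl w)"
      unfolding q_def by (intro order_trans[OF abs_triangle_ineq]) (simp add: algebra_simps)
    also have "\<dots> \<le> 2 * norm e * (R * fl w)"
      using True elim(3) by (intro mult_left_mono mult_right_mono) auto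
    finally have q: "\<bar>q\<bar> \<le> 2 * norm e * (R * fl w)" .
    have pf: "0 \<le> p * (2 / R\<^sup>2 * (f0 * f2))" using p f0 f2 by simp
    have "p * (2 / R\<^sup>2 * (f0 * f2)) \<le> 1 * (2 / R\<^sup>2 * (1 * 2))"
      using p f0 f2 R by (intro mult_mono) auto
    then have "p * (2 / R\<^sup>2 * (f0 * f2)) * \<bar>q\<bar> \<le> (1 * (2 / R\<^sup>2 * (1 * 2))) * (2 * norm e * (R * fl w))"
      by (rule mult_mono[OF _ q]) (use R in auto)
    also have "\<dots> = 8 * norm e / R * fl w" using R by (simp add: field_simps power2_eq_square)
    finally have "p * (2 / R\<^sup>2 * (f0 * f2)) * \<bar>q\<bar> \<le> 8 * norm e / R * fl w" .
    then show ?thesis unfolding ce abs_mult[of "p * (2 / R\<^sup>2 * (f0 * f2))" q] abs_of_nonneg[OF pf] .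
  qed
qed

lemma cut_error_integrable:
  assumes "R \<ge> 1"
  shows "integrable PI (cut_error e s \<delta> R)"
proof (rule Bochner_Integration.integrable_bound[OF integrable_mult_right[OF fl_integrable, of "8 * norm e / R"]])
  have fm: "flat n \<in> borel_measurable borel" for n
    using Ck_on_flat[of "\<lambda>x. x" 0 n] by (auto intro!: borel_measurable_continuous_onI Ck_on_intros)
  note [measurable] = fst_snd_w_meas pressure_fluct_meas stress_fluct_meas[OF borel_measurable_const fst_snd_w_meas(2), of e] fm
  show "cut_error e s \<delta> R \<in> borel_measurable PI"
    unfolding cut_error_def[abs_def] time_cutoff_def by measurable
  show "AE w in PI. norm (cut_error e s \<delta> R w) \<le> norm (8 * norm e / R * fl w)"
    using cut_error_bound[OF assms, of \<delta>]
    by eventually_elim (simp only: real_norm_def order_trans[OF _ abs_ge_self])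
qed

text \<open>The tested defect has mean zero, so its signed part has the same integral as the
  error.\<close>

lemma cut_defect_integral:
  assumes "R \<ge> 1" "\<delta> > 0"
  shows "integrable PI (cut_defect e s \<delta> R)" "(LINT w|PI. cut_defect e s \<delta> R w) \<le> 8 * norm e / R * (LINT w|PI. fl w)"
proof -
  have t: "test_fun \<infinity> {0<..<T} (time_cutoff T \<delta>)" "test_fun \<infinity> Q (space_cutoff e s R)"
    using assms by (simp_all add: test_fun_time_cutoff test_fun_space_cutoff[OF half])
  note di = defect_integrable[OF t, of e] and d0 = defect_mean_0[OF t, of e]
  note ei = cut_error_integrable[OF assms(1), of \<delta>]
  have eq: "cut_defect e s \<delta> R = (\<lambda>w. defect (time_cutoff T \<delta>) (space_cutoff e s R) e w + cut_error e s \<delta> R w)"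
    by (rule ext) (simp add: defect_cutoff)
  show "integrable PI (cut_defect e s \<delta> R)"
    unfolding eq by (rule Bochner_Integration.integrable_add[OF di ei])
  have "(LINT w|PI. cut_defect e s \<delta> R w) = (LINT w|PI. cut_error e s \<delta> R w)"
    unfolding eq using Bochner_Integration.integral_add[OF di ei] d0 by simp
  also have "\<dots> \<le> (LINT w|PI. 8 * norm e / R * fl w)"
    by (rule integral_mono_AE[OF ei integrable_mult_right[OF fl_integrable]])
      (use cut_error_bound[OF assms(1), of \<delta>] in \<open>auto elim: eventually_mono\<close>)
  finally show "(LINT w|PI. cut_defect e s \<delta> R w) \<le> 8 * norm e / R * (LINT w|PI. fl w)" by simp
qed

text \<open>Enlarging \<open>R\<close> only enlarges the radial factor; this lets the bound at large
  radii act on a fixed radius.\<close>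

lemma cut_defect_nonneg_mono:
  "AE w in PI. 0 \<le> cut_defect e s \<delta> R w \<and> (\<forall>R'\<ge>R. R \<ge> 1 \<longrightarrow> cut_defect e s \<delta> R w \<le> cut_defect e s \<delta> R' w)"
  using adm_AE pressure_le_fl
proof eventually_elim
  case (elim w)
  define x where "x = snd (snd w)"
  define p where "p = time_cutoff T \<delta> (fst (snd w))"
  define q where "q = stress_fluct (vel (snd w)) (Z w) e e + pressure_fluct (dens (snd w)) (fst (Z w)) * (e \<bullet> e)"
  have cd: "cut_defect e s \<delta> R w = p * (flat 2 (x \<bullet> e - s) * flat 0 (1 - (x \<bullet> x) / R\<^sup>2)) * q" for R
    by (simp add: cut_defect_def x_def p_def q_def)
  have nn: "0 \<le> p" "0 \<le> q"
    using elim stress_diag_nonneg[OF elim(1)] by (auto simp: p_def time_cutoff_def q_def intro!: add_nonneg_nonneg)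
  have "cut_defect e s \<delta> R w \<le> cut_defect e s \<delta> R' w" if R: "R' \<ge> R" "R \<ge> 1" for R'
  proof -
    have "R\<^sup>2 \<le> R'\<^sup>2" using R by (intro power_mono) auto
    then have "(x \<bullet> x) / R'\<^sup>2 \<le> (x \<bullet> x) / R\<^sup>2" using R by (intro divide_left_mono) auto
    then have "flat 0 (1 - (x \<bullet> x) / R\<^sup>2) \<le> flat 0 (1 - (x \<bullet> x) / R'\<^sup>2)" by (intro flat_mono) simp
    then show ?thesis unfolding cd using nn by (intro mult_right_mono mult_left_mono) auto
  qed
  moreover have "0 \<le> cut_defect e s \<delta> R w" unfolding cd using nn by simp
  ultimately show ?case by blast
qed

text \<open>By monotonicity the integral at radius \<open>R\<close> is at most the one at radius R +
  k, hence at most a multiple of 1/(R + k) for every \<open>k\<close>.\<close>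

lemma cut_defect_zero:
  assumes R: "R \<ge> 1" and \<delta>: "\<delta> > 0"
  shows "AE w in PI. cut_defect e s \<delta> R w = 0"
proof -
  note i = cut_defect_integral[OF _ \<delta>]
  have "(LINT w|PI. cut_defect e s \<delta> R w) \<le> 0"
  proof (rule LIMSEQ_le_const)
    show "(\<lambda>k. 8 * norm e / (R + real k) * (LINT w|PI. fl w)) \<longlonglongrightarrow> 0"
    proof (rule tendsto_mult_left_zero)
      have "filterlim (\<lambda>k. R + real k) at_top sequentially"
        by (rule filterlim_tendsto_add_at_top[OF tendsto_const filterlim_real_sequentially])
      then show "(\<lambda>k. 8 * norm e / (R + real k)) \<longlonglongrightarrow> 0"
        by (intro tendsto_divide_0[OF tendsto_const] filterlim_at_top_imp_at_infinity)
    qed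
    have "(LINT w|PI. cut_defect e s \<delta> R w) \<le> 8 * norm e / (R + real k) * (LINT w|PI. fl w)" for k
    proof -
      have "(LINT w|PI. cut_defect e s \<delta> R w) \<le> (LINT w|PI. cut_defect e s \<delta> (R + real k) w)"
        using R cut_defect_nonneg_mono[of \<delta> R] by (intro integral_mono_AE i(1)) (auto elim: eventually_mono)
      also have "\<dots> \<le> 8 * norm e / (R + real k) * (LINT w|PI. fl w)"
        using R by (intro i(2)) simp
      finally show ?thesis .
    qed
    then show "\<exists>N. \<forall>k\<ge>N. (LINT w|PI. cut_defect e s \<delta> R w) \<le> 8 * norm e / (R + real k) * (LINT w|PI. fl w)" by blast
  qed
  moreover have nn: "AE w in PI. 0 \<le> cut_defect e s \<delta> R w"
    using cut_defect_nonneg_mono[of \<delta> R] by eventually_elim simp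
  then have "0 \<le> (LINT w|PI. cut_defect e s \<delta> R w)" by (rule integral_nonneg_AE)
  ultimately show ?thesis
    using integral_nonneg_eq_0_iff_AE[OF i(1)[OF R] nn] by simp
qed

text \<open>Countably many cutoffs suffice: every point of the open half space has positive weight
  for a small time margin and a large radius. Both summands of the integrand are nonnegative, so
  each vanishes; the pressure carries the factor e \<bullet> e, hence the condition on
  \<open>e\<close>.\<close>

lemma fluct_vanishes_half_space:
  "AE w in PI. snd (snd w) \<bullet> e > s \<longrightarrow> stress_fluct (vel (snd w)) (Z w) e e = 0 \<and> (e \<noteq> 0 \<longrightarrow> pressure_fluct (dens (snd w)) (fst (Z w)) = 0)"
proof -
  have "AE w in PI. \<forall>j k. cut_defect e s (1 / real (Suc j)) (real (Suc k)) w = 0"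
    unfolding AE_all_countable by (intro allI cut_defect_zero) auto
  then show ?thesis
    using adm_AE pressure_le_fl AE_space
  proof eventually_elim
    case (elim w)
    define x where "x = snd (snd w)"
    define t where "t = fst (snd w)"
    define q where "q = stress_fluct (vel (snd w)) (Z w) e e + pressure_fluct (dens (snd w)) (fst (Z w)) * (e \<bullet> e)"
    have t: "0 < t" "t < T" using elim(4) by (auto simp: t_def space_pair_measure space_restrict_space)
    show ?case
    proof
      assume "snd (snd w) \<bullet> e > s"
      then have xs: "x \<bullet> e > s" by (simp add: x_def)
      obtain j where j: "inverse (real (Suc j)) < min t (T - t)"
        using reals_Archimedean[of "min t (T - t)"] t by auto
      obtain k where k: "norm x < real k" using reals_Archimedean2 by blast
      have "(norm x)\<^sup>2 < (real (Suc k))\<^sup>2" using k by (intro power_strict_mono) auto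
      then have "(x \<bullet> x) / (real (Suc k))\<^sup>2 < 1" unfolding power2_norm_eq_inner by (simp del: of_nat_Suc)
      then have "flat 0 (1 - (x \<bullet> x) / (real (Suc k))\<^sup>2) > 0" by simp
      moreover have "time_cutoff T (1 / real (Suc j)) t > 0"
        using j by (simp add: time_cutoff_def inverse_eq_divide del: of_nat_Suc)
      moreover have "flat 2 (x \<bullet> e - s) > 0" using xs by simp
      ultimately have "0 < time_cutoff T (1 / real (Suc j)) t * (flat 2 (x \<bullet> e - s) * flat 0 (1 - (x \<bullet> x) / (real (Suc k))\<^sup>2))"
        by (intro mult_pos_pos)
      moreover have "time_cutoff T (1 / real (Suc j)) t * (flat 2 (x \<bullet> e - s) * flat 0 (1 - (x \<bullet> x) / (real (Suc k))\<^sup>2)) * q = 0"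
        using elim(1)[rule_format, of j k] unfolding cut_defect_def x_def t_def q_def .
      ultimately have "q = 0" by (metis mult_eq_0_iff less_irrefl)
      moreover have "stress_fluct (vel (snd w)) (Z w) e e \<ge> 0" by (rule stress_diag_nonneg[OF elim(2)])
      moreover have "pressure_fluct (dens (snd w)) (fst (Z w)) * (e \<bullet> e) \<ge> 0" using elim(3) by simp
      ultimately have "stress_fluct (vel (snd w)) (Z w) e e = 0" "pressure_fluct (dens (snd w)) (fst (Z w)) * (e \<bullet> e) = 0"
        unfolding q_def by linarith+
      then show "stress_fluct (vel (snd w)) (Z w) e e = 0 \<and> (e \<noteq> 0 \<longrightarrow> pressure_fluct (dens (snd w)) (fst (Z w)) = 0)" by auto
    qed
  qed
qed

end

text \<open>A half space separating \<open>x0\<close> from the obstacle still does so when its normal is tilted a little towards the coordinate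
  axes, and the tilted normals determine the vector that they are all orthogonal to.\<close>

lemma Z_eq_bar_local:
  assumes B: "convex B" "compact B" "Q = - B" and x0: "x0 \<in> Q"
  shows "\<exists>S. open S \<and> x0 \<in> S \<and> (AE w in PI. snd (snd w) \<in> S \<longrightarrow> Z w = bar (snd w))"
proof -
  obtain a' b' where ab: "a' \<bullet> x0 < b'" "\<And>y. y \<in> B \<Longrightarrow> a' \<bullet> y > b'"
    using separating_hyperplane_closed_point[OF B(1) compact_imp_closed[OF B(2)], of x0] x0 B(3) by auto
  define e0 where "e0 = - a'"
  define s where "s = - b'"
  have e0: "x0 \<bullet> e0 > s" "\<And>y. y \<in> B \<Longrightarrow> y \<bullet> e0 < s"
    using ab by (auto simp: e0_def s_def inner_commute)
  define gap where "gap = x0 \<bullet> e0 - s"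
  have gap: "gap > 0" using e0 by (simp add: gap_def)
  obtain R where R: "\<And>y. y \<in> B \<Longrightarrow> norm y \<le> R" using compact_imp_bounded[OF B(2)] by (auto simp: bounded_iff)
  \<comment> \<open>The ball of radius \<open>M\<close> contains the obstacle and \<open>x0\<close>.
    A tilt of length gap/(3 M) moves values on it by at most gap/3, so the level \<open>s1\<close>
    in the middle of the gap still separates.\<close>
  define M where "M = \<bar>R\<bar> + norm x0 + 1"
  have M: "M > 0" by (simp add: M_def add_nonneg_pos)
  define d where "d = gap / (3 * M)"
  have d: "d > 0" using gap M by (simp add: d_def)
  define s1 where "s1 = s + gap / 2"
  define ei where "ei j = e0 + d *\<^sub>R axis j 1" for j :: 'n
  have small: "\<bar>y \<bullet> (d *\<^sub>R axis j 1)\<bar> \<le> gap / 3" if "norm y \<le> M" for y :: "real^'n" and j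
  proof -
    have "\<bar>y \<bullet> (d *\<^sub>R axis j 1)\<bar> \<le> norm y * norm (d *\<^sub>R (axis j 1 :: real^'n))" by (rule Cauchy_Schwarz_ineq2)
    also have "\<dots> \<le> M * d" using that d M by (intro mult_mono) auto
    also have "\<dots> = gap / 3" using M by (simp add: d_def)
    finally show ?thesis .
  qed
  have half0: "{x. x \<bullet> e0 \<ge> s1} \<subseteq> Q"
    using e0(2) gap by (force simp: B(3) s1_def)
  have halfj: "{x. x \<bullet> ei j \<ge> s1} \<subseteq> Q" for j
  proof
    fix x assume x: "x \<in> {x. x \<bullet> ei j \<ge> s1}"
    show "x \<in> Q"
    proof (rule ccontr)
      assume "x \<notin> Q"
      then have xB: "x \<in> B" by (simp add: B(3))
      have "norm x \<le> M" using R[OF xB] norm_ge_zero[of x0] abs_ge_self[of R] unfolding M_def by linarith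
      then have "x \<bullet> ei j \<le> x \<bullet> e0 + gap / 3" using small[of x j] unfolding ei_def inner_add_right by linarith
      also have "\<dots> < s + gap / 3" using e0(2)[OF xB] by simp
      finally show False using x gap by (simp add: s1_def)
    qed
  qed
  define S where "S = {x. s1 < x \<bullet> e0} \<inter> (\<Inter>j\<in>UNIV. {x. s1 < x \<bullet> ei j})"
  have "open S"
    unfolding S_def by (intro open_Int open_INT finite ballI open_Collect_less continuous_intros)
  moreover have "x0 \<in> S"
  proof -
    have "norm x0 \<le> M" by (simp add: M_def)
    then have "x0 \<bullet> ei j \<ge> x0 \<bullet> e0 - gap / 3" for j using small[of x0 j] unfolding ei_def inner_add_right by linarith
    moreover have "x0 \<bullet> e0 - gap / 3 > s1" "x0 \<bullet> e0 > s1" using gap by (simp_all add: s1_def gap_def field_simps)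
    ultimately show ?thesis unfolding S_def by (auto intro: less_le_trans)
  qed
  moreover have "AE w in PI. snd (snd w) \<in> S \<longrightarrow> Z w = bar (snd w)"
  proof -
    have "AE w in PI. \<forall>j. snd (snd w) \<bullet> ei j > s1 \<longrightarrow> stress_fluct (vel (snd w)) (Z w) (ei j) (ei j) = 0 \<and>
        (ei j \<noteq> 0 \<longrightarrow> pressure_fluct (dens (snd w)) (fst (Z w)) = 0)"
      using AE_finite_allI[OF finite_class.finite_UNIV fluct_vanishes_half_space[OF halfj]] by simp
    moreover have "AE w in PI. dens (snd w) \<ge> 0 \<and> (dens (snd w) = 0 \<longrightarrow> snd (bar (snd w)) = 0)"
      by (rule AE_snd_component) (use slice_jensen in \<open>auto elim: eventually_mono\<close>)
    ultimately show ?thesis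
      using fluct_vanishes_half_space[OF half0] adm_AE
    proof eventually_elim
      case (elim w)
      show ?case
      proof
        assume xS: "snd (snd w) \<in> S"
        define y where "y = snd (Z w) - fst (Z w) *\<^sub>R vel (snd w)"
        have r: "fst (Z w) \<ge> 0" "fst (Z w) = 0 \<Longrightarrow> snd (Z w) = 0" using elim(4) by (auto simp: admissible_def)
        have j0: "stress_fluct (vel (snd w)) (Z w) (ei j) (ei j) = 0" "ei j \<noteq> 0 \<Longrightarrow> pressure_fluct (dens (snd w)) (fst (Z w)) = 0" for j
          using elim(1) xS by (auto simp: S_def)
        have e00: "stress_fluct (vel (snd w)) (Z w) e0 e0 = 0" "e0 \<noteq> 0 \<Longrightarrow> pressure_fluct (dens (snd w)) (fst (Z w)) = 0"
          using elim(3) xS by (auto simp: S_def)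
        have "pressure_fluct (dens (snd w)) (fst (Z w)) = 0"
        \<comment> \<open>A zero normal can separate only when the obstacle is empty; the tilted
          normals are then nonzero multiples of axis vectors.\<close>
        proof (cases "e0 = 0")
          case True
          then have "ei undefined \<noteq> 0" using d by (simp add: ei_def axis_eq_0_iff)
          then show ?thesis by (rule j0(2))
        qed (rule e00(2))
        then have rd: "fst (Z w) = dens (snd w)"
          using pressure_fluct_eq_0[OF r(1), of "dens (snd w)"] elim(2) by simp
        show "Z w = bar (snd w)"
        \<comment> \<open>In vacuum \<open>stress_fluct\<close> is 0 by the convention for division
          and carries no information; there both momenta vanish.\<close>
        proof (cases "fst (Z w) = 0")
          case True
          then have "snd (Z w) = 0" "snd (bar (snd w)) = 0" using r(2) rd elim(2) by auto
          then show ?thesis using rd by (simp add: prod_eq_iff)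
        next
          case False
          have "y \<bullet> e0 = 0" "y \<bullet> ei j = 0" for j
            using e00(1) j0(1)[of j] False by (simp_all add: stress_fluct_def y_def)
          then have "y \<bullet> (d *\<^sub>R axis j 1) = 0" for j
            unfolding ei_def inner_add_right by simp
          then have "y $ j = 0" for j using d by (simp add: inner_axis_1)
          then have "y = 0" by (simp add: vec_eq_iff)
          then have "snd (Z w) = dens (snd w) *\<^sub>R vel (snd w)" by (simp add: y_def rd)
          also have "\<dots> = snd (bar (snd w))" using False rd by (simp add: vel_def)
          finally show ?thesis using rd by (simp add: prod_eq_iff)
        qed
      qed
    qed
  qed
  ultimately show ?thesis by blast
qed

text \<open>The exceptional null set depends on \<open>x0\<close>; Lindelof's theorem reduces the
  cover of \<open>Q\<close> to countably many neighbourhoods.\<close>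

theorem Z_eq_bar:
  assumes B: "convex B" "compact B" "Q = - B"
  shows "AE w in PI. Z w = bar (snd w)"
proof -
  define \<F> where "\<F> = {S. open S \<and> (AE w in PI. snd (snd w) \<in> S \<longrightarrow> Z w = bar (snd w))}"
  obtain \<F>' where F: "\<F>' \<subseteq> \<F>" "countable \<F>'" "\<Union>\<F>' = \<Union>\<F>"
    using Lindelof[of \<F>] by (auto simp: \<F>_def)
  have "AE w in PI. \<forall>S\<in>\<F>'. snd (snd w) \<in> S \<longrightarrow> Z w = bar (snd w)"
    using F(1) by (intro AE_ball_countable' F(2)) (auto simp: \<F>_def)
  then show ?thesis
    using AE_space
  proof eventually_elim
    case (elim w)
    then have "snd (snd w) \<in> Q" by (auto simp: space_pair_measure space_restrict_space)
    then have "snd (snd w) \<in> \<Union>\<F>'"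
      unfolding F(3) \<F>_def using Z_eq_bar_local[OF B] by blast
    then show ?case using elim(1) by blast
  qed
qed

end

section \<open>The limit law and strong convergence\<close>

lemma pairing_cong_AE:
  assumes h: "h \<in> trajectories T \<gamma> Q" and g: "g \<in> trajectories T \<gamma> Q" and t: "t \<in> {0..T}" and d: "dual_pair \<gamma> Q \<phi> \<Phi>"
    and eq: "AE x in lborel. x \<in> Q \<longrightarrow> traj_val h t x = traj_val g t x"
  shows "pairing Q h \<phi> \<Phi> t = pairing Q g \<phi> \<Phi> t"
proof -
  have [measurable]: "\<phi> \<in> borel_measurable lborel" "\<Phi> \<in> borel_measurable lborel"
    using d by (auto simp: dual_pair_def Lp_comp_def)
  have m: "(\<lambda>x. indicator Q x *\<^sub>R fst f t x) \<in> borel_measurable lborel" "(\<lambda>x. indicator Q x *\<^sub>R snd f t x) \<in> borel_measurable lborel"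
    if "f \<in> trajectories T \<gamma> Q" for f
    using that t unfolding trajectories_def Lp_loc_def set_borel_measurable_def by blast+
  have eq': "indicator Q x *\<^sub>R (fst f t x * \<phi> x) = (indicator Q x *\<^sub>R fst f t x) * \<phi> x"
    "indicator Q x *\<^sub>R (snd f t x \<bullet> \<Phi> x) = (indicator Q x *\<^sub>R snd f t x) \<bullet> \<Phi> x" for f x by simp_all
  note [measurable] = m[OF h] m[OF g]
  have "AE x in lborel. (indicator Q x *\<^sub>R fst h t x) * \<phi> x = (indicator Q x *\<^sub>R fst g t x) * \<phi> x"
    "AE x in lborel. (indicator Q x *\<^sub>R snd h t x) \<bullet> \<Phi> x = (indicator Q x *\<^sub>R snd g t x) \<bullet> \<Phi> x"
    using eq by (auto simp: traj_val_def split: split_indicator elim!: eventually_mono)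
  then show ?thesis
    unfolding pairing_def set_lebesgue_integral_def eq' by (intro arg_cong2[where f = "(+)"] integral_cong_AE) measurable
qed

text \<open>The points of the open interval where the functions differ form an open null set, which
  is empty; closedness of the coincidence set reaches the end points.\<close>

lemma continuous_AE_eq:
  fixes f g :: "real \<Rightarrow> real"
  assumes f: "continuous_on {0..T} f" "continuous_on {0..T} g" and T: "T > 0"
    and eq: "AE t in lborel. t \<in> {0<..<T} \<longrightarrow> f t = g t"
    and t: "t \<in> {0..T}"
  shows "f t = g t"
proof -
  define C where "C = {t \<in> {0..T}. f t - g t = 0}"
  have C: "closed C"
    unfolding C_def using f by (intro continuous_closed_preimage_constant continuous_intros) auto
  define O' where "O' = {0<..<T} - C"
  have O': "open O'" unfolding O'_def by (intro open_Diff C) auto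
  have "AE t in lborel. t \<notin> O'"
    using eq by eventually_elim (auto simp: O'_def C_def)
  then have "O' \<in> null_sets lborel" using O' by (subst AE_iff_null_sets) auto
  then have "negligible O'" by (simp add: negligible_iff_null_sets null_sets_completionI)
  then have "O' = {}" using open_not_negligible[OF O'] by blast
  then have "{0<..<T} \<subseteq> C" by (auto simp: O'_def)
  then have "closure {0<..<T} \<subseteq> C" using C by (rule closure_minimal)
  then have "t \<in> C" using T t by (auto simp: closure_greaterThanLessThan)
  then show ?thesis by (simp add: C_def)
qed

text \<open>Membership in a generating set depends on the pairings only, and intersections and
  unions preserve this. Representatives of one trajectory are thus indistinguishable for the
  topology, and by \<open>same_pairings_borel\<close> for its Borel sets.\<close>

lemma same_pairings_openin:
  assumes h: "h \<in> trajectories T \<gamma> Q" "g \<in> trajectories T \<gamma> Q"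
    and eq: "\<And>\<phi> \<Phi> t. dual_pair \<gamma> Q \<phi> \<Phi> \<Longrightarrow> t \<in> {0..T} \<Longrightarrow> pairing Q h \<phi> \<Phi> t = pairing Q g \<phi> \<Phi> t"
    and U: "openin (traj_topology T \<gamma> Q) U"
  shows "h \<in> U \<longleftrightarrow> g \<in> U"
  using U[unfolded traj_topology_def openin_topology_generated_by_iff]
proof induction
  case (UN K)
  then show ?case by blast
next
  case (Basis s)
  then obtain f \<phi> \<Phi> e where s: "s = {h \<in> trajectories T \<gamma> Q. \<forall>t\<in>{0..T}. \<bar>pairing Q h \<phi> \<Phi> t - pairing Q f \<phi> \<Phi> t\<bar> < e}"
    and "dual_pair \<gamma> Q \<phi> \<Phi>" by blast
  then show ?case using h eq by simp
qed auto

lemma same_pairings_borel: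
  assumes h: "h \<in> trajectories T \<gamma> Q" "g \<in> trajectories T \<gamma> Q"
    and eq: "\<And>\<phi> \<Phi> t. dual_pair \<gamma> Q \<phi> \<Phi> \<Longrightarrow> t \<in> {0..T} \<Longrightarrow> pairing Q h \<phi> \<Phi> t = pairing Q g \<phi> \<Phi> t"
    and A: "A \<in> sets (traj_borel T \<gamma> Q)"
  shows "h \<in> A \<longleftrightarrow> g \<in> A"
proof -
  have "sets (traj_borel T \<gamma> Q) = sigma_sets (trajectories T \<gamma> Q) {U. openin (traj_topology T \<gamma> Q) U}"
    unfolding traj_borel_def topspace_traj_topology[symmetric] by (rule sets_measure_of) (auto dest: openin_subset)
  with A have "A \<in> sigma_sets (trajectories T \<gamma> Q) {U. openin (traj_topology T \<gamma> Q) U}" by simp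
  then show ?thesis
  proof induction
    case (Basic U)
    then show ?case using same_pairings_openin[OF h eq] by simp
  qed (use h in auto)
qed

lemma tendsto_0_ennrealI:
  fixes f :: "'a \<Rightarrow> ennreal"
  assumes "\<And>e. e > 0 \<Longrightarrow> \<forall>\<^sub>F x in F. f x \<le> ennreal e"
  shows "(f \<longlongrightarrow> 0) F"
proof (rule order_tendstoI)
  fix b :: ennreal assume "0 < b"
  then obtain c where c: "0 < c" "c < b" using dense by blast
  have "c \<noteq> \<top>" using c(2) by auto
  then have "ennreal (enn2real c) = c" by (simp add: less_top)
  moreover have "enn2real c > 0" using c \<open>c \<noteq> \<top>\<close> by (simp add: enn2real_positive_iff less_top)
  ultimately have "\<forall>\<^sub>F x in F. f x \<le> c" using assms[of "enn2real c"] by simp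
  then show "\<forall>\<^sub>F x in F. f x < b" by eventually_elim (use c in auto)
qed simp

section \<open>Trajectories that agree almost everywhere\<close>

context trajectory_law
begin

lemma AE_eq_pairing:
  assumes h: "h \<in> trajectories T \<gamma> Q" and g: "g \<in> trajectories T \<gamma> Q"
    and eq: "AE z in cyl Q. traj_val h (fst z) (snd z) = traj_val g (fst z) (snd z)"
    and d: "dual_pair \<gamma> Q \<phi> \<Phi>" and t: "t \<in> {0..T}"
  shows "pairing Q h \<phi> \<Phi> t = pairing Q g \<phi> \<Phi> t"
proof (rule continuous_AE_eq[OF _ _ T_pos _ t])
  show "continuous_on {0..T} (pairing Q h \<phi> \<Phi>)" "continuous_on {0..T} (pairing Q g \<phi> \<Phi>)"
    using h g d unfolding trajectories_def by blast+
  have "AE z in lborel \<Otimes>\<^sub>M lborel. z \<in> {0<..<T} \<times> Q \<longrightarrow> traj_val h (fst z) (snd z) = traj_val g (fst z) (snd z)"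
    unfolding lborel_prod using eq cyl_set[OF Q_borel] by (simp add: AE_restrict_space_iff)
  from lborel_pair.AE_pair[OF this]
  have "AE t in lborel. AE x in lborel. (t, x) \<in> {0<..<T} \<times> Q \<longrightarrow> traj_val h t x = traj_val g t x" by simp
  then show "AE t in lborel. t \<in> {0<..<T} \<longrightarrow> pairing Q h \<phi> \<Phi> t = pairing Q g \<phi> \<Phi> t"
  proof eventually_elim
    case (elim t)
    show ?case
    proof
      assume t: "t \<in> {0<..<T}"
      then have "AE x in lborel. x \<in> Q \<longrightarrow> traj_val h t x = traj_val g t x" using elim by simp
      then show "pairing Q h \<phi> \<Phi> t = pairing Q g \<phi> \<Phi> t"
        using t by (intro pairing_cong_AE[OF h g _ d]) auto
    qed
  qed
qed

lemma AE_cyl_mono: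
  assumes "AE z in cyl Q. p z" "K \<subseteq> Q" "K \<in> sets borel"
  shows "AE z in cyl K. p z"
  using assms cyl_set[OF Q_borel] cyl_set[OF assms(3)] by (auto simp: AE_restrict_space_iff elim!: eventually_mono)

lemma nn_integral_cyl_mono:
  assumes "K \<subseteq> Q" "K \<in> sets borel"
  shows "(\<integral>\<^sup>+z. f z \<partial>cyl K) \<le> (\<integral>\<^sup>+z. f z \<partial>cyl Q)"
  using assms cyl_set[OF Q_borel] cyl_set[OF assms(2)]
  by (auto simp: nn_integral_restrict_space intro!: nn_integral_mono split: split_indicator)

end

section \<open>Cutting off large states\<close>

lemma abs_le_square: "e > 0 \<Longrightarrow> \<bar>x\<bar> \<le> e + x\<^sup>2 / e" for x e :: real
proof -
  assume e: "e > 0"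
  have "0 \<le> (\<bar>x\<bar> - e)\<^sup>2" by simp
  then have "2 * (\<bar>x\<bar> * e) \<le> e * e + x * x" by (simp add: power2_eq_square algebra_simps)
  moreover have "0 \<le> \<bar>x\<bar> * e" using e by simp
  ultimately have "\<bar>x\<bar> * e \<le> e * e + x * x" by linarith
  then have "\<bar>x\<bar> * e \<le> (e + x\<^sup>2 / e) * e"
    using e by (simp add: power2_eq_square algebra_simps)
  then show ?thesis using e by simp
qed

text \<open>Multiplied with a coordinate it yields an admissible \<open>b\<close>, which the
  coordinate itself is not; \<open>norm_diff_le_cut\<close> accounts for the tails left
  over.\<close>

definition radial_cut :: "real \<Rightarrow> 'a::real_normed_vector \<Rightarrow> real" where
  "radial_cut M y = max 0 (min 1 (M + 1 - norm y))"

lemma test_fun_radial_cut: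
  fixes i :: "'a::euclidean_space"
  shows "test_fun 0 UNIV (\<lambda>y. radial_cut M y * (y \<bullet> i))"
proof -
  have "radial_cut M y * (y \<bullet> i) = 0" if "y \<notin> cball 0 (M + 1)" for y
    using that by (simp add: radial_cut_def)
  then have "\<exists>K. compact K \<and> K \<subseteq> UNIV \<and> (\<forall>y. y \<notin> K \<longrightarrow> radial_cut M y * (y \<bullet> i) = 0)"
    by (intro exI[of _ "cball 0 (M + 1)"]) auto
  moreover have "continuous_on UNIV (\<lambda>y. radial_cut M y * (y \<bullet> i))"
    unfolding radial_cut_def by (intro continuous_intros)
  ultimately show ?thesis unfolding test_fun_def by (simp add: zero_enat_def)
qed

lemma norm_diff_le_cut:
  fixes y y' :: "'a::euclidean_space"
  shows "norm (y - y') \<le> (\<Sum>i\<in>Basis. \<bar>radial_cut M y * (y \<bullet> i) - radial_cut M y' * (y' \<bullet> i)\<bar>)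
    + (1 - radial_cut M y) * norm y + (1 - radial_cut M y') * norm y'"
proof -
  define c where "c = radial_cut M y"
  define c' where "c' = radial_cut M y'"
  have c: "c \<le> 1" "c' \<le> 1" by (auto simp: c_def c'_def radial_cut_def)
  have "y - y' = (c *\<^sub>R y - c' *\<^sub>R y') + (1 - c) *\<^sub>R y - (1 - c') *\<^sub>R y'" by (simp add: algebra_simps)
  then have "norm (y - y') \<le> norm (c *\<^sub>R y - c' *\<^sub>R y') + norm ((1 - c) *\<^sub>R y) + norm ((1 - c') *\<^sub>R y')"
    by (metis norm_triangle_ineq norm_triangle_ineq4 add_right_mono order_trans)
  also have "norm (c *\<^sub>R y - c' *\<^sub>R y') \<le> (\<Sum>i\<in>Basis. \<bar>(c *\<^sub>R y - c' *\<^sub>R y') \<bullet> i\<bar>)" by (rule norm_le_l1)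
  finally show ?thesis using c by (simp add: inner_diff_left c_def[symmetric] c'_def[symmetric])
qed

context cesaro_limit
begin

text \<open>Where the norm exceeds 2 C, half of it absorbs the additive constant of
  \<open>state_le_energy\<close>, which leaves \<eta> times the energy; elsewhere the cut is
  inactive.\<close>

lemma cut_tail_energy:
  assumes "\<eta> > 0"
  shows "\<exists>M\<ge>0. \<forall>y. ennreal ((1 - radial_cut M y) * norm y) \<le> ennreal \<eta> * E0 y"
proof -
  obtain C where C: "C \<ge> 0" "\<And>y. admissible y \<Longrightarrow> norm y \<le> (\<eta> / 2) * energy uinf y + C"
    using state_le_energy[of "\<eta> / 2" uinf] assms by auto
  have "ennreal ((1 - radial_cut (2 * C) y) * norm y) \<le> ennreal \<eta> * E0 y" for y
  proof (cases "admissible y")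
    case False
    then show ?thesis using assms by (simp add: rel_energy_eq ennreal_mult_top)
  next
    case True
    have e: "energy uinf y \<ge> 0" using True by (auto simp: admissible_def intro: energy_ge)
    have r: "0 \<le> radial_cut (2 * C) y" "radial_cut (2 * C) y \<le> 1" by (auto simp: radial_cut_def)
    have "(1 - radial_cut (2 * C) y) * norm y \<le> \<eta> * energy uinf y"
    proof (cases "norm y \<le> 2 * C")
      case True
      then have "radial_cut (2 * C) y = 1" by (simp add: radial_cut_def)
      then show ?thesis using e assms by simp
    next
      case False
      have "(1 - radial_cut (2 * C) y) * norm y \<le> 1 * norm y" using r by (intro mult_right_mono) auto
      also have "\<dots> \<le> \<eta> * energy uinf y" using C(2)[OF \<open>admissible y\<close>] False by simp
      finally show ?thesis .
    qed
    then show ?thesis using True e assms by (simp add: rel_energy_eq ennreal_leI flip: ennreal_mult')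
  qed
  then show ?thesis using C(1) by (intro exI[of _ "2 * C"]) auto
qed

end

context euler_limit
begin

section \<open>Consequences of the identity of \<open>Z\<close> and the barycenter\<close>

context
  assumes Z_bar: "AE w in PI. Z w = bar (snd w)"
begin

lemma traj_eq_bar: "AE h in V. AE z in cyl Q. traj_val h (fst z) (snd z) = bar z"
proof -
  have "AE h in V. AE z in cyl Q. Z (h, z) = bar z" using VQ.AE_pair[OF Z_bar] by simp
  then show ?thesis using Z_version by eventually_elim (auto elim: eventually_elim2)
qed

text \<open>Almost every sample has the same pairings as the barycenter at all times. Borel sets
  cannot tell such representatives apart, so each has measure 1 or 0 according to whether it
  contains the barycenter.\<close>

theorem law_eq_return: "V = return (traj_borel T \<gamma> Q) (\<rho>bar, mbar)"
proof (rule measure_eqI)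
  show "sets V = sets (return (traj_borel T \<gamma> Q) (\<rho>bar, mbar))" using sets_P by simp
  fix A assume A: "A \<in> sets V"
  then have A': "A \<in> sets (traj_borel T \<gamma> Q)" using sets_P by simp
  have AE: "AE h in V. h \<in> A \<longleftrightarrow> (\<rho>bar, mbar) \<in> A"
    using traj_eq_bar AE_space
  proof eventually_elim
    case (elim h)
    have h: "h \<in> trajectories T \<gamma> Q" using elim(2) by (simp add: space_P)
    show ?case
      by (rule same_pairings_borel[OF h bar_traj AE_eq_pairing[OF h bar_traj elim(1)] A'])
  qed
  show "emeasure V A = emeasure (return (traj_borel T \<gamma> Q) (\<rho>bar, mbar)) A"
  proof (cases "(\<rho>bar, mbar) \<in> A")
    case True
    then have "AE h in V. h \<in> A" using AE by simp
    then show ?thesis using True A A' by (simp add: emeasure_eq_1_AE)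
  next
    case False
    then have "AE h in V. h \<notin> A" using AE by simp
    then have "emeasure V A = 0" using A by (simp add: AE_iff_null_sets[symmetric] null_setsD1)
    then show ?thesis using False A' by simp
  qed
qed

text \<open>Supplies the tail estimate for the limit state in \<open>state_L1\<close>.\<close>

lemma bar_energy: "(\<integral>\<^sup>+z. E0 (bar z) \<partial>cyl Q) < \<infinity>"
proof -
  have m: "(\<lambda>w. E0 (bar (snd w))) \<in> borel_measurable PI"
    by (rule measurable_compose[OF measurable_snd E0_measurable[OF bar_meas]])
  have "(\<integral>\<^sup>+w. E0 (Z w) \<partial>PI) = (\<integral>\<^sup>+w. E0 (bar (snd w)) \<partial>PI)"
    using Z_bar by (intro nn_integral_cong_AE) (auto elim: eventually_mono)
  also have "\<dots> = (\<integral>\<^sup>+h. \<integral>\<^sup>+z. E0 (bar z) \<partial>cyl Q \<partial>V)"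
    using m by (subst VQ.M2.nn_integral_fst[symmetric]) auto
  also have "\<dots> = (\<integral>\<^sup>+z. E0 (bar z) \<partial>cyl Q)" by (simp add: emeasure_space_1)
  finally show ?thesis using limit_energy[OF Z_lborel Z_version] by simp
qed

text \<open>Under the Dirac law the expectation of an observable is its value at the barycenter; the
  fundamental lemma makes this identity pointwise.\<close>

lemma mean_eq_bar:
  fixes b :: "real \<times> (real^'n) \<Rightarrow> real"
  assumes b: "test_fun 0 UNIV b" and g: "mean_of T Q V b g"
  shows "(\<lambda>z. g (fst z) (snd z)) \<in> borel_measurable (cyl Q)" "AE z in cyl Q. g (fst z) (snd z) = b (bar z)"
proof -
  let ?D = "{0<..<T} \<times> Q"
  have D: "?D \<in> sets borel" by (rule cyl_set[OF Q_borel])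
  show gm: "(\<lambda>z. g (fst z) (snd z)) \<in> borel_measurable (cyl Q)"
    using g D unfolding mean_of_def by (auto simp: set_borel_measurable_def borel_measurable_restrict_space_iff)
  obtain Cg where Cg: "AE z in cyl Q. \<bar>g (fst z) (snd z)\<bar> \<le> Cg"
    using g D unfolding mean_of_def by (auto simp: AE_restrict_space_iff)
  let ?f = "\<lambda>z. indicator ?D z * (g (fst z) (snd z) - b (bar z)) :: real"
  have "AE z in lborel. z \<in> ?D \<longrightarrow> ?f z = 0"
  proof (rule fundamental_lemma_variations[OF open_D])
    fix \<phi> :: "real \<times> (real^'n) \<Rightarrow> real" assume "test_fun \<infinity> ?D \<phi>"
    then have \<phi>: "test_fun 0 ?D \<phi>" by (rule test_fun_mono)
    have gi: "integrable (cyl Q) (\<lambda>z. g (fst z) (snd z) * \<phi> z)" by (rule integrable_bounded_test[OF gm Cg \<phi>])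
    have bi: "integrable (cyl Q) (\<lambda>z. b (bar z) * \<phi> z)" by (rule integrable_observable[OF b \<phi> bar_meas])
    have eq: "?f z * \<phi> z = indicator ?D z *\<^sub>R (g (fst z) (snd z) * \<phi> z - b (bar z) * \<phi> z)" for z
      by (simp add: algebra_simps)
    show "integrable lborel (\<lambda>z. ?f z * \<phi> z)"
      unfolding eq using Bochner_Integration.integrable_diff[OF gi bi] D by (simp add: integrable_restrict_space)
    have "(LINT z|lborel. ?f z * \<phi> z) = (LINT z|cyl Q. g (fst z) (snd z) * \<phi> z - b (bar z) * \<phi> z)"
      unfolding eq using D by (simp add: integral_restrict_space set_lebesgue_integral_def)
    also have "\<dots> = (LINT z|cyl Q. g (fst z) (snd z) * \<phi> z) - (LINT z|cyl Q. b (bar z) * \<phi> z)"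
      by (rule Bochner_Integration.integral_diff[OF gi bi])
    also have "(LINT z|cyl Q. g (fst z) (snd z) * \<phi> z) = (LINT h|V. LINT z|cyl Q. b (traj_val h (fst z) (snd z)) * \<phi> z)"
      using g \<phi> Q_borel unfolding mean_of_def by (simp add: st_integral_restrict traj_val_def)
    also have "\<dots> = (LINT z|cyl Q. b (bar z) * \<phi> z)"
    proof -
      have "(\<lambda>h. LINT z|cyl Q. b (traj_val h (fst z) (snd z)) * \<phi> z) \<in> borel_measurable (traj_borel T \<gamma> Q)"
        using observable_measurable[OF b \<phi>] by (simp cong: measurable_cong_sets add: sets_P)
      then show ?thesis
        by (subst law_eq_return) (rule integral_return, use bar_traj in \<open>simp_all add: space_traj_borel\<close>)
    qed
    finally show "(LINT z|lborel. ?f z * \<phi> z) = 0" by simp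
  qed
  then show "AE z in cyl Q. g (fst z) (snd z) = b (bar z)"
    using D by (auto simp: AE_restrict_space_iff elim: eventually_mono)
qed

section \<open>Strong convergence on a compact set\<close>

context
  fixes K :: "(real^'n) set"
  assumes K: "compact K" "K \<subseteq> Q"
begin

interpretation c: finite_measure "cyl K" by (rule finite_cyl[OF K(1)])

lemma K_borel: "K \<in> sets borel"
  using K(1) by (simp add: compact_imp_closed)

lemma traj_meas_K: "h \<in> trajectories T \<gamma> Q \<Longrightarrow> (\<lambda>z. traj_val h (fst z) (snd z)) \<in> borel_measurable (cyl K)"
  by (rule traj_val_measurable[OF _ open_Q K_borel K(2)])

lemma observable_integrable_K:
  fixes b :: "real \<times> (real^'n) \<Rightarrow> real"
  assumes b: "test_fun 0 UNIV b" and h: "h \<in> trajectories T \<gamma> Q"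
    and f: "f \<in> borel_measurable (cyl K)" "\<And>z. \<bar>f z\<bar> \<le> Cf"
  shows "integrable (cyl K) (\<lambda>z. f z * b (traj_val h (fst z) (snd z)))"
proof -
  obtain C where C: "C \<ge> 0" "\<And>y. \<bar>b y\<bar> \<le> C" using test_fun_bounded_measurable(2)[OF b] by auto
  have "(\<lambda>z. f z * b (traj_val h (fst z) (snd z))) \<in> borel_measurable (cyl K)"
    by (intro borel_measurable_times f(1) measurable_compose[OF traj_meas_K[OF h] test_fun_bounded_measurable(1)[OF b]])
  moreover have "\<bar>f z * b y\<bar> \<le> \<bar>Cf\<bar> * C" for z y
    unfolding abs_mult using f(2)[of z] C by (intro mult_mono) auto
  ultimately show ?thesis by (intro c.integrable_const_bound[of _ "\<bar>Cf\<bar> * C"]) auto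
qed

text \<open>The weight is there for the mixed term of the mean square deviation, which pairs the
  averages with \<open>b (bar z)\<close>.\<close>

lemma weighted_averages:
  fixes b :: "real \<times> (real^'n) \<Rightarrow> real"
  assumes b: "test_fun 0 UNIV b" and f: "f \<in> borel_measurable (cyl K)" "\<And>z. \<bar>f z\<bar> \<le> Cf"
  shows "(\<lambda>k. (\<Sum>n=1..N k. LINT z|cyl K. f z * b (traj_val (seq n) (fst z) (snd z))) / real (N k)) \<longlonglongrightarrow> (LINT z|cyl K. f z * b (bar z))"
proof -
  obtain g where g: "mean_of T Q V b g"
    and conv: "(\<lambda>k. L1_norm {0<..<T} K (\<lambda>t x. (\<Sum>n=1..N k. b (traj_val (seq n) t x)) / real (N k) - g t x)) \<longlonglongrightarrow> 0"
    using averages[OF b] K by blast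
  define A where "A k z = (\<Sum>n=1..N k. b (traj_val (seq n) (fst z) (snd z))) / real (N k)" for k z
  have one: "(\<lambda>_. 1 :: real) \<in> borel_measurable (cyl K)" by simp
  have bi: "integrable (cyl K) (\<lambda>z. b (traj_val (seq n) (fst z) (snd z)))" if "n \<in> {1..N k}" for n k
    using observable_integrable_K[OF b seq_traj one, of n 1] that by simp
  have bbar: "integrable (cyl K) (\<lambda>z. b (bar z))" "integrable (cyl K) (\<lambda>z. f z * b (bar z))"
    using observable_integrable_K[OF b bar_traj one, of 1] observable_integrable_K[OF b bar_traj f] by simp_all
  have Ai: "integrable (cyl K) (A k)" for k
    unfolding A_def using bi by (intro Bochner_Integration.integrable_divide Bochner_Integration.integrable_sum) auto
  have fA: "(LINT z|cyl K. f z * A k z) = (\<Sum>n=1..N k. LINT z|cyl K. f z * b (traj_val (seq n) (fst z) (snd z))) / real (N k)"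
    "integrable (cyl K) (\<lambda>z. f z * A k z)" for k
  proof -
    have i: "integrable (cyl K) (\<lambda>z. f z * b (traj_val (seq n) (fst z) (snd z)))" if "n \<in> {1..N k}" for n
      using that by (intro observable_integrable_K[OF b seq_traj f]) auto
    have e: "f z * A k z = (\<Sum>n=1..N k. f z * b (traj_val (seq n) (fst z) (snd z))) / real (N k)" for z
      by (simp add: A_def sum_distrib_left)
    show "integrable (cyl K) (\<lambda>z. f z * A k z)"
      unfolding e using i by (intro Bochner_Integration.integrable_divide Bochner_Integration.integrable_sum)
    show "(LINT z|cyl K. f z * A k z) = (\<Sum>n=1..N k. LINT z|cyl K. f z * b (traj_val (seq n) (fst z) (snd z))) / real (N k)"
      unfolding e using i by (simp add: Bochner_Integration.integral_sum)
  qed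
  have L1: "L1_norm {0<..<T} K (\<lambda>t x. (\<Sum>n=1..N k. b (traj_val (seq n) t x)) / real (N k) - g t x) = ennreal (LINT z|cyl K. \<bar>A k z - b (bar z)\<bar>)" for k
  proof -
    have "L1_norm {0<..<T} K (\<lambda>t x. (\<Sum>n=1..N k. b (traj_val (seq n) t x)) / real (N k) - g t x) =
        (\<integral>\<^sup>+z. ennreal \<bar>A k z - g (fst z) (snd z)\<bar> \<partial>cyl K)"
      using K_borel by (simp add: L1_norm_restrict A_def)
    also have "\<dots> = (\<integral>\<^sup>+z. ennreal \<bar>A k z - b (bar z)\<bar> \<partial>cyl K)"
      using AE_cyl_mono[OF mean_eq_bar(2)[OF b g] K(2) K_borel]
      by (intro nn_integral_cong_AE) (auto elim: eventually_mono)
    also have "\<dots> = ennreal (LINT z|cyl K. \<bar>A k z - b (bar z)\<bar>)"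
      using Ai bbar(1) by (intro nn_integral_eq_integral) auto
    finally show ?thesis .
  qed
  have "(\<lambda>k. LINT z|cyl K. \<bar>A k z - b (bar z)\<bar>) \<longlonglongrightarrow> 0"
    using tendsto_enn2real[of _ 0, unfolded ennreal_0, OF conv[unfolded L1]] by (simp add: Bochner_Integration.integral_nonneg)
  then have lim: "(\<lambda>k. \<bar>Cf\<bar> * (LINT z|cyl K. \<bar>A k z - b (bar z)\<bar>)) \<longlonglongrightarrow> 0"
    by (rule tendsto_mult_right_zero)
  have "\<bar>(LINT z|cyl K. f z * A k z) - (LINT z|cyl K. f z * b (bar z))\<bar> \<le> \<bar>Cf\<bar> * (LINT z|cyl K. \<bar>A k z - b (bar z)\<bar>)" for k
  proof -
    have "\<bar>(LINT z|cyl K. f z * A k z) - (LINT z|cyl K. f z * b (bar z))\<bar> = \<bar>LINT z|cyl K. f z * A k z - f z * b (bar z)\<bar>"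
      using fA(2) bbar(2) by simp
    also have "\<dots> \<le> (LINT z|cyl K. \<bar>f z * A k z - f z * b (bar z)\<bar>)" by (rule integral_abs_bound)
    also have "\<dots> \<le> (LINT z|cyl K. \<bar>Cf\<bar> * \<bar>A k z - b (bar z)\<bar>)"
    proof (rule integral_mono)
      fix z
      have "\<bar>f z\<bar> * \<bar>A k z - b (bar z)\<bar> \<le> \<bar>Cf\<bar> * \<bar>A k z - b (bar z)\<bar>"
        using f(2)[of z] by (intro mult_right_mono) auto
      then show "\<bar>f z * A k z - f z * b (bar z)\<bar> \<le> \<bar>Cf\<bar> * \<bar>A k z - b (bar z)\<bar>"
        by (simp add: abs_mult flip: right_diff_distrib)
    qed (use fA(2) bbar Ai in auto)
    finally show ?thesis by simp
  qed
  then have "(\<lambda>k. (LINT z|cyl K. f z * A k z) - (LINT z|cyl K. f z * b (bar z))) \<longlonglongrightarrow> 0"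
    by (intro Lim_null_comparison[OF always_eventually lim]) simp
  then show ?thesis unfolding fA(1) by (rule LIM_zero_cancel)
qed

text \<open>The averages of \<open>b\<close> and \<open>b\<^sup>2\<close> have the limits \<open>b(bar)\<close> and \<open>b(bar)\<^sup>2\<close>, so the mean square deviation from \<open>b(bar)\<close> vanishes.\<close>

lemma observable_L1:
  fixes b :: "real \<times> (real^'n) \<Rightarrow> real"
  assumes b: "test_fun 0 UNIV b"
  shows "(\<lambda>k. (\<Sum>n=1..N k. LINT z|cyl K. \<bar>b (traj_val (seq n) (fst z) (snd z)) - b (bar z)\<bar>) / real (N k)) \<longlonglongrightarrow> 0"
proof -
  obtain C where C: "C \<ge> 0" "\<And>y. \<bar>b y\<bar> \<le> C" using test_fun_bounded_measurable(2)[OF b] by auto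
  have b2: "test_fun 0 UNIV (\<lambda>y. (b y)\<^sup>2)"
  proof -
    obtain S where S: "compact S" "\<And>y. y \<notin> S \<Longrightarrow> b y = 0" "continuous_on UNIV b"
      using test_fun_0D[OF b] by metis
    then have "continuous_on UNIV (\<lambda>y. (b y)\<^sup>2)" by (intro continuous_intros)
    then show ?thesis using S(1,2) unfolding test_fun_def by (auto simp: zero_enat_def intro!: exI[of _ S])
  qed
  have one: "(\<lambda>_. 1 :: real) \<in> borel_measurable (cyl K)" by simp
  have fb: "(\<lambda>z. b (bar z)) \<in> borel_measurable (cyl K)"
    by (rule measurable_compose[OF traj_meas_K[OF bar_traj] test_fun_bounded_measurable(1)[OF b]])
  have fC: "\<bar>b (bar z)\<bar> \<le> C" for z by (rule C(2))
  let ?y = "\<lambda>n z. traj_val (seq n) (fst z) (snd z)"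
  define S where "S n = (LINT z|cyl K. (b (?y n z) - b (bar z))\<^sup>2)" for n
  have i1: "integrable (cyl K) (\<lambda>z. (b (traj_val h (fst z) (snd z)))\<^sup>2)" if "h \<in> trajectories T \<gamma> Q" for h
    using observable_integrable_K[OF b2 that one, of 1] by simp
  note i2 = observable_integrable_K[OF b _ fb fC]
  note i3 = i1[OF bar_traj]
  have sq: "(b (?y n z) - b (bar z))\<^sup>2 = (b (?y n z))\<^sup>2 - 2 * (b (bar z) * b (?y n z)) + (b (bar z))\<^sup>2" for n z
    by (simp add: power2_eq_square algebra_simps)
  have Si: "integrable (cyl K) (\<lambda>z. (b (?y n z) - b (bar z))\<^sup>2)" if "n \<ge> 1" for n
    unfolding sq using i1[OF seq_traj[OF that]] i2[OF seq_traj[OF that]] i3 by simp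
  have S_eq: "S n = (LINT z|cyl K. 1 * (b (?y n z))\<^sup>2) - 2 * (LINT z|cyl K. b (bar z) * b (?y n z)) + (LINT z|cyl K. (b (bar z))\<^sup>2)" if "n \<ge> 1" for n
    unfolding S_def sq using i1[OF seq_traj[OF that]] i2[OF seq_traj[OF that]] i3 by simp
  have Slim: "(\<lambda>k. (\<Sum>n=1..N k. S n) / real (N k)) \<longlonglongrightarrow> 0"
  proof -
    have "(\<lambda>k. (\<Sum>n=1..N k. LINT z|cyl K. 1 * (b (?y n z))\<^sup>2) / real (N k)
        - 2 * ((\<Sum>n=1..N k. LINT z|cyl K. b (bar z) * b (?y n z)) / real (N k)) + (LINT z|cyl K. (b (bar z))\<^sup>2))
      \<longlonglongrightarrow> (LINT z|cyl K. 1 * (b (bar z))\<^sup>2) - 2 * (LINT z|cyl K. b (bar z) * b (bar z)) + (LINT z|cyl K. (b (bar z))\<^sup>2)"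
      using weighted_averages[OF b2 one, of 1] weighted_averages[OF b fb fC]
      by (intro tendsto_add tendsto_diff tendsto_mult tendsto_const) auto
    moreover have "\<forall>\<^sub>F k in sequentially. (\<Sum>n=1..N k. LINT z|cyl K. 1 * (b (?y n z))\<^sup>2) / real (N k)
        - 2 * ((\<Sum>n=1..N k. LINT z|cyl K. b (bar z) * b (?y n z)) / real (N k)) + (LINT z|cyl K. (b (bar z))\<^sup>2)
        = (\<Sum>n=1..N k. S n) / real (N k)"
      using N_pos
    proof eventually_elim
      case (elim k)
      have "(\<Sum>n=1..N k. S n) = (\<Sum>n=1..N k. LINT z|cyl K. 1 * (b (?y n z))\<^sup>2)
          - 2 * (\<Sum>n=1..N k. LINT z|cyl K. b (bar z) * b (?y n z)) + real (N k) * (LINT z|cyl K. (b (bar z))\<^sup>2)"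
        by (simp add: S_eq sum.distrib sum_subtractf sum_distrib_left)
      then show ?case using elim by (simp add: add_divide_distrib diff_divide_distrib)
    qed
    ultimately have "(\<lambda>k. (\<Sum>n=1..N k. S n) / real (N k)) \<longlonglongrightarrow> (LINT z|cyl K. 1 * (b (bar z))\<^sup>2) - 2 * (LINT z|cyl K. b (bar z) * b (bar z)) + (LINT z|cyl K. (b (bar z))\<^sup>2)"
      by (rule Lim_transform_eventually)
    then show ?thesis by (simp add: power2_eq_square)
  qed
  define m where "m = measure (cyl K) (space (cyl K))"
  have m0: "m \<ge> 0" by (simp add: m_def)
  define D where "D n = (LINT z|cyl K. \<bar>b (?y n z) - b (bar z)\<bar>)" for n
  have D0: "0 \<le> D n" for n unfolding D_def by (intro Bochner_Integration.integral_nonneg) simp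
  \<comment> \<open>On the finite measure space the mean square deviation controls the mean absolute
    one; \<open>e\<close> is later chosen in terms of the total mass \<open>m\<close>.\<close>
  have bound: "D n \<le> e * m + S n / e" if "n \<ge> 1" "e > 0" for n e
  proof -
    have "integrable (cyl K) (\<lambda>z. \<bar>b (?y n z) - b (bar z)\<bar>)"
      using observable_integrable_K[OF b seq_traj[OF that(1)] one, of 1] observable_integrable_K[OF b bar_traj one, of 1] by simp
    then have "D n \<le> (LINT z|cyl K. e + (b (?y n z) - b (bar z))\<^sup>2 / e)"
      unfolding D_def using Si[OF that(1)] that(2) by (intro integral_mono abs_le_square) auto
    also have "\<dots> = e * m + S n / e" unfolding S_def m_def using Si[OF that(1)] by simp
    finally show ?thesis .
  qed
  show ?thesis
  proof (rule LIMSEQ_I)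
    fix r :: real assume r: "r > 0"
    define e where "e = r / (2 * (m + 1))"
    have e: "e > 0" using r m0 by (simp add: e_def)
    have em: "e * m \<le> r / 2"
    proof -
      have "e * m \<le> e * (m + 1)" using e by simp
      also have "\<dots> = r / 2" using m0 by (simp add: e_def field_simps)
      finally show ?thesis .
    qed
    have "\<forall>\<^sub>F k in sequentially. (\<Sum>n=1..N k. S n) / real (N k) < r / 2 * e"
      using order_tendstoD(2)[OF Slim, of "r / 2 * e"] r e by simp
    then have "\<forall>\<^sub>F k in sequentially. norm ((\<Sum>n=1..N k. D n) / real (N k) - 0) < r"
      using N_pos
    proof eventually_elim
      case (elim k)
      have "(\<Sum>n=1..N k. D n) \<le> (\<Sum>n=1..N k. e * m + S n / e)" using bound e by (intro sum_mono) auto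
      also have "\<dots> = real (N k) * (e * m) + (\<Sum>n=1..N k. S n) / e" by (simp add: sum.distrib sum_divide_distrib)
      finally have "(\<Sum>n=1..N k. D n) / real (N k) \<le> e * m + ((\<Sum>n=1..N k. S n) / real (N k)) / e"
        using elim(2) by (simp add: field_simps)
      also have "((\<Sum>n=1..N k. S n) / real (N k)) / e < r / 2" unfolding pos_divide_less_eq[OF e] by (rule elim(1))
      finally have "(\<Sum>n=1..N k. D n) / real (N k) < r" using em by simp
      moreover have "0 \<le> (\<Sum>n=1..N k. D n) / real (N k)" using D0 by (intro divide_nonneg_nonneg sum_nonneg) auto
      ultimately show ?case by simp
    qed
    then show "\<exists>no. \<forall>k\<ge>no. norm ((\<Sum>n=1..N k. LINT z|cyl K. \<bar>b (?y n z) - b (bar z)\<bar>) / real (N k) - 0) < r"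
      unfolding D_def eventually_sequentially .
  qed
qed

text \<open>The states are split into cut coordinates, to which \<open>observable_L1\<close>
  applies, and tails bounded by \<eta> times energies with bounded averages.\<close>

lemma state_L1:
  "(\<lambda>k. (\<Sum>n=1..N k. \<integral>\<^sup>+z. ennreal (norm (traj_val (seq n) (fst z) (snd z) - bar z)) \<partial>cyl K) / of_nat (N k)) \<longlonglongrightarrow> 0"
proof (rule tendsto_0_ennrealI)
  fix e :: real assume e: "e > 0"
  let ?y = "\<lambda>n z. traj_val (seq n) (fst z) (snd z)"
  obtain C0 where C0: "C0 \<ge> 0" "\<And>J. J \<ge> 1 \<Longrightarrow> (\<Sum>n=1..J. \<integral>\<^sup>+z. E0 (?y n z) \<partial>cyl Q) / of_nat J \<le> ennreal C0"
    using average_energy by blast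
  define Eb where "Eb = enn2real (\<integral>\<^sup>+z. E0 (bar z) \<partial>cyl Q)"
  have Eb: "(\<integral>\<^sup>+z. E0 (bar z) \<partial>cyl Q) = ennreal Eb" "Eb \<ge> 0"
    using bar_energy by (simp_all add: Eb_def less_top)
  \<comment> \<open>Makes the tails of the sequence and of the limit together at most e/2; the
    summand 1 avoids a zero denominator.\<close>
  define \<eta> where "\<eta> = e / (2 * (C0 + Eb + 1))"
  have \<eta>: "\<eta> > 0" using e C0(1) Eb(2) by (simp add: \<eta>_def)
  obtain M where M: "\<And>y. ennreal ((1 - radial_cut M y) * norm y) \<le> ennreal \<eta> * E0 y"
    using cut_tail_energy[OF \<eta>] by blast
  define b where "b i y = radial_cut M y * (y \<bullet> i)" for i y :: "real \<times> (real^'n)"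
  have b: "test_fun 0 UNIV (b i)" for i unfolding b_def by (rule test_fun_radial_cut)
  define R where "R n = (\<Sum>i\<in>Basis. LINT z|cyl K. \<bar>b i (?y n z) - b i (bar z)\<bar>)" for n
  have "(\<lambda>k. \<Sum>i\<in>Basis. (\<Sum>n=1..N k. LINT z|cyl K. \<bar>b i (?y n z) - b i (bar z)\<bar>) / real (N k)) \<longlonglongrightarrow> (\<Sum>i\<in>(Basis :: (real \<times> (real^'n)) set). 0)"
    by (intro tendsto_sum observable_L1 b)
  moreover have "(\<Sum>i\<in>Basis. (\<Sum>n=1..N k. LINT z|cyl K. \<bar>b i (?y n z) - b i (bar z)\<bar>) / real (N k)) = (\<Sum>n=1..N k. R n) / real (N k)" for k
    unfolding R_def sum_divide_distrib[symmetric] by (subst sum.swap) (rule refl)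
  ultimately have "(\<lambda>k. (\<Sum>n=1..N k. R n) / real (N k)) \<longlonglongrightarrow> 0" by simp
  from order_tendstoD(2)[OF this, of "e / 2"] e
  have "\<forall>\<^sub>F k in sequentially. (\<Sum>n=1..N k. R n) / real (N k) < e / 2" by simp
  then show "\<forall>\<^sub>F k in sequentially. (\<Sum>n=1..N k. \<integral>\<^sup>+z. ennreal (norm (?y n z - bar z)) \<partial>cyl K) / of_nat (N k) \<le> ennreal e"
    using N_pos
  proof eventually_elim
    case (elim k)
    have R0: "R n \<ge> 0" for n unfolding R_def by (intro sum_nonneg Bochner_Integration.integral_nonneg) simp
    have one: "(\<lambda>_. 1 :: real) \<in> borel_measurable (cyl K)" by simp
    have single: "(\<integral>\<^sup>+z. ennreal (norm (?y n z - bar z)) \<partial>cyl K) \<le> ennreal (R n) + ennreal \<eta> * (\<integral>\<^sup>+z. E0 (?y n z) \<partial>cyl Q) + ennreal (\<eta> * Eb)" if n: "n \<ge> 1" for n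
    proof -
      note ym = E0_measurable[OF traj_meas_K[OF seq_traj[OF n]]] and bm = E0_measurable[OF traj_meas_K[OF bar_traj]]
      have di: "integrable (cyl K) (\<lambda>z. \<bar>b i (?y n z) - b i (bar z)\<bar>)" for i
        using observable_integrable_K[OF b seq_traj[OF n] one, of 1] observable_integrable_K[OF b bar_traj one, of 1] by simp
      have "(\<integral>\<^sup>+z. ennreal (norm (?y n z - bar z)) \<partial>cyl K) \<le>
        (\<integral>\<^sup>+z. ennreal (\<Sum>i\<in>Basis. \<bar>b i (?y n z) - b i (bar z)\<bar>) + (ennreal \<eta> * E0 (?y n z) + ennreal \<eta> * E0 (bar z)) \<partial>cyl K)"
      proof (rule nn_integral_mono)
        fix z
        have c1: "0 \<le> (1 - radial_cut M y) * norm y" for y :: "real \<times> (real^'n)"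
          by (intro mult_nonneg_nonneg) (auto simp: radial_cut_def)
        have "ennreal (norm (?y n z - bar z)) \<le> ennreal ((\<Sum>i\<in>Basis. \<bar>b i (?y n z) - b i (bar z)\<bar>)
            + (1 - radial_cut M (?y n z)) * norm (?y n z) + (1 - radial_cut M (bar z)) * norm (bar z))"
          unfolding b_def by (rule ennreal_leI[OF norm_diff_le_cut])
        also have "\<dots> = ennreal (\<Sum>i\<in>Basis. \<bar>b i (?y n z) - b i (bar z)\<bar>) + (ennreal ((1 - radial_cut M (?y n z)) * norm (?y n z))
           + ennreal ((1 - radial_cut M (bar z)) * norm (bar z)))"
          using c1 by (simp add: sum_nonneg add.assoc)
        also have "\<dots> \<le> ennreal (\<Sum>i\<in>Basis. \<bar>b i (?y n z) - b i (bar z)\<bar>) + (ennreal \<eta> * E0 (?y n z) + ennreal \<eta> * E0 (bar z))"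
          by (intro add_left_mono add_mono M)
        finally show "ennreal (norm (?y n z - bar z)) \<le> ennreal (\<Sum>i\<in>Basis. \<bar>b i (?y n z) - b i (bar z)\<bar>) + (ennreal \<eta> * E0 (?y n z) + ennreal \<eta> * E0 (bar z))" .
      qed
      also have "\<dots> = (\<integral>\<^sup>+z. ennreal (\<Sum>i\<in>Basis. \<bar>b i (?y n z) - b i (bar z)\<bar>) \<partial>cyl K)
          + (ennreal \<eta> * (\<integral>\<^sup>+z. E0 (?y n z) \<partial>cyl K) + ennreal \<eta> * (\<integral>\<^sup>+z. E0 (bar z) \<partial>cyl K))"
      proof -
        have dm: "(\<lambda>z. ennreal (\<Sum>i\<in>Basis. \<bar>b i (?y n z) - b i (bar z)\<bar>)) \<in> borel_measurable (cyl K)"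
          using di by (intro measurable_compose[OF _ measurable_ennreal] borel_measurable_sum) auto
        have m1: "(\<lambda>z. ennreal \<eta> * E0 (?y n z)) \<in> borel_measurable (cyl K)" "(\<lambda>z. ennreal \<eta> * E0 (bar z)) \<in> borel_measurable (cyl K)"
          using ym bm by (intro borel_measurable_times_ennreal borel_measurable_const; simp)+
        show ?thesis
          by (simp only: nn_integral_add[OF dm borel_measurable_add[OF m1]] nn_integral_add[OF m1] nn_integral_cmult[OF ym] nn_integral_cmult[OF bm])
      qed
      also have "(\<integral>\<^sup>+z. ennreal (\<Sum>i\<in>Basis. \<bar>b i (?y n z) - b i (bar z)\<bar>) \<partial>cyl K) = ennreal (R n)"
      proof -
        have "(\<integral>\<^sup>+z. ennreal (\<Sum>i\<in>Basis. \<bar>b i (?y n z) - b i (bar z)\<bar>) \<partial>cyl K) = ennreal (LINT z|cyl K. (\<Sum>i\<in>Basis. \<bar>b i (?y n z) - b i (bar z)\<bar>))"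
          using di by (intro nn_integral_eq_integral Bochner_Integration.integrable_sum AE_I2 sum_nonneg) auto
        also have "(LINT z|cyl K. (\<Sum>i\<in>Basis. \<bar>b i (?y n z) - b i (bar z)\<bar>)) = R n"
          unfolding R_def by (intro Bochner_Integration.integral_sum di)
        finally show ?thesis .
      qed
      also have "ennreal (R n) + (ennreal \<eta> * (\<integral>\<^sup>+z. E0 (?y n z) \<partial>cyl K) + ennreal \<eta> * (\<integral>\<^sup>+z. E0 (bar z) \<partial>cyl K))
        \<le> ennreal (R n) + (ennreal \<eta> * (\<integral>\<^sup>+z. E0 (?y n z) \<partial>cyl Q) + ennreal \<eta> * (\<integral>\<^sup>+z. E0 (bar z) \<partial>cyl Q))"
        by (intro add_left_mono add_mono mult_left_mono nn_integral_cyl_mono K(2) K_borel) auto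
      finally show ?thesis using \<eta> Eb by (simp add: ennreal_mult' add.assoc)
    qed
    have NN: "of_nat (N k) / of_nat (N k) = (1 :: ennreal)" using elim(2) by (intro ennreal_divide_self) (auto simp: of_nat_less_top)
    have "(\<Sum>n=1..N k. \<integral>\<^sup>+z. ennreal (norm (?y n z - bar z)) \<partial>cyl K) \<le>
      (\<Sum>n=1..N k. ennreal (R n) + ennreal \<eta> * (\<integral>\<^sup>+z. E0 (?y n z) \<partial>cyl Q) + ennreal (\<eta> * Eb))"
      using single by (intro sum_mono) auto
    also have "\<dots> = ennreal (\<Sum>n=1..N k. R n) + ennreal \<eta> * (\<Sum>n=1..N k. \<integral>\<^sup>+z. E0 (?y n z) \<partial>cyl Q) + ennreal (\<eta> * Eb) * of_nat (N k)"
      using R0 by (simp add: sum.distrib sum_distrib_left mult.commute)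
    finally have "(\<Sum>n=1..N k. \<integral>\<^sup>+z. ennreal (norm (?y n z - bar z)) \<partial>cyl K) / of_nat (N k) \<le>
      (ennreal (\<Sum>n=1..N k. R n) + ennreal \<eta> * (\<Sum>n=1..N k. \<integral>\<^sup>+z. E0 (?y n z) \<partial>cyl Q) + ennreal (\<eta> * Eb) * of_nat (N k)) / of_nat (N k)"
      by (rule divide_right_mono_ennreal)
    also have "\<dots> = ennreal (\<Sum>n=1..N k. R n) / of_nat (N k) + ennreal \<eta> * ((\<Sum>n=1..N k. \<integral>\<^sup>+z. E0 (?y n z) \<partial>cyl Q) / of_nat (N k)) + ennreal (\<eta> * Eb)"
      by (simp only: add_divide_distrib_ennreal ennreal_times_divide[symmetric] NN mult_1_right)
    also have "ennreal (\<Sum>n=1..N k. R n) / of_nat (N k) = ennreal ((\<Sum>n=1..N k. R n) / real (N k))"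
      using elim(2) R0 by (subst divide_ennreal[symmetric]) (auto intro: sum_nonneg simp: ennreal_of_nat_eq_real_of_nat)
    also have "ennreal ((\<Sum>n=1..N k. R n) / real (N k)) + ennreal \<eta> * ((\<Sum>n=1..N k. \<integral>\<^sup>+z. E0 (?y n z) \<partial>cyl Q) / of_nat (N k)) + ennreal (\<eta> * Eb)
       \<le> ennreal (e / 2) + ennreal \<eta> * ennreal C0 + ennreal (\<eta> * Eb)"
      using elim \<eta> by (intro add_mono mult_left_mono C0(2) ennreal_leI) auto
    also have "\<dots> = ennreal (e / 2 + \<eta> * (C0 + Eb))"
      using e \<eta> C0(1) Eb(2) by (simp add: ennreal_mult' algebra_simps)
    also have "\<dots> \<le> ennreal e"
    proof (rule ennreal_leI)
      have "\<eta> * (C0 + Eb) \<le> \<eta> * (C0 + Eb + 1)" using \<eta> by simp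
      also have "\<dots> = e / 2" using C0(1) Eb(2) by (simp add: \<eta>_def field_simps)
      finally show "e / 2 + \<eta> * (C0 + Eb) \<le> e" by simp
    qed
    finally show ?case .
  qed
qed

text \<open>Density and momentum are each dominated by the norm of the pair, whence the factor 2 in
  the comparison.\<close>

theorem strong_convergence:
  "(\<lambda>k. (\<Sum>n=1..N k. L1_norm {0<..<T} K (\<lambda>t x. fst (seq n) t x - \<rho>bar t x)
     + L1_norm {0<..<T} K (\<lambda>t x. snd (seq n) t x - mbar t x)) / of_nat (N k)) \<longlonglongrightarrow> 0"
proof -
  let ?X = "\<lambda>n. \<integral>\<^sup>+z. ennreal (norm (traj_val (seq n) (fst z) (snd z) - bar z)) \<partial>cyl K"
  have fst_le: "\<bar>r\<bar> \<le> norm (r, w)" for r :: real and w :: "real^'n"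
    using norm_fst_le[of r w] by simp
  have L: "L1_norm {0<..<T} K (\<lambda>t x. fst (seq n) t x - \<rho>bar t x) \<le> ?X n"
    "L1_norm {0<..<T} K (\<lambda>t x. snd (seq n) t x - mbar t x) \<le> ?X n" for n
  proof -
    show "L1_norm {0<..<T} K (\<lambda>t x. fst (seq n) t x - \<rho>bar t x) \<le> ?X n"
      "L1_norm {0<..<T} K (\<lambda>t x. snd (seq n) t x - mbar t x) \<le> ?X n"
      using K_borel by (auto simp: L1_norm_restrict traj_val_def intro!: nn_integral_mono ennreal_leI fst_le norm_snd_le)
  qed
  have lim: "(\<lambda>k. 2 * ((\<Sum>n=1..N k. ?X n) / of_nat (N k))) \<longlonglongrightarrow> 0"
    using ennreal_tendsto_cmult[OF _ state_L1, of 2] by simp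
  show ?thesis
  proof (rule tendsto_sandwich[OF _ _ tendsto_const lim])
    show "\<forall>\<^sub>F k in sequentially. (\<Sum>n=1..N k. L1_norm {0<..<T} K (\<lambda>t x. fst (seq n) t x - \<rho>bar t x)
     + L1_norm {0<..<T} K (\<lambda>t x. snd (seq n) t x - mbar t x)) / of_nat (N k) \<le> 2 * ((\<Sum>n=1..N k. ?X n) / of_nat (N k))"
    proof (intro always_eventually allI)
      fix k
      have "(\<Sum>n=1..N k. L1_norm {0<..<T} K (\<lambda>t x. fst (seq n) t x - \<rho>bar t x)
     + L1_norm {0<..<T} K (\<lambda>t x. snd (seq n) t x - mbar t x)) \<le> (\<Sum>n=1..N k. ?X n + ?X n)"
        by (intro sum_mono add_mono L)
      also have "\<dots> = 2 * (\<Sum>n=1..N k. ?X n)" by (simp add: sum.distrib mult_2)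
      finally show "(\<Sum>n=1..N k. L1_norm {0<..<T} K (\<lambda>t x. fst (seq n) t x - \<rho>bar t x)
     + L1_norm {0<..<T} K (\<lambda>t x. snd (seq n) t x - mbar t x)) / of_nat (N k) \<le> 2 * ((\<Sum>n=1..N k. ?X n) / of_nat (N k))"
        by (simp only: ennreal_times_divide divide_right_mono_ennreal)
    qed
  qed simp
qed

end

end

end

theorem theorem5p7:
  fixes T a \<gamma> \<mu> lam L rinf Ebar :: real
    and B Q :: "(real^'n) set"
    and uinf :: "real^'n" and U :: "real^'n \<Rightarrow> real^'n"
    and \<epsilon> :: "nat \<Rightarrow> real"
    and \<rho> :: "nat \<Rightarrow> real \<Rightarrow> real^'n \<Rightarrow> real"
    and m u :: "nat \<Rightarrow> real \<Rightarrow> real^'n \<Rightarrow> real^'n"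
    and Du :: "nat \<Rightarrow> real \<Rightarrow> real^'n \<Rightarrow> real^'n^'n"
    and N :: "nat \<Rightarrow> nat"
    and V :: "'n trajectory measure"
    and \<P> :: "'o measure" and X :: "'o \<Rightarrow> 'n trajectory"
    and M :: "'w measure" and Filt :: "real \<Rightarrow> 'w measure"
    and W :: "nat \<Rightarrow> real \<Rightarrow> 'w \<Rightarrow> real"
    and F :: "nat \<Rightarrow> real \<Rightarrow> 'w \<Rightarrow> (real^'n \<Rightarrow> real^'n) \<Rightarrow> real"
    and Y :: "'w \<Rightarrow> 'n trajectory"
    and \<rho>bar :: "real \<Rightarrow> real^'n \<Rightarrow> real" and mbar :: "real \<Rightarrow> real^'n \<Rightarrow> real^'n"
  assumes dim: "CARD('n) \<in> {2, 3}"
    and params: "T > 0" "a > 0" "\<gamma> > 1" "\<mu> > 0" "lam \<ge> 0"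
    and domain: "convex B" "compact B" "Q = - B" "smooth_boundary Q"
    and far_field: "rinf > 0" "L > 0" "B \<subseteq> {x. norm x < L}" "smooth_on Q U"
      "\<forall>x\<in>Q. norm x < L \<longrightarrow> U x = 0" "\<forall>x\<in>Q. norm x > 2 * L \<longrightarrow> U x = uinf"
    and vanishing_viscosity: "\<forall>n\<ge>1. \<epsilon> n > 0" "antimono_on {1..} \<epsilon>" "\<epsilon> \<longlonglongrightarrow> 0"
    and solutions: "\<forall>n\<ge>1. finite_energy_weak_solution T a \<gamma> (\<epsilon> n) \<mu> lam Q rinf U
                            (\<rho> n) (m n) (u n) (Du n)"
    and energy_bound: "\<forall>K\<ge>1. (\<Sum>n=1..K. (SUP \<tau>\<in>{0..T}. total_energy a \<gamma> Q rinf U (\<rho> n \<tau>) (m n \<tau>))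
                                + dissipation (\<epsilon> n) \<mu> lam Q T (Du n)) / of_nat K \<le> ennreal Ebar"
    and limit_measure: "prob_on (traj_borel T \<gamma> Q) V" "filterlim N at_top sequentially"
      "narrow_limit (traj_topology T \<gamma> Q)
         (\<lambda>k. cesaro_measure (traj_borel T \<gamma> Q) (\<lambda>n. (\<rho> n, m n)) (N k)) V"
    and averages: "\<forall>b. test_fun 0 UNIV b \<longrightarrow> (\<exists>g. mean_of T Q V b g \<and>
      (\<forall>K. compact K \<and> K \<subseteq> Q \<longrightarrow>
        (\<lambda>k. L1_norm {0<..<T} K (\<lambda>t x.
           (\<Sum>n=1..N k. b (\<rho> n t x, m n t x)) / real (N k) - g t x)) \<longlonglongrightarrow> 0))"
    and skorokhod: "prob_space \<P>" "X \<in> measurable \<P> (traj_borel T \<gamma> Q)"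
      "distr \<P> (traj_borel T \<gamma> Q) X = V"
    and stochastic_euler: "stochastic_euler_solution M Filt T a \<gamma> Q W F Y"
    and forcing: "\<exists>l. square_integrable_forcing M T Q l F"
    and equivalence: "statistically_equivalent T a \<gamma> Q
      (distr \<P> (traj_borel T \<gamma> Q) X) (distr M (traj_borel T \<gamma> Q) Y)"
    and bary: "barycenter T \<gamma> Q V (\<rho>bar, mbar)"
    and bary_euler: "euler_weak_solution T a \<gamma> Q (\<rho>bar, mbar)"
  shows "V = return (traj_borel T \<gamma> Q) (\<rho>bar, mbar) \<and>
    (\<forall>K. compact K \<and> K \<subseteq> Q \<longrightarrow>
      (\<lambda>k. (\<Sum>n=1..N k. L1_norm {0<..<T} K (\<lambda>t x. \<rho> n t x - \<rho>bar t x)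
                          + L1_norm {0<..<T} K (\<lambda>t x. m n t x - mbar t x)) / of_nat (N k))
        \<longlonglongrightarrow> 0)"
proof -
  have V: "prob_space V" "sets V = sets (traj_borel T \<gamma> Q)" using limit_measure(1) by (auto simp: prob_on_def)
  have Q: "open Q" using domain(2,3) by (simp add: compact_imp_closed open_Compl)
  interpret I: isentropic a \<gamma> rinf
    using params far_field by unfold_locales auto
  interpret P: prob_space V by (rule V(1))
  interpret TL: trajectory_law V T \<gamma> Q
    using V(2) params Q by unfold_locales auto
  have seq: "(\<rho> n, m n) \<in> trajectories T \<gamma> Q" if "n \<ge> 1" for n
    using solutions that unfolding finite_energy_weak_solution_def by blast
  have U: "continuous_on Q U" using far_field(4) unfolding smooth_on_def by (metis Ck_on.simps(1))
  interpret CL: cesaro_limit a \<gamma> rinf V T Q L Ebar uinf U "\<lambda>n. (\<rho> n, m n)" "\<lambda>n. dissipation (\<epsilon> n) \<mu> lam Q T (Du n)" N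
  proof unfold_locales
    show "- ball 0 L \<subseteq> Q" using domain(3) far_field(3) by auto
  qed (use far_field U seq energy_bound limit_measure(2) averages in \<open>auto simp: traj_val_def\<close>)
  obtain Z where Z: "Z \<in> borel_measurable (V \<Otimes>\<^sub>M lborel)" "AE h in V. AE z in TL.cyl Q. Z (h, z) = traj_val h (fst z) (snd z)"
    using TL.measurable_version by blast
  \<comment> \<open>The law of \<open>X\<close> is \<open>V\<close>, which turns the equivalence of
    the two processes into one between \<open>V\<close> and the law of \<open>Y\<close>.\<close>
  interpret EL: euler_limit a \<gamma> rinf V T Q L Ebar uinf U "\<lambda>n. (\<rho> n, m n)" "\<lambda>n. dissipation (\<epsilon> n) \<mu> lam Q T (Du n)" N \<rho>bar mbar Z
    using bary bary_euler Z expected_euler_obs[OF stochastic_euler equivalence[unfolded skorokhod(3)] params(3)]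
    by unfold_locales auto
  note Z_bar = EL.Z_eq_bar[OF domain(1-3)]
  show ?thesis
    using EL.law_eq_return[OF Z_bar] EL.strong_convergence[OF Z_bar] by simp
qed

end
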